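(* Let $\mathcal A=\{A_\alpha\}\subset\tilde{\mathcal A}$ be a null family. Assume that there is a uniform Lyapunov function in $\mathcal U$ with respect to the family $\{\mathcal L_{A_\alpha}\}$ and denote by $\{\mu_\alpha\}$ the set of all stationary measures corresponding to $\{\mathcal L_{A_\alpha}\}$. Then the following holds. (a) (Tightness of stationary measures) $\{\mu_\alpha\}$ is $\mathcal A$-sequentially null compact in $M(\mathcal U)$, i.e., for any sequence $\{A_\ell\}_{\ell=1}^\infty\subset\mathcal A$ with $A_\ell\to0$ and corresponding stationary measures $\mu_\ell$, the sequence $\{\mu_\ell\}_{\ell=1}^\infty$ is relatively compact in $M(\mathcal U)$. (b) (Global concentration of limit measures) If $V\in C^1(\mathcal U,\mathbb R^n)$, then any $\mathcal A$-limit measure is an invariant measure of $\varphi^t$ concentrated on the global attractor of $\varphi^t$.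
   Context: Setting. $\mathcal U\subset\mathbb R^n$ is a connected open set, $V=(V^i)\in C(\mathcal U,\mathbb R^n)$, and the ODE $\dot x=V(x)$ is assumed to generate a (continuous) local flow $\varphi^t$ on $\mathcal U$: $\varphi^t(\xi)$ is the unique solution through $\xi$, defined for $t$ in its maximal interval $\mathcal I_\xi$ of existence in $\mathcal U$. Diffusion matrices. Fix an integer $m\ge n$ and a real $p>n$. $\tilde{\mathcal A}$ is the set of matrix functions $A=(a^{ij})\in W^{1,p}_{loc}(\mathcal U,GL(n,\mathbb R))$ of the form $A=\frac12GG^\top$, where $G=(g^{ij})$ is an $n\times m$ matrix function on $\mathcal U$ with $g^{ij}\in W^{1,2p}_{loc}(\mathcal U)$ and $\mathrm{Rank}(G)\equiv n$ (continuous representatives are used). With summation over repeated indices, $\mathcal L_A=a^{ij}\partial^2_{ij}+V^i\partial_i$. A stationary measure corresponding to $\mathcal L_A$ is a Borel probability measure $\mu$ on $\mathcal U$ with $\int_{\mathcal U}\mathcal L_Af\,d\mu=0$ for all $f\in C_0^\infty(\mathcal U)$. Null families and limit measures. A null family is a directed net $\mathcal A=\{A_\alpha\}$ in $\tilde{\mathcal A}$ converging to the zero matrix in the (metrizable) topology of $W^{1,p}$-convergence on compact subsets of $\mathcal U$. $M(\mathcal U)$ is the space of Borel probability measures on $\mathcal U$ with the weak$^*$-topology (testing against bounded continuous functions). An $\mathcal A$-limit measure is a $\mu\in M(\mathcal U)$ for which there are $\{A_\ell\}\subset\mathcal A$ with $A_\ell\to0$ and stationary measures $\mu_\ell$ corresponding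 to $\mathcal L_{A_\ell}$ with $\mu_\ell\to\mu$ in $M(\mathcal U)$. Uniform Lyapunov function. For a connected open $\Omega\subset\mathcal U$, a nonnegative $U\in C(\Omega)$ is a compact function if, with $\rho_M=\sup_\Omega U$ (possibly $\infty$), $U<\rho_M$ on $\Omega$ and $U(x)\to\rho_M$ as $x\to\partial\Omega$ (i.e. as $x$ leaves every compact subset of $\Omega$, points at infinity counting as boundary points when $\Omega$ is unbounded). A compact function $U\in C^2(\Omega)$ is a uniform Lyapunov function in $\Omega$ with respect to $\{\mathcal L_{A_\alpha}\}$ if there are constants $\rho_m\in(0,\rho_M)$ and $\gamma>0$, independent of $\alpha$, with $\mathcal L_{A_\alpha}U(x)\le-\gamma$ for all $\alpha$ and all $x\in\Omega\setminus\overline{\Omega}_{\rho_m}$, where $\Omega_\rho=\{x\in\Omega:U(x)<\rho\}$. Global attractor. $B\subset\mathcal U$ is invariant if $\mathcal I_\xi=\mathbb R$ for $\xi\in B$ and $\varphi^t(B)=B$ for all $t\in\mathbb R$. (Under the hypotheses, $\varphi^t$ is a positive semiflow on $\mathcal U$ possessing a global attractor.) The global attractor is the compact invariant set $\mathcal J\subset\mathcal U$ attracting every pre-compact $K\subset\mathcal U$, i.e. $\lim_{t\to+\infty}\mathrm{dist}(\varphi^t(K),\mathcal J)=0$ with $\mathrm{dist}$ the Hausdorff semi-distance. $\mu$ concentrated on $\mathcal J$ means $\mathrm{supp}(\mu)\subset\mathcal J$. $\mu$ is an invariant measure of $\varphi^t$ if $\mu(\varphi^{-t}(B))=\mu(B)$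 for all Borel $B$ and all $t\in\mathbb R$, where $\varphi^{-t}(B)=\{x: t\in\mathcal I_x,\ \varphi^t(x)\in B\}$. *)

theory Defs
  imports "HOL-Probability.Probability"
begin

definition partial_deriv :: "'n::finite \<Rightarrow> (real^'n \<Rightarrow> real) \<Rightarrow> real^'n \<Rightarrow> real" where
  "partial_deriv i f x = frechet_derivative f (at x) (axis i 1)"

text \<open>Only used on open sets, where \<open>differentiable_on\<close> is differentiability at each point.\<close>

primrec C_k_on :: "nat \<Rightarrow> (real^'n::finite) set \<Rightarrow> (real^'n \<Rightarrow> real) \<Rightarrow> bool" where
  "C_k_on 0 S f \<longleftrightarrow> continuous_on S f"
| "C_k_on (Suc k) S f \<longleftrightarrow> f differentiable_on S \<and> (\<forall>i. C_k_on k S (partial_deriv i f))"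

definition test_function :: "(real^'n::finite) set \<Rightarrow> (real^'n \<Rightarrow> real) \<Rightarrow> bool" where
  "test_function \<U> f \<longleftrightarrow> (\<forall>k. C_k_on k UNIV f) \<and>
     compact (closure {x. f x \<noteq> 0}) \<and> closure {x. f x \<noteq> 0} \<subseteq> \<U>"

definition Lp_loc :: "(real^'n::finite) set \<Rightarrow> real \<Rightarrow> (real^'n \<Rightarrow> real) \<Rightarrow> bool" where
  "Lp_loc \<U> p f \<longleftrightarrow> set_borel_measurable lebesgue \<U> f \<and>
     (\<forall>K. compact K \<and> K \<subseteq> \<U> \<longrightarrow> set_integrable lebesgue K (\<lambda>x. \<bar>f x\<bar> powr p))"

definition has_weak_partial ::
  "(real^'n::finite) set \<Rightarrow> 'n \<Rightarrow> (real^'n \<Rightarrow> real) \<Rightarrow> (real^'n \<Rightarrow> real) \<Rightarrow> bool" where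
  "has_weak_partial \<U> i f g \<longleftrightarrow> Lp_loc \<U> 1 f \<and> Lp_loc \<U> 1 g \<and>
     (\<forall>\<psi>. test_function \<U> \<psi> \<longrightarrow>
        (LINT x:\<U>|lebesgue. f x * partial_deriv i \<psi> x) = - (LINT x:\<U>|lebesgue. g x * \<psi> x))"

definition W1p_loc :: "(real^'n::finite) set \<Rightarrow> real \<Rightarrow> (real^'n \<Rightarrow> real) \<Rightarrow> bool" where
  "W1p_loc \<U> p f \<longleftrightarrow> Lp_loc \<U> p f \<and> (\<forall>i. \<exists>g. Lp_loc \<U> p g \<and> has_weak_partial \<U> i f g)"

text \<open>The choice below is unique up to a null set, so the norm does not depend on it.\<close>

definition weak_partial ::
  "(real^'n::finite) set \<Rightarrow> 'n \<Rightarrow> (real^'n \<Rightarrow> real) \<Rightarrow> real^'n \<Rightarrow> real" where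
  "weak_partial \<U> i f = (SOME g. has_weak_partial \<U> i f g)"

definition W1p_norm ::
  "(real^'n::finite) set \<Rightarrow> real \<Rightarrow> (real^'n) set \<Rightarrow> (real^'n \<Rightarrow> real) \<Rightarrow> real" where
  "W1p_norm \<U> p K f =
     ((LINT x:K|lebesgue. \<bar>f x\<bar> powr p) +
      (\<Sum>i\<in>UNIV. LINT x:K|lebesgue. \<bar>weak_partial \<U> i f x\<bar> powr p)) powr (1 / p)"

definition W1p_loc_tendsto ::
  "(real^'n::finite) set \<Rightarrow> real \<Rightarrow> ('k \<Rightarrow> real^'n \<Rightarrow> real^'n^'n) \<Rightarrow>
   (real^'n \<Rightarrow> real^'n^'n) \<Rightarrow> 'k filter \<Rightarrow> bool" where
  "W1p_loc_tendsto \<U> p A B F \<longleftrightarrow>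
     (\<forall>K i j. compact K \<and> K \<subseteq> \<U> \<longrightarrow>
        ((\<lambda>\<alpha>. W1p_norm \<U> p K (\<lambda>x. A \<alpha> x $ i $ j - B x $ i $ j)) \<longlongrightarrow> 0) F)"

text \<open>The first argument only carries the number \<open>m = CARD('m)\<close> of columns of \<open>G\<close>.
  Continuity of \<open>A\<close> and \<open>G\<close> expresses that continuous representatives are used.\<close>

definition diffusion_matrices ::
  "'m::finite itself \<Rightarrow> (real^'n::finite) set \<Rightarrow> real \<Rightarrow> (real^'n \<Rightarrow> real^'n^'n) set" where
  "diffusion_matrices _ \<U> p =
     {A. continuous_on \<U> A \<and> (\<forall>i j. W1p_loc \<U> p (\<lambda>x. A x $ i $ j)) \<and>
         (\<forall>x\<in>\<U>. invertible (A x)) \<and>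
         (\<exists>G :: real^'n \<Rightarrow> real^'m^'n.
            continuous_on \<U> G \<and> (\<forall>i j. W1p_loc \<U> (2 * p) (\<lambda>x. G x $ i $ j)) \<and>
            (\<forall>x\<in>\<U>. rank (G x) = CARD('n)) \<and>
            (\<forall>x\<in>\<U>. A x = (1/2) *\<^sub>R (G x ** transpose (G x))))}"

definition directed_set :: "'k set \<Rightarrow> ('k \<Rightarrow> 'k \<Rightarrow> bool) \<Rightarrow> bool" where
  "directed_set D le \<longleftrightarrow> D \<noteq> {} \<and> reflp_on D le \<and> transp_on D le \<and>
     (\<forall>a\<in>D. \<forall>b\<in>D. \<exists>c\<in>D. le a c \<and> le b c)"

definition net_filter :: "'k set \<Rightarrow> ('k \<Rightarrow> 'k \<Rightarrow> bool) \<Rightarrow> 'k filter" where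
  "net_filter D le = (INF a\<in>D. principal {b\<in>D. le a b})"

definition null_family ::
  "'m::finite itself \<Rightarrow> (real^'n::finite) set \<Rightarrow> real \<Rightarrow> 'k set \<Rightarrow> ('k \<Rightarrow> 'k \<Rightarrow> bool) \<Rightarrow>
   ('k \<Rightarrow> real^'n \<Rightarrow> real^'n^'n) \<Rightarrow> bool" where
  "null_family m \<U> p D le A \<longleftrightarrow> directed_set D le \<and>
     (\<forall>\<alpha>\<in>D. A \<alpha> \<in> diffusion_matrices m \<U> p) \<and>
     W1p_loc_tendsto \<U> p A (\<lambda>x. 0) (net_filter D le)"

definition null_sequence ::
  "(real^'n::finite) set \<Rightarrow> real \<Rightarrow> (real^'n \<Rightarrow> real^'n^'n) set \<Rightarrow>
   (nat \<Rightarrow> real^'n \<Rightarrow> real^'n^'n) \<Rightarrow> bool" where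
  "null_sequence \<U> p \<A> B \<longleftrightarrow>
     (\<forall>l. B l \<in> \<A>) \<and> W1p_loc_tendsto \<U> p B (\<lambda>x. 0) sequentially"

definition generator ::
  "(real^'n::finite \<Rightarrow> real^'n) \<Rightarrow> (real^'n \<Rightarrow> real^'n^'n) \<Rightarrow>
   (real^'n \<Rightarrow> real) \<Rightarrow> real^'n \<Rightarrow> real" where
  "generator V A f x =
     (\<Sum>i\<in>UNIV. \<Sum>j\<in>UNIV. A x $ i $ j * partial_deriv i (partial_deriv j f) x) +
     (\<Sum>i\<in>UNIV. V x $ i * partial_deriv i f x)"

text \<open>Since the \<open>\<sigma>\<close>-algebra determines the space, members of \<open>prob_measures \<U>\<close> have space \<open>\<U>\<close>.\<close>

definition prob_measures :: "'a::topological_space set \<Rightarrow> 'a measure set" where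
  "prob_measures \<U> = {\<mu>. prob_space \<mu> \<and> sets \<mu> = sets (restrict_space borel \<U>)}"

definition weak_topology :: "'a::topological_space set \<Rightarrow> 'a measure topology" where
  "weak_topology \<U> = topology_generated_by
     {{\<mu> \<in> prob_measures \<U>. integral\<^sup>L \<mu> f \<in> S} | (f :: 'a \<Rightarrow> real) S.
        continuous_on \<U> f \<and> bounded (f ` \<U>) \<and> open S}"

definition stationary_measure ::
  "(real^'n::finite) set \<Rightarrow> (real^'n \<Rightarrow> real^'n) \<Rightarrow> (real^'n \<Rightarrow> real^'n^'n) \<Rightarrow>
   (real^'n) measure \<Rightarrow> bool" where
  "stationary_measure \<U> V A \<mu> \<longleftrightarrow> \<mu> \<in> prob_measures \<U> \<and>
     (\<forall>f. test_function \<U> f \<longrightarrow> (LINT x|\<mu>. generator V A f x) = 0)"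

definition sequentially_null_compact ::
  "(real^'n::finite) set \<Rightarrow> (real^'n \<Rightarrow> real^'n) \<Rightarrow> real \<Rightarrow>
   (real^'n \<Rightarrow> real^'n^'n) set \<Rightarrow> bool" where
  "sequentially_null_compact \<U> V p \<A> \<longleftrightarrow>
     (\<forall>B \<nu>. null_sequence \<U> p \<A> B \<and> (\<forall>l. stationary_measure \<U> V (B l) (\<nu> l)) \<longrightarrow>
        compactin (weak_topology \<U>) (weak_topology \<U> closure_of range \<nu>))"

definition limit_measure ::
  "(real^'n::finite) set \<Rightarrow> (real^'n \<Rightarrow> real^'n) \<Rightarrow> real \<Rightarrow>
   (real^'n \<Rightarrow> real^'n^'n) set \<Rightarrow> (real^'n) measure \<Rightarrow> bool" where
  "limit_measure \<U> V p \<A> \<mu> \<longleftrightarrow>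
     (\<exists>B \<nu>. null_sequence \<U> p \<A> B \<and> (\<forall>l. stationary_measure \<U> V (B l) (\<nu> l)) \<and>
        limitin (weak_topology \<U>) \<nu> \<mu> sequentially)"

text \<open>The filter of points of \<open>\<Omega>\<close> tending to the boundary of \<open>\<Omega>\<close>, infinity included.\<close>

definition to_boundary :: "'a::topological_space set \<Rightarrow> 'a filter" where
  "to_boundary \<Omega> = (INF K\<in>{K. compact K \<and> K \<subseteq> \<Omega>}. principal (\<Omega> - K))"

definition compact_function :: "'a::topological_space set \<Rightarrow> ('a \<Rightarrow> real) \<Rightarrow> bool" where
  "compact_function \<Omega> U \<longleftrightarrow> continuous_on \<Omega> U \<and> (\<forall>x\<in>\<Omega>. 0 \<le> U x) \<and>
     (\<forall>x\<in>\<Omega>. ereal (U x) < (SUP y\<in>\<Omega>. ereal (U y))) \<and>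
     ((\<lambda>x. ereal (U x)) \<longlongrightarrow> (SUP y\<in>\<Omega>. ereal (U y))) (to_boundary \<Omega>)"

definition uniform_lyapunov_function ::
  "(real^'n::finite) set \<Rightarrow> (real^'n \<Rightarrow> real^'n) \<Rightarrow> (real^'n \<Rightarrow> real^'n^'n) set \<Rightarrow>
   (real^'n \<Rightarrow> real) \<Rightarrow> bool" where
  "uniform_lyapunov_function \<Omega> V \<A> U \<longleftrightarrow> compact_function \<Omega> U \<and> C_k_on 2 \<Omega> U \<and>
     (\<exists>\<rho>\<^sub>m \<gamma>. 0 < \<rho>\<^sub>m \<and> ereal \<rho>\<^sub>m < (SUP y\<in>\<Omega>. ereal (U y)) \<and> 0 < \<gamma> \<and>
        (\<forall>A\<in>\<A>. \<forall>x \<in> \<Omega> - closure {y\<in>\<Omega>. U y < \<rho>\<^sub>m}. generator V A U x \<le> - \<gamma>))"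

definition solution_on ::
  "'a::real_normed_vector set \<Rightarrow> ('a \<Rightarrow> 'a) \<Rightarrow> 'a \<Rightarrow> real set \<Rightarrow> (real \<Rightarrow> 'a) \<Rightarrow> bool" where
  "solution_on \<U> V \<xi> J y \<longleftrightarrow> is_interval J \<and> 0 \<in> J \<and> y 0 = \<xi> \<and>
     (\<forall>t\<in>J. y t \<in> \<U> \<and> (y has_vector_derivative V (y t)) (at t within J))"

text \<open>\<open>\<I> \<xi>\<close> is the maximal interval of existence; on their domains \<open>\<I>\<close> and \<open>\<phi>\<close> are determined
  by \<open>\<U>\<close> and \<open>V\<close>.  Values of \<open>\<phi> t \<xi>\<close> with \<open>t \<notin> \<I> \<xi>\<close> are irrelevant.\<close>

definition generates_local_flow ::
  "'a::real_normed_vector set \<Rightarrow> ('a \<Rightarrow> 'a) \<Rightarrow> ('a \<Rightarrow> real set) \<Rightarrow> (real \<Rightarrow> 'a \<Rightarrow> 'a) \<Rightarrow> bool" where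
  "generates_local_flow \<U> V \<I> \<phi> \<longleftrightarrow>
     (\<forall>\<xi>\<in>\<U>. solution_on \<U> V \<xi> (\<I> \<xi>) (\<lambda>t. \<phi> t \<xi>) \<and>
        (\<forall>J y. solution_on \<U> V \<xi> J y \<longrightarrow> J \<subseteq> \<I> \<xi> \<and> (\<forall>t\<in>J. y t = \<phi> t \<xi>))) \<and>
     open {(t, \<xi>). \<xi> \<in> \<U> \<and> t \<in> \<I> \<xi>} \<and>
     continuous_on {(t, \<xi>). \<xi> \<in> \<U> \<and> t \<in> \<I> \<xi>} (\<lambda>(t, \<xi>). \<phi> t \<xi>)"

definition invariant_set ::
  "('a \<Rightarrow> real set) \<Rightarrow> (real \<Rightarrow> 'a \<Rightarrow> 'a) \<Rightarrow> 'a set \<Rightarrow> bool" where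
  "invariant_set \<I> \<phi> B \<longleftrightarrow> (\<forall>\<xi>\<in>B. \<I> \<xi> = UNIV) \<and> (\<forall>t. \<phi> t ` B = B)"

definition invariant_measure ::
  "('a \<Rightarrow> real set) \<Rightarrow> (real \<Rightarrow> 'a \<Rightarrow> 'a) \<Rightarrow> 'a measure \<Rightarrow> bool" where
  "invariant_measure \<I> \<phi> \<mu> \<longleftrightarrow>
     (\<forall>t. \<forall>B\<in>sets \<mu>. emeasure \<mu> {x \<in> space \<mu>. t \<in> \<I> x \<and> \<phi> t x \<in> B} = emeasure \<mu> B)"

definition measure_support :: "'a::topological_space measure \<Rightarrow> 'a set" where
  "measure_support \<mu> =
     {x \<in> space \<mu>. \<forall>W. open W \<and> x \<in> W \<longrightarrow> 0 < emeasure \<mu> (W \<inter> space \<mu>)}"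

definition hausdorff_semidist :: "'a::metric_space set \<Rightarrow> 'a set \<Rightarrow> ennreal" where
  "hausdorff_semidist A B = (SUP a\<in>A. ennreal (infdist a B))"

text \<open>Nonemptiness of \<open>J\<close> is explicit because \<open>infdist x {} = 0\<close>.
  Pre-compactness of \<open>K\<close> is relative to \<open>\<U>\<close>: its closure is a compact subset of \<open>\<U>\<close>.\<close>

definition is_global_attractor ::
  "'a::metric_space set \<Rightarrow> ('a \<Rightarrow> real set) \<Rightarrow> (real \<Rightarrow> 'a \<Rightarrow> 'a) \<Rightarrow> 'a set \<Rightarrow> bool" where
  "is_global_attractor \<U> \<I> \<phi> J \<longleftrightarrow>
     (\<forall>\<xi>\<in>\<U>. {0..} \<subseteq> \<I> \<xi>) \<and>
     J \<noteq> {} \<and> J \<subseteq> \<U> \<and> compact J \<and> invariant_set \<I> \<phi> J \<and>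
     (\<forall>K. compact (closure K) \<and> closure K \<subseteq> \<U> \<longrightarrow>
        ((\<lambda>t. hausdorff_semidist (\<phi> t ` K) J) \<longlongrightarrow> 0) at_top)"

definition global_attractor ::
  "'a::metric_space set \<Rightarrow> ('a \<Rightarrow> real set) \<Rightarrow> (real \<Rightarrow> 'a \<Rightarrow> 'a) \<Rightarrow> 'a set" where
  "global_attractor \<U> \<I> \<phi> = (THE J. is_global_attractor \<U> \<I> \<phi> J)"

end

theory Submission
  imports Defs
begin

text \<open>
  Let \<open>W\<close> be the uniform Lyapunov function, with \<open>\<L>\<^sub>A W \<le> - \<gamma>\<close> where \<open>W > \<rho>\<close>, and let \<open>\<mu>\<close> be a
  stationary measure of \<open>\<L>\<^sub>A\<close>.  Four ideas carry the proof.

  Small diffusion is uniformly small.  As \<open>p > n\<close>, Morrey's inequality bounds the supremum of a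
  continuous function on a compact set by its \<open>W\<^sup>1\<^sup>,\<^sup>p\<close> norm on a compact neighbourhood, so that a null
  family tends to zero locally uniformly (\<open>W1p_null_imp_uniformly_null\<close>).  From there on, the
  matrices enter only through this fact, continuity and positive semidefiniteness.

  The tails of \<open>\<mu>\<close> are controlled by the diffusion near one level set of \<open>W\<close>.  For a function \<open>F\<close> of
  one variable,
  \<open>\<L>\<^sub>A (F \<circ> W) = F'(W) \<L>\<^sub>A W + F''(W) \<langle>\<nabla>W, A \<nabla>W\<rangle>\<close>
  has integral zero if \<open>F \<circ> W\<close> is constant outside a compact set.  Let \<open>F'\<close> increase from \<open>0\<close> to \<open>1\<close> on
  \<open>[\<rho>, r]\<close>, equal \<open>1\<close> on \<open>[r, c]\<close> and decrease to \<open>0\<close> afterwards.  The first term is nonpositive, and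
  at most \<open>- \<gamma>\<close> on \<open>{r \<le> W \<le> c}\<close>; the second is positive only where \<open>\<rho> < W < r\<close>, and there it is
  bounded by a constant times the size of \<open>A\<close>.  Hence \<open>\<mu> {r \<le> W \<le> c} \<le> C sup \<bar>A\<bar>\<close> with \<open>C\<close> independent of
  \<open>c\<close> (\<open>slab_estimate\<close>), and \<open>c\<close> may tend to the supremum of \<open>W\<close>.  Along a null sequence the mass above
  each level \<open>r > \<rho>\<close> vanishes.  This is tightness, and Prokhorov's theorem gives part (a); it also
  shows that limit measures live on the compact set \<open>N = {W \<le> \<rho>}\<close> (\<open>AE_sublevel\<close>).

  The deterministic flow inherits the Lyapunov function.  As \<open>A\<close> tends to zero at a fixed point, the drift
  condition becomes \<open>\<nabla>W \<cdot> V \<le> - \<gamma>\<close> where \<open>W > \<rho>\<close>.  Trajectories descend into \<open>N\<close> and stay there, so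
  that the flow is complete forward in time and \<open>\<Inter>\<^sub>t \<phi>\<^sup>t(N)\<close> is the global attractor
  (\<open>core_is_global_attractor\<close>).

  Limit measures are invariant.  In the limit, \<open>\<integral>\<L>\<^sub>A g d\<mu> = 0\<close> becomes \<open>\<integral>V \<cdot> \<nabla>g d\<mu> = 0\<close>, first for
  test functions and then, by mollification, for compactly supported \<open>g\<close> of class \<open>C\<^sup>1\<close>.  One would
  like to take \<open>g = f \<circ> \<phi>\<^sup>t\<close>, which calls for a derivative of the flow with respect to the initial point.
  Euler polygons of a cut-off of \<open>V\<close> are differentiable by construction: a step of length \<open>h\<close> changes
  \<open>\<integral>g d\<mu>\<close> by \<open>o(h)\<close>, as its first-order effect is the integral that vanishes, so that \<open>n\<close> steps of
  length \<open>t/n\<close> change it by \<open>o(1)\<close>; and the polygons converge to the flow on \<open>N\<close>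
  (\<open>flow_integral_invariant\<close>).  Finally \<open>\<mu>(\<phi>\<^sup>t(N)) \<ge> \<mu>(N) = 1\<close> puts all mass on the attractor, where the
  flow is invertible; this yields the statement about the support and invariance for negative times.
\<close>

section \<open>Gradients and smooth bump functions\<close>

definition grad :: "(real^'n::finite \<Rightarrow> real) \<Rightarrow> real^'n \<Rightarrow> real^'n" where
  "grad f x = (\<chi> i. partial_deriv i f x)"

lemma partial_deriv_eq:
  "(f has_derivative f') (at x) \<Longrightarrow> partial_deriv i f x = f' (axis i 1)"
  unfolding partial_deriv_def by (metis frechet_derivative_at)

lemma has_derivative_grad:
  fixes f :: "real^'n::finite \<Rightarrow> real"
  assumes "f differentiable (at x)"
  shows "(f has_derivative (\<lambda>h. grad f x \<bullet> h)) (at x)"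
proof -
  from assms obtain f' where f': "(f has_derivative f') (at x)"
    unfolding differentiable_def by blast
  have "f' = (\<lambda>h. grad f x \<bullet> h)"
  proof
    fix h
    interpret bounded_linear f' using f' by (rule has_derivative_bounded_linear)
    have "f' h = f' (\<Sum>i\<in>UNIV. (h $ i) *\<^sub>R axis i 1)"
      by (simp add: basis_expansion scalar_mult_eq_scaleR[symmetric])
    also have "\<dots> = (\<Sum>i\<in>UNIV. h $ i * f' (axis i 1))"
      by (simp add: sum scaleR)
    also have "\<dots> = grad f x \<bullet> h"
      by (simp add: grad_def inner_vec_def partial_deriv_eq[OF f'] mult.commute)
    finally show "f' h = grad f x \<bullet> h" .
  qed
  with f' show ?thesis by simp
qed

lemma partial_deriv_cong:
  assumes "open S" "x \<in> S" "\<And>y. y \<in> S \<Longrightarrow> f y = g y"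
  shows "partial_deriv i f x = partial_deriv i g x"
proof -
  have "(f has_derivative F) (at x) \<longleftrightarrow> (g has_derivative F) (at x)" for F
    using has_derivative_transform_within_open[OF _ assms(1,2)] assms(3) by metis
  then show ?thesis by (simp add: partial_deriv_def frechet_derivative_def)
qed

lemma continuous_on_grad_iff:
  "continuous_on S (grad f) \<longleftrightarrow> (\<forall>i. continuous_on S (partial_deriv i f))"
proof
  assume "continuous_on S (grad f)"
  then have "continuous_on S (\<lambda>x. grad f x $ i)" for i by (rule continuous_on_component)
  then show "\<forall>i. continuous_on S (partial_deriv i f)" by (simp add: grad_def)
qed (auto simp: grad_def[abs_def] intro!: continuous_on_vec_lambda)

lemma C_k_on_cong:
  assumes "open S" "\<And>x. x \<in> S \<Longrightarrow> f x = g x" "C_k_on k S f"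
  shows "C_k_on k S g"
  using assms
proof (induction k arbitrary: f g)
  case 0
  then show ?case by (metis C_k_on.simps(1) continuous_on_cong)
next
  case (Suc k)
  have "C_k_on k S (partial_deriv i g)" for i
  proof (rule Suc.IH[OF Suc.prems(1)])
    show "partial_deriv i f x = partial_deriv i g x" if "x \<in> S" for x
      by (rule partial_deriv_cong[OF Suc.prems(1) that Suc.prems(2)])
    show "C_k_on k S (partial_deriv i f)" using Suc.prems(3) by simp
  qed
  moreover have "g differentiable_on S"
    unfolding differentiable_on_def
  proof
    fix x assume "x \<in> S"
    with Suc.prems have "f differentiable (at x within S)" by (simp add: differentiable_on_def)
    then show "g differentiable (at x within S)"
      by (rule differentiable_transform_within[OF _ zero_less_one \<open>x \<in> S\<close>])
         (simp add: Suc.prems(2))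
  qed
  ultimately show ?case by simp
qed

lemma C_k_on_subset:
  "C_k_on k S f \<Longrightarrow> T \<subseteq> S \<Longrightarrow> C_k_on k T f"
  by (induction k arbitrary: f) (auto intro: continuous_on_subset differentiable_on_subset)

text \<open>The functions \<open>t\<^sup>-\<^sup>k exp (- 1/t)\<close>, cut off at \<open>0\<close>.  Carrying the power \<open>k\<close> along makes the family closed
  under differentiation up to linear combinations, so that its smoothness is one induction.\<close>

definition flat :: "nat \<Rightarrow> real \<Rightarrow> real" where
  "flat k t = (if t > 0 then exp (- (1 / t)) / t ^ k else 0)"

lemma flat_tendsto_0: "((flat k) \<longlongrightarrow> 0) (at 0)"
proof -
  have "((\<lambda>x::real. x ^ k / exp x) \<longlongrightarrow> 0) at_top" by (rule tendsto_power_div_exp_0)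
  then have "((\<lambda>t::real. inverse t ^ k / exp (inverse t)) \<longlongrightarrow> 0) (at_right 0)"
    using filterlim_compose filterlim_inverse_at_top_right by blast
  then have R: "(flat k \<longlongrightarrow> 0) (at_right 0)"
    by (rule Lim_transform_eventually)
       (auto simp: eventually_at_filter flat_def exp_minus field_simps)
  have L: "(flat k \<longlongrightarrow> 0) (at_left 0)"
    by (rule Lim_transform_eventually[of "\<lambda>_. 0"]) (auto simp: eventually_at_filter flat_def)
  from L R show ?thesis by (simp add: filterlim_split_at)
qed

lemma flat_derivative:
  "(flat k has_real_derivative (flat (k + 2) t - real k * flat (Suc k) t)) (at t)"
proof -
  consider "t > 0" | "t < 0" | "t = 0" by linarith
  then show ?thesis
  proof cases
    case 1
    have "((\<lambda>t. exp (- (1 / t)) / t ^ k) has_real_derivative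
        (flat (k + 2) t - real k * flat (Suc k) t)) (at t)"
    proof (cases k)
      case 0
      then show ?thesis
        using 1 by (auto intro!: derivative_eq_intros simp: flat_def field_simps power2_eq_square)
    next
      case (Suc j)
      then show ?thesis
        using 1 by (auto intro!: derivative_eq_intros simp del: power_Suc)
           (simp add: flat_def field_simps power2_eq_square)
    qed
    then show ?thesis
      by (rule has_field_derivative_transform_within_open[where S="{0<..}"])
         (use 1 in \<open>auto simp: flat_def\<close>)
  next
    case 2
    have "((\<lambda>t. 0::real) has_real_derivative 0) (at t)" by simp
    then have "(flat k has_real_derivative 0) (at t)"
      by (rule has_field_derivative_transform_within_open[where S="{..<0}"])
         (use 2 in \<open>auto simp: flat_def\<close>)
    then show ?thesis using 2 by (simp add: flat_def)
  next
    case 3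
    have "((\<lambda>h. flat k h / h) \<longlongrightarrow> 0) (at 0)"
      by (rule Lim_transform_eventually[OF flat_tendsto_0[of "Suc k"]])
         (auto simp: eventually_at_filter flat_def)
    then show ?thesis using 3 by (simp add: DERIV_def flat_def)
  qed
qed

lemma flat_nonneg: "0 \<le> flat k t" by (simp add: flat_def)
lemma flat_0_le_1: "flat 0 t \<le> 1" by (simp add: flat_def)
lemma flat_pos_iff: "0 < flat k t \<longleftrightarrow> 0 < t" by (simp add: flat_def)

text \<open>Expressions with syntactically evident derivatives: every partial derivative of a member is again a
  member, hence all members are smooth.  Affine arguments of \<open>flat\<close> suffice to build bumps supported on boxes.\<close>

inductive smooth_expr :: "(real^'n::finite \<Rightarrow> real) \<Rightarrow> bool" where
  const: "smooth_expr (\<lambda>x. c)"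
| coord: "smooth_expr (\<lambda>x. x $ i)"
| flat: "smooth_expr (\<lambda>x. flat k (c * x $ i + d))"
| add: "smooth_expr f \<Longrightarrow> smooth_expr g \<Longrightarrow> smooth_expr (\<lambda>x. f x + g x)"
| mult: "smooth_expr f \<Longrightarrow> smooth_expr g \<Longrightarrow> smooth_expr (\<lambda>x. f x * g x)"

lemma smooth_expr_has_derivative:
  fixes f :: "real^'n::finite \<Rightarrow> real"
  assumes "smooth_expr f"
  shows "\<exists>g. (\<forall>x. (f has_derivative (\<lambda>h. g x \<bullet> h)) (at x)) \<and> (\<forall>i. smooth_expr (\<lambda>x. g x $ i))"
  using assms
proof induction
  case (const c)
  show ?case by (rule exI[of _ "\<lambda>x. 0"]) (auto intro: smooth_expr.const)
next
  case (coord j)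
  have "smooth_expr (\<lambda>x::real^'n. axis j (1::real) $ i)" for i by (rule smooth_expr.const)
  moreover have "((\<lambda>x::real^'n. x $ j) has_derivative (\<lambda>h. axis j 1 \<bullet> h)) (at x)" for x
    by (simp add: inner_axis') (rule bounded_linear_imp_has_derivative[OF bounded_linear_vec_nth])
  ultimately show ?case by (intro exI[of _ "\<lambda>x. axis j 1"]) auto
next
  case (flat k c j d)
  let ?g' = "\<lambda>x. c * (flat (k + 2) (c * x $ j + d) + (- real k) * flat (Suc k) (c * x $ j + d))"
  let ?g = "\<lambda>x. ?g' x *\<^sub>R (axis j 1 :: real^'n)"
  have "((\<lambda>x. flat k (c * x $ j + d)) has_derivative (\<lambda>h. ?g x \<bullet> h)) (at x)" for x
  proof -
    have "((\<lambda>x::real^'n. c * x $ j + d) has_derivative (\<lambda>h. c * h $ j)) (at x)"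
      by (auto intro!: derivative_eq_intros bounded_linear_imp_has_derivative[OF bounded_linear_vec_nth])
    from has_derivative_compose[OF this flat_derivative[THEN has_field_derivative_imp_has_derivative]]
    show ?thesis by (simp add: inner_axis' algebra_simps)
  qed
  moreover have "smooth_expr (\<lambda>x. ?g x $ i)" for i
  proof -
    have "smooth_expr (\<lambda>x. ?g' x * (axis j 1 :: real^'n) $ i)"
      by (intro smooth_expr.intros)
    then show ?thesis by simp
  qed
  ultimately show ?case by (intro exI[of _ ?g]) auto
next
  case (add f1 f2)
  then obtain g1 g2 where g: "\<forall>x. (f1 has_derivative (\<lambda>h. g1 x \<bullet> h)) (at x)" "\<forall>i. smooth_expr (\<lambda>x. g1 x $ i)"
     "\<forall>x. (f2 has_derivative (\<lambda>h. g2 x \<bullet> h)) (at x)" "\<forall>i. smooth_expr (\<lambda>x. g2 x $ i)" by blast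
  show ?case
    by (rule exI[of _ "\<lambda>x. g1 x + g2 x"])
       (use g in \<open>auto simp: inner_add_left intro!: has_derivative_add smooth_expr.add\<close>)
next
  case (mult f1 f2)
  then obtain g1 g2 where g: "\<forall>x. (f1 has_derivative (\<lambda>h. g1 x \<bullet> h)) (at x)" "\<forall>i. smooth_expr (\<lambda>x. g1 x $ i)"
     "\<forall>x. (f2 has_derivative (\<lambda>h. g2 x \<bullet> h)) (at x)" "\<forall>i. smooth_expr (\<lambda>x. g2 x $ i)" by blast
  have "((\<lambda>x. f1 x * f2 x) has_derivative (\<lambda>h. (f1 x *\<^sub>R g2 x + f2 x *\<^sub>R g1 x) \<bullet> h)) (at x)" for x
    using has_derivative_mult[OF g(1)[rule_format, of x] g(3)[rule_format, of x]]
    by (simp add: inner_add_left algebra_simps)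
  moreover have "smooth_expr (\<lambda>x. (f1 x *\<^sub>R g2 x + f2 x *\<^sub>R g1 x) $ i)" for i
    using g mult by (auto intro!: smooth_expr.intros)
  ultimately show ?case by (intro exI[of _ "\<lambda>x. f1 x *\<^sub>R g2 x + f2 x *\<^sub>R g1 x"]) auto
qed

lemma smooth_expr_partial_deriv: "smooth_expr f \<Longrightarrow> smooth_expr (partial_deriv i f)"
proof -
  assume "smooth_expr f"
  then obtain g where g: "\<And>x. (f has_derivative (\<lambda>h. g x \<bullet> h)) (at x)" "\<And>i. smooth_expr (\<lambda>x. g x $ i)"
    using smooth_expr_has_derivative by blast
  have "partial_deriv i f = (\<lambda>x. g x $ i)"
    by (rule ext) (simp add: partial_deriv_eq[OF g(1)] inner_axis)
  with g(2) show ?thesis by simp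
qed

lemma smooth_expr_differentiable: "smooth_expr f \<Longrightarrow> f differentiable (at x)"
  using smooth_expr_has_derivative unfolding differentiable_def by blast

lemma smooth_expr_C_k: "smooth_expr f \<Longrightarrow> C_k_on k UNIV f"
proof (induction k arbitrary: f)
  case 0
  then show ?case
    using smooth_expr_differentiable by (auto intro!: continuous_at_imp_continuous_on differentiable_imp_continuous_within)
next
  case (Suc k)
  then show ?case
    by (auto simp: differentiable_on_def smooth_expr_differentiable smooth_expr_partial_deriv)
qed

lemma smooth_expr_prod:
  "finite I \<Longrightarrow> (\<And>i. i \<in> I \<Longrightarrow> smooth_expr (f i)) \<Longrightarrow> smooth_expr (\<lambda>x. \<Prod>i\<in>I. f i x)"
  by (induction I rule: finite_induct) (auto intro: smooth_expr.intros)

text \<open>Positive exactly on the open box between \<open>a\<close> and \<open>b\<close>.  The steepness \<open>k\<close> lets these bumps increase to the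
  indicator function of the box.\<close>

definition box_bump :: "real \<Rightarrow> real^'n::finite \<Rightarrow> real^'n \<Rightarrow> real^'n \<Rightarrow> real" where
  "box_bump k a b x = (\<Prod>i\<in>UNIV. flat 0 (k * (x $ i - a $ i)) * flat 0 (k * (b $ i - x $ i)))"

lemma smooth_expr_box_bump: "smooth_expr (box_bump k a b)"
proof -
  have "smooth_expr (\<lambda>x. \<Prod>i\<in>UNIV. flat 0 (k * x $ i + (- k * a $ i)) * flat 0 ((- k) * x $ i + k * b $ i))"
    by (intro smooth_expr_prod smooth_expr.intros) auto
  then show ?thesis by (simp add: box_bump_def[abs_def] algebra_simps)
qed

lemma box_bump_nonneg: "0 \<le> box_bump k a b x"
  unfolding box_bump_def by (intro prod_nonneg) (simp add: flat_nonneg)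

lemma box_bump_le_1: "box_bump k a b x \<le> 1"
  unfolding box_bump_def by (intro prod_le_1) (simp add: flat_nonneg flat_0_le_1 mult_le_one)

lemma box_bump_pos_iff: "k > 0 \<Longrightarrow> 0 < box_bump k a b x \<longleftrightarrow> x \<in> box a b"
proof -
  assume k: "k > 0"
  have "0 < box_bump k a b x \<longleftrightarrow> (\<forall>i. 0 < flat 0 (k * (x $ i - a $ i)) * flat 0 (k * (b $ i - x $ i)))"
  proof
    assume P: "0 < box_bump k a b x"
    show "\<forall>i. 0 < flat 0 (k * (x $ i - a $ i)) * flat 0 (k * (b $ i - x $ i))"
    proof (rule ccontr)
      assume "\<not> ?thesis"
      then obtain i where "flat 0 (k * (x $ i - a $ i)) * flat 0 (k * (b $ i - x $ i)) = 0"
        by (metis flat_nonneg less_eq_real_def mult_nonneg_nonneg)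
      then have "box_bump k a b x = 0" unfolding box_bump_def by (intro prod_zero) auto
      with P show False by simp
    qed
  qed (auto simp: box_bump_def intro: prod_pos)
  also have "\<dots> \<longleftrightarrow> (\<forall>i. 0 < k * (x $ i - a $ i) \<and> 0 < k * (b $ i - x $ i))"
    by (simp add: zero_less_mult_iff flat_pos_iff) (meson flat_nonneg not_less)
  also have "\<dots> \<longleftrightarrow> x \<in> box a b"
    using k by (simp add: mem_box_cart zero_less_mult_iff)
  finally show ?thesis .
qed

lemma box_bump_eq_0_iff: "k > 0 \<Longrightarrow> box_bump k a b x = 0 \<longleftrightarrow> x \<notin> box a b"
  by (metis box_bump_nonneg box_bump_pos_iff less_eq_real_def order_less_irrefl)

text \<open>Links smooth test functions to the boxes that generate the Borel sets: integrals against
  test functions determine measures and locally integrable functions.\<close>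

lemma box_bump_tendsto:
  "(\<lambda>k. box_bump (real (Suc k)) a b x) \<longlonglongrightarrow> indicator (box a b) x"
proof (cases "x \<in> box a b")
  case True
  have *: "(\<lambda>k. flat 0 (real (Suc k) * t)) \<longlonglongrightarrow> 1" if "t > 0" for t
  proof -
    have "(\<lambda>k. inverse (real (Suc k))) \<longlonglongrightarrow> 0" by (rule LIMSEQ_inverse_real_of_nat)
    then have "(\<lambda>k. exp (- (inverse (real (Suc k)) * (1 / t)))) \<longlonglongrightarrow> exp (- (0 * (1 / t)))"
      by (intro tendsto_intros)
    moreover have "flat 0 (real (Suc k) * t) = exp (- (inverse (real (Suc k)) * (1 / t)))" for k
      using that by (simp add: flat_def divide_simps del: of_nat_Suc)
    ultimately show ?thesis by simp
  qed
  have "(\<lambda>k. box_bump (real (Suc k)) a b x) \<longlonglongrightarrow> (\<Prod>i\<in>(UNIV::'a set). 1 * 1)"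
    unfolding box_bump_def using True
    by (intro tendsto_prod tendsto_mult *) (auto simp: mem_box_cart)
  with True show ?thesis by simp
next
  case False
  then have "box_bump (real (Suc k)) a b x = 0" for k
    by (subst box_bump_eq_0_iff) auto
  then show ?thesis using False by simp
qed

lemma test_functionI:
  assumes "\<And>k. C_k_on k UNIV f" "compact K" "K \<subseteq> U" "\<And>x. x \<notin> K \<Longrightarrow> f x = 0"
  shows "test_function U f"
proof -
  have "{x. f x \<noteq> 0} \<subseteq> K" using assms by auto
  then have "closure {x. f x \<noteq> 0} \<subseteq> K" by (simp add: assms(2) closure_minimal compact_imp_closed)
  moreover have "compact (closure {x. f x \<noteq> 0})"
    by (metis assms(2) calculation closed_closure compact_Int_closed inf.absorb_iff2)
  ultimately show ?thesis using assms unfolding test_function_def by blast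
qed

lemma test_function_box_bump:
  assumes "smooth_expr g" "k > 0" "cbox a b \<subseteq> U"
  shows "test_function U (\<lambda>x. g x * box_bump k a b x)"
proof (rule test_functionI[where K="cbox a b"])
  show "C_k_on j UNIV (\<lambda>x. g x * box_bump k a b x)" for j
    by (intro smooth_expr_C_k smooth_expr.mult assms smooth_expr_box_bump)
  show "g x * box_bump k a b x = 0" if "x \<notin> cbox a b" for x
    using that assms box_bump_eq_0_iff[of k a b x] box_subset_cbox by auto
qed (use assms in auto)

section \<open>Mollification\<close>

lemma integrable_lborel_continuous_supported:
  fixes h :: "real^'n::finite \<Rightarrow> real"
  assumes "continuous_on (cbox a b) h" "\<And>x. x \<notin> cbox a b \<Longrightarrow> h x = 0"
  shows "integrable lborel h" "integral\<^sup>L lborel h = integral (cbox a b) h"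
proof -
  have eq: "(\<lambda>x. indicator (cbox a b) x *\<^sub>R h x) = h"
    using assms(2) by (auto simp: indicator_def fun_eq_iff)
  show i: "integrable lborel h"
    using borel_integrable_compact[OF compact_cbox assms(1)] unfolding eq .
  have "set_integrable lborel (cbox a b) h"
    unfolding set_integrable_def eq by (rule i)
  from set_borel_integral_eq_integral(2)[OF this]
  show "integral\<^sup>L lborel h = integral (cbox a b) h"
    unfolding set_lebesgue_integral_def eq .
qed

lemma integral_lborel_reflect:
  fixes h :: "real^'n::finite \<Rightarrow> real"
  shows "integral\<^sup>L lborel (\<lambda>y. h (x - y)) = integral\<^sup>L lborel h"
proof -
  have d: "lborel = distr lborel borel (\<lambda>y. x + (-1) *\<^sub>R (y::real^'n))"
    using lborel_affine[of "-1" x] by (simp add: density_1)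
  show ?thesis
  proof (cases "h \<in> borel_measurable lborel")
    case True
    then have "integral\<^sup>L lborel h = integral\<^sup>L lborel (\<lambda>y. h (x + (-1) *\<^sub>R y))"
      by (subst d) (rule integral_distr, auto)
    then show ?thesis by simp
  next
    case False
    have "\<not> integrable lborel h" using False by auto
    moreover have "\<not> integrable lborel (\<lambda>y. h (x - y))"
    proof
      assume "integrable lborel (\<lambda>y. h (x - y))"
      then have "(\<lambda>y. h (x - y)) \<in> borel_measurable lborel" by auto
      then have "(\<lambda>z. h (x - (x - z))) \<in> borel_measurable lborel"
        by measurable
      with False show False by simp
    qed
    ultimately show ?thesis by (simp add: not_integrable_integral_eq)
  qed
qed

text \<open>Differentiation under the integral sign, with derivatives represented by gradients.\<close>

lemma integral_has_grad:
  fixes F :: "real^'n::finite \<Rightarrow> real^'n \<Rightarrow> real"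
  assumes "\<And>x t. t \<in> cbox a b \<Longrightarrow> ((\<lambda>x. F x t) has_derivative (\<lambda>h. G x t \<bullet> h)) (at x)"
    and G: "continuous_on (UNIV \<times> cbox a b) (\<lambda>(x, t). G x t)"
    and "\<And>x. continuous_on (cbox a b) (F x)"
  shows "((\<lambda>x. integral (cbox a b) (F x)) has_derivative (\<lambda>h. integral (cbox a b) (G x) \<bullet> h)) (at x)"
proof -
  let ?fx = "\<lambda>x t. blinfun_inner_right (G x t)"
  have "((\<lambda>x. integral (cbox a b) (F x)) has_derivative
      blinfun_apply (integral (cbox a b) (?fx x))) (at x within UNIV)"
  proof (rule leibniz_rule)
    show "((\<lambda>x. F x t) has_derivative blinfun_apply (?fx x t)) (at x within UNIV)"
      if "t \<in> cbox a b" for x t using assms(1)[OF that] by simp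
    show "F x integrable_on cbox a b" for x by (rule integrable_continuous[OF assms(3)])
    show "continuous_on (UNIV \<times> cbox a b) (\<lambda>(x, t). ?fx x t)"
      using bounded_linear.continuous_on[OF bounded_linear_blinfun_inner_right G]
      by (simp add: split_beta)
  qed auto
  moreover have "integral (cbox a b) (?fx x) = blinfun_inner_right (integral (cbox a b) (G x))"
  proof -
    have "continuous_on (cbox a b) (\<lambda>t. (\<lambda>(x,t). G x t) (x, t))"
      by (rule continuous_on_compose2[OF G]) (auto intro!: continuous_intros)
    then have "G x integrable_on cbox a b" using integrable_continuous by simp
    from integral_linear[OF this bounded_linear_blinfun_inner_right] show ?thesis
      by (simp add: o_def)
  qed
  ultimately show ?thesis by simp
qed

lemma integral_vec_nth:
  fixes G :: "'a::euclidean_space \<Rightarrow> real^'n::finite"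
  assumes "G integrable_on S"
  shows "integral S G $ i = integral S (\<lambda>t. G t $ i)"
  using integral_linear[OF assms bounded_linear_vec_nth[of i]] by (simp add: o_def)

lemma smooth_expr_continuous_on: "smooth_expr f \<Longrightarrow> continuous_on S f"
  using smooth_expr_C_k[of f 0] by (auto intro: continuous_on_subset)

text \<open>Derivatives fall on the smooth kernel, whose derivatives are again smooth expressions; this makes the
  claim an induction over the kernel.\<close>

lemma C_k_on_convolution:
  fixes f g :: "real^'n::finite \<Rightarrow> real"
  assumes f: "continuous_on (cbox a b) f" and g: "smooth_expr g"
  shows "C_k_on k UNIV (\<lambda>x. integral (cbox a b) (\<lambda>y. f y * g (x - y)))"
  using g
proof (induction k arbitrary: g)
  case (0 g)
  have "continuous_on (UNIV \<times> cbox a b) (\<lambda>(x, y). f y * g (x - y))"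
    unfolding split_beta
    by (intro continuous_intros continuous_on_compose2[OF f]
        continuous_on_compose2[OF smooth_expr_continuous_on[OF 0, of UNIV]]) auto
  then show ?case
    by (simp add: integral_continuous_on_param)
next
  case (Suc k g)
  have gc: "continuous_on UNIV (grad g)"
    unfolding continuous_on_grad_iff
    using smooth_expr_continuous_on[OF smooth_expr_partial_deriv[OF Suc.prems]] by blast
  have gd: "(g has_derivative (\<lambda>h. grad g x \<bullet> h)) (at x)" for x
    by (rule has_derivative_grad[OF smooth_expr_differentiable[OF Suc.prems]])
  let ?G = "\<lambda>x y. f y *\<^sub>R grad g (x - y)"
  have Gc: "continuous_on (UNIV \<times> cbox a b) (\<lambda>(x, y). ?G x y)"
    unfolding split_beta
    by (intro continuous_intros continuous_on_compose2[OF f] continuous_on_compose2[OF gc]) auto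
  have der: "((\<lambda>x. integral (cbox a b) (\<lambda>y. f y * g (x - y))) has_derivative
      (\<lambda>h. integral (cbox a b) (?G x) \<bullet> h)) (at x)" for x
  proof (rule integral_has_grad[OF _ Gc])
    fix x t
    have "((\<lambda>x. g (x - t)) has_derivative (\<lambda>h. grad g (x - t) \<bullet> h)) (at x)"
      by (rule has_derivative_compose[of "\<lambda>x. x - t" "\<lambda>h. h", OF _ gd]) (auto intro!: derivative_eq_intros)
    then show "((\<lambda>x. f t * g (x - t)) has_derivative (\<lambda>h. ?G x t \<bullet> h)) (at x)"
      by (auto intro!: derivative_eq_intros)
  next
    show "continuous_on (cbox a b) (\<lambda>y. f y * g (x - y))" for x
      by (intro continuous_intros f continuous_on_compose2[OF smooth_expr_continuous_on[OF Suc.prems, of UNIV]]) auto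
  qed
  have "partial_deriv i (\<lambda>x. integral (cbox a b) (\<lambda>y. f y * g (x - y))) =
      (\<lambda>x. integral (cbox a b) (\<lambda>y. f y * partial_deriv i g (x - y)))" for i
  proof
    fix x
    have "continuous_on (cbox a b) (\<lambda>t. (\<lambda>(x,t). ?G x t) (x, t))"
      by (rule continuous_on_compose2[OF Gc]) (auto intro!: continuous_intros)
    then have "?G x integrable_on cbox a b" using integrable_continuous by simp
    then show "partial_deriv i (\<lambda>x. integral (cbox a b) (\<lambda>y. f y * g (x - y))) x =
      integral (cbox a b) (\<lambda>y. f y * partial_deriv i g (x - y))"
      by (simp add: partial_deriv_eq[OF der] inner_axis integral_vec_nth grad_def)
  qed
  then show ?case
    using der Suc.IH[OF smooth_expr_partial_deriv[OF Suc.prems]]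
    by (auto simp: differentiable_on_def differentiable_def)
qed

definition moll_kernel :: "real \<Rightarrow> real^'n::finite \<Rightarrow> real" where
  "moll_kernel e y = box_bump 1 (- vec e) (vec e) y /
     integral (cbox (- vec e) (vec e)) (box_bump 1 (- vec e) (vec e :: real^'n))"

definition mollify :: "real \<Rightarrow> (real^'n::finite \<Rightarrow> real) \<Rightarrow> real^'n \<Rightarrow> real" where
  "mollify e f x = integral (cbox (- vec e) (vec e)) (\<lambda>y. f (x - y) * moll_kernel e y)"

lemma integral_box_bump_pos:
  fixes a b :: "real^'n::finite"
  assumes "box a b \<noteq> {}"
  shows "0 < integral (cbox a b) (box_bump 1 a b)"
proof -
  obtain x where x: "x \<in> box a b" using assms by blast
  have c: "continuous_on (cbox a b) (box_bump 1 a b)"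
    by (rule smooth_expr_continuous_on[OF smooth_expr_box_bump])
  have "integral (cbox a b) (box_bump 1 a b) \<noteq> 0"
  proof
    assume "integral (cbox a b) (box_bump 1 a b) = 0"
    then have "(box_bump 1 a b has_integral 0) (cbox a b)"
      using integrable_integral[OF integrable_continuous[OF c]] by simp
    then have "box_bump 1 a b x = 0"
      using has_integral_0_cbox_imp_0[OF c _ _ ] x box_subset_cbox assms
      by (metis box_bump_nonneg subsetD)
    with x show False using box_bump_eq_0_iff[of 1 a b x] by simp
  qed
  moreover have "0 \<le> integral (cbox a b) (box_bump 1 a b)"
    by (rule integral_nonneg[OF integrable_continuous[OF c]]) (simp add: box_bump_nonneg)
  ultimately show ?thesis by simp
qed

lemma moll_kernel:
  fixes y :: "real^'n::finite"
  assumes "e > 0"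
  shows "0 \<le> moll_kernel e y" "smooth_expr (moll_kernel e :: real^'n \<Rightarrow> real)"
    "integral (cbox (- vec e) (vec e)) (moll_kernel e :: real^'n \<Rightarrow> real) = 1"
    "y \<notin> cbox (- vec e) (vec e) \<Longrightarrow> moll_kernel e y = 0"
proof -
  have "0 \<in> box (- vec e) (vec e :: real^'n)"
    using assms by (simp add: mem_box_cart)
  then have "box (- vec e) (vec e :: real^'n) \<noteq> {}" by blast
  note pos = integral_box_bump_pos[OF this]
  show "0 \<le> moll_kernel e y"
    unfolding moll_kernel_def using less_imp_le[OF pos] by (intro divide_nonneg_nonneg box_bump_nonneg)
  have "smooth_expr (\<lambda>y. (1 / integral (cbox (- vec e) (vec e)) (box_bump 1 (- vec e) (vec e :: real^'n))) *
      box_bump 1 (- vec e) (vec e :: real^'n) y)"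
    by (intro smooth_expr.intros smooth_expr_box_bump)
  then show "smooth_expr (moll_kernel e :: real^'n \<Rightarrow> real)"
    by (simp add: moll_kernel_def[abs_def])
  show "integral (cbox (- vec e) (vec e)) (moll_kernel e :: real^'n \<Rightarrow> real) = 1"
    using pos unfolding moll_kernel_def by (simp add: less_imp_neq[symmetric])
  show "y \<notin> cbox (- vec e) (vec e) \<Longrightarrow> moll_kernel e y = 0"
    unfolding moll_kernel_def using box_bump_eq_0_iff[of 1 "- vec e" "vec e" y] box_subset_cbox by auto
qed

lemma continuous_on_shift:
  fixes f :: "real^'n::finite \<Rightarrow> 'b::topological_space"
  assumes "continuous_on UNIV f" shows "continuous_on S (\<lambda>y. f (x - y))"
  by (rule continuous_on_compose2[OF assms]) (auto intro!: continuous_intros)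

text \<open>The substitution \<open>y \<mapsto> x - y\<close> moves the variable \<open>x\<close> from the rough function into the kernel.\<close>

lemma mollify_C_k:
  fixes f :: "real^'n::finite \<Rightarrow> real"
  assumes "e > 0" "continuous_on UNIV f" "compact K" "\<And>x. x \<notin> K \<Longrightarrow> f x = 0"
  shows "C_k_on k UNIV (mollify e f)"
proof -
  note mk = moll_kernel[where 'n='n, OF assms(1)]
  obtain a b where K: "K \<subseteq> cbox a b"
    using bounded_subset_cbox_symmetric[OF compact_imp_bounded[OF assms(3)]] by metis
  have kc: "continuous_on UNIV (moll_kernel e :: real^'n \<Rightarrow> real)"
    by (rule smooth_expr_continuous_on[OF mk(2)])
  have "mollify e f = (\<lambda>x. integral (cbox a b) (\<lambda>y. f y * moll_kernel e (x - y)))"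
  proof
    fix x
    have "mollify e f x = integral\<^sup>L lborel (\<lambda>y. f (x - y) * moll_kernel e y)"
      unfolding mollify_def
      by (intro integrable_lborel_continuous_supported(2)[symmetric] continuous_intros
          continuous_on_shift assms continuous_on_subset[OF kc]) (auto simp: mk)
    also have "\<dots> = integral\<^sup>L lborel (\<lambda>y. f y * moll_kernel e (x - y))"
      using integral_lborel_reflect[of "\<lambda>y. f y * moll_kernel e (x - y)" x] by simp
    also have "\<dots> = integral (cbox a b) (\<lambda>y. f y * moll_kernel e (x - y))"
      by (intro integrable_lborel_continuous_supported(2) continuous_intros continuous_on_shift kc
          continuous_on_subset[OF assms(2)]) (use K assms(4) in auto)
    finally show "mollify e f x = integral (cbox a b) (\<lambda>y. f y * moll_kernel e (x - y))" .
  qed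
  then show ?thesis
    using C_k_on_convolution[OF continuous_on_subset[OF assms(2)] mk(2)] by simp
qed

text \<open>In the form with the kernel unshifted, derivatives fall on the mollified function instead; so mollification
  approximates the derivatives of a function together with the function.\<close>

lemma mollify_partial_deriv:
  fixes f :: "real^'n::finite \<Rightarrow> real"
  assumes "e > 0" "C_k_on 1 UNIV f"
  shows "partial_deriv i (mollify e f) = mollify e (partial_deriv i f)"
proof
  fix x
  note mk = moll_kernel[where 'n='n, OF assms(1)]
  have kc: "continuous_on S (moll_kernel e :: real^'n \<Rightarrow> real)" for S
    by (rule smooth_expr_continuous_on[OF mk(2)])
  have fd: "(f has_derivative (\<lambda>h. grad f x \<bullet> h)) (at x)" for x
    using assms(2) by (intro has_derivative_grad) (auto simp: differentiable_on_def)
  have fc: "continuous_on UNIV f"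
    using fd by (auto intro!: continuous_at_imp_continuous_on has_derivative_continuous)
  have gc: "continuous_on UNIV (grad f)"
    unfolding continuous_on_grad_iff using assms(2) by simp
  let ?C = "cbox (- vec e) (vec e :: real^'n)"
  let ?G = "\<lambda>x y. moll_kernel e y *\<^sub>R grad f (x - y)"
  have Gc: "continuous_on (UNIV \<times> ?C) (\<lambda>(x, y). ?G x y)"
    unfolding split_beta
    by (intro continuous_intros continuous_on_compose2[OF kc[of UNIV]] continuous_on_compose2[OF gc]) auto
  have der: "(mollify e f has_derivative (\<lambda>h. integral ?C (?G x) \<bullet> h)) (at x)"
    unfolding mollify_def[abs_def]
  proof (rule integral_has_grad[OF _ Gc])
    fix x t
    have "((\<lambda>x. f (x - t)) has_derivative (\<lambda>h. grad f (x - t) \<bullet> h)) (at x)"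
      by (rule has_derivative_compose[of "\<lambda>x. x - t" "\<lambda>h. h", OF _ fd]) (auto intro!: derivative_eq_intros)
    then show "((\<lambda>x. f (x - t) * moll_kernel e t) has_derivative (\<lambda>h. ?G x t \<bullet> h)) (at x)"
      by (auto intro!: derivative_eq_intros)
  next
    show "continuous_on ?C (\<lambda>y. f (x - y) * moll_kernel e y)" for x
      by (intro continuous_intros continuous_on_shift fc kc)
  qed
  have "?G x integrable_on ?C"
    by (intro integrable_continuous continuous_intros continuous_on_shift gc kc)
  then show "partial_deriv i (mollify e f) x = mollify e (partial_deriv i f) x"
    by (simp add: partial_deriv_eq[OF der] inner_axis integral_vec_nth grad_def mollify_def mult.commute)
qed

lemma norm_le_of_cube:
  fixes y :: "real^'n::finite"
  assumes "y \<in> cbox (- vec e) (vec e)" shows "norm y \<le> real CARD('n) * e"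
proof -
  have "norm y \<le> (\<Sum>i\<in>UNIV. \<bar>y $ i\<bar>)" by (rule norm_le_l1_cart)
  also have "\<dots> \<le> (\<Sum>i\<in>(UNIV::'n set). e)"
    using assms by (intro sum_mono) (auto simp: mem_box_cart abs_le_iff minus_le_iff)
  finally show ?thesis by simp
qed

text \<open>Two points at distance less than \<open>1\<close> both lie in a larger ball, where compactness applies, or both lie
  outside the support.\<close>

lemma uniformly_continuous_on_compact_support:
  fixes f :: "'a::euclidean_space \<Rightarrow> 'b::real_normed_vector"
  assumes "continuous_on UNIV f" "compact K" "\<And>x. x \<notin> K \<Longrightarrow> f x = 0"
  shows "uniformly_continuous_on UNIV f"
  unfolding uniformly_continuous_on_def
proof (intro allI impI)
  fix e :: real assume e: "e > 0"
  obtain r where r: "r > 0" "K \<subseteq> cball 0 r"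
    using compact_imp_bounded[OF assms(2)] by (metis bounded_subset_ballD ball_subset_cball order_trans)
  have "uniformly_continuous_on (cball 0 (r + 1)) f"
    by (intro compact_uniformly_continuous continuous_on_subset[OF assms(1)]) auto
  then obtain d where d: "d > 0" "\<And>x y. x \<in> cball 0 (r+1) \<Longrightarrow> y \<in> cball 0 (r+1) \<Longrightarrow> dist y x < d \<Longrightarrow> dist (f y) (f x) < e"
    unfolding uniformly_continuous_on_def using e by metis
  show "\<exists>d>0. \<forall>x\<in>UNIV. \<forall>x'\<in>UNIV. dist x' x < d \<longrightarrow> dist (f x') (f x) < e"
  proof (intro exI[of _ "min d 1"] conjI ballI impI)
    fix x x' :: 'a assume c: "dist x' x < min d 1"
    show "dist (f x') (f x) < e"
    proof (cases "x \<in> cball 0 (r+1) \<and> x' \<in> cball 0 (r+1)")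
      case True then show ?thesis using d c by auto
    next
      case False
      have "norm x' \<le> norm x + dist x' x" "norm x \<le> norm x' + dist x' x"
        using norm_triangle_sub[of x' x] norm_triangle_sub[of x x'] by (auto simp: dist_norm norm_minus_commute)
      then have "norm x > r \<and> norm x' > r" using False c by auto
      then have "x \<notin> K" "x' \<notin> K" using r by auto
      then show ?thesis using assms(3) e by simp
    qed
  qed (use d in auto)
qed

lemma mollify_uniform_limit:
  fixes f :: "real^'n::finite \<Rightarrow> real"
  assumes "continuous_on UNIV f" "compact K" "\<And>x. x \<notin> K \<Longrightarrow> f x = 0" "\<epsilon> > 0"
  shows "\<exists>d>0. \<forall>e x. 0 < e \<and> e < d \<longrightarrow> \<bar>mollify e f x - f x\<bar> \<le> \<epsilon>"
proof -
  obtain d where d: "d > 0" "\<And>x y. dist y x < d \<Longrightarrow> dist (f y) (f x) < \<epsilon>"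
    using uniformly_continuous_on_compact_support[OF assms(1-3)] assms(4)
    unfolding uniformly_continuous_on_def by (metis UNIV_I)
  show ?thesis
  proof (intro exI[of _ "d / real CARD('n)"] conjI allI impI)
    show "0 < d / real CARD('n)" using d by simp
    fix e x assume e: "0 < e \<and> e < d / real CARD('n)"
    note mk = moll_kernel[where 'n='n, OF conjunct1[OF e]]
    let ?C = "cbox (- vec e) (vec e :: real^'n)"
    have kc: "continuous_on S (moll_kernel e :: real^'n \<Rightarrow> real)" for S
      by (rule smooth_expr_continuous_on[OF mk(2)])
    have i1: "(\<lambda>y. f (x - y) * moll_kernel e y) integrable_on ?C"
      by (intro integrable_continuous continuous_intros continuous_on_shift assms kc)
    have i2: "(\<lambda>y. f x * moll_kernel e y) integrable_on ?C"
      by (intro integrable_continuous continuous_intros kc)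
    have "mollify e f x - f x = integral ?C (\<lambda>y. f (x - y) * moll_kernel e y) - integral ?C (\<lambda>y. f x * moll_kernel e y)"
      by (simp add: mollify_def mk(3))
    also have "\<dots> = integral ?C (\<lambda>y. f (x - y) * moll_kernel e y - f x * moll_kernel e y)"
      by (rule integral_diff[OF i1 i2, symmetric])
    also have "norm \<dots> \<le> integral ?C (\<lambda>y. \<epsilon> * moll_kernel e y)"
    proof (rule integral_norm_bound_integral)
      show "(\<lambda>y. f (x - y) * moll_kernel e y - f x * moll_kernel e y) integrable_on ?C"
        by (rule integrable_diff[OF i1 i2])
      show "(\<lambda>y. \<epsilon> * moll_kernel e y) integrable_on ?C"
        by (intro integrable_continuous continuous_intros kc)
      fix y assume y: "y \<in> ?C"
      have "real CARD('n) * e < d" using e by (simp add: field_simps)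
      then have "dist (x - y) x < d" using norm_le_of_cube[OF y] by (simp add: dist_norm)
      then have "\<bar>f (x - y) - f x\<bar> \<le> \<epsilon>" using d(2) by (fastforce simp: dist_real_def)
      then have "\<bar>f (x - y) - f x\<bar> * moll_kernel e y \<le> \<epsilon> * moll_kernel e y"
        by (intro mult_right_mono mk)
      then show "norm (f (x - y) * moll_kernel e y - f x * moll_kernel e y) \<le> \<epsilon> * moll_kernel e y"
        by (simp add: left_diff_distrib[symmetric] abs_mult mk(1))
    qed
    also have "\<dots> = \<epsilon>" by (simp add: mk(3))
    finally show "\<bar>mollify e f x - f x\<bar> \<le> \<epsilon>" by simp
  qed
qed

lemma partial_deriv_outside_support:
  assumes "compact K" "\<And>x. x \<notin> K \<Longrightarrow> f x = (0::real)" "x \<notin> K"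
  shows "partial_deriv i f x = 0"
proof -
  have "partial_deriv i f x = partial_deriv i (\<lambda>_. 0) x"
    by (rule partial_deriv_cong[of "- K"]) (use assms in \<open>auto simp: compact_imp_closed\<close>)
  also have "\<dots> = 0" by (simp add: partial_deriv_eq[OF has_derivative_const])
  finally show ?thesis .
qed

lemma C_k_on_Suc_D: "C_k_on (Suc k) UNIV f \<Longrightarrow> C_k_on k UNIV f"
proof (induction k arbitrary: f)
  case 0
  then show ?case by (auto intro: differentiable_imp_continuous_on)
qed auto

text \<open>The kernel lives in a cube of half side \<open>e\<close>, so the support grows by at most \<open>n e\<close> and stays inside
  one compact neighbourhood for all small \<open>e\<close>.\<close>

lemma mollify_supported:
  fixes K :: "(real^'n::finite) set"
  assumes "open U" "compact K" "K \<subseteq> U"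
  shows "\<exists>K' d. compact K' \<and> K' \<subseteq> U \<and> d > 0 \<and> K \<subseteq> K' \<and>
    (\<forall>e g. 0 < e \<longrightarrow> e < d \<longrightarrow> (\<forall>x. x \<notin> K \<longrightarrow> g x = 0) \<longrightarrow> (\<forall>x. x \<notin> K' \<longrightarrow> mollify e g x = 0))"
proof -
  obtain \<delta> where \<delta>: "\<delta> > 0" "(\<Union>x\<in>K. cball x \<delta>) \<subseteq> U"
    using compact_subset_open_imp_cball_epsilon_subset[OF assms(2,1,3)] by blast
  let ?K' = "\<Union>x\<in>K. \<Union>y\<in>cball 0 \<delta>. {x + y}"
  show ?thesis
  proof (intro exI[of _ ?K'] exI[of _ "\<delta> / real CARD('n)"] conjI allI impI)
    show "compact ?K'" by (intro compact_sums' assms compact_cball)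
    show "?K' \<subseteq> U"
    proof
      fix z assume "z \<in> ?K'"
      then obtain x y where "x \<in> K" "norm y \<le> \<delta>" "z = x + y" by auto
      then have "z \<in> cball x \<delta>" by (simp add: dist_norm)
      then show "z \<in> U" using \<delta>(2) \<open>x \<in> K\<close> by blast
    qed
    show "K \<subseteq> ?K'" using \<delta> by (auto intro!: bexI[of _ 0])
    show "0 < \<delta> / real CARD('n)" using \<delta> by simp
    fix e x and g :: "real^'n \<Rightarrow> real"
    assume e: "0 < e" "e < \<delta> / real CARD('n)" and g: "\<forall>x. x \<notin> K \<longrightarrow> g x = 0" and x: "x \<notin> ?K'"
    have "g (x - y) = 0" if "y \<in> cbox (- vec e) (vec e)" for y
    proof (rule g[rule_format])
      have "real CARD('n) * e < \<delta>" using e by (simp add: field_simps)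
      then have "y \<in> cball 0 \<delta>" using norm_le_of_cube[OF that] by simp
      then have "(x - y) + y \<in> ?K'" if "x - y \<in> K" using that by blast
      then show "x - y \<notin> K" using x by auto
    qed
    then have "mollify e g x = integral (cbox (- vec e) (vec e :: real^'n)) (\<lambda>y. 0)"
      unfolding mollify_def by (intro integral_cong) simp
    then show "mollify e g x = 0" by simp
  qed
qed

text \<open>Supports are kept in one compact set \<open>K'\<close>, on which coefficients of the generator are bounded: this is
  what allows the limit in integrals against stationary measures.\<close>

lemma test_function_approx_C2:
  fixes f :: "real^'n::finite \<Rightarrow> real"
  assumes "open U" "compact K" "K \<subseteq> U" "\<And>x. x \<notin> K \<Longrightarrow> f x = 0" "C_k_on 2 UNIV f"
  obtains K' where "compact K'" "K' \<subseteq> U" "K \<subseteq> K'"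
    "\<And>\<epsilon>. \<epsilon> > 0 \<Longrightarrow> \<exists>g. test_function U g \<and> (\<forall>x. x \<notin> K' \<longrightarrow> g x = 0) \<and>
       (\<forall>x i. \<bar>partial_deriv i g x - partial_deriv i f x\<bar> \<le> \<epsilon>) \<and>
       (\<forall>x i j. \<bar>partial_deriv i (partial_deriv j g) x - partial_deriv i (partial_deriv j f) x\<bar> \<le> \<epsilon>)"
proof -
  from mollify_supported[OF assms(1-3)]
  obtain K' d where K': "compact K'" "K' \<subseteq> U" "d > 0" "K \<subseteq> K'"
    "\<forall>e g. 0 < e \<longrightarrow> e < d \<longrightarrow> (\<forall>x. x \<notin> K \<longrightarrow> g x = 0) \<longrightarrow> (\<forall>x. x \<notin> K' \<longrightarrow> mollify e g x = 0)"
    by (elim exE conjE)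
  have C1: "C_k_on 1 UNIV f" using C_k_on_Suc_D[of 1 f] assms(5) by (simp add: numeral_2_eq_2)
  have Cp: "C_k_on 1 UNIV (partial_deriv j f)" for j using assms(5) by (simp add: numeral_2_eq_2)
  have p0: "x \<notin> K \<Longrightarrow> partial_deriv j f x = 0" for x j
    by (rule partial_deriv_outside_support[OF assms(2,4)])
  have pp0: "x \<notin> K \<Longrightarrow> partial_deriv i (partial_deriv j f) x = 0" for x i j
    by (rule partial_deriv_outside_support[OF assms(2) p0])
  have c1: "continuous_on UNIV (partial_deriv i f)" for i using C1 by simp
  have c2: "continuous_on UNIV (partial_deriv i (partial_deriv j f))" for i j using Cp[of j] by simp
  have c0: "continuous_on UNIV f" using C_k_on_Suc_D[of 0 f] C1 by simp
  show ?thesis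
  proof (rule that[OF K'(1,2,4)])
    fix \<epsilon> :: real assume \<epsilon>: "\<epsilon> > 0"
    have "\<forall>i. \<exists>d>0. \<forall>e x. 0 < e \<and> e < d \<longrightarrow> \<bar>mollify e (partial_deriv i f) x - partial_deriv i f x\<bar> \<le> \<epsilon>"
      using mollify_uniform_limit[OF c1 assms(2) p0 \<epsilon>] by blast
    then obtain d1 where d1: "\<And>i. d1 i > 0" "\<And>i e x. 0 < e \<Longrightarrow> e < d1 i \<Longrightarrow> \<bar>mollify e (partial_deriv i f) x - partial_deriv i f x\<bar> \<le> \<epsilon>"
      by metis
    have "\<forall>i j. \<exists>d>0. \<forall>e x. 0 < e \<and> e < d \<longrightarrow> \<bar>mollify e (partial_deriv i (partial_deriv j f)) x - partial_deriv i (partial_deriv j f) x\<bar> \<le> \<epsilon>"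
      using mollify_uniform_limit[OF c2 assms(2) pp0 \<epsilon>] by blast
    then obtain d2 where d2: "\<And>i j. d2 i j > 0" "\<And>i j e x. 0 < e \<Longrightarrow> e < d2 i j \<Longrightarrow> \<bar>mollify e (partial_deriv i (partial_deriv j f)) x - partial_deriv i (partial_deriv j f) x\<bar> \<le> \<epsilon>"
      by metis
    define m where "m = Min (insert d (range d1 \<union> range (\<lambda>(i,j). d2 i j)))"
    have fin: "finite (insert d (range d1 \<union> range (\<lambda>(i,j). d2 i j)))" by simp
    have m: "m > 0" unfolding m_def using K'(3) d1(1) d2(1) by (subst Min_gr_iff[OF fin]) auto
    have md: "m \<le> d" "m \<le> d1 i" "m \<le> d2 i j" for i j
      unfolding m_def by (rule Min_le[OF fin], force)+
    define e where "e = m / 2"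
    have e: "e > 0" "e < d" "e < d1 i" "e < d2 i j" for i j
      using m md(1) md(2)[of i] md(3)[of i j] unfolding e_def by auto
    let ?g = "mollify e f"
    have out: "x \<notin> K' \<Longrightarrow> ?g x = 0" for x using K'(5) e(1,2) assms(4) by blast
    have "test_function U ?g"
      by (rule test_functionI[OF mollify_C_k[OF e(1) c0 assms(2,4)] K'(1,2) out])
    moreover have "partial_deriv i ?g = mollify e (partial_deriv i f)" for i
      by (rule mollify_partial_deriv[OF e(1) C1])
    moreover have "partial_deriv i (mollify e (partial_deriv j f)) = mollify e (partial_deriv i (partial_deriv j f))" for i j
      by (rule mollify_partial_deriv[OF e(1) Cp])
    ultimately show "\<exists>g. test_function U g \<and> (\<forall>x. x \<notin> K' \<longrightarrow> g x = 0) \<and>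
       (\<forall>x i. \<bar>partial_deriv i g x - partial_deriv i f x\<bar> \<le> \<epsilon>) \<and>
       (\<forall>x i j. \<bar>partial_deriv i (partial_deriv j g) x - partial_deriv i (partial_deriv j f) x\<bar> \<le> \<epsilon>)"
      using d1(2)[OF e(1) e(3)] d2(2)[OF e(1) e(4)] out by (intro exI[of _ ?g]) simp
  qed
qed

lemma test_function_approx_C1:
  fixes f :: "real^'n::finite \<Rightarrow> real"
  assumes "open U" "compact K" "K \<subseteq> U" "\<And>x. x \<notin> K \<Longrightarrow> f x = 0" "C_k_on 1 UNIV f"
  obtains K' where "compact K'" "K' \<subseteq> U" "K \<subseteq> K'"
    "\<And>\<epsilon>. \<epsilon> > 0 \<Longrightarrow> \<exists>g. test_function U g \<and> (\<forall>x. x \<notin> K' \<longrightarrow> g x = 0) \<and>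
       (\<forall>x i. \<bar>partial_deriv i g x - partial_deriv i f x\<bar> \<le> \<epsilon>)"
proof -
  from mollify_supported[OF assms(1-3)]
  obtain K' d where K': "compact K'" "K' \<subseteq> U" "d > 0" "K \<subseteq> K'"
    "\<forall>e g. 0 < e \<longrightarrow> e < d \<longrightarrow> (\<forall>x. x \<notin> K \<longrightarrow> g x = 0) \<longrightarrow> (\<forall>x. x \<notin> K' \<longrightarrow> mollify e g x = 0)"
    by (elim exE conjE)
  have p0: "x \<notin> K \<Longrightarrow> partial_deriv j f x = 0" for x j
    by (rule partial_deriv_outside_support[OF assms(2,4)])
  have c1: "continuous_on UNIV (partial_deriv i f)" for i using assms(5) by simp
  have c0: "continuous_on UNIV f" using C_k_on_Suc_D[of 0 f] assms(5) by simp
  show ?thesis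
  proof (rule that[OF K'(1,2,4)])
    fix \<epsilon> :: real assume \<epsilon>: "\<epsilon> > 0"
    have "\<forall>i. \<exists>d>0. \<forall>e x. 0 < e \<and> e < d \<longrightarrow> \<bar>mollify e (partial_deriv i f) x - partial_deriv i f x\<bar> \<le> \<epsilon>"
      using mollify_uniform_limit[OF c1 assms(2) p0 \<epsilon>] by blast
    then obtain d1 where d1: "\<And>i. d1 i > 0" "\<And>i e x. 0 < e \<Longrightarrow> e < d1 i \<Longrightarrow> \<bar>mollify e (partial_deriv i f) x - partial_deriv i f x\<bar> \<le> \<epsilon>"
      by metis
    define m where "m = Min (insert d (range d1))"
    have fin: "finite (insert d (range d1))" by simp
    have m: "m > 0" unfolding m_def using K'(3) d1(1) by (subst Min_gr_iff[OF fin]) auto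
    have md: "m \<le> d" "m \<le> d1 i" for i
      unfolding m_def by (rule Min_le[OF fin], force)+
    define e where "e = m / 2"
    have e: "e > 0" "e < d" "e < d1 i" for i
      using m md(1) md(2)[of i] unfolding e_def by auto
    let ?g = "mollify e f"
    have out: "x \<notin> K' \<Longrightarrow> ?g x = 0" for x using K'(5) e(1,2) assms(4) by blast
    have "test_function U ?g"
      by (rule test_functionI[OF mollify_C_k[OF e(1) c0 assms(2,4)] K'(1,2) out])
    moreover have "partial_deriv i ?g = mollify e (partial_deriv i f)" for i
      by (rule mollify_partial_deriv[OF e(1) assms(5)])
    ultimately show "\<exists>g. test_function U g \<and> (\<forall>x. x \<notin> K' \<longrightarrow> g x = 0) \<and>
       (\<forall>x i. \<bar>partial_deriv i g x - partial_deriv i f x\<bar> \<le> \<epsilon>)"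
      using d1(2)[OF e(1) e(3)] out by (intro exI[of _ ?g]) simp
  qed
qed

section \<open>Vanishing of a function from its integrals\<close>

text \<open>The sets over which the integral vanishes form a Dynkin system, and the boxes are an intersection-stable
  generator of the Borel sets; so the integral vanishes over every Borel
  set, as it does for the density \<open>0\<close>.\<close>

lemma AE_zero_of_box_integrals:
  fixes H :: "real^'n::finite \<Rightarrow> real"
  assumes H: "integrable lborel H" and box: "\<And>a b. (LINT x:box a b|lborel. H x) = 0"
  shows "AE x in lborel. H x = 0"
proof -
  have sets: "sets (borel :: (real^'n) measure) = sigma_sets UNIV (range (\<lambda>(a, b). box a b))"
    by (subst borel_eq_box) simp
  have si: "set_integrable lborel A H" if "A \<in> sets borel" for A
    using that H integrable_mult_indicator[of A lborel H] by (simp add: set_integrable_def)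
  have U: "(LINT x:UNIV|lborel. H x) = 0"
  proof -
    let ?B = "\<lambda>i::nat. box (- (real i *\<^sub>R One)) (real i *\<^sub>R One) :: (real^'n) set"
    have "(\<lambda>i. LINT x|lborel. indicator (?B i) x *\<^sub>R H x) \<longlonglongrightarrow> (LINT x|lborel. H x)"
    proof (rule integral_dominated_convergence[where w="\<lambda>x. \<bar>H x\<bar>"])
      show "AE x in lborel. (\<lambda>i. indicator (?B i) x *\<^sub>R H x) \<longlonglongrightarrow> H x"
      proof (rule AE_I2, rule tendsto_eventually)
        fix x :: "real^'n"
        obtain i where i: "x \<in> ?B i" using UN_box_eq_UNIV by blast
        have "x \<in> ?B j" if "j \<ge> i" for j
        proof -
          have "real i \<le> real j" using that by simp
          then show ?thesis using i unfolding mem_box by (auto simp: algebra_simps)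
        qed
        then show "\<forall>\<^sub>F j in sequentially. indicator (?B j) x *\<^sub>R H x = H x"
          by (auto simp: eventually_sequentially intro!: exI[of _ i])
      qed
    qed (use H in \<open>auto simp: indicator_def\<close>)
    moreover have "(LINT x|lborel. indicator (?B i) x *\<^sub>R H x) = 0" for i
      using box unfolding set_lebesgue_integral_def .
    ultimately show ?thesis by (simp add: set_lebesgue_integral_def LIMSEQ_const_iff)
  qed
  have "(LINT x:A|lborel. H x) = 0" if "A \<in> sigma_sets UNIV (range (\<lambda>(a, b). box a b))" for A :: "(real^'n) set"
  proof -
    have G: "Int_stable (range (\<lambda>(a, b). box a b :: (real^'n) set))"
      by (auto simp: Int_stable_def box_Int_box)
    have G2: "range (\<lambda>(a, b). box a b :: (real^'n) set) \<subseteq> Pow UNIV" by simp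
    from G G2 that show ?thesis
    proof (induction rule: sigma_sets_induct_disjoint)
      case (basic A) then show ?case using box by auto
    next
      case (compl A)
      then have A: "A \<in> sets borel" using sets by simp
      have "(LINT x:A \<union> (UNIV - A)|lborel. H x) = (LINT x:A|lborel. H x) + (LINT x:UNIV - A|lborel. H x)"
        by (rule set_integral_Un) (use A si in auto)
      then show ?case using compl U by simp
    next
      case (union A)
      then have A: "A i \<in> sets borel" for i using sets by auto
      have "(LINT x:(\<Union>i. A i)|lborel. H x) = (\<Sum>i. LINT x:A i|lborel. H x)"
        by (rule lebesgue_integral_countable_add)
           (use A si union.hyps in \<open>auto simp: disjoint_family_on_def\<close>)
      then show ?case using union by simp
    qed (auto simp: set_lebesgue_integral_def)
  qed
  then have "(LINT x:A|lborel. H x) = (LINT x:A|lborel. 0)" if "A \<in> sets lborel" for A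
    using that sets by simp
  from density_unique_real[OF H _ this] show ?thesis by simp
qed

text \<open>The fundamental lemma of the calculus of variations.  Steep bumps turn test integrals into integrals over
  boxes, and countably many boxes exhaust the open set.\<close>

lemma AE_zero_of_test_integrals:
  fixes h :: "real^'n::finite \<Rightarrow> real"
  assumes U: "open U" and int: "\<And>K. compact K \<Longrightarrow> K \<subseteq> U \<Longrightarrow> set_integrable lebesgue K h"
    and test: "\<And>\<psi>. test_function U \<psi> \<Longrightarrow> (LINT x:U|lebesgue. h x * \<psi> x) = 0"
  shows "AE x in lebesgue. x \<in> U \<longrightarrow> h x = 0"
proof -
  have ib: "set_integrable lebesgue (box a b) h" if "cbox a b \<subseteq> U" for a b
    by (rule set_integrable_subset[OF int[OF compact_cbox that]]) (auto simp: box_subset_cbox)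
  have zero: "(LINT x:box a b|lebesgue. h x) = 0" if ab: "cbox a b \<subseteq> U" for a b
  proof -
    have "(\<lambda>k. LINT x|lebesgue. indicator U x *\<^sub>R (h x * box_bump (real (Suc k)) a b x))
        \<longlonglongrightarrow> (LINT x|lebesgue. indicator (box a b) x *\<^sub>R h x)"
    proof (rule integral_dominated_convergence[where w="\<lambda>x. \<bar>indicator (cbox a b) x *\<^sub>R h x\<bar>"])
      have eq: "indicator U x *\<^sub>R (h x * box_bump (real (Suc k)) a b x) =
          (indicator (cbox a b) x *\<^sub>R h x) * box_bump (real (Suc k)) a b x" for k x
        using ab box_subset_cbox[of a b] box_bump_eq_0_iff[of "real (Suc k)" a b x]
        by (auto simp: indicator_def simp del: of_nat_Suc)
      have i: "integrable lebesgue (\<lambda>x. indicator (cbox a b) x *\<^sub>R h x)"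
        using int[OF compact_cbox ab] by (simp add: set_integrable_def)
      then show "integrable lebesgue (\<lambda>x. \<bar>indicator (cbox a b) x *\<^sub>R h x\<bar>)" by (rule integrable_abs)
      show "(\<lambda>x. indicator (box a b) x *\<^sub>R h x) \<in> borel_measurable lebesgue"
        using ib[OF ab] by (simp add: set_integrable_def)
      have "box_bump (real (Suc k)) a b \<in> borel_measurable borel" for k
        by (rule borel_measurable_continuous_onI[OF smooth_expr_continuous_on[OF smooth_expr_box_bump]])
      then show "(\<lambda>x. indicator U x *\<^sub>R (h x * box_bump (real (Suc k)) a b x)) \<in> borel_measurable lebesgue" for k
        unfolding eq by (intro borel_measurable_times borel_measurable_integrable[OF i]) (simp add: measurable_completion)
      show "AE x in lebesgue. norm (indicator U x *\<^sub>R (h x * box_bump (real (Suc k)) a b x)) \<le> \<bar>indicator (cbox a b) x *\<^sub>R h x\<bar>" for k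
        unfolding eq by (simp add: abs_mult box_bump_nonneg box_bump_le_1 mult_left_le del: of_nat_Suc)
      have "(\<lambda>k. (indicator (cbox a b) x *\<^sub>R h x) * box_bump (real (Suc k)) a b x) \<longlonglongrightarrow>
          (indicator (cbox a b) x *\<^sub>R h x) * indicator (box a b) x" for x
        by (intro tendsto_intros box_bump_tendsto)
      moreover have "(indicator (cbox a b) x *\<^sub>R h x) * indicator (box a b) x = indicator (box a b) x *\<^sub>R h x" for x
        using box_subset_cbox[of a b] by (auto simp: indicator_def)
      ultimately have "(\<lambda>k. (indicator (cbox a b) x *\<^sub>R h x) * box_bump (real (Suc k)) a b x) \<longlonglongrightarrow>
          indicator (box a b) x *\<^sub>R h x" for x by (simp only:)
      then show "AE x in lebesgue. (\<lambda>k. indicator U x *\<^sub>R (h x * box_bump (real (Suc k)) a b x))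
          \<longlonglongrightarrow> indicator (box a b) x *\<^sub>R h x"
        unfolding eq by (rule AE_I2)
    qed
    moreover have "(LINT x|lebesgue. indicator U x *\<^sub>R (h x * box_bump (real (Suc k)) a b x)) = 0" for k
      using test[OF test_function_box_bump[OF smooth_expr.const[of 1], of "real (Suc k)", OF _ ab]]
      by (simp add: set_lebesgue_integral_def)
    ultimately show ?thesis by (simp add: set_lebesgue_integral_def LIMSEQ_const_iff)
  qed
  have AE_box: "AE x in lebesgue. x \<in> box a b \<longrightarrow> h x = 0" if ab: "cbox a b \<subseteq> U" for a b
  proof -
    let ?H = "\<lambda>x. indicator (box a b) x *\<^sub>R h x"
    have iH: "integrable lebesgue ?H" using ib[OF ab] by (simp add: set_integrable_def)
    obtain H' where H': "H' \<in> borel_measurable lborel" "AE x in lborel. ?H x = H' x"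
      using completion_ex_borel_measurable_real[OF borel_measurable_integrable[OF iH]] by blast
    have ae: "AE x in lebesgue. ?H x = H' x" using H'(2) by (rule AE_completion)
    have H'l: "H' \<in> borel_measurable lebesgue" using H'(1) by (rule measurable_completion)
    have "integrable lebesgue H'"
      using integrable_cong_AE[OF borel_measurable_integrable[OF iH] H'l ae] iH by simp
    then have iH': "integrable lborel H'" using H'(1) by (simp add: integrable_completion)
    have "(LINT x:box c d|lborel. H' x) = 0" for c d
    proof -
      obtain a' b' where b': "box c d \<inter> box a b = box a' b'" by (simp add: box_Int_box)
      have m: "(\<lambda>x. indicator (box c d) x *\<^sub>R H' x) \<in> borel_measurable lborel" using H'(1) by measurable
      have "(LINT x:box c d|lborel. H' x) = (LINT x|lebesgue. indicator (box c d) x *\<^sub>R H' x)"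
        unfolding set_lebesgue_integral_def by (rule integral_completion[symmetric, OF m])
      also have "\<dots> = (LINT x|lebesgue. indicator (box c d) x *\<^sub>R ?H x)"
      proof (rule integral_cong_AE)
        show "(\<lambda>x. indicator (box c d) x *\<^sub>R H' x) \<in> borel_measurable lebesgue"
          using m by (rule measurable_completion)
        show "(\<lambda>x. indicator (box c d) x *\<^sub>R ?H x) \<in> borel_measurable lebesgue"
          using integrable_mult_indicator[OF _ iH, of "box c d"] by auto
        show "AE x in lebesgue. indicator (box c d) x *\<^sub>R H' x = indicator (box c d) x *\<^sub>R ?H x"
          using ae by eventually_elim simp
      qed
      also have "\<dots> = (LINT x:box a' b'|lebesgue. h x)"
        unfolding set_lebesgue_integral_def b'[symmetric] by (simp add: indicator_inter_arith mult.assoc)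
      also have "\<dots> = 0"
      proof (cases "box a' b' = {}")
        case False
        have "cbox a' b' = closure (box c d \<inter> box a b)" using False b' by (simp add: closure_box)
        also have "\<dots> \<subseteq> cbox a b" by (rule closure_minimal) (use box_subset_cbox in auto)
        finally show ?thesis using zero ab by auto
      qed (simp add: set_lebesgue_integral_def)
      finally show ?thesis .
    qed
    from AE_completion[OF AE_zero_of_box_integrals[OF iH' this]] ae
    show ?thesis by eventually_elim auto
  qed
  have AE_cbox: "AE x in lebesgue. x \<in> cbox a b \<longrightarrow> h x = 0" if "cbox a b \<subseteq> U" for a b
  proof -
    have "cbox a b - box a b \<in> null_sets lebesgue"
      using negligible_frontier_interval[of a b] by (simp add: negligible_iff_null_sets)
    from AE_not_in[OF this] AE_box[OF that] show ?thesis by eventually_elim auto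
  qed
  obtain D where D: "countable D" "D \<subseteq> Pow U" "\<And>X. X \<in> D \<Longrightarrow> \<exists>a b. X = cbox a b" "\<Union>D = U"
    using open_countable_Union_open_cbox[OF U] by metis
  have "AE x in lebesgue. \<forall>X\<in>D. x \<in> X \<longrightarrow> h x = 0"
    unfolding AE_ball_countable[OF D(1)]
  proof
    fix X assume "X \<in> D"
    then obtain a b where "X = cbox a b" "X \<subseteq> U" using D by blast
    then show "AE x in lebesgue. x \<in> X \<longrightarrow> h x = 0" using AE_cbox by simp
  qed
  then show ?thesis by eventually_elim (use D(4) in blast)
qed

section \<open>A pointwise Morrey estimate\<close>

text \<open>A linearised Young inequality: where \<open>a\<close> exceeds the threshold \<open>l\<close>, the power \<open>a\<^sup>p\<close> takes over.  It
  stands in for Hoelder's inequality, the threshold being chosen afterwards.\<close>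

lemma le_add_powr:
  fixes a l p :: real
  assumes "0 \<le> a" "0 < l" "1 \<le> p"
  shows "a \<le> l + l powr (1 - p) * a powr p"
proof (cases "a \<le> l")
  case True
  then show ?thesis using assms by (simp add: add_increasing2)
next
  case False
  have "a = a powr (1 - p) * a powr p" using False assms by (simp add: powr_add[symmetric])
  also have "\<dots> \<le> l powr (1 - p) * a powr p"
    using False assms by (intro mult_right_mono powr_mono2') auto
  finally show ?thesis using assms by simp
qed

abbreviation cube :: "real^'n::finite \<Rightarrow> real \<Rightarrow> (real^'n) set" where
  "cube x r \<equiv> cbox (x - vec r) (x + vec r)"

lemma measure_cube: "0 \<le> r \<Longrightarrow> measure lebesgue (cube (x::real^'n::finite) r) = (2 * r) ^ CARD('n)"
proof -
  assume r: "0 \<le> r"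
  have "cube x r \<noteq> {}" using r by (simp add: interval_ne_empty_cart)
  from content_cbox_cart[OF this] show ?thesis by (simp add: measure_completion)
qed

lemma cube_mono: "r \<le> s \<Longrightarrow> cube x r \<subseteq> cube x s"
  by (simp add: subset_interval_cart)

text \<open>The replacement for Hoelder's inequality on small cubes: apply \<open>le_add_powr\<close> under the integral.  The
  choice of \<open>l\<close> as a power of \<open>r\<close> recovers the exponent that Hoelder's inequality would give.\<close>

lemma cube_integral_bound:
  fixes g \<psi> :: "real^'n::finite \<Rightarrow> real"
  assumes gp: "set_integrable lebesgue (cube x R) (\<lambda>y. \<bar>g y\<bar> powr p)"
    and r: "0 < r" "r \<le> R" and R: "cube x R \<subseteq> U" and p: "1 \<le> p" and l: "0 < l" and M: "0 \<le> M"
    and \<psi>: "\<And>y. y \<notin> cube x r \<Longrightarrow> \<psi> y = 0" "\<And>y. \<bar>\<psi> y\<bar> \<le> M"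
  shows "\<bar>LINT y:U|lebesgue. g y * \<psi> y\<bar>
    \<le> M * (l * (2 * r) ^ CARD('n) + l powr (1 - p) * (LINT y:cube x R|lebesgue. \<bar>g y\<bar> powr p))"
proof -
  let ?w = "\<lambda>y. M * (l * indicator (cube x r) y + l powr (1 - p) * (indicator (cube x R) y * \<bar>g y\<bar> powr p))"
  have i1: "integrable lebesgue (indicator (cube x r) :: real^'n \<Rightarrow> real)"
    by (intro integrable_real_indicator) (auto simp: emeasure_completion emeasure_lborel_cbox_eq)
  have i2: "integrable lebesgue (\<lambda>y. indicator (cube x R) y * \<bar>g y\<bar> powr p)"
    using gp by (simp add: set_integrable_def)
  have iw: "integrable lebesgue ?w"
    by (intro integrable_mult_right Bochner_Integration.integrable_add i1 i2)
  have "\<bar>LINT y:U|lebesgue. g y * \<psi> y\<bar> \<le> (LINT y|lebesgue. \<bar>indicator U y *\<^sub>R (g y * \<psi> y)\<bar>)"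
    unfolding set_lebesgue_integral_def by (rule integral_abs_bound)
  also have "\<dots> \<le> (LINT y|lebesgue. ?w y)"
  proof (rule integral_mono_AE')
    show "AE y in lebesgue. 0 \<le> ?w y" using M l by simp
  next
    show "integrable lebesgue ?w" by (rule iw)
    show "AE y in lebesgue. \<bar>indicator U y *\<^sub>R (g y * \<psi> y)\<bar> \<le> ?w y"
    proof (rule AE_I2)
      fix y
      show "\<bar>indicator U y *\<^sub>R (g y * \<psi> y)\<bar> \<le> ?w y"
      proof (cases "y \<in> cube x r")
        case False
        then show ?thesis using \<psi>(1)[OF False] M l by (auto simp: indicator_def)
      next
        case True
        then have yR: "y \<in> cube x R" "y \<in> U" using cube_mono[OF r(2), of x] R by blast+
        have "\<bar>g y * \<psi> y\<bar> \<le> \<bar>g y\<bar> * M" using \<psi>(2)[of y] by (simp add: abs_mult mult_left_mono)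
        also have "\<dots> \<le> (l + l powr (1 - p) * \<bar>g y\<bar> powr p) * M"
          by (intro mult_right_mono le_add_powr) (use l p M in auto)
        finally show ?thesis using True yR by (simp add: mult.commute)
      qed
    qed
  qed
  also have "\<dots> = M * (l * (2 * r) ^ CARD('n) + l powr (1 - p) * (LINT y:cube x R|lebesgue. \<bar>g y\<bar> powr p))"
    using i1 i2 r measure_cube[of r x] by (simp add: set_lebesgue_integral_def)
  finally show ?thesis .
qed

definition unit_bump :: "real^'n::finite \<Rightarrow> real" where
  "unit_bump = box_bump 1 (- vec 1) (vec 1)"

text \<open>An \<open>n\<close>-dimensional rescaling that keeps the integral constant in \<open>r\<close>; averages of a continuous function
  against it tend to a multiple of the value at \<open>x\<close> as \<open>r\<close> tends to \<open>0\<close>.\<close>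

definition scaled_bump :: "real^'n::finite \<Rightarrow> real \<Rightarrow> real^'n \<Rightarrow> real" where
  "scaled_bump x r y = unit_bump ((1 / r) *\<^sub>R (y - x)) / r ^ CARD('n)"

text \<open>The field that transports the scaled bumps: its divergence is minus their derivative in \<open>r\<close>
  (\<open>scaled_bump_derivative\<close>, \<open>scaled_field_divergence\<close>).\<close>

definition scaled_field :: "real^'n::finite \<Rightarrow> real \<Rightarrow> 'n \<Rightarrow> real^'n \<Rightarrow> real" where
  "scaled_field x r i y = (y $ i - x $ i) / r * scaled_bump x r y"

lemma unit_bump_scale:
  "r > 0 \<Longrightarrow> unit_bump ((1 / r) *\<^sub>R (y - x)) = box_bump (1 / r) (x - vec r) (x + vec r) (y::real^'n::finite)"
  unfolding unit_bump_def box_bump_def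
  by (intro prod.cong refl) (simp add: field_simps)

lemma test_function_scaled_field:
  fixes x :: "real^'n::finite"
  assumes "r > 0" "cube x r \<subseteq> U"
  shows "test_function U (scaled_field x r i)"
proof -
  have "smooth_expr (\<lambda>y. (1 / r ^ Suc CARD('n)) * (y $ i + (- x $ i)))"
    by (intro smooth_expr.intros)
  from test_function_box_bump[OF this, of "1 / r", OF _ assms(2)] assms(1)
  have "test_function U (\<lambda>y. ((1 / r ^ Suc CARD('n)) * (y $ i + (- x $ i))) * box_bump (1 / r) (x - vec r) (x + vec r) y)"
    by simp
  moreover have "scaled_field x r i =
      (\<lambda>y. ((1 / r ^ Suc CARD('n)) * (y $ i + (- x $ i))) * box_bump (1 / r) (x - vec r) (x + vec r) y)"
    unfolding scaled_field_def scaled_bump_def unit_bump_scale[OF assms(1)]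
    using assms(1) by (simp add: field_simps)
  ultimately show ?thesis by simp
qed

lemma scaled_bump_outside: "r > 0 \<Longrightarrow> y \<notin> cube x r \<Longrightarrow> scaled_bump x r y = 0"
  using box_bump_eq_0_iff[of "1 / r" "x - vec r" "x + vec r" y] box_subset_cbox
  by (auto simp: scaled_bump_def unit_bump_scale)

lemma scaled_bump_bound: "r > 0 \<Longrightarrow> \<bar>scaled_bump x r (y::real^'n::finite)\<bar> \<le> 1 / r ^ CARD('n)"
  by (simp add: scaled_bump_def unit_bump_scale box_bump_nonneg box_bump_le_1 divide_right_mono)

lemma scaled_field_bound: "r > 0 \<Longrightarrow> \<bar>scaled_field x r i (y::real^'n::finite)\<bar> \<le> 1 / r ^ CARD('n)"
proof (cases "y \<in> cube x r")
  case True
  assume r: "r > 0"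
  have "\<bar>(y $ i - x $ i) / r\<bar> \<le> 1"
    using True r by (auto simp: mem_box_cart abs_le_iff field_simps)
  then have "\<bar>(y $ i - x $ i) / r\<bar> * \<bar>scaled_bump x r y\<bar> \<le> 1 * (1 / r ^ CARD('n))"
    using scaled_bump_bound[OF r, of x y] by (intro mult_mono) auto
  then show ?thesis by (simp add: scaled_field_def abs_mult)
qed (simp add: scaled_field_def scaled_bump_outside)

lemma scaled_field_outside: "r > 0 \<Longrightarrow> y \<notin> cube x r \<Longrightarrow> scaled_field x r i y = 0"
  by (simp add: scaled_field_def scaled_bump_outside)

lemma unit_bump_smooth: "smooth_expr unit_bump"
  unfolding unit_bump_def by (rule smooth_expr_box_bump)

lemma unit_bump_derivative: "(unit_bump has_derivative (\<lambda>h. grad unit_bump y \<bullet> h)) (at y)"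
  by (rule has_derivative_grad[OF smooth_expr_differentiable[OF unit_bump_smooth]])

lemma continuous_on_grad_unit_bump: "continuous_on UNIV (grad unit_bump)"
  unfolding continuous_on_grad_iff
  using smooth_expr_continuous_on[OF smooth_expr_partial_deriv[OF unit_bump_smooth]] by blast

text \<open>The derivative of \<open>scaled_bump x r y\<close> in \<open>r\<close>.\<close>

definition bump_rate :: "real^'n::finite \<Rightarrow> real \<Rightarrow> real^'n \<Rightarrow> real" where
  "bump_rate x r y = - (real CARD('n) * unit_bump ((1 / r) *\<^sub>R (y - x)) +
      (1 / r) * (grad unit_bump ((1 / r) *\<^sub>R (y - x)) \<bullet> (y - x))) / r ^ Suc CARD('n)"

lemma scaled_bump_derivative:
  fixes x :: "real^'n::finite"
  assumes "r > 0"
  shows "((\<lambda>r. scaled_bump x r y) has_real_derivative bump_rate x r y) (at r)"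
proof -
  let ?z = "(1 / r) *\<^sub>R (y - x)"
  have "((\<lambda>r. (1 / r) *\<^sub>R (y - x)) has_derivative (\<lambda>h. (- h / r^2) *\<^sub>R (y - x))) (at r)"
    using assms by (auto intro!: derivative_eq_intros simp: field_simps power2_eq_square)
  from has_derivative_compose[OF this unit_bump_derivative]
  have 1: "((\<lambda>r. unit_bump ((1 / r) *\<^sub>R (y - x))) has_real_derivative
      - (grad unit_bump ?z \<bullet> (y - x)) / r^2) (at r)"
    unfolding has_field_derivative_def
    by (rule has_derivative_eq_rhs) (auto simp: fun_eq_iff)
  obtain m where m: "CARD('n) = Suc m" using zero_less_card_finite[where 'a='n] gr0_conv_Suc by blast
  have "((\<lambda>r. unit_bump ((1 / r) *\<^sub>R (y - x)) / r ^ CARD('n)) has_real_derivative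
     (- (grad unit_bump ?z \<bullet> (y - x)) / r^2 * r ^ CARD('n) - unit_bump ?z * (real CARD('n) * r ^ m)) / (r ^ CARD('n) * r ^ CARD('n))) (at r)"
    by (rule DERIV_cong[OF DERIV_divide[OF 1 DERIV_pow]]) (use assms in \<open>simp_all add: m\<close>)
  also have "(- (grad unit_bump ?z \<bullet> (y - x)) / r^2 * r ^ CARD('n) - unit_bump ?z * (real CARD('n) * r ^ m)) / (r ^ CARD('n) * r ^ CARD('n)) = bump_rate x r y"
    using assms by (simp add: bump_rate_def m field_simps power2_eq_square)
  finally show ?thesis by (simp add: scaled_bump_def)
qed

lemma scaled_field_divergence:
  fixes x :: "real^'n::finite"
  assumes "r > 0"
  shows "(\<Sum>i\<in>UNIV. partial_deriv i (scaled_field x r i) y) = - bump_rate x r y"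
proof -
  let ?z = "(1 / r) *\<^sub>R (y - x)"
  have "((\<lambda>y. (1 / r) *\<^sub>R (y - x)) has_derivative (\<lambda>h. (1 / r) *\<^sub>R h)) (at y)"
    by (auto intro!: derivative_eq_intros)
  from has_derivative_compose[OF this unit_bump_derivative]
  have 1: "((\<lambda>y. unit_bump ((1 / r) *\<^sub>R (y - x))) has_derivative (\<lambda>h. grad unit_bump ?z \<bullet> ((1 / r) *\<^sub>R h))) (at y)" .
  have "partial_deriv i (scaled_field x r i) y =
      (unit_bump ?z + (y $ i - x $ i) * ((1 / r) * grad unit_bump ?z $ i)) / r ^ Suc CARD('n)" for i
  proof -
    have 2: "((\<lambda>y::real^'n. y $ i - x $ i) has_derivative (\<lambda>h. h $ i)) (at y)"
      by (auto intro!: derivative_eq_intros bounded_linear_imp_has_derivative[OF bounded_linear_vec_nth])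
    have "((\<lambda>y. (1 / r ^ Suc CARD('n)) * ((y $ i - x $ i) * unit_bump ((1 / r) *\<^sub>R (y - x)))) has_derivative
       (\<lambda>h. (1 / r ^ Suc CARD('n)) * ((y $ i - x $ i) * (grad unit_bump ?z \<bullet> ((1 / r) *\<^sub>R h)) + h $ i * unit_bump ?z))) (at y)"
      by (rule has_derivative_mult_right[OF has_derivative_mult[OF 2 1]])
    moreover have "scaled_field x r i = (\<lambda>y. (1 / r ^ Suc CARD('n)) * ((y $ i - x $ i) * unit_bump ((1 / r) *\<^sub>R (y - x))))"
      by (simp add: scaled_field_def[abs_def] scaled_bump_def)
    ultimately show ?thesis
      by (simp add: partial_deriv_eq inner_axis add.commute)
  qed
  then have "(\<Sum>i\<in>UNIV. partial_deriv i (scaled_field x r i) y) =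
      (\<Sum>i\<in>UNIV. (unit_bump ?z + (y $ i - x $ i) * ((1 / r) * grad unit_bump ?z $ i))) / r ^ Suc CARD('n)"
    by (simp add: sum_divide_distrib)
  also have "(\<Sum>i\<in>UNIV. (unit_bump ?z + (y $ i - x $ i) * ((1 / r) * grad unit_bump ?z $ i))) =
      real CARD('n) * unit_bump ?z + (1 / r) * (grad unit_bump ?z \<bullet> (y - x))"
    by (simp add: sum.distrib inner_vec_def sum_distrib_left mult_ac)
  finally show ?thesis unfolding bump_rate_def by (simp only: minus_divide_left minus_minus)
qed

lemma integral_scaled_bump:
  fixes x :: "real^'n::finite"
  assumes "r > 0"
  shows "integral\<^sup>L lborel (scaled_bump x r) = integral\<^sup>L lborel (unit_bump :: real^'n \<Rightarrow> real)"
proof -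
  have m: "scaled_bump x r \<in> borel_measurable borel"
  proof (rule borel_measurable_continuous_onI)
    show "continuous_on UNIV (scaled_bump x r)"
      unfolding scaled_bump_def[abs_def]
      by (intro continuous_intros continuous_on_compose2[OF smooth_expr_continuous_on[OF unit_bump_smooth, of UNIV]]) (use assms in auto)
  qed
  have "lborel = density (distr lborel borel (\<lambda>z::real^'n. x + r *\<^sub>R z)) (\<lambda>_. ennreal (r ^ CARD('n)))"
    using lborel_affine[of r x] assms by simp
  then have "integral\<^sup>L lborel (scaled_bump x r) =
      integral\<^sup>L (density (distr lborel borel (\<lambda>z::real^'n. x + r *\<^sub>R z)) (\<lambda>_. ennreal (r ^ CARD('n)))) (scaled_bump x r)"
    by simp
  also have "\<dots> = integral\<^sup>L (distr lborel borel (\<lambda>z::real^'n. x + r *\<^sub>R z)) (\<lambda>y. r ^ CARD('n) *\<^sub>R scaled_bump x r y)"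
    using m assms by (intro integral_density) auto
  also have "\<dots> = integral\<^sup>L lborel (\<lambda>z. r ^ CARD('n) *\<^sub>R scaled_bump x r (x + r *\<^sub>R z))"
    using m by (intro integral_distr) auto
  also have "(\<lambda>z. r ^ CARD('n) *\<^sub>R scaled_bump x r (x + r *\<^sub>R z)) = unit_bump"
    using assms by (simp add: scaled_bump_def fun_eq_iff)
  finally show ?thesis .
qed

text \<open>The averages of a function tend to this factor times its value at the centre, so it is divided by in the end.\<close>

lemma integral_unit_bump_pos: "0 < integral\<^sup>L lborel (unit_bump :: real^'n::finite \<Rightarrow> real)"
proof -
  have "(0::real^'n) \<in> box (- vec 1) (vec 1)" by (simp add: mem_box_cart)
  then have "box (- vec 1) (vec 1 :: real^'n) \<noteq> {}" by blast
  from integral_box_bump_pos[OF this]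
  have "0 < integral (cbox (- vec 1) (vec 1)) (unit_bump :: real^'n \<Rightarrow> real)" by (simp add: unit_bump_def)
  also have "\<dots> = integral\<^sup>L lborel (unit_bump :: real^'n \<Rightarrow> real)"
    by (rule integrable_lborel_continuous_supported(2)[symmetric])
       (use smooth_expr_continuous_on[OF unit_bump_smooth] box_bump_eq_0_iff[of 1 "- vec 1" "vec 1 :: real^'n"]
          box_subset_cbox[of "- vec 1" "vec 1 :: real^'n"]
        in \<open>auto simp: unit_bump_def\<close>)
  finally show ?thesis .
qed

lemma cube_norm_bound:
  fixes x y :: "real^'n::finite"
  assumes "y \<in> cube x r" shows "norm (y - x) \<le> real CARD('n) * r"
proof (rule norm_le_of_cube)
  have "x $ i - r \<le> y $ i \<and> y $ i \<le> x $ i + r" for i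
    using assms by (simp add: mem_box_cart)
  then show "y - x \<in> cbox (- vec r) (vec r)"
    by (auto simp: mem_box_cart algebra_simps diff_le_eq)
qed

lemma set_integral_eq_integral_cube:
  fixes h :: "real^'n::finite \<Rightarrow> real"
  assumes "continuous_on (cbox a b) h" "\<And>y. y \<notin> cbox a b \<Longrightarrow> h y = 0" "cbox a b \<subseteq> U"
  shows "(LINT y:U|lebesgue. h y) = integral (cbox a b) h"
proof -
  have "(\<lambda>y. indicator U y *\<^sub>R h y) = h"
    using assms(2,3) by (auto simp: indicator_def fun_eq_iff)
  then have "(LINT y:U|lebesgue. h y) = integral\<^sup>L lebesgue h" by (simp add: set_lebesgue_integral_def)
  also have "\<dots> = integral\<^sup>L lborel h"
    by (rule integral_completion) (use integrable_lborel_continuous_supported(1)[OF assms(1,2)] in auto)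
  also have "\<dots> = integral (cbox a b) h" by (rule integrable_lborel_continuous_supported(2)[OF assms(1,2)])
  finally show ?thesis .
qed

text \<open>Consider the averages \<open>F r\<close> of \<open>f\<close> against the bumps of radius \<open>r\<close> around \<open>x\<close>.  Their derivative is minus the
  integral of \<open>f\<close> against the divergence of a test field, that is the integral of the weak gradient of
  \<open>f\<close> against that field, and is bounded by a multiple of \<open>r powr (- n/p)\<close>.  This is integrable at \<open>0\<close>
  because \<open>p > n\<close>, so the limit of \<open>F\<close> at \<open>0\<close>, which is a multiple of \<open>f x\<close>, differs from \<open>F \<rho>\<close> by a bounded amount, and \<open>F \<rho>\<close> is
  controlled by the norm of \<open>f\<close>.\<close>

lemma morrey_pointwise:
  fixes f :: "real^'n::finite \<Rightarrow> real" and g :: "'n \<Rightarrow> real^'n \<Rightarrow> real"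
  assumes f: "continuous_on U f" and g: "\<And>i. has_weak_partial U i f (g i)"
    and \<rho>: "0 < \<rho>" "cube x (2 * \<rho>) \<subseteq> U" and p: "real CARD('n) < p" and \<tau>: "0 < \<tau>"
    and fp: "set_integrable lebesgue (cube x (2 * \<rho>)) (\<lambda>y. \<bar>f y\<bar> powr p)"
    and gp: "\<And>i. set_integrable lebesgue (cube x (2 * \<rho>)) (\<lambda>y. \<bar>g i y\<bar> powr p)"
    and fN: "(LINT y:cube x (2 * \<rho>)|lebesgue. \<bar>f y\<bar> powr p) \<le> N"
    and gN: "\<And>i. (LINT y:cube x (2 * \<rho>)|lebesgue. \<bar>g i y\<bar> powr p) \<le> N"
  shows "integral\<^sup>L lborel (unit_bump :: real^'n \<Rightarrow> real) * \<bar>f x\<bar> \<le>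
      (2 ^ CARD('n) * \<tau> + \<tau> powr (1 - p) * N / \<rho> ^ CARD('n)) +
      real CARD('n) * (2 ^ CARD('n) * \<tau> + \<tau> powr (1 - p) * N) *
        (\<rho> powr (1 - real CARD('n) / p) / (1 - real CARD('n) / p))"
proof -
  let ?n = "CARD('n)" and ?Q = "cube x (2 * \<rho>)"
  define a where "a = 1 - real ?n / p"
  have p1: "p > 1" using p by (smt (verit) of_nat_1 of_nat_le_iff One_nat_def Suc_leI zero_less_card_finite)
  have a: "a > 0" using p p1 by (simp add: a_def)
  define B where "B = real ?n * (2 ^ ?n * \<tau> + \<tau> powr (1 - p) * N)"
  have fQ: "continuous_on ?Q f" using f \<rho>(2) by (rule continuous_on_subset)
  have N0: "N \<ge> 0"
    using fN by (rule order_trans[rotated]) (simp add: set_lebesgue_integral_def)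
  define F where "F r = integral ?Q (\<lambda>y. f y * scaled_bump x r y)" for r
  have bc: "continuous_on S (scaled_bump x r)" if "r > 0" for r S
    unfolding scaled_bump_def[abs_def]
    by (intro continuous_intros continuous_on_compose2[OF smooth_expr_continuous_on[OF unit_bump_smooth, of UNIV]]) (use that in auto)
  have rc: "continuous_on ({0<..} \<times> S) (\<lambda>(r, y). bump_rate x r y)" for S
    unfolding bump_rate_def split_beta
    by (intro continuous_intros continuous_on_compose2[OF smooth_expr_continuous_on[OF unit_bump_smooth, of UNIV]]
        continuous_on_compose2[OF continuous_on_grad_unit_bump]) auto
  have sub: "cube x r \<subseteq> ?Q" if "r \<le> 2 * \<rho>" for r using that by (rule cube_mono)
  have F': "(F has_real_derivative integral ?Q (\<lambda>y. f y * bump_rate x r y)) (at r)" if r: "0 < r" for r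
  proof -
    have "((\<lambda>r. integral ?Q (\<lambda>y. f y * scaled_bump x r y)) has_field_derivative
        integral ?Q (\<lambda>y. f y * bump_rate x r y)) (at r within {0<..})"
    proof (rule leibniz_rule_field_derivative)
      show "((\<lambda>r. f y * scaled_bump x r y) has_field_derivative f y * bump_rate x s y) (at s within {0<..})"
        if "s \<in> {0<..}" for s y
        using that by (intro DERIV_cmult has_field_derivative_at_within[OF scaled_bump_derivative]) auto
      show "(\<lambda>y. f y * scaled_bump x s y) integrable_on ?Q" if "s \<in> {0<..}" for s
        using that by (intro integrable_continuous continuous_intros fQ bc) auto
      show "continuous_on ({0<..} \<times> ?Q) (\<lambda>(r, y). f y * bump_rate x r y)"
        using rc[of ?Q] unfolding split_beta
        by (intro continuous_intros continuous_on_compose2[OF fQ]) auto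
    qed (use r in auto)
    then show ?thesis using r by (simp add: F_def[abs_def] at_within_open[of _ "{0<..}"])
  qed
  \<comment> \<open>the weak derivative is tested with the scaled field, whose divergence is minus the rate of the bump\<close>
  have bound: "\<bar>integral ?Q (\<lambda>y. f y * bump_rate x r y)\<bar> \<le> B * r powr (a - 1)" if r: "0 < r" "r \<le> 2 * \<rho>" for r
  proof -
    have tf: "test_function U (scaled_field x r i)" for i
      using test_function_scaled_field r sub \<rho>(2) by blast
    have pc: "continuous_on S (partial_deriv i (scaled_field x r i))" for S i
    proof -
      have "C_k_on (Suc 0) UNIV (scaled_field x r i)" using tf[of i] unfolding test_function_def by blast
      then show ?thesis by (auto intro: continuous_on_subset)
    qed
    have s0: "scaled_field x r i y = 0" if "y \<notin> ?Q" for i y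
      by (rule scaled_field_outside[OF r(1)]) (use that sub[OF r(2)] in blast)
    have p0: "partial_deriv i (scaled_field x r i) y = 0" if "y \<notin> ?Q" for i y
      by (rule partial_deriv_outside_support[OF compact_cbox s0 that])
    have "integral ?Q (\<lambda>y. f y * bump_rate x r y) =
        integral ?Q (\<lambda>y. - (\<Sum>i\<in>UNIV. f y * partial_deriv i (scaled_field x r i) y))"
      by (simp add: sum_distrib_left[symmetric] scaled_field_divergence[OF r(1)])
    also have "\<dots> = - (\<Sum>i\<in>UNIV. integral ?Q (\<lambda>y. f y * partial_deriv i (scaled_field x r i) y))"
      by (simp add: integral_sum integrable_continuous continuous_on_mult fQ pc)
    also have "\<dots> = - (\<Sum>i\<in>UNIV. LINT y:U|lebesgue. f y * partial_deriv i (scaled_field x r i) y)"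
      by (intro arg_cong[of _ _ uminus] sum.cong refl set_integral_eq_integral_cube[symmetric] \<rho>)
         (auto intro!: continuous_on_mult fQ pc simp: p0)
    also have "\<dots> = (\<Sum>i\<in>UNIV. LINT y:U|lebesgue. g i y * scaled_field x r i y)"
      using g tf unfolding has_weak_partial_def by (simp add: sum_negf)
    finally have "\<bar>integral ?Q (\<lambda>y. f y * bump_rate x r y)\<bar> \<le> (\<Sum>i\<in>UNIV. \<bar>LINT y:U|lebesgue. g i y * scaled_field x r i y\<bar>)"
      by simp
    also have "\<dots> \<le> (\<Sum>i\<in>(UNIV::'n set). (2 ^ ?n * \<tau> + \<tau> powr (1 - p) * N) * r powr (a - 1))"
    proof (rule sum_mono)
      fix i
      \<comment> \<open>this threshold gives both terms of the estimate the same power of \<open>r\<close>\<close>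
      define l where "l = \<tau> * r powr (- real ?n / p)"
      have l: "l > 0" using \<tau> r by (simp add: l_def)
      have "\<bar>LINT y:U|lebesgue. g i y * scaled_field x r i y\<bar> \<le>
        (1 / r ^ ?n) * (l * (2 * r) ^ ?n + l powr (1 - p) * (LINT y:?Q|lebesgue. \<bar>g i y\<bar> powr p))"
        by (rule cube_integral_bound[OF gp r \<rho>(2) _ l])
           (use p1 r scaled_field_outside scaled_field_bound in auto)
      also have "\<dots> \<le> (1 / r ^ ?n) * (l * (2 * r) ^ ?n + l powr (1 - p) * N)"
        using r by (intro mult_left_mono add_left_mono gN) auto
      also have "\<dots> = 2 ^ ?n * l + l powr (1 - p) / r ^ ?n * N"
        using r by (simp add: field_simps power_mult_distrib)
      also have "l powr (1 - p) / r ^ ?n = \<tau> powr (1 - p) * r powr (a - 1)"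
      proof -
        have "l powr (1 - p) / r ^ ?n = \<tau> powr (1 - p) * (r powr (- real ?n / p * (1 - p)) * r powr (- real ?n))"
        proof -
          have "l powr (1 - p) = \<tau> powr (1 - p) * r powr (- real ?n / p * (1 - p))"
            unfolding l_def using \<tau> r by (simp only: powr_mult powr_powr)
          moreover have "r powr (- real ?n) = 1 / r ^ ?n"
            using r by (simp add: powr_minus powr_realpow divide_inverse)
          ultimately show ?thesis by (simp only: times_divide_eq_right mult_1_right)
        qed
        also have "r powr (- real ?n / p * (1 - p)) * r powr (- real ?n) = r powr (- real ?n / p * (1 - p) - real ?n)"
          by (simp add: powr_add[symmetric])
        also have "- real ?n / p * (1 - p) - real ?n = a - 1"
          using p1 by (simp add: a_def field_simps)
        finally show ?thesis .
      qed
      also have "l = \<tau> * r powr (a - 1)" by (simp add: l_def a_def)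
      finally show "\<bar>LINT y:U|lebesgue. g i y * scaled_field x r i y\<bar> \<le> (2 ^ ?n * \<tau> + \<tau> powr (1 - p) * N) * r powr (a - 1)"
        by (simp add: algebra_simps)
    qed
    also have "\<dots> = B * r powr (a - 1)" by (simp add: B_def)
    finally show ?thesis .
  qed
  have small: "\<bar>F r\<bar> \<le> \<bar>F \<rho>\<bar> + B * (\<rho> powr a / a)" if r: "0 < r" "r < \<rho>" for r
  proof -
    have d: "((\<lambda>s. B * (s powr a / a)) has_real_derivative B * s powr (a - 1)) (at s)" if "s > 0" for s
      using that a by (auto intro!: derivative_eq_intros simp: field_simps)
    have "B * (r powr a / a) + F r \<le> B * (\<rho> powr a / a) + F \<rho>"
    proof (rule DERIV_nonneg_imp_nondecreasing[of r \<rho> "\<lambda>s. B * (s powr a / a) + F s"])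
      fix s assume s: "r \<le> s" "s \<le> \<rho>"
      have "0 \<le> B * s powr (a - 1) + integral ?Q (\<lambda>y. f y * bump_rate x s y)"
        using bound[of s] s r by auto
      moreover have "((\<lambda>s. B * (s powr a / a) + F s) has_real_derivative (B * s powr (a - 1) + integral ?Q (\<lambda>y. f y * bump_rate x s y))) (at s)"
        using s r by (intro DERIV_add d F') auto
      ultimately show "\<exists>z. ((\<lambda>s. B * (s powr a / a) + F s) has_real_derivative z) (at s) \<and> 0 \<le> z" by blast
    qed (use r in auto)
    moreover have "B * (r powr a / a) - F r \<le> B * (\<rho> powr a / a) - F \<rho>"
    proof (rule DERIV_nonneg_imp_nondecreasing[of r \<rho> "\<lambda>s. B * (s powr a / a) - F s"])
      fix s assume s: "r \<le> s" "s \<le> \<rho>"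
      have "0 \<le> B * s powr (a - 1) - integral ?Q (\<lambda>y. f y * bump_rate x s y)"
        using bound[of s] s r by auto
      moreover have "((\<lambda>s. B * (s powr a / a) - F s) has_real_derivative (B * s powr (a - 1) - integral ?Q (\<lambda>y. f y * bump_rate x s y))) (at s)"
        using s r by (intro DERIV_diff d F') auto
      ultimately show "\<exists>z. ((\<lambda>s. B * (s powr a / a) - F s) has_real_derivative z) (at s) \<and> 0 \<le> z" by blast
    qed (use r in auto)
    moreover have "0 \<le> B * (r powr a / a)" using a N0 \<tau> by (simp add: B_def)
    ultimately show ?thesis by linarith
  qed
  have big: "\<bar>F \<rho>\<bar> \<le> 2 ^ ?n * \<tau> + \<tau> powr (1 - p) * N / \<rho> ^ ?n"
  proof -
    have "F \<rho> = (LINT y:U|lebesgue. f y * scaled_bump x \<rho> y)"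
      unfolding F_def
      by (intro set_integral_eq_integral_cube[symmetric] \<rho>)
         (use \<rho> sub[of \<rho>] scaled_bump_outside[of \<rho> _ x] in \<open>auto intro!: continuous_on_mult fQ bc\<close>)
    also have "\<bar>\<dots>\<bar> \<le> (1 / \<rho> ^ ?n) * (\<tau> * (2 * \<rho>) ^ ?n + \<tau> powr (1 - p) * (LINT y:?Q|lebesgue. \<bar>f y\<bar> powr p))"
      by (rule cube_integral_bound[OF fp \<rho>(1) _ \<rho>(2) _ \<tau>])
         (use p1 \<rho> scaled_bump_outside scaled_bump_bound in auto)
    also have "\<dots> \<le> (1 / \<rho> ^ ?n) * (\<tau> * (2 * \<rho>) ^ ?n + \<tau> powr (1 - p) * N)"
      using \<rho> by (intro mult_left_mono add_left_mono fN) auto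
    also have "\<dots> = 2 ^ ?n * \<tau> + \<tau> powr (1 - p) * N / \<rho> ^ ?n"
      using \<rho> by (simp add: field_simps power_mult_distrib)
    finally show ?thesis .
  qed
  define c where "c = integral\<^sup>L lborel (unit_bump :: real^'n \<Rightarrow> real)"
  have c: "c > 0" unfolding c_def by (rule integral_unit_bump_pos)
  have lim: "\<exists>r. 0 < r \<and> r < \<rho> \<and> \<bar>F r - c * f x\<bar> \<le> c * \<epsilon>" if \<epsilon>: "\<epsilon> > 0" for \<epsilon>
  proof -
    have xQ: "x \<in> ?Q" using \<rho> by (simp add: mem_box_cart)
    obtain d where d: "d > 0" "\<And>y. y \<in> ?Q \<Longrightarrow> dist y x < d \<Longrightarrow> dist (f y) (f x) < \<epsilon>"
      using fQ xQ \<epsilon> unfolding continuous_on_iff by metis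
    define r where "r = min (\<rho> / 2) (d / (2 * real ?n))"
    have r: "r > 0" "r < \<rho>" "real ?n * r < d"
    proof -
      have "real ?n * r \<le> real ?n * (d / (2 * real ?n))" unfolding r_def by (intro mult_left_mono) auto
      also have "\<dots> < d" using d by simp
      finally show "real ?n * r < d" .
    qed (use \<rho> d in \<open>auto simp: r_def min_def\<close>)
    have b0: "scaled_bump x r y = 0" if "y \<notin> ?Q" for y
      using that sub[of r] r scaled_bump_outside by fastforce
    have ib: "integral ?Q (scaled_bump x r) = c"
      unfolding c_def integral_scaled_bump[OF r(1), of x, symmetric]
      by (rule integrable_lborel_continuous_supported(2)[symmetric]) (use b0 bc r in auto)
    have i1: "(\<lambda>y. f y * scaled_bump x r y) integrable_on ?Q"
      by (intro integrable_continuous continuous_intros fQ bc r)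
    have i2: "(\<lambda>y. f x * scaled_bump x r y) integrable_on ?Q"
      by (intro integrable_continuous continuous_intros bc r)
    have "F r - c * f x = integral ?Q (\<lambda>y. f y * scaled_bump x r y - f x * scaled_bump x r y)"
      by (simp add: integral_diff[OF i1 i2] F_def ib)
    also have "norm \<dots> \<le> integral ?Q (\<lambda>y. \<epsilon> * scaled_bump x r y)"
    proof (rule integral_norm_bound_integral)
      show "(\<lambda>y. f y * scaled_bump x r y - f x * scaled_bump x r y) integrable_on ?Q"
        by (rule integrable_diff[OF i1 i2])
      show "(\<lambda>y. \<epsilon> * scaled_bump x r y) integrable_on ?Q"
        by (intro integrable_continuous continuous_intros bc r)
      fix y assume y: "y \<in> ?Q"
      have nn: "0 \<le> scaled_bump x r y"
        using r by (simp add: scaled_bump_def unit_bump_def box_bump_nonneg)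
      show "norm (f y * scaled_bump x r y - f x * scaled_bump x r y) \<le> \<epsilon> * scaled_bump x r y"
      proof (cases "y \<in> cube x r")
        case True
        have "dist y x < d" using cube_norm_bound[OF True] r by (simp add: dist_norm)
        then have "\<bar>f y - f x\<bar> \<le> \<epsilon>" using d(2)[OF y] by (simp add: dist_real_def)
        then have "\<bar>f y - f x\<bar> * scaled_bump x r y \<le> \<epsilon> * scaled_bump x r y"
          using nn by (rule mult_right_mono)
        then show ?thesis using nn by (simp add: left_diff_distrib[symmetric] abs_mult)
      qed (simp add: scaled_bump_outside r)
    qed
    also have "\<dots> = c * \<epsilon>" by (simp add: ib)
    finally show ?thesis using r by auto
  qed
  have "c * \<bar>f x\<bar> \<le> \<bar>F \<rho>\<bar> + B * (\<rho> powr a / a)"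
  proof (rule field_le_epsilon)
    fix e :: real assume e: "e > 0"
    obtain r where r: "0 < r" "r < \<rho>" "\<bar>F r - c * f x\<bar> \<le> c * (e / c)" using lim[of "e / c"] e c by auto
    have "c * \<bar>f x\<bar> = \<bar>c * f x\<bar>" using c by (simp add: abs_mult)
    also have "\<dots> \<le> \<bar>F r\<bar> + e" using r(3) c by (simp add: abs_le_iff) linarith
    finally show "c * \<bar>f x\<bar> \<le> \<bar>F \<rho>\<bar> + B * (\<rho> powr a / a) + e" using small[OF r(1,2)] by simp
  qed
  with big show ?thesis unfolding c_def B_def a_def by simp
qed

section \<open>Sobolev convergence is locally uniform convergence\<close>

lemma Lp_loc_1_set_integrable:
  assumes "Lp_loc U 1 g" "compact K" "K \<subseteq> U"
  shows "set_integrable lebesgue K g"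
proof -
  have m: "(\<lambda>x. indicator U x *\<^sub>R g x) \<in> borel_measurable lebesgue"
    and i: "integrable lebesgue (\<lambda>x. indicator K x *\<^sub>R (\<bar>g x\<bar> powr 1))"
    using assms unfolding Lp_loc_def set_borel_measurable_def set_integrable_def by blast+
  have "(\<lambda>x. indicator K x *\<^sub>R (indicator U x *\<^sub>R g x)) \<in> borel_measurable lebesgue"
    by (rule borel_measurable_scaleR[OF borel_measurable_indicator m])
       (rule fmeasurableD[OF lmeasurable_compact[OF assms(2)]])
  also have "(\<lambda>x. indicator K x *\<^sub>R (indicator U x *\<^sub>R g x)) = (\<lambda>x. indicator K x *\<^sub>R g x)"
    using assms(3) by (auto simp: indicator_def fun_eq_iff)
  finally have "integrable lebesgue (\<lambda>x. \<bar>indicator K x *\<^sub>R g x\<bar>) = integrable lebesgue (\<lambda>x. indicator K x *\<^sub>R g x)"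
    by (rule integrable_abs_iff)
  moreover have "(\<lambda>x. \<bar>indicator K x *\<^sub>R g x\<bar>) = (\<lambda>x. indicator K x *\<^sub>R (\<bar>g x\<bar> powr 1))"
    by (auto simp: indicator_def fun_eq_iff)
  ultimately show ?thesis using i by (simp add: set_integrable_def)
qed

lemma test_function_continuous: "test_function U \<psi> \<Longrightarrow> continuous_on S \<psi>"
proof -
  assume "test_function U \<psi>"
  then have "C_k_on 0 UNIV \<psi>" unfolding test_function_def by blast
  then show ?thesis by (auto intro: continuous_on_subset)
qed

lemma set_integrable_times_test_function:
  assumes "\<And>K. compact K \<Longrightarrow> K \<subseteq> U \<Longrightarrow> set_integrable lebesgue K g" "test_function U \<psi>"
  shows "set_integrable lebesgue U (\<lambda>x. g x * \<psi> x)"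
proof -
  let ?K = "closure {x. \<psi> x \<noteq> 0}"
  have K: "compact ?K" "?K \<subseteq> U" using assms(2) by (auto simp: test_function_def)
  have out: "\<psi> x = 0" if "x \<notin> ?K" for x using that closure_subset[of "{x. \<psi> x \<noteq> 0}"] by blast
  have "compact (\<psi> ` ?K)" by (rule compact_continuous_image[OF test_function_continuous[OF assms(2)] K(1)])
  then have "bounded (\<psi> ` ?K)" by (rule compact_imp_bounded)
  then obtain M where M: "\<And>x. x \<in> ?K \<Longrightarrow> \<bar>\<psi> x\<bar> \<le> M"
    unfolding bounded_real by blast
  have i: "integrable lebesgue (\<lambda>x. indicator ?K x *\<^sub>R g x)"
    using assms(1)[OF K] by (simp add: set_integrable_def)
  have "integrable lebesgue (\<lambda>x. (indicator ?K x *\<^sub>R g x) * \<psi> x)"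
  proof (rule Bochner_Integration.integrable_bound)
    show "integrable lebesgue (\<lambda>x. M * \<bar>indicator ?K x *\<^sub>R g x\<bar>)"
      using i by (intro integrable_mult_right integrable_abs)
    have "\<psi> \<in> borel_measurable borel"
      by (rule borel_measurable_continuous_onI[OF test_function_continuous[OF assms(2)]])
    then have "\<psi> \<in> borel_measurable lebesgue" by (simp add: measurable_completion)
    then show "(\<lambda>x. (indicator ?K x *\<^sub>R g x) * \<psi> x) \<in> borel_measurable lebesgue"
      by (intro borel_measurable_times borel_measurable_integrable[OF i])
    show "AE x in lebesgue. norm ((indicator ?K x *\<^sub>R g x) * \<psi> x) \<le> norm (M * \<bar>indicator ?K x *\<^sub>R g x\<bar>)"
    proof (rule AE_I2)
      fix x
      show "norm ((indicator ?K x *\<^sub>R g x) * \<psi> x) \<le> norm (M * \<bar>indicator ?K x *\<^sub>R g x\<bar>)"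
      proof (cases "x \<in> ?K")
        case True
        have "\<bar>g x\<bar> * \<bar>\<psi> x\<bar> \<le> \<bar>g x\<bar> * \<bar>M\<bar>" using M[OF True] by (intro mult_left_mono) auto
        then show ?thesis using True by (simp add: abs_mult mult.commute)
      qed simp
    qed
  qed
  moreover have "(\<lambda>x. (indicator ?K x *\<^sub>R g x) * \<psi> x) = (\<lambda>x. indicator U x *\<^sub>R (g x * \<psi> x))"
  proof
    fix x
    show "(indicator ?K x *\<^sub>R g x) * \<psi> x = indicator U x *\<^sub>R (g x * \<psi> x)"
    proof (cases "x \<in> ?K")
      case True
      then have "x \<in> U" using K(2) by blast
      with True show ?thesis by simp
    next
      case False
      from out[OF this] show ?thesis by simp
    qed
  qed
  ultimately show ?thesis by (simp add: set_integrable_def)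
qed

lemma weak_partial_unique:
  assumes U: "open U" and g: "has_weak_partial U i f g1" "has_weak_partial U i f g2"
  shows "AE x in lebesgue. x \<in> U \<longrightarrow> g1 x = g2 x"
proof -
  have L: "Lp_loc U 1 g1" "Lp_loc U 1 g2" using g by (auto simp: has_weak_partial_def)
  note i = Lp_loc_1_set_integrable[OF L(1)] Lp_loc_1_set_integrable[OF L(2)]
  have "AE x in lebesgue. x \<in> U \<longrightarrow> g1 x - g2 x = 0"
  proof (rule AE_zero_of_test_integrals[OF U])
    show "set_integrable lebesgue K (\<lambda>x. g1 x - g2 x)" if "compact K" "K \<subseteq> U" for K
      using i[OF that] by (rule set_integral_diff)
    fix \<psi> assume t: "test_function U \<psi>"
    have "(LINT x:U|lebesgue. (g1 x - g2 x) * \<psi> x) = (LINT x:U|lebesgue. g1 x * \<psi> x - g2 x * \<psi> x)"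
      by (simp add: left_diff_distrib)
    also have "\<dots> = (LINT x:U|lebesgue. g1 x * \<psi> x) - (LINT x:U|lebesgue. g2 x * \<psi> x)"
      by (intro set_integral_diff set_integrable_times_test_function i t)
    also have "\<dots> = 0" using g t unfolding has_weak_partial_def by (metis diff_self neg_equal_iff_equal)
    finally show "(LINT x:U|lebesgue. (g1 x - g2 x) * \<psi> x) = 0" .
  qed
  then show ?thesis by eventually_elim auto
qed

text \<open>The choice in the definition of \<open>weak_partial\<close> is made among all weak derivatives, while \<open>W1p_loc\<close> provides one that is
  locally \<open>p\<close>-integrable; uniqueness up to null sets transfers integrability to the chosen one.\<close>

lemma weak_partial_props:
  assumes U: "open U" and f: "W1p_loc U p f"
  shows "has_weak_partial U i f (weak_partial U i f)"
    "compact K \<Longrightarrow> K \<subseteq> U \<Longrightarrow> set_integrable lebesgue K (\<lambda>x. \<bar>weak_partial U i f x\<bar> powr p)"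
proof -
  obtain g where g: "Lp_loc U p g" "has_weak_partial U i f g" using f unfolding W1p_loc_def by blast
  show w: "has_weak_partial U i f (weak_partial U i f)"
    unfolding weak_partial_def by (rule someI[of _ g]) (rule g)
  let ?w = "weak_partial U i f"
  assume K: "compact K" "K \<subseteq> U"
  have i: "integrable lebesgue (\<lambda>x. indicator K x *\<^sub>R (\<bar>g x\<bar> powr p))"
    using g(1) K unfolding Lp_loc_def set_integrable_def by blast
  have wm: "(\<lambda>x. indicator U x *\<^sub>R ?w x) \<in> borel_measurable lebesgue"
    using w unfolding has_weak_partial_def Lp_loc_def set_borel_measurable_def by blast
  have Ks: "K \<in> sets lebesgue" by (rule fmeasurableD[OF lmeasurable_compact[OF K(1)]])
  have "(\<lambda>x. indicator K x *\<^sub>R (\<bar>indicator U x *\<^sub>R ?w x\<bar> powr p)) \<in> borel_measurable lebesgue"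
    using wm Ks by measurable
  also have "(\<lambda>x. indicator K x *\<^sub>R (\<bar>indicator U x *\<^sub>R ?w x\<bar> powr p)) = (\<lambda>x. indicator K x *\<^sub>R (\<bar>?w x\<bar> powr p))"
    using K(2) by (auto simp: indicator_def fun_eq_iff)
  finally have m: "(\<lambda>x. indicator K x *\<^sub>R (\<bar>?w x\<bar> powr p)) \<in> borel_measurable lebesgue" .
  have "AE x in lebesgue. indicator K x *\<^sub>R (\<bar>g x\<bar> powr p) = indicator K x *\<^sub>R (\<bar>?w x\<bar> powr p)"
    using weak_partial_unique[OF U g(2) w]
    by eventually_elim (use K(2) in \<open>auto simp: indicator_def\<close>)
  from integrable_cong_AE[OF borel_measurable_integrable[OF i] m this] i
  show "set_integrable lebesgue K (\<lambda>x. \<bar>?w x\<bar> powr p)" by (simp add: set_integrable_def)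
qed

lemma set_integral_powr_nonneg: "0 \<le> (LINT x:K|M. \<bar>f x\<bar> powr (p::real))"
  unfolding set_lebesgue_integral_def by (intro integral_nonneg_AE AE_I2) auto

lemma W1p_norm_bounds:
  assumes "p > 0" "N > 0" "W1p_norm U p K f < N powr (1 / p)"
  shows "(LINT x:K|lebesgue. \<bar>f x\<bar> powr p) \<le> N"
    "(LINT x:K|lebesgue. \<bar>weak_partial U i f x\<bar> powr p) \<le> N"
proof -
  let ?a = "LINT x:K|lebesgue. \<bar>f x\<bar> powr p"
  let ?b = "\<lambda>i. LINT x:K|lebesgue. \<bar>weak_partial U i f x\<bar> powr p"
  have n: "0 \<le> ?a" "0 \<le> ?b i" for i by (rule set_integral_powr_nonneg)+
  have "?a + (\<Sum>i\<in>UNIV. ?b i) \<le> N"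
  proof (rule ccontr)
    assume "\<not> ?thesis"
    then have "N powr (1 / p) \<le> (?a + (\<Sum>i\<in>UNIV. ?b i)) powr (1 / p)"
      using assms by (intro powr_mono2) auto
    with assms(3) show False by (simp add: W1p_norm_def)
  qed
  moreover have "?b i \<le> (\<Sum>i\<in>UNIV. ?b i)" by (rule member_le_sum) (use n in auto)
  moreover have "0 \<le> (\<Sum>i\<in>UNIV. ?b i)" by (rule sum_nonneg) (use n in auto)
  ultimately show "?a \<le> N" "?b i \<le> N" using n(1) n(2)[of i] by linarith+
qed

lemma set_integral_powr_mono:
  fixes f :: "'a::euclidean_space \<Rightarrow> real" and p :: real
  assumes "set_integrable lebesgue K (\<lambda>x. \<bar>f x\<bar> powr p)" "C \<subseteq> K" "C \<in> sets lebesgue"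
  shows "set_integrable lebesgue C (\<lambda>x. \<bar>f x\<bar> powr p)"
    "(LINT x:C|lebesgue. \<bar>f x\<bar> powr p) \<le> (LINT x:K|lebesgue. \<bar>f x\<bar> powr p)"
proof -
  show i: "set_integrable lebesgue C (\<lambda>x. \<bar>f x\<bar> powr p)"
    by (rule set_integrable_subset[OF assms(1,3,2)])
  show "(LINT x:C|lebesgue. \<bar>f x\<bar> powr p) \<le> (LINT x:K|lebesgue. \<bar>f x\<bar> powr p)"
    unfolding set_lebesgue_integral_def
    by (rule integral_mono_AE') (use assms in \<open>auto simp: set_integrable_def indicator_def\<close>)
qed

text \<open>Morrey's embedding: a small norm on \<open>K'\<close> forces a small supremum on \<open>K\<close>.  In the pointwise estimate the parameter \<open>\<tau>\<close> is
  fixed first, to make the part independent of the norm at most half of the bound, and the norm is then taken small.\<close>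

lemma morrey_uniform:
  fixes K :: "(real^'n::finite) set"
  assumes U: "open U" and K: "compact K" "K \<subseteq> U" and p: "real CARD('n) < p" and e: "e > 0"
  shows "\<exists>K' \<delta>. compact K' \<and> K' \<subseteq> U \<and> \<delta> > 0 \<and>
    (\<forall>f. continuous_on U f \<longrightarrow> W1p_loc U p f \<longrightarrow> W1p_norm U p K' f < \<delta> \<longrightarrow> (\<forall>x\<in>K. \<bar>f x\<bar> \<le> e))"
proof -
  let ?n = "CARD('n)"
  obtain d where d: "d > 0" "(\<Union>x\<in>K. cball x d) \<subseteq> U"
    using compact_subset_open_imp_cball_epsilon_subset[OF K(1) U K(2)] by blast
  define \<rho> where "\<rho> = d / (2 * real ?n)"
  have \<rho>: "\<rho> > 0" using d by (simp add: \<rho>_def)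
  let ?K' = "\<Union>x\<in>K. \<Union>y\<in>cball 0 d. {x + y}"
  have K'eq: "?K' = (\<Union>x\<in>K. cball x d)"
  proof -
    have "(\<Union>y\<in>cball 0 d. {x + y}) = cball x d" for x :: "real^'n"
    proof (intro set_eqI iffI)
      fix z assume "z \<in> cball x d"
      then have "z - x \<in> cball 0 d" by (simp add: dist_norm norm_minus_commute)
      then show "z \<in> (\<Union>y\<in>cball 0 d. {x + y})" by (intro UN_I[of "z - x"]) auto
    qed (auto simp: dist_norm)
    then show ?thesis by simp
  qed
  have K': "compact ?K'" by (intro compact_sums' K compact_cball)
  have cube: "cube x (2 * \<rho>) \<subseteq> ?K'" if "x \<in> K" for x
  proof
    fix y assume "y \<in> cube x (2 * \<rho>)"
    from cube_norm_bound[OF this] have "norm (y - x) \<le> d" by (simp add: \<rho>_def)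
    then have "y \<in> cball x d" by (simp add: dist_norm norm_minus_commute)
    then show "y \<in> ?K'" unfolding K'eq using that by blast
  qed
  define c where "c = integral\<^sup>L lborel (unit_bump :: real^'n \<Rightarrow> real)"
  have c: "c > 0" unfolding c_def by (rule integral_unit_bump_pos)
  have p1: "p > 1" using p by (smt (verit) of_nat_1 of_nat_le_iff One_nat_def Suc_leI zero_less_card_finite)
  define X where "X = \<rho> powr (1 - real ?n / p) / (1 - real ?n / p)"
  have X: "X \<ge> 0" using p p1 by (simp add: X_def)
  define C1 where "C1 = 2 ^ ?n + real ?n * 2 ^ ?n * X"
  define C2 where "C2 = 1 / \<rho> ^ ?n + real ?n * X"
  have C1: "C1 > 0" using X by (simp add: C1_def add_pos_nonneg)
  have C2: "C2 > 0" using X \<rho> by (simp add: C2_def add_pos_nonneg)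
  define \<tau> where "\<tau> = c * e / (2 * C1)"
  have \<tau>: "\<tau> > 0" using c e C1 by (simp add: \<tau>_def)
  define N where "N = c * e / (2 * (C2 * \<tau> powr (1 - p)))"
  have N: "N > 0" using c e C2 \<tau> by (simp add: N_def)
  have main: "\<bar>f x\<bar> \<le> e" if f: "continuous_on U f" "W1p_loc U p f" "W1p_norm U p ?K' f < N powr (1 / p)" and x: "x \<in> K" for f x
  proof -
    have K'U: "?K' \<subseteq> U" unfolding K'eq by (rule d)
    have fi: "set_integrable lebesgue ?K' (\<lambda>x. \<bar>f x\<bar> powr p)"
      using f(2) K' K'U unfolding W1p_loc_def Lp_loc_def by blast
    note wi = weak_partial_props(2)[OF U f(2) K' K'U]
    have pp: "p > 0" using p1 by simp
    note bd = W1p_norm_bounds[OF pp N f(3)]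
    have Cm: "cube x (2 * \<rho>) \<in> sets lebesgue" by auto
    have "c * \<bar>f x\<bar> \<le> (2 ^ ?n * \<tau> + \<tau> powr (1 - p) * N / \<rho> ^ ?n) +
      real ?n * (2 ^ ?n * \<tau> + \<tau> powr (1 - p) * N) * X"
      unfolding c_def X_def
    proof (rule morrey_pointwise[OF f(1) weak_partial_props(1)[OF U f(2)] \<rho> _ p \<tau>])
      show "cube x (2 * \<rho>) \<subseteq> U" using cube[OF x] K'U by (rule order_trans)
      show "set_integrable lebesgue (cube x (2 * \<rho>)) (\<lambda>y. \<bar>f y\<bar> powr p)"
        by (rule set_integral_powr_mono(1)[OF fi cube[OF x] Cm])
      show "set_integrable lebesgue (cube x (2 * \<rho>)) (\<lambda>y. \<bar>weak_partial U i f y\<bar> powr p)" for i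
        by (rule set_integral_powr_mono(1)[OF wi cube[OF x] Cm])
      show "(LINT y:cube x (2 * \<rho>)|lebesgue. \<bar>f y\<bar> powr p) \<le> N"
        using set_integral_powr_mono(2)[OF fi cube[OF x] Cm] bd(1) by linarith
      show "(LINT y:cube x (2 * \<rho>)|lebesgue. \<bar>weak_partial U i f y\<bar> powr p) \<le> N" for i
        using set_integral_powr_mono(2)[OF wi[of i] cube[OF x] Cm] bd(2)[of i] by linarith
    qed
    also have "\<dots> = C1 * \<tau> + C2 * \<tau> powr (1 - p) * N"
      by (simp add: C1_def C2_def algebra_simps)
    also have "C1 * \<tau> = c * e / 2" using C1 by (simp add: \<tau>_def)
    also have "C2 * \<tau> powr (1 - p) * N = c * e / 2" using C2 \<tau> by (simp add: N_def)
    finally show ?thesis using c by simp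
  qed
  show ?thesis
    by (intro exI[of _ ?K'] exI[of _ "N powr (1 / p)"] conjI allI impI ballI K' main)
       (use d(2) N in \<open>auto simp: K'eq\<close>)
qed

text \<open>The form in which all later arguments use a null family.\<close>

lemma W1p_null_imp_uniformly_null:
  fixes B :: "'k \<Rightarrow> real^'n::finite \<Rightarrow> real^'n^'n"
  assumes U: "open U" and p: "real CARD('n) < p" and K: "compact K" "K \<subseteq> U" and e: "e > 0"
    and B: "\<forall>\<^sub>F l in F. B l \<in> diffusion_matrices TYPE('m::finite) U p"
    and null: "W1p_loc_tendsto U p B (\<lambda>x. 0) F"
  shows "\<forall>\<^sub>F l in F. \<forall>x\<in>K. \<forall>i j. \<bar>B l x $ i $ j\<bar> \<le> e"
proof -
  from morrey_uniform[OF U K p e] obtain K' d where K': "compact K'" "K' \<subseteq> U" "d > 0"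
    "\<forall>f. continuous_on U f \<longrightarrow> W1p_loc U p f \<longrightarrow> W1p_norm U p K' f < d \<longrightarrow> (\<forall>x\<in>K. \<bar>f x\<bar> \<le> e)"
    by (elim exE conjE)
  have "\<forall>\<^sub>F l in F. W1p_norm U p K' (\<lambda>x. B l x $ i $ j) < d" for i j
  proof -
    have "((\<lambda>l. W1p_norm U p K' (\<lambda>x. B l x $ i $ j)) \<longlongrightarrow> 0) F"
      using null K' unfolding W1p_loc_tendsto_def by force
    then show ?thesis using K'(3) by (rule order_tendstoD(2))
  qed
  then have "\<forall>\<^sub>F l in F. \<forall>i j. W1p_norm U p K' (\<lambda>x. B l x $ i $ j) < d"
    by (intro eventually_all_finite)
  from this B show ?thesis
  proof eventually_elim
    case (elim l)
    have "continuous_on U (\<lambda>x. B l x $ i $ j)" "W1p_loc U p (\<lambda>x. B l x $ i $ j)" for i j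
      using elim(2) by (auto simp: diffusion_matrices_def intro!: continuous_on_component)
    with K'(4) elim(1) show ?case by blast
  qed
qed

section \<open>Prokhorov's theorem\<close>

definition bounded_cont :: "'a::topological_space set \<Rightarrow> ('a \<Rightarrow> real) set" where
  "bounded_cont U = {f. continuous_on U f \<and> bounded (f ` U)}"

lemma bounded_contI:
  "continuous_on U f \<Longrightarrow> (\<And>x. x \<in> U \<Longrightarrow> \<bar>f x\<bar> \<le> b) \<Longrightarrow> f \<in> bounded_cont U"
  unfolding bounded_cont_def bounded_real by auto

lemma bounded_contE:
  assumes "f \<in> bounded_cont U"
  obtains b where "b > 0" "\<And>x. x \<in> U \<Longrightarrow> \<bar>f x\<bar> \<le> b"
proof -
  obtain b where "\<forall>x\<in>f ` U. \<bar>x\<bar> \<le> b" using assms unfolding bounded_cont_def bounded_real by blast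
  then have "\<bar>f x\<bar> \<le> max b 1" if "x \<in> U" for x using that by (simp add: le_max_iff_disj)
  then show ?thesis by (rule that[of "max b 1", rotated]) auto
qed

lemma bounded_cont_continuous: "f \<in> bounded_cont U \<Longrightarrow> continuous_on U f"
  by (simp add: bounded_cont_def)

lemma bounded_cont_intros:
  "(\<lambda>x. c) \<in> bounded_cont U"
  "f \<in> bounded_cont U \<Longrightarrow> g \<in> bounded_cont U \<Longrightarrow> (\<lambda>x. f x + g x) \<in> bounded_cont U"
  "f \<in> bounded_cont U \<Longrightarrow> (\<lambda>x. c * f x) \<in> bounded_cont U"
  "f \<in> bounded_cont U \<Longrightarrow> g \<in> bounded_cont U \<Longrightarrow> (\<lambda>x. f x - g x) \<in> bounded_cont U"
  "f \<in> bounded_cont U \<Longrightarrow> g \<in> bounded_cont U \<Longrightarrow> (\<lambda>x. min (f x) (g x)) \<in> bounded_cont U"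
  "f \<in> bounded_cont U \<Longrightarrow> g \<in> bounded_cont U \<Longrightarrow> (\<lambda>x. max (f x) (g x)) \<in> bounded_cont U"
proof -
  show "(\<lambda>x. c) \<in> bounded_cont U" by (rule bounded_contI[of _ _ "\<bar>c\<bar>"]) auto
  assume f: "f \<in> bounded_cont U"
  obtain a where a: "\<And>x. x \<in> U \<Longrightarrow> \<bar>f x\<bar> \<le> a" using bounded_contE[OF f] by metis
  show "(\<lambda>x. c * f x) \<in> bounded_cont U"
    by (rule bounded_contI[of _ _ "\<bar>c\<bar> * a"])
       (auto intro!: continuous_intros bounded_cont_continuous[OF f] mult_left_mono a simp: abs_mult)
  assume g: "g \<in> bounded_cont U"
  obtain b where b: "\<And>x. x \<in> U \<Longrightarrow> \<bar>g x\<bar> \<le> b" using bounded_contE[OF g] by metis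
  note c = bounded_cont_continuous[OF f] bounded_cont_continuous[OF g]
  have ab: "\<bar>f x + g x\<bar> \<le> a + b" "\<bar>f x - g x\<bar> \<le> a + b" "\<bar>min (f x) (g x)\<bar> \<le> a + b" "\<bar>max (f x) (g x)\<bar> \<le> a + b"
    if "x \<in> U" for x using a[OF that] b[OF that] by auto
  show "(\<lambda>x. f x + g x) \<in> bounded_cont U"
    by (rule bounded_contI[of _ _ "a + b"]) (auto intro!: continuous_intros c ab)
  show "(\<lambda>x. f x - g x) \<in> bounded_cont U"
    by (rule bounded_contI[of _ _ "a + b"]) (auto intro!: continuous_intros c ab)
  show "(\<lambda>x. min (f x) (g x)) \<in> bounded_cont U"
    by (rule bounded_contI[of _ _ "a + b"]) (auto intro!: continuous_intros c ab)
  show "(\<lambda>x. max (f x) (g x)) \<in> bounded_cont U"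
    by (rule bounded_contI[of _ _ "a + b"]) (auto intro!: continuous_intros c ab)
qed

lemma bounded_cont_sum: "(\<And>i. i \<in> I \<Longrightarrow> f i \<in> bounded_cont U) \<Longrightarrow> (\<lambda>x. \<Sum>i\<in>I. f i x) \<in> bounded_cont U"
  by (induction I rule: infinite_finite_induct) (auto intro: bounded_cont_intros)

text \<open>Continuous functions that increase to the indicator of an open set.  The case \<open>G = UNIV\<close> is separate as
  \<open>infdist\<close> to the empty set is \<open>0\<close> by convention.\<close>

definition open_approx :: "'a::metric_space set \<Rightarrow> nat \<Rightarrow> 'a \<Rightarrow> real" where
  "open_approx G k x = (if G = UNIV then 1 else min 1 (real k * infdist x (- G)))"

lemma open_approx_bounds: "0 \<le> open_approx G k x" "open_approx G k x \<le> 1"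
  "open_approx G k x \<le> indicator G x"
  by (auto simp: open_approx_def infdist_nonneg indicator_def)

lemma open_approx_mono: "k \<le> l \<Longrightarrow> open_approx G k x \<le> open_approx G l x"
proof -
  assume "k \<le> l"
  then have "real k * infdist x (- G) \<le> real l * infdist x (- G)"
    by (intro mult_right_mono infdist_nonneg) auto
  then show ?thesis by (auto simp: open_approx_def min_def)
qed

lemma open_approx_bounded_cont: "open_approx G k \<in> bounded_cont U"
proof (rule bounded_contI)
  show "continuous_on U (open_approx G k)"
    unfolding open_approx_def[abs_def] by (cases "G = UNIV") (auto intro!: continuous_intros)
  show "\<bar>open_approx G k x\<bar> \<le> 1" for x using open_approx_bounds[of G k x] by simp
qed

lemma open_approx_eventually:
  assumes "open G" "x \<in> G"
  shows "\<exists>k0. \<forall>k\<ge>k0. open_approx G k x = 1"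
proof (cases "G = UNIV")
  case False
  then have "infdist x (- G) > 0"
    using assms by (intro infdist_pos_not_in_closed) auto
  then obtain k0 where k0: "1 < real k0 * infdist x (- G)" using reals_Archimedean3 by blast
  have "open_approx G k x = 1" if "k \<ge> k0" for k
  proof -
    have "real k0 * infdist x (- G) \<le> real k * infdist x (- G)"
      using that by (intro mult_right_mono infdist_nonneg) auto
    then show ?thesis using k0 False by (simp add: open_approx_def)
  qed
  then show ?thesis by blast
qed (simp add: open_approx_def)

lemma open_approx_tendsto: "open G \<Longrightarrow> (\<lambda>k. open_approx G k x) \<longlonglongrightarrow> indicator G x"
proof (cases "x \<in> G")
  case True
  assume "open G"
  then show ?thesis using open_approx_eventually[OF _ True] True
    by (intro tendsto_eventually) (auto simp: eventually_sequentially)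
next
  case False
  then have "open_approx G k x = 0" for k using open_approx_bounds[where G=G and k=k and x=x] by auto
  then show ?thesis using False by simp
qed

text \<open>A Riesz representation theorem: such a functional is integration against a Borel probability measure on
  \<open>U\<close>.  On bounded functions tightness replaces compactness of the space; it yields Dini's theorem,
  and with it \<open>\<sigma>\<close>-additivity.\<close>

locale tight_functional =
  fixes U :: "'a::metric_space set" and L :: "('a \<Rightarrow> real) \<Rightarrow> real"
  assumes add: "\<And>f g. f \<in> bounded_cont U \<Longrightarrow> g \<in> bounded_cont U \<Longrightarrow> L (\<lambda>x. f x + g x) = L f + L g"
    and scale: "\<And>f c. f \<in> bounded_cont U \<Longrightarrow> L (\<lambda>x. c * f x) = c * L f"
    and nonneg: "\<And>f. f \<in> bounded_cont U \<Longrightarrow> (\<And>x. x \<in> U \<Longrightarrow> 0 \<le> f x) \<Longrightarrow> 0 \<le> L f"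
    and one: "L (\<lambda>x. 1) = 1"
    and tight: "\<And>e. e > 0 \<Longrightarrow> \<exists>K f. compact K \<and> K \<subseteq> U \<and> f \<in> bounded_cont U \<and>
       (\<forall>x\<in>U. 0 \<le> f x) \<and> (\<forall>x\<in>U - K. 1 \<le> f x) \<and> L f \<le> e"
begin

lemma diff: "f \<in> bounded_cont U \<Longrightarrow> g \<in> bounded_cont U \<Longrightarrow> L (\<lambda>x. f x - g x) = L f - L g"
  using add[of f "\<lambda>x. (- 1) * g x"] scale[of g "- 1"] bounded_cont_intros(3)[of g U "- 1"] by simp

lemma mono: "f \<in> bounded_cont U \<Longrightarrow> g \<in> bounded_cont U \<Longrightarrow> (\<And>x. x \<in> U \<Longrightarrow> f x \<le> g x) \<Longrightarrow> L f \<le> L g"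
  using nonneg[of "\<lambda>x. g x - f x"] diff[of g f] bounded_cont_intros(4)[of g U f] by simp

lemma cong: "f \<in> bounded_cont U \<Longrightarrow> g \<in> bounded_cont U \<Longrightarrow> (\<And>x. x \<in> U \<Longrightarrow> f x = g x) \<Longrightarrow> L f = L g"
  by (intro antisym mono) auto

lemma const: "L (\<lambda>x. c) = c"
  using scale[of "\<lambda>x. 1" c] bounded_cont_intros(1)[of 1 U] one by simp

lemma sum: "finite I \<Longrightarrow> (\<And>i. i \<in> I \<Longrightarrow> f i \<in> bounded_cont U) \<Longrightarrow> L (\<lambda>x. \<Sum>i\<in>I. f i x) = (\<Sum>i\<in>I. L (f i))"
proof (induction I rule: finite_induct)
  case (insert i I)
  have "L (\<lambda>x. f i x + (\<Sum>i\<in>I. f i x)) = L (f i) + L (\<lambda>x. \<Sum>i\<in>I. f i x)"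
    by (rule add) (use insert.prems in \<open>auto intro: bounded_cont_sum\<close>)
  then show ?case using insert by simp
qed (simp add: const)

text \<open>On a compact set that is nearly full in the sense of \<open>tight\<close>, Dini's theorem gives uniform
  convergence; off it, \<open>g 0\<close> bounds the sequence and the functional is small.\<close>

lemma dini:
  assumes g: "\<And>n. g n \<in> bounded_cont U" and mono_g: "\<And>m n x. m \<le> n \<Longrightarrow> x \<in> U \<Longrightarrow> g n x \<le> g m x"
    and g0: "\<And>x. x \<in> U \<Longrightarrow> (\<lambda>n. g n x) \<longlonglongrightarrow> 0" and e: "e > 0"
  shows "\<exists>n. L (g n) \<le> e"
proof -
  obtain b where b: "b > 0" "\<And>x. x \<in> U \<Longrightarrow> \<bar>g 0 x\<bar> \<le> b" using bounded_contE[OF g[of 0]] by metis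
  obtain K f where K: "compact K" "K \<subseteq> U" and f: "f \<in> bounded_cont U" "\<forall>x\<in>U. 0 \<le> f x"
    "\<forall>x\<in>U - K. 1 \<le> f x" "L f \<le> e / (2 * b)" using tight[of "e / (2 * b)"] e b(1) by auto
  have "\<exists>n G. open G \<and> x \<in> G \<and> (\<forall>y\<in>G \<inter> U. g n y < e / 2)" if "x \<in> K" for x
  proof -
    have xU: "x \<in> U" using that K by blast
    have "\<forall>\<^sub>F n in sequentially. g n x < e / 2" using order_tendstoD(2)[OF g0[OF xU], of "e / 2"] e by simp
    then obtain n where n: "g n x < e / 2" unfolding eventually_sequentially by blast
    have "openin (top_of_set U) (U \<inter> g n -` {..<e / 2})"
      by (rule continuous_openin_preimage_gen[OF bounded_cont_continuous[OF g]]) auto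
    then obtain G where "open G" "U \<inter> g n -` {..<e / 2} = U \<inter> G" unfolding openin_open by blast
    then show ?thesis using n xU by (intro exI[of _ n] exI[of _ G]) auto
  qed
  then obtain n G where nG: "\<And>x. x \<in> K \<Longrightarrow> open (G x) \<and> x \<in> G x \<and> (\<forall>y\<in>G x \<inter> U. g (n x) y < e / 2)" by metis
  obtain C where C: "C \<subseteq> K" "finite C" "K \<subseteq> (\<Union>x\<in>C. G x)"
    by (rule compactE_image[OF K(1), of K G]) (use nG in auto)
  define N where "N = Max (insert 0 (n ` C))"
  have gK: "g N y \<le> e / 2" if y: "y \<in> K" for y
  proof -
    obtain x where x: "x \<in> C" "y \<in> G x" using C(3) y by blast
    have "n x \<le> N" unfolding N_def using x C(2) by (intro Max_ge) auto
    then have "g N y \<le> g (n x) y" using mono_g y K by blast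
    also have "\<dots> < e / 2" using nG[of x] x C(1) y K by blast
    finally show ?thesis by simp
  qed
  have "L (g N) \<le> L (\<lambda>x. e / 2 + b * f x)"
  proof (rule mono)
    fix x assume x: "x \<in> U"
    show "g N x \<le> e / 2 + b * f x"
    proof (cases "x \<in> K")
      case True then show ?thesis using gK[OF True] f(2) x b by (simp add: add_increasing2)
    next
      case False
      have "g N x \<le> b" using mono_g[of 0 N x] b(2)[OF x] x by auto
      also have "b * 1 \<le> b * f x" using f(3) x False b by (intro mult_left_mono) auto
      finally show ?thesis using e by simp
    qed
  qed (auto intro!: g bounded_cont_intros f)
  also have "\<dots> = e / 2 + b * L f"
    by (simp add: add const scale bounded_cont_intros f)
  also have "b * L f \<le> b * (e / (2 * b))" using f(4) b by (intro mult_left_mono) auto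
  finally show ?thesis using b by (intro exI[of _ N]) simp
qed

lemma monotone_approx:
  assumes "\<And>n. h n \<in> bounded_cont U" "f \<in> bounded_cont U"
    and "\<And>m n x. m \<le> n \<Longrightarrow> x \<in> U \<Longrightarrow> h m x \<le> h n x"
    and "\<And>x. x \<in> U \<Longrightarrow> (\<lambda>n. h n x) \<longlonglongrightarrow> f x" and "e > 0"
  shows "\<exists>n. L f \<le> L (h n) + e"
proof -
  have "\<exists>n. L (\<lambda>x. f x - h n x) \<le> e"
  proof (rule dini)
    show "(\<lambda>n. f x - h n x) \<longlonglongrightarrow> 0" if "x \<in> U" for x
      using tendsto_diff[OF tendsto_const assms(4)[OF that], of "f x"] by simp
  qed (use assms in \<open>auto intro!: bounded_cont_intros\<close>)
  then show ?thesis using diff[OF assms(2,1)] by (simp add: algebra_simps)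
qed

definition dominated :: "'a set \<Rightarrow> ('a \<Rightarrow> real) set" where
  "dominated E = {f \<in> bounded_cont U. \<forall>x\<in>U. 0 \<le> f x \<and> f x \<le> indicator E x}"

text \<open>The classical construction: the mass of an open set is the supremum of the functional over the
  functions below its indicator, and outer measure is outer regularity.\<close>

definition open_mass :: "'a set \<Rightarrow> ennreal" where
  "open_mass G = (SUP f\<in>dominated G. ennreal (L f))"

definition outer_mass :: "'a set \<Rightarrow> ennreal" where
  "outer_mass E = (INF G\<in>{G. open G \<and> E \<subseteq> G}. open_mass G)"

lemma dominatedD:
  assumes "f \<in> dominated E"
  shows "f \<in> bounded_cont U" "x \<in> U \<Longrightarrow> 0 \<le> f x" "x \<in> U \<Longrightarrow> f x \<le> 1"
    "x \<in> U \<Longrightarrow> x \<notin> E \<Longrightarrow> f x = 0"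
proof -
  show "f \<in> bounded_cont U" using assms by (simp add: dominated_def)
  assume x: "x \<in> U"
  then have *: "0 \<le> f x" "f x \<le> indicator E x" using assms by (auto simp: dominated_def)
  show "0 \<le> f x" by fact
  show "f x \<le> 1" using * by (rule_tac order_trans[of _ "indicator E x"]) (auto simp: indicator_def)
  show "x \<notin> E \<Longrightarrow> f x = 0" using * by simp
qed

lemma dominatedI:
  assumes "f \<in> bounded_cont U" "\<And>x. x \<in> U \<Longrightarrow> 0 \<le> f x \<and> f x \<le> 1" "\<And>x. x \<in> U \<Longrightarrow> x \<notin> E \<Longrightarrow> f x = 0"
  shows "f \<in> dominated E"
  using assms by (auto simp: dominated_def indicator_def)

lemma zero_dominated: "(\<lambda>x. 0) \<in> dominated E"
  by (auto simp: dominated_def bounded_cont_intros)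

lemma open_mass_mono: "G \<subseteq> H \<Longrightarrow> open_mass G \<le> open_mass H"
  unfolding open_mass_def
  by (rule SUP_subset_mono) (auto intro!: dominatedI dest: dominatedD)

lemma open_mass_empty: "open_mass {} = 0"
proof -
  have "ennreal (L f) = 0" if "f \<in> dominated {}" for f
  proof -
    have "L f = L (\<lambda>x. 0)" using that by (intro cong) (auto simp: dominated_def bounded_cont_intros)
    then show ?thesis by (simp add: const)
  qed
  then show ?thesis unfolding open_mass_def by (auto intro!: antisym SUP_least)
qed

lemma open_mass_le_1: "open_mass G \<le> 1"
  unfolding open_mass_def
proof (rule SUP_least)
  fix f assume "f \<in> dominated G"
  then have "L f \<le> L (\<lambda>x. 1)"
    by (intro mono) (auto intro: bounded_cont_intros dest: dominatedD)
  then show "ennreal (L f) \<le> 1" by (simp add: one)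
qed

lemma open_mass_countable_subadditive:
  assumes G: "\<And>i::nat. open (G i)"
  shows "open_mass (\<Union>i. G i) \<le> (\<Sum>i. open_mass (G i))"
  unfolding open_mass_def[of "\<Union>i. G i"]
proof (rule SUP_least)
  fix f assume f: "f \<in> dominated (\<Union>i. G i)"
  show "ennreal (L f) \<le> (\<Sum>i. open_mass (G i))"
  proof (rule ennreal_le_epsilon)
    fix e :: real assume e: "e > 0"
    \<comment> \<open>these increase to \<open>f\<close> and lie below finite sums of functions that are dominated by the single sets\<close>
    define h where "h n x = min (f x) (\<Sum>i<n. open_approx (G i) n x)" for n x
    have sb: "(\<lambda>x. \<Sum>i<n. open_approx (G i) n x) \<in> bounded_cont U" for n
      by (intro bounded_cont_sum open_approx_bounded_cont)
    have fb: "f \<in> bounded_cont U" using f by (simp add: dominated_def)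
    have hb: "h n \<in> bounded_cont U" for n
      unfolding h_def[abs_def] by (intro bounded_cont_intros fb sb)
    have "\<exists>n. L f \<le> L (h n) + e"
    proof (rule monotone_approx[OF hb fb _ _ e])
      show "h m x \<le> h n x" if "m \<le> n" for m n x
      proof -
        have "(\<Sum>i<m. open_approx (G i) m x) \<le> (\<Sum>i<m. open_approx (G i) n x)"
          by (intro sum_mono open_approx_mono that)
        also have "\<dots> \<le> (\<Sum>i<n. open_approx (G i) n x)"
          by (rule sum_mono2) (use that in \<open>auto intro: open_approx_bounds\<close>)
        finally show ?thesis unfolding h_def by (intro min.mono) auto
      qed
      show "(\<lambda>n. h n x) \<longlonglongrightarrow> f x" if x: "x \<in> U" for x
      proof (cases "x \<in> (\<Union>i. G i)")
        case False
        then have "f x = 0" using f x by (force simp: dominated_def)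
        then have "h n x = 0" for n unfolding h_def by (simp add: min_def sum_nonneg open_approx_bounds)
        then show ?thesis using \<open>f x = 0\<close> by simp
      next
        case True
        then obtain i where i: "x \<in> G i" by blast
        obtain k0 where k0: "\<And>k. k \<ge> k0 \<Longrightarrow> open_approx (G i) k x = 1" using open_approx_eventually[OF G i] by blast
        have "h n x = f x" if "n \<ge> max k0 (Suc i)" for n
        proof -
          have "f x \<le> 1" by (rule dominatedD(3)[OF f x])
          also have "1 = open_approx (G i) n x" using k0 that by simp
          also have "\<dots> \<le> (\<Sum>i<n. open_approx (G i) n x)"
            by (rule member_le_sum) (use that in \<open>auto intro: open_approx_bounds\<close>)
          finally show ?thesis by (simp add: h_def)
        qed
        then show ?thesis
          by (intro tendsto_eventually) (auto simp: eventually_sequentially intro!: exI[of _ "max k0 (Suc i)"])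
      qed
    qed
    then obtain n where n: "L f \<le> L (h n) + e" ..
    have "L (h n) \<le> L (\<lambda>x. \<Sum>i<n. open_approx (G i) n x)"
      by (rule mono[OF hb sb]) (simp add: h_def)
    also have "\<dots> = (\<Sum>i<n. L (open_approx (G i) n))"
      by (rule sum) (auto intro: open_approx_bounded_cont)
    finally have "ennreal (L f) \<le> ennreal ((\<Sum>i<n. L (open_approx (G i) n)) + e)"
      using n by (intro ennreal_leI) simp
    also have "\<dots> = (\<Sum>i<n. ennreal (L (open_approx (G i) n))) + ennreal e"
    proof -
      have nn: "0 \<le> L (open_approx (G i) n)" for i
        by (rule nonneg[OF open_approx_bounded_cont]) (rule open_approx_bounds)
      then show ?thesis using e by (simp add: ennreal_plus sum_nonneg sum_ennreal)
    qed
    also have "(\<Sum>i<n. ennreal (L (open_approx (G i) n))) \<le> (\<Sum>i<n. open_mass (G i))"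
      unfolding open_mass_def
      by (intro sum_mono SUP_upper) (auto simp: dominated_def open_approx_bounded_cont open_approx_bounds)
    also have "\<dots> \<le> (\<Sum>i. open_mass (G i))" by (rule sum_le_suminf) auto
    finally show "ennreal (L f) \<le> (\<Sum>i. open_mass (G i)) + ennreal e"
      by (simp add: add_right_mono)
  qed
qed

lemma outer_mass_mono: "E \<subseteq> F \<Longrightarrow> outer_mass E \<le> outer_mass F"
  unfolding outer_mass_def by (rule INF_superset_mono) auto

lemma outer_open: "open G \<Longrightarrow> outer_mass G = open_mass G"
  unfolding outer_mass_def by (rule antisym) (auto intro!: INF_lower INF_greatest open_mass_mono)

lemma outer_le_inner: "open G \<Longrightarrow> E \<subseteq> G \<Longrightarrow> outer_mass E \<le> open_mass G"
  unfolding outer_mass_def by (rule INF_lower) auto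

lemma outer_le_1: "outer_mass E \<le> 1"
  using outer_le_inner[of UNIV E] open_mass_le_1[of UNIV] by simp

lemma outer_approx:
  assumes "e > 0" shows "\<exists>G. open G \<and> E \<subseteq> G \<and> open_mass G \<le> outer_mass E + ennreal e"
proof -
  have fin: "outer_mass E < \<top>" using outer_le_1[of E] by (rule le_less_trans) simp
  then have "outer_mass E < outer_mass E + ennreal e" using assms by (cases "outer_mass E") (auto simp: ennreal_plus[symmetric] ennreal_less_iff simp del: ennreal_plus)
  then show ?thesis unfolding outer_mass_def[of E] INF_less_iff by (force intro: less_imp_le)
qed

lemma outer_mass_countably_subadditive:
  fixes E :: "nat \<Rightarrow> 'a set"
  shows "outer_mass (\<Union>i. E i) \<le> (\<Sum>i. outer_mass (E i))"
proof (rule ennreal_le_epsilon)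
  fix e :: real assume e: "e > 0"
  have "\<forall>i. \<exists>G. open G \<and> E i \<subseteq> G \<and> open_mass G \<le> outer_mass (E i) + ennreal (e * (1/2) ^ Suc i)"
    using e by (intro allI outer_approx) simp
  then obtain G where G: "\<And>i. open (G i)" "\<And>i. E i \<subseteq> G i"
    "\<And>i. open_mass (G i) \<le> outer_mass (E i) + ennreal (e * (1/2) ^ Suc i)" by metis
  have "outer_mass (\<Union>i. E i) \<le> open_mass (\<Union>i. G i)"
    by (rule outer_le_inner) (use G in auto)
  also have "\<dots> \<le> (\<Sum>i. open_mass (G i))" by (rule open_mass_countable_subadditive) (rule G)
  also have "\<dots> \<le> (\<Sum>i. outer_mass (E i) + ennreal (e * (1/2) ^ Suc i))"
    by (rule suminf_le) (use G in auto)
  also have "\<dots> = (\<Sum>i. outer_mass (E i)) + (\<Sum>i. ennreal (e * (1/2) ^ Suc i))"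
    by (rule suminf_add[symmetric]) auto
  also have "(\<Sum>i. ennreal (e * (1/2) ^ Suc i)) = ennreal e"
    by (rule suminf_ennreal_eq) (use e sums_mult[OF power_half_series, of e] in auto)
  finally show "outer_mass (\<Union>i. E i) \<le> (\<Sum>i. outer_mass (E i)) + ennreal e" .
qed

text \<open>The key to measurability of open sets.  Given a nearly optimal \<open>f\<close> below \<open>G \<inter> H\<close>, the set where \<open>f\<close> is
  less than \<open>e\<close> is an open neighbourhood of \<open>G - H\<close>; functions \<open>g\<close> supported there can be
  added to \<open>max 0 (f - e)\<close> without exceeding \<open>1\<close>.\<close>

lemma open_mass_split:
  assumes G: "open G" and H: "open H"
  shows "open_mass (G \<inter> H) + outer_mass (U \<inter> (G - H)) \<le> open_mass G"
proof (rule ennreal_le_epsilon)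
  fix e :: real assume e: "e > 0"
  have "ennreal (L f) + outer_mass (U \<inter> (G - H)) \<le> open_mass G + ennreal e" if f: "f \<in> dominated (G \<inter> H)" for f
  proof -
    note fD = dominatedD[OF f]
    have "openin (top_of_set U) (U \<inter> f -` {..<e})"
      by (rule continuous_openin_preimage_gen[OF bounded_cont_continuous[OF fD(1)]]) auto
    then obtain V where V: "open V" "U \<inter> f -` {..<e} = U \<inter> V" unfolding openin_open by blast
    have sub: "U \<inter> (G - H) \<subseteq> G \<inter> V"
    proof
      fix x assume x: "x \<in> U \<inter> (G - H)"
      then have "f x = 0" using fD(4) by blast
      then have "x \<in> U \<inter> f -` {..<e}" using x e by simp
      then show "x \<in> G \<inter> V" using V(2) x by blast
    qed
    have "ennreal (L f) + ennreal (L g) \<le> open_mass G + ennreal e" if g: "g \<in> dominated (G \<inter> V)" for g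
    proof -
      note gD = dominatedD[OF g]
      let ?f = "\<lambda>x. max 0 (f x - e)"
      have fb: "?f \<in> bounded_cont U" by (intro bounded_cont_intros fD)
      have "(\<lambda>x. ?f x + g x) \<in> dominated G"
      proof (rule dominatedI)
        show "(\<lambda>x. ?f x + g x) \<in> bounded_cont U" by (intro bounded_cont_intros fb gD fD)
        fix x assume x: "x \<in> U"
        show "0 \<le> ?f x + g x \<and> ?f x + g x \<le> 1"
        proof (cases "f x < e")
          case True
          then show ?thesis using gD(2,3)[OF x] by simp
        next
          case False
          then have "x \<notin> V" using V(2) x by auto
          then have "g x = 0" using gD(4)[OF x] by blast
          then show ?thesis using fD(2,3)[OF x] e by (simp add: max_def)
        qed
        show "x \<notin> G \<Longrightarrow> ?f x + g x = 0" using fD(4)[OF x] gD(4)[OF x] e by simp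
      qed
      then have "ennreal (L (\<lambda>x. ?f x + g x)) \<le> open_mass G" unfolding open_mass_def by (rule SUP_upper)
      moreover have "L f - e + L g \<le> L (\<lambda>x. ?f x + g x)"
      proof -
        have "L f - e = L (\<lambda>x. f x - e)" using diff[OF fD(1) bounded_cont_intros(1)] const by simp
        also have "\<dots> \<le> L ?f" by (rule mono) (auto intro!: bounded_cont_intros fD fb)
        finally show ?thesis using add[OF fb gD(1)] by simp
      qed
      moreover have "0 \<le> L f" "0 \<le> L g" using nonneg[OF fD(1)] fD(2) nonneg[OF gD(1)] gD(2) by auto
      ultimately have "ennreal (L f + L g) \<le> open_mass G + ennreal e"
      proof -
        have "ennreal (L f + L g) \<le> ennreal (L (\<lambda>x. ?f x + g x) + e)"
          using \<open>L f - e + L g \<le> L (\<lambda>x. ?f x + g x)\<close> by (intro ennreal_leI) simp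
        also have "\<dots> = ennreal (L (\<lambda>x. ?f x + g x)) + ennreal e"
          using e by (intro ennreal_plus nonneg bounded_cont_intros fb gD fD) (auto intro: add_nonneg_nonneg gD)
        also have "\<dots> \<le> open_mass G + ennreal e"
          using \<open>ennreal (L (\<lambda>x. ?f x + g x)) \<le> open_mass G\<close> by (rule add_right_mono)
        finally show ?thesis .
      qed
      then show ?thesis using \<open>0 \<le> L f\<close> \<open>0 \<le> L g\<close> by simp
    qed
    then have "(SUP g\<in>dominated (G \<inter> V). ennreal (L f) + ennreal (L g)) \<le> open_mass G + ennreal e"
      by (rule SUP_least)
    then have "ennreal (L f) + open_mass (G \<inter> V) \<le> open_mass G + ennreal e"
      unfolding open_mass_def[of "G \<inter> V"]
      by (subst ennreal_SUP_add_right) (use zero_dominated in auto)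
    moreover have "outer_mass (U \<inter> (G - H)) \<le> open_mass (G \<inter> V)"
      by (rule outer_le_inner) (use sub G V in auto)
    ultimately show ?thesis using add_left_mono order_trans by metis
  qed
  then have "(SUP f\<in>dominated (G \<inter> H). ennreal (L f) + outer_mass (U \<inter> (G - H))) \<le> open_mass G + ennreal e"
    by (rule SUP_least)
  moreover have "outer_mass (U \<inter> (G - H)) \<noteq> \<top>" using outer_le_1[of "U \<inter> (G - H)"] by (auto simp: top_unique)
  ultimately show "open_mass (G \<inter> H) + outer_mass (U \<inter> (G - H)) \<le> open_mass G + ennreal e"
    unfolding open_mass_def[of "G \<inter> H"]
    by (subst ennreal_SUP_add_left[symmetric]) (use zero_dominated in auto)
qed

lemma outer_measure_space_outer_mass: "outer_measure_space (Pow U) outer_mass"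
  unfolding outer_measure_space_def
proof (intro conjI)
  show "positive (Pow U) outer_mass"
    using outer_open[of "{}"] open_mass_empty by (simp add: positive_def)
  show "increasing (Pow U) outer_mass" by (auto simp: increasing_def intro: outer_mass_mono)
  show "countably_subadditive (Pow U) outer_mass"
    by (auto simp: countably_subadditive_def intro: outer_mass_countably_subadditive)
qed

lemma open_in_lambda_system:
  assumes H: "open H" shows "U \<inter> H \<in> lambda_system U (Pow U) outer_mass"
  unfolding lambda_system_def
proof (intro CollectI conjI ballI)
  fix E assume E: "E \<in> Pow U"
  have "outer_mass E \<le> outer_mass (U \<inter> H \<inter> E) + outer_mass ((U - U \<inter> H) \<inter> E)"
  proof -
    interpret Pow: ring_of_sets U "Pow U" by (rule ring_of_sets_Pow)
    have "subadditive (Pow U) outer_mass"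
      by (rule Pow.countably_subadditive_subadditive)
         (use outer_measure_space_outer_mass in \<open>auto simp: outer_measure_space_def\<close>)
    then have "outer_mass ((U \<inter> H \<inter> E) \<union> ((U - U \<inter> H) \<inter> E)) \<le>
        outer_mass (U \<inter> H \<inter> E) + outer_mass ((U - U \<inter> H) \<inter> E)"
      by (rule subadditive_def[THEN iffD1, rule_format]) auto
    moreover have "(U \<inter> H \<inter> E) \<union> ((U - U \<inter> H) \<inter> E) = E" using E by blast
    ultimately show ?thesis by simp
  qed
  moreover have "outer_mass (U \<inter> H \<inter> E) + outer_mass ((U - U \<inter> H) \<inter> E) \<le> outer_mass E"
    unfolding outer_mass_def[of E]
  proof (rule INF_greatest)
    fix G assume "G \<in> {G. open G \<and> E \<subseteq> G}"
    then have G: "open G" "E \<subseteq> G" by auto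
    have "outer_mass (U \<inter> H \<inter> E) + outer_mass ((U - U \<inter> H) \<inter> E)
        \<le> open_mass (G \<inter> H) + outer_mass (U \<inter> (G - H))"
      by (intro add_mono outer_le_inner outer_mass_mono) (use G H in auto)
    also have "\<dots> \<le> open_mass G" by (rule open_mass_split[OF G(1) H])
    finally show "outer_mass (U \<inter> H \<inter> E) + outer_mass ((U - U \<inter> H) \<inter> E) \<le> open_mass G" .
  qed
  ultimately show "outer_mass (U \<inter> H \<inter> E) + outer_mass ((U - U \<inter> H) \<inter> E) = outer_mass E"
    by (rule antisym[rotated])
qed auto

definition represented :: "'a measure" where
  "represented = measure_of U (sets (restrict_space borel U)) outer_mass"

lemma borel_measure_space: "measure_space U (sets (restrict_space borel U)) outer_mass"
proof -
  let ?L = "lambda_system U (Pow U) outer_mass"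
  interpret P: sigma_algebra U "Pow U" by (rule sigma_algebra_Pow)
  have L: "measure_space U ?L outer_mass"
    by (rule P.caratheodory_lemma[OF outer_measure_space_outer_mass])
  then interpret L: sigma_algebra U ?L by (simp add: measure_space_def)
  have "U \<inter> A \<in> ?L" if "A \<in> sigma_sets UNIV {S. open S}" for A
    using that
  proof induction
    case (Compl A)
    have "U \<inter> (UNIV - A) = U - U \<inter> A" by blast
    then show ?case using L.compl_sets[OF Compl.IH] by simp
  next
    case (Union A)
    have "U \<inter> (\<Union>i. A i) = (\<Union>i. U \<inter> A i)" by blast
    moreover have "(\<Union>i. U \<inter> A i) \<in> ?L" using Union by (intro L.countable_UN) auto
    ultimately show ?case by simp
  qed (auto intro: open_in_lambda_system)
  then have "sets (restrict_space borel U) \<subseteq> ?L"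
    by (auto simp: sets_restrict_space borel_def)
  moreover have "sigma_algebra U (sets (restrict_space borel U))"
    using sets.sigma_algebra_axioms[of "restrict_space borel U"] by (simp add: space_restrict_space)
  ultimately show ?thesis using measure_down[OF L] by blast
qed

lemma space_represented: "space represented = U"
  and sets_represented: "sets represented = sets (restrict_space borel U)"
proof -
  have "sets (restrict_space borel U) \<subseteq> Pow U"
    using sets.space_closed[of "restrict_space borel U"] by (simp add: space_restrict_space)
  then show "space represented = U" unfolding represented_def by (rule space_measure_of)
  show "sets represented = sets (restrict_space borel U)" unfolding represented_def
    using borel_measure_space sigma_algebra.sets_measure_of_eq by (auto simp: measure_space_def)
qed

lemma emeasure_represented:
  "A \<in> sets (restrict_space borel U) \<Longrightarrow> emeasure represented A = outer_mass A"
  unfolding represented_def using borel_measure_space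
  by (intro emeasure_measure_of_sigma) (auto simp: measure_space_def)

lemma dominated_le_outer:
  assumes f: "f \<in> dominated E" and E: "E \<subseteq> U" shows "ennreal (L f) \<le> outer_mass E"
  unfolding outer_mass_def
proof (rule INF_greatest)
  fix G assume "G \<in> {G. open G \<and> E \<subseteq> G}"
  then have "f \<in> dominated G" by (intro dominatedI) (use dominatedD[OF f] in auto)
  then show "ennreal (L f) \<le> open_mass G" unfolding open_mass_def by (rule SUP_upper)
qed

lemma represented_in_prob_measures: "represented \<in> prob_measures U"
proof -
  have "(\<lambda>x. 1) \<in> dominated U" by (auto intro!: dominatedI bounded_cont_intros)
  from dominated_le_outer[OF this order_refl] have "1 \<le> outer_mass U" by (simp add: one)
  then have "outer_mass U = 1" using outer_le_1[of U] by simp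
  moreover have "U \<in> sets (restrict_space borel U)"
    using sets.top[of "restrict_space borel U"] by (simp add: space_restrict_space)
  ultimately have "prob_space represented"
    by (intro prob_spaceI) (simp add: space_represented emeasure_represented)
  then show ?thesis by (simp add: prob_measures_def sets_represented)
qed

end

lemma clamp_sum:
  fixes s :: real assumes "s \<ge> 0"
  shows "(\<Sum>j<N. min 1 (max 0 (s - real j))) = min s (real N)"
  by (induction N) (use assms in auto)

lemma level_sum:
  fixes s :: real assumes "s \<ge> 0"
  shows "(\<Sum>j<N. if s > real j then 1 else 0) \<le> min (s + 1) (real N)"
  by (induction N) (use assms in auto)

lemma bounded_cont_integrable:
  assumes "\<mu> \<in> prob_measures U" "f \<in> bounded_cont U"
  shows "integrable \<mu> f"
proof -
  interpret prob_space \<mu> using assms by (simp add: prob_measures_def)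
  have s: "sets \<mu> = sets (restrict_space borel U)" using assms by (simp add: prob_measures_def)
  have sp: "space \<mu> = U" using sets_eq_imp_space_eq[OF s] by (simp add: space_restrict_space)
  have "f \<in> borel_measurable (restrict_space borel U)"
    by (rule borel_measurable_continuous_on_restrict[OF bounded_cont_continuous[OF assms(2)]])
  then have m: "f \<in> borel_measurable \<mu>" using s by (simp cong: measurable_cong_sets)
  obtain b where "\<And>x. x \<in> U \<Longrightarrow> \<bar>f x\<bar> \<le> b" using bounded_contE[OF assms(2)] by metis
  then show ?thesis by (intro integrable_const_bound[of _ b] AE_I2 m) (simp add: sp)
qed

lemma prob_measures_space: "\<mu> \<in> prob_measures U \<Longrightarrow> space \<mu> = U"
  using sets_eq_imp_space_eq[of \<mu> "restrict_space borel U"] by (simp add: prob_measures_def space_restrict_space)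

context tight_functional
begin

text \<open>Layer-cake decomposition: \<open>N f\<close> is the sum of \<open>N\<close> clamped layers, each of which is dominated by the
  indicator of a superlevel set; the resulting step function exceeds \<open>N f\<close> by at most \<open>1\<close>.\<close>

lemma unit_le_integral:
  assumes f: "f \<in> bounded_cont U" and b: "\<And>x. x \<in> U \<Longrightarrow> 0 \<le> f x \<and> f x \<le> 1"
  shows "L f \<le> integral\<^sup>L represented f"
proof (rule field_le_epsilon)
  fix e :: real assume "e > 0"
  then obtain N :: nat where N: "N > 0" "1 / real N < e"
    by (metis nat_approx_posE zero_less_Suc)
  note P = represented_in_prob_measures
  interpret prob_space represented using P by (simp add: prob_measures_def)
  let ?f = "\<lambda>j x. min 1 (max 0 (real N * f x - real j))"
  let ?E = "\<lambda>j. {x \<in> U. real N * f x > real j}"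
  have fb: "?f j \<in> bounded_cont U" for j by (intro bounded_cont_intros f)
  have Es: "?E j \<in> sets (restrict_space borel U)" for j
  proof -
    have "openin (top_of_set U) (U \<inter> (\<lambda>x. real N * f x) -` {real j<..})"
      by (rule continuous_openin_preimage_gen) (auto intro!: continuous_intros bounded_cont_continuous[OF f])
    then obtain V where V: "open V" "U \<inter> (\<lambda>x. real N * f x) -` {real j<..} = U \<inter> V" unfolding openin_open by blast
    have "?E j = U \<inter> V" using V(2) by auto
    then show ?thesis using V(1) by (auto simp: sets_restrict_space)
  qed
  have Lj: "L (?f j) \<le> measure represented (?E j)" for j
  proof -
    have "?f j \<in> dominated (?E j)" by (rule dominatedI[OF fb]) auto
    then have "ennreal (L (?f j)) \<le> outer_mass (?E j)" by (rule dominated_le_outer) auto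
    also have "\<dots> = ennreal (measure represented (?E j))"
      using Es[of j] by (simp add: emeasure_represented[symmetric] emeasure_eq_measure)
    finally show ?thesis by (simp add: ennreal_le_iff)
  qed
  have "real N * L f = L (\<lambda>x. \<Sum>j<N. ?f j x)"
  proof -
    have "L (\<lambda>x. real N * f x) = L (\<lambda>x. \<Sum>j<N. ?f j x)"
    proof (rule cong)
      fix x assume x: "x \<in> U"
      have "real N * f x \<le> real N * 1" using b[OF x] by (intro mult_left_mono) auto
      then show "real N * f x = (\<Sum>j<N. ?f j x)" using b[OF x] by (simp add: clamp_sum)
    qed (auto intro!: bounded_cont_sum bounded_cont_intros f)
    then show ?thesis by (simp add: scale[OF f])
  qed
  also have "\<dots> = (\<Sum>j<N. L (?f j))" by (rule sum) (auto intro: fb)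
  also have "\<dots> \<le> (\<Sum>j<N. measure represented (?E j))" by (intro sum_mono Lj)
  also have "\<dots> = (\<Sum>j<N. integral\<^sup>L represented (indicator (?E j)))"
    using Es by (intro sum.cong refl) (simp add: sets_represented)
  also have "\<dots> = integral\<^sup>L represented (\<lambda>x. \<Sum>j<N. indicator (?E j) x)"
    using Es by (intro Bochner_Integration.integral_sum[symmetric]) (simp add: sets_represented emeasure_eq_measure)
  also have "\<dots> \<le> integral\<^sup>L represented (\<lambda>x. real N * f x + 1)"
  proof (rule integral_mono_AE)
    show "integrable represented (\<lambda>x. \<Sum>j<N. indicator (?E j) x :: real)"
      using Es by (intro Bochner_Integration.integrable_sum) (simp add: sets_represented emeasure_eq_measure)
    show "integrable represented (\<lambda>x. real N * f x + 1)"
      by (intro bounded_cont_integrable[OF P] bounded_cont_intros f)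
    show "AE x in represented. (\<Sum>j<N. indicator (?E j) x) \<le> real N * f x + 1"
    proof (rule AE_I2)
      fix x assume "x \<in> space represented"
      then have x: "x \<in> U" by (simp add: space_represented)
      have "(\<Sum>j<N. indicator (?E j) x) = (\<Sum>j<N. if real N * f x > real j then 1 else (0::real))"
        using x by (intro sum.cong refl) (simp add: indicator_def)
      also have "\<dots> \<le> real N * f x + 1"
        using level_sum[of "real N * f x" N] b[OF x] by simp
      finally show "(\<Sum>j<N. indicator (?E j) x) \<le> real N * f x + 1" .
    qed
  qed
  also have "\<dots> = real N * integral\<^sup>L represented f + 1"
    using bounded_cont_integrable[OF P f] by (simp add: prob_space)
  finally have "L f \<le> integral\<^sup>L represented f + 1 / real N"
    using N(1) by (simp add: field_simps)
  then show "L f \<le> integral\<^sup>L represented f + e" using N by simp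
qed

text \<open>The inequality for functions with values in the unit interval becomes an equality when applied to \<open>1 - h\<close>
  as well, and affine rescaling reaches all bounded functions.\<close>

lemma integral_represented:
  assumes f: "f \<in> bounded_cont U" shows "integral\<^sup>L represented f = L f"
proof -
  note P = represented_in_prob_measures
  interpret prob_space represented using P by (simp add: prob_measures_def)
  have unit: "integral\<^sup>L represented h = L h" if h: "h \<in> bounded_cont U" "\<And>x. x \<in> U \<Longrightarrow> 0 \<le> h x \<and> h x \<le> 1" for h
  proof -
    have "L (\<lambda>x. 1 - h x) \<le> integral\<^sup>L represented (\<lambda>x. 1 - h x)"
      by (rule unit_le_integral) (auto intro!: bounded_cont_intros h(1) dest: h(2))
    then have "1 - L h \<le> 1 - integral\<^sup>L represented h"
      using diff[OF bounded_cont_intros(1) h(1), of 1] bounded_cont_integrable[OF P h(1)] by (simp add: const prob_space)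
    with unit_le_integral[OF h] show ?thesis by simp
  qed
  obtain b where b: "b > 0" "\<And>x. x \<in> U \<Longrightarrow> \<bar>f x\<bar> \<le> b" using bounded_contE[OF f] by metis
  let ?h = "\<lambda>x. (1 / (2 * b)) * f x + 1 / 2"
  have "integral\<^sup>L represented ?h = L ?h"
  proof (rule unit)
    show "0 \<le> ?h x \<and> ?h x \<le> 1" if "x \<in> U" for x
      using b(2)[OF that] b(1) by (auto simp: field_simps abs_le_iff)
  qed (intro bounded_cont_intros f)
  moreover have "L ?h = (1 / (2 * b)) * L f + 1 / 2"
    unfolding add[OF bounded_cont_intros(3)[OF f] bounded_cont_intros(1)] scale[OF f] const ..
  moreover have "integral\<^sup>L represented ?h = (1 / (2 * b)) * integral\<^sup>L represented f + 1 / 2"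
    using bounded_cont_integrable[OF P f] by (simp add: prob_space)
  ultimately show ?thesis using b(1) by simp
qed

end

lemma prob_measures_eqI:
  fixes U :: "'a::metric_space set"
  assumes U: "open U" and \<mu>: "\<mu> \<in> prob_measures U" and \<nu>: "\<nu> \<in> prob_measures U"
    and eq: "\<And>f. f \<in> bounded_cont U \<Longrightarrow> integral\<^sup>L \<mu> f = integral\<^sup>L \<nu> f"
  shows "\<mu> = \<nu>"
proof -
  let ?E = "(\<inter>) U ` {S. open S}"
  have gen: "sets (restrict_space borel U) = sigma_sets U ?E"
    unfolding sets_restrict_space sets_borel
    by (rule sigma_sets_Int) (use U in \<open>auto intro: sigma_sets.Basic\<close>)
  have lim: "(\<lambda>k. integral\<^sup>L \<kappa> (open_approx G k)) \<longlonglongrightarrow> measure \<kappa> (U \<inter> G)"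
    if \<kappa>: "\<kappa> \<in> prob_measures U" and G: "open G" for \<kappa> G
  proof -
    interpret prob_space \<kappa> using \<kappa> by (simp add: prob_measures_def)
    have sk: "space \<kappa> = U" by (rule prob_measures_space[OF \<kappa>])
    have UG: "U \<inter> G \<in> sets \<kappa>" using \<kappa> G by (auto simp: prob_measures_def sets_restrict_space)
    have "(\<lambda>k. integral\<^sup>L \<kappa> (open_approx G k)) \<longlonglongrightarrow> integral\<^sup>L \<kappa> (indicator (U \<inter> G))"
    proof (rule integral_dominated_convergence[where w="\<lambda>_. 1"])
      show "open_approx G k \<in> borel_measurable \<kappa>" for k
        by (rule borel_measurable_integrable[OF bounded_cont_integrable[OF \<kappa> open_approx_bounded_cont]])
      show "AE x in \<kappa>. (\<lambda>k. open_approx G k x) \<longlonglongrightarrow> indicator (U \<inter> G) x"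
        using open_approx_tendsto[OF G] sk by (intro AE_I2) (simp add: indicator_inter_arith)
      show "AE x in \<kappa>. norm (open_approx G k x) \<le> 1" for k
        by (simp add: abs_le_iff open_approx_bounds order_trans[OF _ open_approx_bounds(1)])
    qed (use UG in auto)
    then show ?thesis using UG by simp
  qed
  interpret M: prob_space \<mu> using \<mu> by (simp add: prob_measures_def)
  interpret N: prob_space \<nu> using \<nu> by (simp add: prob_measures_def)
  show ?thesis
  proof (rule measure_eqI_generator_eq)
    show "Int_stable ?E"
    proof (rule Int_stableI)
      fix a b assume "a \<in> ?E" "b \<in> ?E"
      then obtain S T where "open S" "open T" "a = U \<inter> S" "b = U \<inter> T" by auto
      then show "a \<inter> b \<in> ?E" by (intro image_eqI[of _ _ "S \<inter> T"]) auto
    qed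
    show "?E \<subseteq> Pow U" by auto
    show "sets \<mu> = sigma_sets U ?E" "sets \<nu> = sigma_sets U ?E"
      using \<mu> \<nu> gen by (auto simp: prob_measures_def)
    show "range (\<lambda>i::nat. U) \<subseteq> ?E" by (auto intro!: image_eqI[of _ _ UNIV])
    show "(\<Union>i::nat. U) = U" by auto
    show "emeasure \<mu> U \<noteq> \<infinity>" by simp
    fix X assume "X \<in> ?E"
    then obtain G where G: "open G" "X = U \<inter> G" by auto
    have "measure \<mu> X = measure \<nu> X"
      using LIMSEQ_unique[OF lim[OF \<mu> G(1)]] lim[OF \<nu> G(1)] eq[OF open_approx_bounded_cont] G(2) by simp
    then show "emeasure \<mu> X = emeasure \<nu> X" by (simp add: M.emeasure_eq_measure N.emeasure_eq_measure)
  qed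
qed

lemma topspace_weak_topology: "topspace (weak_topology U) = prob_measures U"
proof -
  have "{\<mu> \<in> prob_measures U. integral\<^sup>L \<mu> (\<lambda>x. 0 :: real) \<in> UNIV} \<in>
    {{\<mu> \<in> prob_measures U. integral\<^sup>L \<mu> f \<in> S} | (f :: _ \<Rightarrow> real) S. continuous_on U f \<and> bounded (f ` U) \<and> open S}"
    by (rule CollectI, rule exI[of _ "\<lambda>x. 0"], rule exI[of _ UNIV])
       (use bounded_cont_intros(1)[of 0 U] in \<open>simp add: bounded_cont_def\<close>)
  then show ?thesis unfolding weak_topology_def by auto
qed

lemma continuous_map_integral:
  assumes "f \<in> bounded_cont U"
  shows "continuous_map (weak_topology U) euclideanreal (\<lambda>\<mu>. integral\<^sup>L \<mu> f)"
  unfolding continuous_map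
proof (intro conjI allI impI)
  fix S :: "real set" assume "openin euclideanreal S"
  then have S: "open S" by simp
  show "openin (weak_topology U) {\<mu> \<in> topspace (weak_topology U). integral\<^sup>L \<mu> f \<in> S}"
    unfolding topspace_weak_topology unfolding weak_topology_def
    by (rule topology_generated_by_Basis) (use assms S in \<open>auto simp: bounded_cont_def\<close>)
qed auto

text \<open>Tightness is expressed by integrals of continuous functions, so that it passes to weak limits.
  Identify measures with their integration functionals inside the product of the compact
  intervals \<open>[- b f, b f]\<close>.  The conditions of \<open>tight_functional\<close> are closed in the product topology and
  cut out a compact set, each of whose points is represented by a measure; the representation
  is continuous, and its image is a compact set that contains the closure of \<open>Ms\<close>.\<close>

theorem prokhorov:
  fixes U :: "'a::metric_space set"
  assumes U: "open U" and Ms: "Ms \<subseteq> prob_measures U"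
    and tight: "\<And>e. e > 0 \<Longrightarrow> \<exists>K f. compact K \<and> K \<subseteq> U \<and> f \<in> bounded_cont U \<and>
       (\<forall>x\<in>U. 0 \<le> f x) \<and> (\<forall>x\<in>U - K. 1 \<le> f x) \<and> (\<forall>\<mu>\<in>Ms. integral\<^sup>L \<mu> f \<le> e)"
  shows "compactin (weak_topology U) (weak_topology U closure_of Ms)"
proof -
  let ?C = "bounded_cont U" and ?W = "weak_topology U"
  have "\<forall>e. \<exists>f. e > 0 \<longrightarrow> (\<exists>K. compact K \<and> K \<subseteq> U \<and> f \<in> ?C \<and>
       (\<forall>x\<in>U. 0 \<le> f x) \<and> (\<forall>x\<in>U - K. 1 \<le> f x) \<and> (\<forall>\<mu>\<in>Ms. integral\<^sup>L \<mu> f \<le> e))"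
  proof
    fix e :: real
    show "\<exists>f. e > 0 \<longrightarrow> (\<exists>K. compact K \<and> K \<subseteq> U \<and> f \<in> ?C \<and>
       (\<forall>x\<in>U. 0 \<le> f x) \<and> (\<forall>x\<in>U - K. 1 \<le> f x) \<and> (\<forall>\<mu>\<in>Ms. integral\<^sup>L \<mu> f \<le> e))"
    proof (cases "e > 0")
      case True
      from tight[OF this] show ?thesis by (elim exE) (rule exI, rule impI, rule exI, assumption)
    qed simp
  qed
  from choice[OF this] obtain h where h: "\<forall>e>0. \<exists>K. compact K \<and> K \<subseteq> U \<and> h e \<in> ?C \<and>
       (\<forall>x\<in>U. 0 \<le> h e x) \<and> (\<forall>x\<in>U - K. 1 \<le> h e x) \<and> (\<forall>\<mu>\<in>Ms. integral\<^sup>L \<mu> (h e) \<le> e)" ..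
  have "\<forall>f\<in>?C. \<exists>b. \<forall>x\<in>U. \<bar>f x\<bar> \<le> b" by (metis bounded_contE)
  from bchoice[OF this] obtain b where b: "\<forall>f\<in>?C. \<forall>x\<in>U. \<bar>f x\<bar> \<le> b f" ..
  define X where "X = product_topology (\<lambda>_. euclideanreal) ?C"
  define P where "P = PiE ?C (\<lambda>f. {- b f..b f})"
  have P: "compactin X P" unfolding X_def P_def by (subst compactin_PiE) auto
  have pr: "continuous_map X euclideanreal (\<lambda>\<Lambda>. \<Lambda> f)" if "f \<in> ?C" for f
    unfolding X_def by (rule continuous_map_product_projection[OF that])
  have ceq: "closedin X {\<Lambda> \<in> topspace X. u \<Lambda> = v \<Lambda>}"
    if "continuous_map X euclideanreal u" "continuous_map X euclideanreal v" for u v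
    by (rule closedin_continuous_maps_eq[OF Hausdorff_space_euclidean that])
  \<comment> \<open>additivity, homogeneity, positivity, normalisation and tightness, as closed conditions\<close>
  define C1 where "C1 = (\<Inter>f\<in>?C. \<Inter>g\<in>?C. {\<Lambda> \<in> topspace X. \<Lambda> (\<lambda>x. f x + g x) = \<Lambda> f + \<Lambda> g})"
  define C2 where "C2 = (\<Inter>f\<in>?C. \<Inter>c\<in>UNIV. {\<Lambda> \<in> topspace X. \<Lambda> (\<lambda>x. c * f x) = c * \<Lambda> f})"
  define C3 where "C3 = (\<Inter>f\<in>{f\<in>?C. \<forall>x\<in>U. 0 \<le> f x}. {\<Lambda> \<in> topspace X. \<Lambda> f \<in> {0..}})"
  define C4 where "C4 = {\<Lambda> \<in> topspace X. \<Lambda> (\<lambda>x. 1) = 1}"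
  define C5 where "C5 = (\<Inter>e\<in>{0<..}. {\<Lambda> \<in> topspace X. \<Lambda> (h e) \<in> {..e}})"
  have ne: "?C \<noteq> {}" "{f\<in>?C. \<forall>x\<in>U. 0 \<le> f x} \<noteq> {}" using bounded_cont_intros(1)[of 0 U] by auto
  have hC: "h e \<in> ?C" if "e > 0" for e using h that by blast
  have "closedin X C1" unfolding C1_def
    by (intro closedin_INT ne ceq pr continuous_map_add bounded_cont_intros)
  moreover have "closedin X C2" unfolding C2_def
    by (intro closedin_INT ne ceq pr continuous_map_real_mult_left bounded_cont_intros) auto
  moreover have "closedin X C3" unfolding C3_def
    by (intro closedin_INT ne closedin_continuous_map_preimage[OF pr]) auto
  moreover have "closedin X C4" unfolding C4_def
    by (intro ceq pr bounded_cont_intros) simp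
  moreover have "closedin X C5" unfolding C5_def
    by (intro closedin_INT closedin_continuous_map_preimage[OF pr] hC) auto
  ultimately have cl: "closedin X (C1 \<inter> C2 \<inter> C3 \<inter> C4 \<inter> C5)"
    by (intro closedin_Int)
  define S where "S = P \<inter> (C1 \<inter> C2 \<inter> C3 \<inter> C4 \<inter> C5)"
  have S: "compactin X S" unfolding S_def by (rule compact_Int_closedin[OF P cl])
  have "\<exists>\<mu>. \<mu> \<in> prob_measures U \<and> (\<forall>f\<in>?C. integral\<^sup>L \<mu> f = \<Lambda> f)" if \<Lambda>: "\<Lambda> \<in> S" for \<Lambda>
  proof -
    interpret tight_functional U \<Lambda>
    proof
      show "\<exists>K f. compact K \<and> K \<subseteq> U \<and> f \<in> ?C \<and> (\<forall>x\<in>U. 0 \<le> f x) \<and> (\<forall>x\<in>U - K. 1 \<le> f x) \<and> \<Lambda> f \<le> e"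
        if e: "e > 0" for e
      proof -
        have "\<Lambda> (h e) \<le> e" using \<Lambda> e by (auto simp: S_def C5_def)
        then show ?thesis using h[rule_format, OF e] by blast
      qed
    qed (use \<Lambda> in \<open>auto simp: S_def C1_def C2_def C3_def C4_def\<close>)
    show ?thesis using represented_in_prob_measures integral_represented by blast
  qed
  then obtain \<Psi> where \<Psi>: "\<And>\<Lambda>. \<Lambda> \<in> S \<Longrightarrow> \<Psi> \<Lambda> \<in> prob_measures U"
    "\<And>\<Lambda> f. \<Lambda> \<in> S \<Longrightarrow> f \<in> ?C \<Longrightarrow> integral\<^sup>L (\<Psi> \<Lambda>) f = \<Lambda> f" by metis
  have tsS: "topspace (subtopology X S) = S" using compactin_subset_topspace[OF S] by (auto simp: topspace_subtopology)
  have "continuous_map (subtopology X S) ?W \<Psi>"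
    unfolding weak_topology_def
  proof (rule continuous_on_generated_topo)
    show "\<Psi> ` topspace (subtopology X S) \<subseteq> \<Union> {{\<mu> \<in> prob_measures U. integral\<^sup>L \<mu> f \<in> S} | (f :: _ \<Rightarrow> real) S. continuous_on U f \<and> bounded (f ` U) \<and> open S}"
    proof -
      have "\<Psi> ` S \<subseteq> prob_measures U" using \<Psi>(1) by blast
      then show ?thesis
        using topspace_weak_topology[of U] unfolding weak_topology_def topology_generated_by_topspace tsS by simp
    qed
    fix T assume "T \<in> {{\<mu> \<in> prob_measures U. integral\<^sup>L \<mu> f \<in> S} | (f :: _ \<Rightarrow> real) S. continuous_on U f \<and> bounded (f ` U) \<and> open S}"
    then obtain f V where fV: "f \<in> ?C" "open V" "T = {\<mu> \<in> prob_measures U. integral\<^sup>L \<mu> f \<in> V}"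
      by (auto simp: bounded_cont_def)
    have "\<Psi> -` T \<inter> topspace (subtopology X S) = {\<Lambda> \<in> topspace (subtopology X S). \<Lambda> f \<in> V}"
      unfolding tsS fV(3) using \<Psi> fV(1) by auto
    moreover have "openin (subtopology X S) {\<Lambda> \<in> topspace (subtopology X S). \<Lambda> f \<in> V}"
      by (rule openin_continuous_map_preimage[OF continuous_map_from_subtopology[OF pr[OF fV(1)]]]) (use fV in simp)
    ultimately show "openin (subtopology X S) (\<Psi> -` T \<inter> topspace (subtopology X S))" by simp
  qed
  moreover have "compactin (subtopology X S) S" using S by (simp add: compactin_subtopology)
  ultimately have comp: "compactin ?W (\<Psi> ` S)" by (rule image_compactin[rotated])
  have "?W closure_of Ms \<subseteq> \<Psi> ` S"
  proof
    fix \<mu> assume \<mu>: "\<mu> \<in> ?W closure_of Ms"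
    then have \<mu>P: "\<mu> \<in> prob_measures U" using closure_of_subset_topspace[of ?W Ms] topspace_weak_topology[of U] by blast
    interpret prob_space \<mu> using \<mu>P by (simp add: prob_measures_def)
    have sp: "space \<mu> = U" by (rule prob_measures_space[OF \<mu>P])
    note int = bounded_cont_integrable[OF \<mu>P]
    have he: "integral\<^sup>L \<mu> (h e) \<le> e" if e: "e > 0" for e
    proof -
      have "closedin ?W {\<nu> \<in> topspace ?W. integral\<^sup>L \<nu> (h e) \<in> {..e}}"
        by (rule closedin_continuous_map_preimage[OF continuous_map_integral[OF hC[OF e]]]) simp
      moreover have "Ms \<subseteq> {\<nu> \<in> topspace ?W. integral\<^sup>L \<nu> (h e) \<in> {..e}}"
        using h e Ms by (auto simp: topspace_weak_topology)
      ultimately have "?W closure_of Ms \<subseteq> {\<nu> \<in> topspace ?W. integral\<^sup>L \<nu> (h e) \<in> {..e}}"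
        by (rule closure_of_minimal[rotated])
      with \<mu> show ?thesis by auto
    qed
    \<comment> \<open>points of the product space are extensional functions, hence the restriction\<close>
    define \<Lambda> where "\<Lambda> = restrict (\<lambda>f. integral\<^sup>L \<mu> f) ?C"
    have \<Lambda>: "\<Lambda> f = integral\<^sup>L \<mu> f" if "f \<in> ?C" for f using that by (simp add: \<Lambda>_def)
    have ts: "\<Lambda> \<in> topspace X" by (simp add: X_def topspace_product_topology \<Lambda>_def)
    have "\<Lambda> \<in> P"
      unfolding P_def
    proof (rule PiE_I)
      fix f assume f: "f \<in> ?C"
      have "\<bar>integral\<^sup>L \<mu> f\<bar> \<le> integral\<^sup>L \<mu> (\<lambda>x. \<bar>f x\<bar>)" by (rule integral_abs_bound)
      also have "\<dots> \<le> integral\<^sup>L \<mu> (\<lambda>x. b f)"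
        by (rule integral_mono_AE) (use int[OF f] b f sp in auto)
      finally show "\<Lambda> f \<in> {- b f..b f}" using f by (simp add: \<Lambda> prob_space abs_le_iff)
    qed (simp add: \<Lambda>_def)
    moreover have "\<Lambda> \<in> C1" unfolding C1_def using ts int by (auto simp: \<Lambda> bounded_cont_intros)
    moreover have "\<Lambda> \<in> C2" unfolding C2_def using ts int by (auto simp: \<Lambda> bounded_cont_intros)
    moreover have "\<Lambda> \<in> C3" unfolding C3_def using ts sp by (auto simp: \<Lambda> intro!: integral_nonneg_AE)
    moreover have "\<Lambda> \<in> C4" unfolding C4_def using ts by (auto simp: \<Lambda> bounded_cont_intros prob_space)
    moreover have "\<Lambda> \<in> C5" unfolding C5_def using ts he hC by (auto simp: \<Lambda>)
    ultimately have "\<Lambda> \<in> S" by (simp add: S_def)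
    moreover have "\<Psi> \<Lambda> = \<mu>"
      by (rule prob_measures_eqI[OF U \<Psi>(1)[OF \<open>\<Lambda> \<in> S\<close>] \<mu>P]) (simp add: \<Psi>(2)[OF \<open>\<Lambda> \<in> S\<close>] \<Lambda>)
    ultimately show "\<mu> \<in> \<Psi> ` S" by blast
  qed
  then show ?thesis by (rule closed_compactin[OF comp _ closedin_closure_of])
qed

section \<open>Local flows and global attractors\<close>

locale local_flow =
  fixes U :: "'a::euclidean_space set" and V :: "'a \<Rightarrow> 'a" and I :: "'a \<Rightarrow> real set" and \<phi> :: "real \<Rightarrow> 'a \<Rightarrow> 'a"
  assumes open_U: "open U" and flow: "generates_local_flow U V I \<phi>"
begin

lemma solution: "x \<in> U \<Longrightarrow> solution_on U V x (I x) (\<lambda>t. \<phi> t x)"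
  using flow by (simp add: generates_local_flow_def)

lemma maximal: "x \<in> U \<Longrightarrow> solution_on U V x J y \<Longrightarrow> J \<subseteq> I x \<and> (\<forall>t\<in>J. y t = \<phi> t x)"
  using flow by (simp add: generates_local_flow_def)

lemma interval: "x \<in> U \<Longrightarrow> is_interval (I x)"
  and zero_in: "x \<in> U \<Longrightarrow> 0 \<in> I x"
  and flow_0: "x \<in> U \<Longrightarrow> \<phi> 0 x = x"
  and flow_in: "x \<in> U \<Longrightarrow> t \<in> I x \<Longrightarrow> \<phi> t x \<in> U"
proof -
  assume "x \<in> U"
  from solution[OF this] have *: "is_interval (I x) \<and> 0 \<in> I x \<and> \<phi> 0 x = x \<and> (\<forall>t\<in>I x. \<phi> t x \<in> U)"
    unfolding solution_on_def by blast
  show "is_interval (I x)" "0 \<in> I x" "\<phi> 0 x = x" using * by blast+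
  show "t \<in> I x \<Longrightarrow> \<phi> t x \<in> U" using * by blast
qed

definition domain :: "(real \<times> 'a) set" where
  "domain = {(t, x). x \<in> U \<and> t \<in> I x}"

lemma open_domain: "open domain"
  and continuous_on_domain: "continuous_on domain (\<lambda>(t, x). \<phi> t x)"
  using flow by (simp_all add: domain_def generates_local_flow_def)

lemma open_interval: "x \<in> U \<Longrightarrow> open (I x)"
proof -
  assume x: "x \<in> U"
  have "open ((\<lambda>t. (t, x)) -` domain)"
    by (rule open_vimage[OF open_domain]) (intro continuous_intros)
  also have "(\<lambda>t. (t, x)) -` domain = I x" using x by (auto simp: domain_def)
  finally show ?thesis .
qed

lemma flow_derivative:
  "x \<in> U \<Longrightarrow> t \<in> I x \<Longrightarrow> ((\<lambda>t. \<phi> t x) has_vector_derivative V (\<phi> t x)) (at t)"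
proof -
  assume x: "x \<in> U" and t: "t \<in> I x"
  from solution[OF x] t have "((\<lambda>t. \<phi> t x) has_vector_derivative V (\<phi> t x)) (at t within I x)"
    unfolding solution_on_def by blast
  then show ?thesis by (simp only: at_within_open[OF t open_interval[OF x]])
qed

lemma continuous_on_flow: "(\<And>x. x \<in> S \<Longrightarrow> x \<in> U \<and> t \<in> I x) \<Longrightarrow> continuous_on S (\<phi> t)"
proof -
  assume "\<And>x. x \<in> S \<Longrightarrow> x \<in> U \<and> t \<in> I x"
  then have "continuous_on S (\<lambda>x. (\<lambda>(t, x). \<phi> t x) (t, x))"
    by (intro continuous_on_compose2[OF continuous_on_domain]) (auto intro!: continuous_intros simp: domain_def)
  then show ?thesis by simp
qed

text \<open>A time shift of a solution is a solution through the shifted point, so maximality applies to it.\<close>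

lemma shift_subset:
  assumes x: "x \<in> U" and s: "s \<in> I x"
  shows "{t. t + s \<in> I x} \<subseteq> I (\<phi> s x)" "t + s \<in> I x \<Longrightarrow> \<phi> t (\<phi> s x) = \<phi> (t + s) x"
proof -
  have "solution_on U V (\<phi> s x) {t. t + s \<in> I x} (\<lambda>t. \<phi> (t + s) x)"
    unfolding solution_on_def
  proof (intro conjI ballI)
    show "is_interval {t. t + s \<in> I x}"
    proof (unfold is_interval_1, intro ballI allI impI)
      fix a b c assume "a \<in> {t. t + s \<in> I x}" "b \<in> {t. t + s \<in> I x}" "a \<le> c \<and> c \<le> b"
      then show "c \<in> {t. t + s \<in> I x}"
        using interval[OF x, unfolded is_interval_1, rule_format, of "a + s" "b + s" "c + s"] by simp
    qed
    fix t assume "t \<in> {t. t + s \<in> I x}"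
    then have t: "t + s \<in> I x" by simp
    show "\<phi> (t + s) x \<in> U" by (rule flow_in[OF x t])
    have "((\<lambda>t. t + s) has_vector_derivative 1) (at t)" by (auto intro!: derivative_eq_intros)
    from vector_diff_chain_at[OF this flow_derivative[OF x t]]
    show "((\<lambda>t. \<phi> (t + s) x) has_vector_derivative V (\<phi> (t + s) x)) (at t within {t. t + s \<in> I x})"
      by (simp add: o_def has_vector_derivative_at_within)
  qed (use s in auto)
  from maximal[OF flow_in[OF x s] this]
  show "{t. t + s \<in> I x} \<subseteq> I (\<phi> s x)" "t + s \<in> I x \<Longrightarrow> \<phi> t (\<phi> s x) = \<phi> (t + s) x" by auto
qed

lemma shift_iff:
  assumes x: "x \<in> U" and s: "s \<in> I x"
  shows "t \<in> I (\<phi> s x) \<longleftrightarrow> t + s \<in> I x"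
proof
  assume t: "t \<in> I (\<phi> s x)"
    have m: "- s \<in> I (\<phi> s x)" by (rule subsetD[OF shift_subset(1)[OF x s]]) (simp add: zero_in[OF x])
  have "\<phi> (- s) (\<phi> s x) = x" using shift_subset(2)[OF x s, of "- s"] zero_in[OF x] flow_0[OF x] by simp
  moreover have "t + s \<in> I (\<phi> (- s) (\<phi> s x))"
    by (rule subsetD[OF shift_subset(1)[OF flow_in[OF x s] m]]) (simp add: t)
  ultimately show "t + s \<in> I x" by simp
qed (use shift_subset(1)[OF x s] in auto)

lemma flow_add:
  "x \<in> U \<Longrightarrow> s \<in> I x \<Longrightarrow> t + s \<in> I x \<Longrightarrow> \<phi> t (\<phi> s x) = \<phi> (t + s) x"
  by (rule shift_subset(2))

text \<open>The open domain of the flow contains \<open>{0} \<times> K\<close>, hence a uniform neighbourhood of it: a trajectory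
  that stays in \<open>K\<close> can always be prolonged by the same amount of time.\<close>

lemma forward_complete:
  assumes x: "x \<in> U" and K: "compact K" "K \<subseteq> U" and stay: "\<And>t. t \<in> I x \<Longrightarrow> 0 \<le> t \<Longrightarrow> \<phi> t x \<in> K"
  shows "{0..} \<subseteq> I x"
proof -
  have "compact ({0::real} \<times> K)" by (intro compact_Times K) auto
  moreover have "{0} \<times> K \<subseteq> domain" using K zero_in by (auto simp: domain_def)
  ultimately obtain e where e: "e > 0" "(\<Union>z\<in>{0} \<times> K. ball z e) \<subseteq> domain"
    by (rule compact_subset_open_imp_ball_epsilon_subset[OF _ open_domain])
  have step: "e / 2 \<in> I z" if "z \<in> K" for z
  proof -
    have "(e / 2, z) \<in> ball (0, z) e" using e(1) by (simp add: dist_Pair_Pair)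
    then have "(e / 2, z) \<in> domain" using e(2) that by blast
    then show ?thesis by (simp add: domain_def)
  qed
  have n: "real n * (e / 2) \<in> I x" for n
  proof (induction n)
    case (Suc n)
    have "\<phi> (real n * (e / 2)) x \<in> K" using stay[OF Suc.IH] e(1) by simp
    from step[OF this] have "e / 2 + real n * (e / 2) \<in> I x" using shift_iff[OF x Suc.IH] by simp
    then show ?case by (simp only: of_nat_Suc distrib_right mult_1)
  qed (simp add: zero_in x)
  show ?thesis
  proof
    fix t :: real assume "t \<in> {0..}"
    obtain n where "t < real n * (e / 2)" using reals_Archimedean3[of "e / 2"] e(1) by auto
    then show "t \<in> I x"
      using interval[OF x, unfolded is_interval_1, rule_format, OF zero_in[OF x] n[of n], of t] \<open>t \<in> {0..}\<close> by simp
  qed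
qed

text \<open>Suppose the bound fails at time \<open>t\<close>.  After the last time before \<open>t\<close> at which \<open>W \<le> \<rho>\<close>, or after time
  \<open>0\<close> if there is none, \<open>W\<close> decreases with speed at least \<open>\<gamma>\<close>, by the mean value theorem.\<close>

lemma lyapunov_decay:
  fixes W :: "'a \<Rightarrow> real"
  assumes W: "\<And>x. x \<in> U \<Longrightarrow> (W has_derivative W' x) (at x)"
    and neg: "\<And>x. x \<in> U \<Longrightarrow> \<rho> < W x \<Longrightarrow> W' x (V x) \<le> - \<gamma>" and \<gamma>: "0 \<le> \<gamma>"
    and x: "x \<in> U" and t: "t \<in> I x" "0 \<le> t"
  shows "W (\<phi> t x) \<le> max \<rho> (W x - \<gamma> * t)"
proof (rule ccontr)
  assume "\<not> ?thesis"
  then have wt: "\<rho> < W (\<phi> t x)" "W x - \<gamma> * t < W (\<phi> t x)" by auto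
  let ?w = "\<lambda>s. W (\<phi> s x)"
  have sI: "s \<in> I x" if "0 \<le> s" "s \<le> t" for s
    using interval[OF x, unfolded is_interval_1, rule_format, OF zero_in[OF x] t(1), of s] that by simp
  have dw: "(?w has_real_derivative W' (\<phi> s x) (V (\<phi> s x))) (at s)" if s: "0 \<le> s" "s \<le> t" for s
  proof -
    have "((\<lambda>s. \<phi> s x) has_derivative (\<lambda>h. h *\<^sub>R V (\<phi> s x))) (at s)"
      using flow_derivative[OF x sI[OF s]] by (simp add: has_vector_derivative_def)
    note * = has_derivative_compose[OF this W[OF flow_in[OF x sI[OF s]]]]
    have "linear (W' (\<phi> s x))" using W[OF flow_in[OF x sI[OF s]]] has_derivative_linear by blast
    then have "(\<lambda>h. W' (\<phi> s x) (h *\<^sub>R V (\<phi> s x))) = (\<lambda>h. W' (\<phi> s x) (V (\<phi> s x)) * h)"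
      by (simp add: linear_cmul mult.commute)
    with * show ?thesis by (simp add: has_field_derivative_def)
  qed
  have drop: "?w b \<le> ?w a - \<gamma> * (b - a)"
    if ab: "0 \<le> a" "a \<le> b" "b \<le> t" and above: "\<And>s. a < s \<Longrightarrow> s < b \<Longrightarrow> \<rho> < ?w s" for a b
  proof (cases "a = b")
    case False
    then have "a < b" using ab by simp
    then have "\<exists>z. a < z \<and> z < b \<and> ?w b - ?w a = (b - a) * W' (\<phi> z x) (V (\<phi> z x))"
      by (rule MVT2) (use dw ab in auto)
    then obtain z where z: "a < z" "z < b" "?w b - ?w a = (b - a) * W' (\<phi> z x) (V (\<phi> z x))" by blast
    have "W' (\<phi> z x) (V (\<phi> z x)) \<le> - \<gamma>"
      using neg[OF flow_in[OF x sI] above] z ab by auto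
    then have "(b - a) * W' (\<phi> z x) (V (\<phi> z x)) \<le> (b - a) * (- \<gamma>)"
      using ab by (intro mult_left_mono) auto
    then show ?thesis using z(3) by (simp add: algebra_simps)
  qed simp
  let ?S = "{s \<in> {0..t}. ?w s \<le> \<rho>}"
  show False
  proof (cases "?S = {}")
    case True
    have "?w t \<le> ?w 0 - \<gamma> * (t - 0)"
    proof (rule drop)
      fix s assume s: "0 < s" "s < t"
      have "s \<notin> ?S" using True by blast
      then show "\<rho> < ?w s" using s by auto
    qed (use t in auto)
    then show False using wt(2) flow_0[OF x] by simp
  next
    case False
    have wc: "continuous_on {0..t} ?w"
      by (intro continuous_at_imp_continuous_on ballI DERIV_isCont[OF dw]) auto
    have "compact ?S"
    proof -
      have "closed ({0..t} \<inter> ?w -` {..\<rho>})" by (rule continuous_closed_preimage[OF wc]) auto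
      moreover have "{0..t} \<inter> ?w -` {..\<rho>} = ?S" by auto
      ultimately have "closed ?S" by simp
      moreover have "bounded ?S" by (rule bounded_subset[of "{0..t}"]) auto
      ultimately show ?thesis by (simp add: compact_eq_bounded_closed)
    qed
    then obtain s0 where s0: "s0 \<in> ?S" "\<And>s. s \<in> ?S \<Longrightarrow> s \<le> s0"
      using compact_attains_sup[OF _ False] by blast
    have "?w t \<le> ?w s0 - \<gamma> * (t - s0)"
    proof (rule drop)
      fix s assume "s0 < s" "s < t"
      then show "\<rho> < ?w s" using s0(2)[of s] s0(1) by (auto simp: not_le[symmetric])
    qed (use s0(1) in auto)
    moreover have "0 \<le> \<gamma> * (t - s0)" using s0(1) \<gamma> by simp
    ultimately show False using s0(1) wt(1) by simp
  qed
qed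

end

text \<open>The classical setting for constructing a global attractor: a forward complete flow with a compact absorbing set.\<close>

locale dissipative_flow = local_flow +
  fixes N :: "'a set"
  assumes complete: "\<And>x. x \<in> U \<Longrightarrow> {0..} \<subseteq> I x"
    and N: "compact N" "N \<subseteq> U" "N \<noteq> {}"
    and trapped: "\<And>t x. 0 \<le> t \<Longrightarrow> x \<in> N \<Longrightarrow> \<phi> t x \<in> N"
    and absorbing: "\<And>K. compact K \<Longrightarrow> K \<subseteq> U \<Longrightarrow> \<exists>T\<ge>0. \<forall>t\<ge>T. \<phi> t ` K \<subseteq> N"
begin

lemma time_in: "x \<in> U \<Longrightarrow> 0 \<le> t \<Longrightarrow> t \<in> I x"
  using complete by auto

text \<open>The intersection of the decreasing compact sets \<open>\<phi> t ` N\<close>; it turns out to be the global attractor.\<close>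

definition core :: "'a set" where
  "core = (\<Inter>t\<in>{0..}. \<phi> t ` N)"

lemma semigroup: "x \<in> U \<Longrightarrow> 0 \<le> s \<Longrightarrow> 0 \<le> t \<Longrightarrow> \<phi> t (\<phi> s x) = \<phi> (t + s) x"
  by (intro flow_add time_in) auto

lemma image_antimono: "0 \<le> s \<Longrightarrow> s \<le> t \<Longrightarrow> \<phi> t ` N \<subseteq> \<phi> s ` N"
proof
  fix y assume st: "0 \<le> s" "s \<le> t" and "y \<in> \<phi> t ` N"
  then obtain x where x: "x \<in> N" "y = \<phi> t x" by blast
  have "y = \<phi> s (\<phi> (t - s) x)" using semigroup[of x "t - s" s] x N(2) st by auto
  moreover have "\<phi> (t - s) x \<in> N" using trapped st x by simp
  ultimately show "y \<in> \<phi> s ` N" by blast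
qed

lemma compact_image: "0 \<le> t \<Longrightarrow> compact (\<phi> t ` N)"
  by (intro compact_continuous_image continuous_on_flow N) (use N(2) time_in in auto)

lemma core_eq_nat: "core = (\<Inter>n::nat. \<phi> (real n) ` N)"
proof
  show "(\<Inter>n::nat. \<phi> (real n) ` N) \<subseteq> core"
    unfolding core_def
  proof (rule INT_greatest)
    fix t :: real assume "t \<in> {0..}"
    then show "(\<Inter>n::nat. \<phi> (real n) ` N) \<subseteq> \<phi> t ` N"
      using image_antimono[of t "real (nat \<lceil>t\<rceil>)"] real_nat_ceiling_ge[of t] by fastforce
  qed
qed (auto simp: core_def)

lemma core_subset: "core \<subseteq> N"
proof -
  have "core \<subseteq> \<phi> 0 ` N" by (auto simp: core_def)
  also have "\<dots> = N" using flow_0 N(2) by force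
  finally show ?thesis .
qed

lemma compact_core: "compact core"
proof -
  have "closed core"
    unfolding core_def by (intro closed_INT ballI compact_imp_closed compact_image) simp
  then have "compact (N \<inter> core)" by (rule compact_Int_closed[OF N(1)])
  moreover have "N \<inter> core = core" using core_subset by blast
  ultimately show ?thesis by simp
qed

lemma core_nonempty: "core \<noteq> {}"
  unfolding core_eq_nat
proof (rule compact_nest)
  show "compact (\<phi> (real n) ` N)" for n :: nat by (rule compact_image) simp
  show "\<phi> (real n) ` N \<noteq> {}" for n :: nat using N(3) by simp
  show "\<phi> (real n) ` N \<subseteq> \<phi> (real m) ` N" if "m \<le> n" for m n :: nat
    using that by (intro image_antimono) auto
qed

text \<open>A point of the core is reached from \<open>N\<close> after an arbitrarily long time, so its solution extends
  arbitrarily far into the past.\<close>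

lemma core_full_orbits: "x \<in> core \<Longrightarrow> I x = UNIV"
proof -
  assume x: "x \<in> core"
  have "t \<in> I x" for t
  proof (cases "0 \<le> t")
    case True then show ?thesis using x core_subset N(2) time_in by blast
  next
    case False
    then have "x \<in> \<phi> (- t) ` N" using x by (auto simp: core_def)
    then obtain y where y: "y \<in> N" "x = \<phi> (- t) y" by blast
    have "- t \<in> I y" "y \<in> U" using y False N(2) time_in by auto
    then show ?thesis using shift_iff[of y "- t" t] y zero_in by simp
  qed
  then show ?thesis by blast
qed

lemma core_forward: "0 \<le> t \<Longrightarrow> x \<in> core \<Longrightarrow> \<phi> t x \<in> core"
  unfolding core_def
proof (rule INT_I)
  fix s :: real assume t: "0 \<le> t" and s: "s \<in> {0..}" and x: "x \<in> (\<Inter>t\<in>{0..}. \<phi> t ` N)"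
  obtain y where y: "y \<in> N" "x = \<phi> s y" using x s by blast
  have "\<phi> t x = \<phi> s (\<phi> t y)"
    using semigroup[of y s t] semigroup[of y t s] y N(2) s t by (auto simp: add.commute)
  then show "\<phi> t x \<in> \<phi> s ` N" using trapped[OF t y(1)] by blast
qed

lemma core_backward:
  assumes t: "0 \<le> t" and x: "x \<in> core"
  shows "\<phi> (- t) x \<in> core" "\<phi> t (\<phi> (- t) x) = x"
proof -
  have xU: "x \<in> U" using x core_subset N(2) by blast
  show "\<phi> t (\<phi> (- t) x) = x"
    using flow_add[OF xU, of "- t" t] core_full_orbits[OF x] flow_0[OF xU] by simp
  show "\<phi> (- t) x \<in> core"
    unfolding core_def
  proof (rule INT_I)
    fix s :: real assume s: "s \<in> {0..}"
    have "x \<in> \<phi> (t + s) ` N" using x s t by (auto simp: core_def)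
    then obtain y where y: "y \<in> N" "x = \<phi> (t + s) y" by blast
    have yU: "y \<in> U" using y N(2) by blast
    have "\<phi> (- t) x = \<phi> s y"
      using flow_add[OF yU, of "t + s" "- t"] time_in[OF yU] s t y(2) by simp
    then show "\<phi> (- t) x \<in> \<phi> s ` N" using y by blast
  qed
qed

lemma core_invariant: "invariant_set I \<phi> core"
  unfolding invariant_set_def
proof (intro conjI ballI allI)
  show "I x = UNIV" if "x \<in> core" for x using core_full_orbits[OF that] .
  fix t :: real
  show "\<phi> t ` core = core"
  proof (cases "0 \<le> t")
    case True
    show ?thesis
    proof
      show "core \<subseteq> \<phi> t ` core"
      proof
        fix x assume "x \<in> core"
        from core_backward[OF True this] show "x \<in> \<phi> t ` core" by force
      qed
    qed (use core_forward True in auto)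
  next
    case False
    then have m: "0 \<le> - t" by simp
    show ?thesis
    proof
      show "\<phi> t ` core \<subseteq> core" using core_backward(1)[OF m] by auto
      show "core \<subseteq> \<phi> t ` core"
      proof
        fix x assume x: "x \<in> core"
        then have xU: "x \<in> U" using core_subset N(2) by blast
        have "\<phi> t (\<phi> (- t) x) = x"
          using flow_add[OF xU, of "- t" t] core_full_orbits[OF x] flow_0[OF xU] by simp
        then show "x \<in> \<phi> t ` core" using core_forward[OF m x] by force
      qed
    qed
  qed
qed

text \<open>Otherwise the sets \<open>\<phi> n ` N\<close>, intersected with the complement of a neighbourhood of the core, would be a
  decreasing sequence of nonempty compact sets with empty intersection.\<close>

lemma eventually_near_core:
  assumes e: "e > 0" shows "\<exists>n::nat. \<forall>x\<in>\<phi> (real n) ` N. infdist x core < e"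
proof (rule ccontr)
  assume "\<not> ?thesis"
  then have ne: "\<phi> (real n) ` N \<inter> {x. e \<le> infdist x core} \<noteq> {}" for n :: nat
    by (force simp: not_less)
  have cl: "closed {x. e \<le> infdist x core}"
    by (intro closed_Collect_le continuous_intros)
  have "(\<Inter>n::nat. \<phi> (real n) ` N \<inter> {x. e \<le> infdist x core}) \<noteq> {}"
  proof (rule compact_nest)
    show "compact (\<phi> (real n) ` N \<inter> {x. e \<le> infdist x core})" for n :: nat
      by (intro compact_Int_closed compact_image cl) simp
    show "\<phi> (real n) ` N \<inter> {x. e \<le> infdist x core} \<subseteq> \<phi> (real m) ` N \<inter> {x. e \<le> infdist x core}"
      if "m \<le> n" for m n :: nat
      using image_antimono[of "real m" "real n"] that by auto
  qed (rule ne)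
  then obtain x where "x \<in> core" "e \<le> infdist x core" unfolding core_eq_nat by auto
  then show False using e by simp
qed

lemma core_attracts:
  assumes K: "compact (closure K)" "closure K \<subseteq> U"
  shows "((\<lambda>t. hausdorff_semidist (\<phi> t ` K) core) \<longlongrightarrow> 0) at_top"
proof (rule order_tendstoI)
  fix a :: ennreal assume "0 < a"
  then obtain z where z: "0 < z" "z < a" using dense by blast
  then obtain e where e: "z = ennreal e" "e > 0"
  proof (cases z)
    case (real r)
    then show ?thesis using z(1) that[of r] by simp
  next
    case top
    then show ?thesis using z(2) by (simp add: top.extremum_strict)
  qed
  obtain T where T: "T \<ge> 0" "\<And>t. t \<ge> T \<Longrightarrow> \<phi> t ` closure K \<subseteq> N" using absorbing[OF K] by blast
  obtain n :: nat where n: "\<And>x. x \<in> \<phi> (real n) ` N \<Longrightarrow> infdist x core < e" using eventually_near_core[OF e(2)] by blast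
  show "\<forall>\<^sub>F t in at_top. hausdorff_semidist (\<phi> t ` K) core < a"
    unfolding eventually_at_top_linorder
  proof (intro exI[of _ "T + real n"] allI impI)
    fix t assume t: "T + real n \<le> t"
    have "hausdorff_semidist (\<phi> t ` K) core \<le> ennreal e"
      unfolding hausdorff_semidist_def
    proof (rule SUP_least)
      fix y assume "y \<in> \<phi> t ` K"
      then obtain x where x: "x \<in> closure K" "y = \<phi> t x" using closure_subset[of K] by blast
      have "y = \<phi> (real n) (\<phi> (t - real n) x)"
        using semigroup[of x "t - real n" "real n"] x K(2) t T(1) by auto
      moreover have "\<phi> (t - real n) x \<in> N" using T(2)[of "t - real n"] t x(1) by auto
      ultimately have "infdist y core < e" using n by blast
      then show "ennreal (infdist y core) \<le> ennreal e" by (intro ennreal_leI) simp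
    qed
    then show "hausdorff_semidist (\<phi> t ` K) core < a" using z(2) e(1) by (metis le_less_trans)
  qed
qed simp

lemma core_is_global_attractor: "is_global_attractor U I \<phi> core"
  unfolding is_global_attractor_def
proof (intro conjI ballI allI impI)
  show "core \<subseteq> U" using core_subset N(2) by blast
  show "((\<lambda>t. hausdorff_semidist (\<phi> t ` K) core) \<longlongrightarrow> 0) at_top"
    if "compact (closure K) \<and> closure K \<subseteq> U" for K
    using that core_attracts by blast
qed (use complete in \<open>auto simp: core_nonempty compact_core core_invariant\<close>)

end

text \<open>An attractor attracts every other one, and an invariant set that is attracted to a closed set is contained in it.\<close>

lemma global_attractor_subset:
  assumes 1: "is_global_attractor U I \<phi> J1" and 2: "is_global_attractor U I \<phi> J2"
  shows "J1 \<subseteq> J2"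
proof
  fix x assume x: "x \<in> J1"
  have J1: "compact J1" "J1 \<subseteq> U" "\<And>t. \<phi> t ` J1 = J1" using 1 by (auto simp: is_global_attractor_def invariant_set_def)
  have J2: "compact J2" "J2 \<noteq> {}" using 2 by (auto simp: is_global_attractor_def)
  have "closure J1 = J1" using J1(1) by (simp add: closure_closed compact_imp_closed)
  then have "((\<lambda>t. hausdorff_semidist (\<phi> t ` J1) J2) \<longlongrightarrow> 0) at_top"
    using 2 J1(1,2) unfolding is_global_attractor_def by metis
  then have "((\<lambda>t::real. hausdorff_semidist J1 J2) \<longlongrightarrow> 0) at_top" by (simp add: J1(3))
  then have "hausdorff_semidist J1 J2 = 0" by (simp add: tendsto_const_iff)
  moreover have "ennreal (infdist x J2) \<le> hausdorff_semidist J1 J2"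
    unfolding hausdorff_semidist_def by (rule SUP_upper[OF x])
  ultimately have "infdist x J2 = 0" using infdist_nonneg[of x J2] by (simp add: ennreal_eq_0_iff)
  then show "x \<in> J2" using in_closed_iff_infdist_zero[OF compact_imp_closed[OF J2(1)] J2(2)] by simp
qed

lemma global_attractor_eq:
  assumes "is_global_attractor U I \<phi> J"
  shows "\<exists>!J. is_global_attractor U I \<phi> J" "global_attractor U I \<phi> = J"
proof -
  have u: "J' = J" if "is_global_attractor U I \<phi> J'" for J'
    using global_attractor_subset[OF that assms] global_attractor_subset[OF assms that] by blast
  show "\<exists>!J. is_global_attractor U I \<phi> J" proof (rule ex1I)
    show "J' = J" if "is_global_attractor U I \<phi> J'" for J' using that by (rule u)
  qed (rule assms)
  show "global_attractor U I \<phi> = J"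
    unfolding global_attractor_def
  proof (rule the_equality)
    show "J' = J" if "is_global_attractor U I \<phi> J'" for J' using that by (rule u)
  qed (rule assms)
qed

section \<open>Invariance by Euler polygons\<close>

text \<open>Bounds and moduli that hold on the whole space, as a cut-off field provides them, so
  that estimates along Euler polygons need no localisation.\<close>

locale bounded_field =
  fixes V :: "'a::euclidean_space \<Rightarrow> 'a" and DV :: "'a \<Rightarrow> 'a \<Rightarrow>\<^sub>L 'a" and S C :: real
  assumes V_deriv: "\<And>x. (V has_derivative blinfun_apply (DV x)) (at x)"
    and V_bound: "\<And>x. norm (V x) \<le> S" and DV_bound: "\<And>x. norm (DV x) \<le> C"
    and DV_uniform: "uniformly_continuous_on UNIV DV"
begin

lemma S_nonneg: "0 \<le> S" and C_nonneg: "0 \<le> C"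
  using V_bound[of 0] DV_bound[of 0] norm_ge_zero[of "V 0"] norm_ge_zero[of "DV 0"] by linarith+

lemma V_lipschitz: "norm (V x - V y) \<le> C * norm (x - y)"
  by (rule differentiable_bound[of UNIV V "\<lambda>x. blinfun_apply (DV x)"])
     (use V_deriv DV_bound in \<open>auto simp: norm_blinfun.rep_eq[symmetric]\<close>)

definition euler :: "real \<Rightarrow> 'a \<Rightarrow> 'a" where
  "euler h x = x + h *\<^sub>R V x"

primrec euler_iter :: "real \<Rightarrow> nat \<Rightarrow> 'a \<Rightarrow> 'a" where
  "euler_iter h 0 x = x"
| "euler_iter h (Suc k) x = euler h (euler_iter h k x)"

text \<open>The derivative of the iterated Euler map, by the chain rule.\<close>

primrec euler_jac :: "real \<Rightarrow> nat \<Rightarrow> 'a \<Rightarrow> 'a \<Rightarrow>\<^sub>L 'a" where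
  "euler_jac h 0 x = id_blinfun"
| "euler_jac h (Suc k) x = (id_blinfun + h *\<^sub>R DV (euler_iter h k x)) o\<^sub>L euler_jac h k x"

text \<open>Splitting off the first step rather than the last writes \<open>f\<close> after \<open>k + 1\<close> steps as a fixed
  function, \<open>f\<close> after \<open>k\<close> steps, evaluated at one Euler step.\<close>

lemma euler_iter_shift: "euler_iter h (Suc k) x = euler_iter h k (euler h x)"
  by (induction k) auto

lemma euler_iter_deriv: "(euler_iter h k has_derivative blinfun_apply (euler_jac h k x)) (at x)"
proof (induction k)
  case 0
  then show ?case by (simp add: id_blinfun.rep_eq)
next
  case (Suc k)
  have "(euler h has_derivative (\<lambda>v. v + h *\<^sub>R blinfun_apply (DV z) v)) (at z)" for z
    unfolding euler_def[abs_def] by (auto intro!: derivative_eq_intros V_deriv)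
  from has_derivative_compose[OF Suc.IH this]
  show ?case
    by (simp add: blinfun.add_left blinfun.scaleR_left id_blinfun.rep_eq)
qed

lemma norm_step: "0 \<le> h \<Longrightarrow> norm (id_blinfun + h *\<^sub>R DV z) \<le> 1 + h * C"
proof -
  assume h: "0 \<le> h"
  have "norm (id_blinfun + h *\<^sub>R DV z) \<le> norm (id_blinfun :: 'a \<Rightarrow>\<^sub>L 'a) + norm (h *\<^sub>R DV z)"
    by (rule norm_triangle_ineq)
  also have "\<dots> \<le> 1 + h * C"
    using h DV_bound[of z] by (intro add_mono) (auto simp: norm_blinfun_id_le mult_left_mono)
  finally show ?thesis .
qed

lemma norm_euler_jac: "0 \<le> h \<Longrightarrow> norm (euler_jac h k x) \<le> (1 + h * C) ^ k"
proof (induction k)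
  case 0
  then show ?case by (simp add: norm_blinfun_id_le)
next
  case (Suc k)
  have "norm (euler_jac h (Suc k) x) \<le> norm (id_blinfun + h *\<^sub>R DV (euler_iter h k x)) * norm (euler_jac h k x)"
    by (simp add: norm_blinfun_compose)
  also have "\<dots> \<le> (1 + h * C) * (1 + h * C) ^ k"
    using Suc C_nonneg by (intro mult_mono norm_step) auto
  finally show ?case by simp
qed

lemma power_le_exp:
  assumes "0 \<le> h" "real k * h \<le> t"
  shows "(1 + h * C) ^ k \<le> exp (t * C)"
proof -
  have "(1 + h * C) ^ k \<le> exp (h * C) ^ k"
    using assms C_nonneg by (intro power_mono exp_ge_add_one_self) auto
  also have "\<dots> = exp (real k * (h * C))" by (simp add: exp_of_nat_mult[symmetric])
  also have "\<dots> \<le> exp (t * C)"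
    using mult_right_mono[OF assms(2) C_nonneg] by (simp add: mult.assoc)
  finally show ?thesis .
qed

lemma euler_iter_lipschitz:
  "0 \<le> h \<Longrightarrow> norm (euler_iter h k x - euler_iter h k y) \<le> (1 + h * C) ^ k * norm (x - y)"
proof (induction k)
  case (Suc k)
  let ?x = "euler_iter h k x" and ?y = "euler_iter h k y"
  have "norm (euler h ?x - euler h ?y) = norm ((?x - ?y) + h *\<^sub>R (V ?x - V ?y))"
    by (simp add: euler_def algebra_simps)
  also have "\<dots> \<le> norm (?x - ?y) + norm (h *\<^sub>R (V ?x - V ?y))" by (rule norm_triangle_ineq)
  also have "\<dots> \<le> norm (?x - ?y) + h * (C * norm (?x - ?y))"
    using Suc.prems V_lipschitz[of ?x ?y] by (simp add: mult_left_mono)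
  also have "\<dots> = (1 + h * C) * norm (?x - ?y)" by (simp add: algebra_simps)
  also have "\<dots> \<le> (1 + h * C) * ((1 + h * C) ^ k * norm (x - y))"
    using Suc C_nonneg by (intro mult_left_mono) auto
  finally show ?case by simp
qed simp

text \<open>A modulus of continuity that is uniform in the number of steps: with it, the remainders of \<open>n\<close> Euler
  steps of length \<open>t/n\<close> add up to a small quantity.  The difference of two products is telescoped, and the factors
  are bounded by \<open>exp (t C)\<close>.\<close>

lemma euler_jac_equicontinuous:
  assumes t: "0 \<le> t" and \<eta>: "\<eta> > 0"
  shows "\<exists>\<delta>>0. \<forall>h k x y. 0 \<le> h \<longrightarrow> real k * h \<le> t \<longrightarrow> norm (x - y) \<le> \<delta> \<longrightarrow>
    norm (euler_jac h k x - euler_jac h k y) \<le> \<eta>"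
proof -
  define M where "M = exp (t * C)"
  have M: "M > 0" by (simp add: M_def)
  define \<eta>0 where "\<eta>0 = \<eta> / (t * M * M + 1)"
  have q: "t * M * M + 1 > 0" using t M by (simp add: add_nonneg_pos)
  have \<eta>0: "\<eta>0 > 0" "t * \<eta>0 * M * M \<le> \<eta>"
    using \<eta> q by (auto simp: \<eta>0_def field_simps)
  obtain \<delta>0 where \<delta>0: "\<delta>0 > 0" "\<And>x y. norm (x - y) < \<delta>0 \<Longrightarrow> norm (DV x - DV y) < \<eta>0"
    using DV_uniform[unfolded uniformly_continuous_on_def, rule_format, OF \<eta>0(1)] by (auto simp: dist_norm)
  have main: "norm (euler_jac h k x - euler_jac h k y) \<le> (real k * h * \<eta>0 * M) * (1 + h * C) ^ k"
    if h: "0 \<le> h" and k: "real k * h \<le> t" and xy: "norm (x - y) \<le> \<delta>0 / (2 * M)" for h k x y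
    using k
  proof (induction k)
    case (Suc k)
    have kt: "real k * h \<le> t" using Suc.prems h by (simp add: algebra_simps)
    note pe = power_le_exp[OF h kt, folded M_def]
    let ?Dx = "DV (euler_iter h k x)" and ?Dy = "DV (euler_iter h k y)"
    let ?Px = "euler_jac h k x" and ?Py = "euler_jac h k y"
    have "norm (euler_iter h k x - euler_iter h k y) \<le> M * (\<delta>0 / (2 * M))"
      using euler_iter_lipschitz[OF h, of k x y] mult_mono[OF pe xy] M by simp
    also have "\<dots> < \<delta>0" using \<delta>0(1) M by simp
    finally have D: "norm (?Dx - ?Dy) \<le> \<eta>0" using \<delta>0(2) by (simp add: less_imp_le)
    have "euler_jac h (Suc k) x - euler_jac h (Suc k) y =
        ((id_blinfun + h *\<^sub>R ?Dx) o\<^sub>L (?Px - ?Py)) + h *\<^sub>R ((?Dx - ?Dy) o\<^sub>L ?Py)"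
      by (rule blinfun_eqI) (simp add: blinfun.add_left blinfun.diff_left blinfun.scaleR_left blinfun.diff_right algebra_simps)
    then have "norm (euler_jac h (Suc k) x - euler_jac h (Suc k) y) \<le>
        norm ((id_blinfun + h *\<^sub>R ?Dx) o\<^sub>L (?Px - ?Py)) + norm (h *\<^sub>R ((?Dx - ?Dy) o\<^sub>L ?Py))"
      by (metis norm_triangle_ineq)
    also have "norm ((id_blinfun + h *\<^sub>R ?Dx) o\<^sub>L (?Px - ?Py)) \<le>
        (1 + h * C) * ((real k * h * \<eta>0 * M) * (1 + h * C) ^ k)"
    proof -
      have "norm ((id_blinfun + h *\<^sub>R ?Dx) o\<^sub>L (?Px - ?Py)) \<le> norm (id_blinfun + h *\<^sub>R ?Dx) * norm (?Px - ?Py)"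
        by (rule norm_blinfun_compose)
      also have "\<dots> \<le> (1 + h * C) * ((real k * h * \<eta>0 * M) * (1 + h * C) ^ k)"
        using h C_nonneg by (intro mult_mono norm_step Suc.IH kt) auto
      finally show ?thesis .
    qed
    also have "norm (h *\<^sub>R ((?Dx - ?Dy) o\<^sub>L ?Py)) \<le> (h * \<eta>0 * M) * 1"
    proof -
      have "norm ((?Dx - ?Dy) o\<^sub>L ?Py) \<le> norm (?Dx - ?Dy) * norm ?Py" by (rule norm_blinfun_compose)
      also have "\<dots> \<le> \<eta>0 * M"
        using D order_trans[OF norm_euler_jac[OF h] pe] \<eta>0(1) by (intro mult_mono) auto
      finally show ?thesis using h by (simp add: mult_left_mono mult.assoc)
    qed
    also have "(h * \<eta>0 * M) * 1 \<le> (h * \<eta>0 * M) * (1 + h * C) ^ Suc k"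
      using h \<eta>0(1) M C_nonneg by (intro mult_left_mono one_le_power) auto
    finally show ?case by (simp add: algebra_simps)
  qed simp
  show ?thesis
  proof (intro exI[of _ "\<delta>0 / (2 * M)"] conjI allI impI)
    fix h k and x y :: 'a assume h: "0 \<le> h" and k: "real k * h \<le> t" and xy: "norm (x - y) \<le> \<delta>0 / (2 * M)"
    have "(real k * h * \<eta>0 * M) * (1 + h * C) ^ k \<le> (t * \<eta>0 * M) * M"
      using k h \<eta>0(1) M t power_le_exp[OF h k, folded M_def] C_nonneg
      by (intro mult_mono) auto
    then show "norm (euler_jac h k x - euler_jac h k y) \<le> \<eta>"
      using main[OF h k xy] \<eta>0(2) by linarith
  qed (use \<delta>0 M in auto)
qed

lemma euler_local_error:
  assumes y: "\<And>s. s \<in> {0..t} \<Longrightarrow> (y has_vector_derivative V (y s)) (at s within {0..t})"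
    and a: "0 \<le> a" "a + h \<le> t" "0 \<le> h"
  shows "norm (y (a + h) - euler h (y a)) \<le> h * (C * (S * h))"
proof -
  have d: "(y has_derivative (\<lambda>r. r *\<^sub>R V (y s))) (at s within {a..a+h})" if "s \<in> {a..a+h}" for s
    using has_vector_derivative_within_subset[OF y[of s], of "{a..a+h}"] that a
    by (auto simp: has_vector_derivative_def)
  have on: "onorm (\<lambda>r::real. r *\<^sub>R v) = norm v" for v :: 'a
    using onorm_scaleR_left[OF bounded_linear_ident, of v] by (simp add: onorm_id)
  have ys: "norm (y s - y a) \<le> S * norm (s - a)" if "s \<in> {a..a+h}" for s
    by (rule differentiable_bound[OF _ d]) (use that a V_bound on in auto)
  have "norm (y (a + h) - y a - (a + h - a) *\<^sub>R V (y a)) \<le> norm (a + h - a) * (C * (S * h))"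
  proof (rule differentiable_bound_linearization[OF _ d])
    show "a + s *\<^sub>R (a + h - a) \<in> {a..a+h}" if "s \<in> {0..1}" for s
      using that a by (auto simp: mult_left_le_one_le)
    show "onorm ((\<lambda>r. r *\<^sub>R V (y s)) - (\<lambda>r. r *\<^sub>R V (y a))) \<le> C * (S * h)" if s: "s \<in> {a..a+h}" for s
    proof -
      have "(\<lambda>r. r *\<^sub>R V (y s)) - (\<lambda>r. r *\<^sub>R V (y a)) = (\<lambda>r. r *\<^sub>R (V (y s) - V (y a)))"
        by (auto simp: fun_eq_iff algebra_simps)
      then have "onorm ((\<lambda>r. r *\<^sub>R V (y s)) - (\<lambda>r. r *\<^sub>R V (y a))) = norm (V (y s) - V (y a))" by (simp add: on)
      also have "\<dots> \<le> C * norm (y s - y a)" by (rule V_lipschitz)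
      also have "\<dots> \<le> C * (S * h)"
      proof -
        have "S * norm (s - a) \<le> S * h" using s S_nonneg by (intro mult_left_mono) auto
        then show ?thesis using ys[OF s] C_nonneg by (intro mult_left_mono) auto
      qed
      finally show ?thesis .
    qed
    show "a \<in> {a..a+h}" using a by simp
  qed
  then show ?thesis using a by (simp add: euler_def algebra_simps)
qed

text \<open>The standard stability argument: local errors of order \<open>h\<^sup>2\<close>, propagated by a Lipschitz map.\<close>

lemma euler_converges:
  assumes y: "\<And>s. s \<in> {0..t} \<Longrightarrow> (y has_vector_derivative V (y s)) (at s within {0..t})"
    and t: "0 \<le> t"
  shows "(\<lambda>n. euler_iter (t / real (Suc n)) (Suc n) (y 0)) \<longlonglongrightarrow> y t"
proof -
  have err: "norm (y (real k * h) - euler_iter h k (y 0)) \<le> (real k * h * (C * (S * h))) * (1 + h * C) ^ k"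
    if h: "0 \<le> h" and k: "real k * h \<le> t" for h k
    using k
  proof (induction k)
    case (Suc k)
    have kt: "real k * h \<le> t" using Suc.prems h by (simp add: algebra_simps)
    let ?a = "real k * h" and ?z = "euler_iter h k (y 0)"
    have "y (?a + h) - euler h ?z = (y (?a + h) - euler h (y ?a)) + (euler h (y ?a) - euler h ?z)" by simp
    then have "norm (y (?a + h) - euler h ?z) \<le> norm (y (?a + h) - euler h (y ?a)) + norm (euler h (y ?a) - euler h ?z)"
      by (metis norm_triangle_ineq)
    also have "norm (euler h (y ?a) - euler h ?z) \<le> (1 + h * C) * norm (y ?a - ?z)"
      using euler_iter_lipschitz[OF h, of 1 "y ?a" ?z] by simp
    also have "\<dots> \<le> (1 + h * C) * ((real k * h * (C * (S * h))) * (1 + h * C) ^ k)"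
      using h C_nonneg by (intro mult_left_mono Suc.IH kt) auto
    also have "norm (y (?a + h) - euler h (y ?a)) \<le> h * (C * (S * h)) * 1"
      using euler_local_error[OF y, of ?a h] Suc.prems h by (simp add: algebra_simps)
    also have "\<dots> \<le> h * (C * (S * h)) * (1 + h * C) ^ Suc k"
      using h C_nonneg S_nonneg by (intro mult_left_mono one_le_power) auto
    finally show ?case by (simp add: algebra_simps)
  qed simp
  have "(\<lambda>n. y t - euler_iter (t / real (Suc n)) (Suc n) (y 0)) \<longlonglongrightarrow> 0"
  proof (rule Lim_null_comparison)
    show "\<forall>\<^sub>F n in sequentially. norm (y t - euler_iter (t / real (Suc n)) (Suc n) (y 0)) \<le>
        (t * (C * S) * t * exp (t * C)) * inverse (real (Suc n))"
    proof (rule always_eventually, rule allI)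
      fix n
      let ?h = "t / real (Suc n)"
      have h: "0 \<le> ?h" "real (Suc n) * ?h = t" using t by auto
      have "norm (y t - euler_iter ?h (Suc n) (y 0)) \<le> (t * (C * (S * ?h))) * (1 + ?h * C) ^ Suc n"
        using err[OF h(1), of "Suc n"] h(2) by (simp del: of_nat_Suc euler_iter.simps)
      also have "\<dots> \<le> (t * (C * (S * ?h))) * exp (t * C)"
        using t C_nonneg S_nonneg h by (intro mult_left_mono power_le_exp) auto
      finally show "norm (y t - euler_iter ?h (Suc n) (y 0)) \<le> (t * (C * S) * t * exp (t * C)) * inverse (real (Suc n))"
        by (simp add: divide_inverse algebra_simps)
    qed
    show "(\<lambda>n. (t * (C * S) * t * exp (t * C)) * inverse (real (Suc n))) \<longlonglongrightarrow> 0"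
      using tendsto_mult[OF tendsto_const LIMSEQ_inverse_real_of_nat] by simp
  qed
  then show ?thesis using tendsto_diff[OF tendsto_const, of _ 0 sequentially "y t"] by force
qed

text \<open>For \<open>g = f \<circ> euler_iter h k\<close>, an Euler step changes \<open>\<integral>g d\<mu>\<close> by \<open>h \<integral>Dg(V) d\<mu>\<close>, which vanishes, up to
  a remainder that is \<open>o(h)\<close> uniformly in \<open>k\<close>.  The total over \<open>n\<close> steps of length \<open>t/n\<close> tends to zero.\<close>

lemma euler_integral_converges:
  fixes f :: "'a \<Rightarrow> real" and Df :: "'a \<Rightarrow> 'a \<Rightarrow>\<^sub>L real"
  assumes f: "\<And>x. (f has_derivative blinfun_apply (Df x)) (at x)" "\<And>x. \<bar>f x\<bar> \<le> F" "\<And>x. norm (Df x) \<le> L"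
    "uniformly_continuous_on UNIV Df"
    and \<mu>: "\<mu> \<in> prob_measures U"
    and inv: "\<And>(g :: 'a \<Rightarrow> real) Dg. (\<And>x. (g has_derivative blinfun_apply (Dg x)) (at x)) \<Longrightarrow> continuous_on UNIV Dg \<Longrightarrow>
       integral\<^sup>L \<mu> (\<lambda>x. blinfun_apply (Dg x) (V x)) = 0"
    and t: "0 \<le> t"
  shows "(\<lambda>n. integral\<^sup>L \<mu> (\<lambda>x. f (euler_iter (t / real (Suc n)) (Suc n) x))) \<longlonglongrightarrow> integral\<^sup>L \<mu> f"
proof -
  interpret prob_space \<mu> using \<mu> by (simp add: prob_measures_def)
  have sp: "space \<mu> = U" by (rule prob_measures_space[OF \<mu>])
  have L0: "L \<ge> 0" using f(3)[of 0] norm_ge_zero order_trans by blast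
  have Vc: "continuous_on A V" for A
    using V_deriv by (intro continuous_at_imp_continuous_on) (auto intro: has_derivative_continuous)
  have DVc: "continuous_on A DV" for A
    using uniformly_continuous_imp_continuous[OF DV_uniform] continuous_on_subset by blast
  have Dfc: "continuous_on A Df" for A
    using uniformly_continuous_imp_continuous[OF f(4)] continuous_on_subset by blast
  have Ec: "continuous_on A (euler_iter h k)" for A h k
    using euler_iter_deriv by (intro continuous_at_imp_continuous_on) (auto intro: has_derivative_continuous)
  have Jc: "continuous_on A (euler_jac h k)" for A h k
    by (induction k) (auto intro!: continuous_intros continuous_on_compose2[OF DVc[of UNIV] Ec]
      bounded_bilinear.continuous_on[OF bounded_bilinear_blinfun_compose])
  have fc: "continuous_on A f" for A
    using f(1) by (intro continuous_at_imp_continuous_on) (auto intro: has_derivative_continuous)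
  define g where "g h k x = f (euler_iter h k x)" for h k x
  define Dg where "Dg h k x = Df (euler_iter h k x) o\<^sub>L euler_jac h k x" for h k x
  have gd: "(g h k has_derivative blinfun_apply (Dg h k x)) (at x)" for h k x
    using has_derivative_compose[OF euler_iter_deriv f(1), of h k x]
    by (simp add: g_def[abs_def] Dg_def blinfun_compose.rep_eq o_def)
  have Dgc: "continuous_on A (Dg h k)" for A h k
    unfolding Dg_def[abs_def]
    by (intro bounded_bilinear.continuous_on[OF bounded_bilinear_blinfun_compose] Jc
        continuous_on_compose2[OF Dfc[of UNIV] Ec]) auto
  have gi: "integrable \<mu> (g h k)" for h k
    by (rule bounded_cont_integrable[OF \<mu>], rule bounded_contI)
       (use f(2) in \<open>auto simp: g_def intro!: continuous_on_compose2[OF fc[of UNIV] Ec]\<close>)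
  \<comment> \<open>one modulus of continuity serves all numbers of steps, so that the remainders add up to a small total\<close>
  have unif: "\<exists>\<delta>>0. \<forall>h k x y. 0 \<le> h \<longrightarrow> real k * h \<le> t \<longrightarrow> norm (x - y) \<le> \<delta> \<longrightarrow> norm (Dg h k x - Dg h k y) \<le> \<eta>"
    if \<eta>: "\<eta> > 0" for \<eta>
  proof -
    define M where "M = exp (t * C)"
    have M: "M > 0" by (simp add: M_def)
    obtain d1 where d1: "d1 > 0" "\<And>x y. norm (x - y) < d1 \<Longrightarrow> norm (Df x - Df y) < \<eta> / (2 * M)"
      using f(4)[unfolded uniformly_continuous_on_def, rule_format, of "\<eta> / (2 * M)"] \<eta> M by (auto simp: dist_norm)
    obtain d2 where d2: "d2 > 0" "\<And>h k x y. 0 \<le> h \<Longrightarrow> real k * h \<le> t \<Longrightarrow> norm (x - y) \<le> d2 \<Longrightarrow>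
        norm (euler_jac h k x - euler_jac h k y) \<le> \<eta> / (2 * (L + 1))"
      using euler_jac_equicontinuous[OF t, of "\<eta> / (2 * (L + 1))"] \<eta> L0 by auto
    show ?thesis
    proof (intro exI[of _ "min d2 (d1 / (2 * M))"] conjI allI impI)
      fix h k and x y :: 'a assume h: "0 \<le> h" and k: "real k * h \<le> t" and xy: "norm (x - y) \<le> min d2 (d1 / (2 * M))"
      note pe = power_le_exp[OF h k, folded M_def]
      let ?Ex = "euler_iter h k x" and ?Ey = "euler_iter h k y"
      let ?Px = "euler_jac h k x" and ?Py = "euler_jac h k y"
      have "norm (?Ex - ?Ey) \<le> M * (d1 / (2 * M))"
        using euler_iter_lipschitz[OF h, of k x y] mult_mono[OF pe, of "norm (x - y)" "d1 / (2 * M)"] xy M by simp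
      also have "\<dots> < d1" using d1(1) M by simp
      finally have D: "norm (Df ?Ex - Df ?Ey) \<le> \<eta> / (2 * M)" using d1(2) by (simp add: less_imp_le)
      have "Dg h k x - Dg h k y = ((Df ?Ex - Df ?Ey) o\<^sub>L ?Px) + (Df ?Ey o\<^sub>L (?Px - ?Py))"
        unfolding Dg_def by (rule blinfun_eqI) (simp add: blinfun.add_left blinfun.diff_left blinfun.diff_right)
      then have "norm (Dg h k x - Dg h k y) \<le> norm ((Df ?Ex - Df ?Ey) o\<^sub>L ?Px) + norm (Df ?Ey o\<^sub>L (?Px - ?Py))"
        by (metis norm_triangle_ineq)
      also have "norm ((Df ?Ex - Df ?Ey) o\<^sub>L ?Px) \<le> \<eta> / (2 * M) * M"
        using D order_trans[OF norm_euler_jac[OF h] pe] \<eta> M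
        by (intro order_trans[OF norm_blinfun_compose] mult_mono) auto
      also have "norm (Df ?Ey o\<^sub>L (?Px - ?Py)) \<le> L * (\<eta> / (2 * (L + 1)))"
        using d2(2)[OF h k] xy f(3) L0 by (intro order_trans[OF norm_blinfun_compose] mult_mono) auto
      also have "L * (\<eta> / (2 * (L + 1))) \<le> \<eta> / 2"
        using L0 \<eta> by (simp add: field_simps)
      finally show "norm (Dg h k x - Dg h k y) \<le> \<eta>" using M by simp
    qed (use d1 d2 M in auto)
  qed
  \<comment> \<open>subtracting the first-order term is free of charge, as its integral vanishes\<close>
  have step: "\<bar>integral\<^sup>L \<mu> (g h (Suc k)) - integral\<^sup>L \<mu> (g h k)\<bar> \<le> h * S * \<eta>"
    if h: "0 \<le> h" "real k * h \<le> t" "h * S \<le> \<delta>"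
      and \<delta>: "\<forall>h k x y. 0 \<le> h \<longrightarrow> real k * h \<le> t \<longrightarrow> norm (x - y) \<le> \<delta> \<longrightarrow> norm (Dg h k x - Dg h k y) \<le> \<eta>"
      and \<delta>0: "\<delta> > 0" for h k \<delta> \<eta>
  proof -
    have pw: "\<bar>g h k (euler h x) - g h k x - h * blinfun_apply (Dg h k x) (V x)\<bar> \<le> h * S * \<eta>" for x
    proof -
      have \<eta>0: "0 \<le> \<eta>" using \<delta>[rule_format, OF h(1,2), of x x] \<delta>0 by simp
      have nb: "norm (h *\<^sub>R V x) \<le> h * S" using h V_bound[of x] by (simp add: mult_left_mono)
      have "norm (g h k (x + h *\<^sub>R V x) - g h k x - blinfun_apply (Dg h k x) (x + h *\<^sub>R V x - x))
          \<le> norm (x + h *\<^sub>R V x - x) * \<eta>"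
      proof (rule differentiable_bound_linearization[of x "x + h *\<^sub>R V x" "cball x \<delta>" _ "\<lambda>x. blinfun_apply (Dg h k x)"])
        show "x + s *\<^sub>R (x + h *\<^sub>R V x - x) \<in> cball x \<delta>" if s: "s \<in> {0..1}" for s
        proof -
          have "norm (s *\<^sub>R (h *\<^sub>R V x)) \<le> 1 * norm (h *\<^sub>R V x)"
            unfolding norm_scaleR[of s] using s by (intro mult_right_mono) auto
          also have "\<dots> \<le> \<delta>" using nb h by simp
          finally show ?thesis by (simp add: dist_norm)
        qed
        show "(g h k has_derivative blinfun_apply (Dg h k z)) (at z within cball x \<delta>)" for z
          using gd by (rule has_derivative_at_withinI)
        show "onorm (blinfun_apply (Dg h k z) - blinfun_apply (Dg h k x)) \<le> \<eta>" if "z \<in> cball x \<delta>" for z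
        proof -
          have "blinfun_apply (Dg h k z) - blinfun_apply (Dg h k x) = blinfun_apply (Dg h k z - Dg h k x)"
            by (auto simp: fun_eq_iff blinfun.diff_left)
          then show ?thesis using \<delta>[rule_format, OF h(1,2), of z x] that
            by (simp add: norm_blinfun.rep_eq[symmetric] dist_norm norm_minus_commute)
        qed
      qed (use \<delta>0 in auto)
      also have "\<dots> \<le> (h * S) * \<eta>" using nb \<eta>0 by (intro mult_right_mono) auto
      finally show ?thesis by (simp add: euler_def blinfun.scaleR_right)
    qed
    have di: "integrable \<mu> (\<lambda>x. blinfun_apply (Dg h k x) (V x))"
    proof (rule bounded_cont_integrable[OF \<mu>], rule bounded_contI)
      show "continuous_on U (\<lambda>x. blinfun_apply (Dg h k x) (V x))"
        by (intro continuous_intros Dgc Vc)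
      fix x
      have "norm (blinfun_apply (Dg h k x) (V x)) \<le> norm (Dg h k x) * norm (V x)" by (rule norm_blinfun)
      also have "\<dots> \<le> (L * (1 + h * C) ^ k) * S"
        unfolding Dg_def using f(3) norm_euler_jac[OF h(1), of k x] V_bound[of x] L0 C_nonneg h
        by (intro mult_mono order_trans[OF norm_blinfun_compose]) (auto intro!: mult_nonneg_nonneg)
      finally show "\<bar>blinfun_apply (Dg h k x) (V x)\<bar> \<le> (L * (1 + h * C) ^ k) * S" by simp
    qed
    have "g h (Suc k) x = g h k (euler h x)" for x
      unfolding g_def euler_iter_shift ..
    then have ge: "g h (Suc k) = (\<lambda>x. g h k (euler h x))" by (rule ext)
    have "integral\<^sup>L \<mu> (g h (Suc k)) - integral\<^sup>L \<mu> (g h k) =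
      integral\<^sup>L \<mu> (\<lambda>x. g h k (euler h x) - g h k x - h * blinfun_apply (Dg h k x) (V x))"
      using gi[of h "Suc k"] gi[of h k] di inv[of "g h k" "Dg h k", OF gd Dgc] unfolding ge by simp
    also have "\<bar>\<dots>\<bar> \<le> integral\<^sup>L \<mu> (\<lambda>x. \<bar>g h k (euler h x) - g h k x - h * blinfun_apply (Dg h k x) (V x)\<bar>)"
      by (rule integral_abs_bound)
    also have "\<dots> \<le> integral\<^sup>L \<mu> (\<lambda>x. h * S * \<eta>)"
      using gi[of h "Suc k"] gi[of h k] di pw unfolding ge by (intro integral_mono_AE) auto
    finally show ?thesis by (simp add: prob_space)
  qed
  show ?thesis
  proof (rule LIMSEQ_I)
    fix e :: real assume e: "e > 0"
    define \<eta> where "\<eta> = e / (2 * (t * S + 1))"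
    have tS: "0 \<le> t * S" using t S_nonneg by simp
    have \<eta>: "\<eta> > 0" using e tS by (simp add: \<eta>_def add_nonneg_pos)
    obtain \<delta> where \<delta>: "\<delta> > 0" "\<forall>h k x y. 0 \<le> h \<longrightarrow> real k * h \<le> t \<longrightarrow> norm (x - y) \<le> \<delta> \<longrightarrow> norm (Dg h k x - Dg h k y) \<le> \<eta>"
      using unif[OF \<eta>] by blast
    obtain n0 where n0: "t * S < real n0 * \<delta>" using reals_Archimedean3[OF \<delta>(1)] by blast
    have "norm (integral\<^sup>L \<mu> (\<lambda>x. f (euler_iter (t / real (Suc n)) (Suc n) x)) - integral\<^sup>L \<mu> f) < e" if n: "n \<ge> n0" for n
    proof -
      let ?h = "t / real (Suc n)"
      have h: "0 \<le> ?h" "real (Suc n) * ?h = t" using t by auto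
      have "real n0 * \<delta> \<le> real (Suc n) * \<delta>" using n \<delta> by (intro mult_right_mono) auto
      then have hS: "?h * S \<le> \<delta>" using n0 by (simp add: field_simps del: of_nat_Suc)
      have "\<bar>integral\<^sup>L \<mu> (g ?h k) - integral\<^sup>L \<mu> (g ?h 0)\<bar> \<le> real k * (?h * S * \<eta>)" if "k \<le> Suc n" for k
        using that
      proof (induction k)
        case (Suc k)
        have "real k * ?h \<le> real (Suc n) * ?h" using Suc.prems h by (intro mult_right_mono) auto
        then have "\<bar>integral\<^sup>L \<mu> (g ?h (Suc k)) - integral\<^sup>L \<mu> (g ?h k)\<bar> \<le> ?h * S * \<eta>"
          using h by (intro step[OF h(1) _ hS \<delta>(2,1)]) simp
        moreover have "\<bar>integral\<^sup>L \<mu> (g ?h k) - integral\<^sup>L \<mu> (g ?h 0)\<bar> \<le> real k * (?h * S * \<eta>)"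
          using Suc by simp
        moreover have "real (Suc k) * (?h * S * \<eta>) = ?h * S * \<eta> + real k * (?h * S * \<eta>)"
          by (simp only: of_nat_Suc distrib_right mult_1)
        ultimately show ?case by linarith
      qed simp
      from this[of "Suc n"] have "\<bar>integral\<^sup>L \<mu> (g ?h (Suc n)) - integral\<^sup>L \<mu> (g ?h 0)\<bar> \<le> (real (Suc n) * ?h) * S * \<eta>"
        by (simp add: mult.assoc del: of_nat_Suc)
      also have "\<dots> = t * S * \<eta>" by (simp only: h)
      also have "\<dots> < e"
      proof -
        have "t * S * \<eta> \<le> (t * S + 1) * \<eta>" using \<eta> by (intro mult_right_mono) auto
        also have "\<dots> = e / 2"
        proof -
          have "q * (e / (2 * q)) = e / 2" if "q > 0" for q :: real using that by simp
          from this[of "t * S + 1"] show ?thesis using tS by (simp add: \<eta>_def)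
        qed
        finally show ?thesis using e by simp
      qed
      finally show ?thesis by (simp add: g_def[abs_def] del: euler_iter.simps(2) of_nat_Suc)
    qed
    then show "\<exists>n0. \<forall>n\<ge>n0. norm (integral\<^sup>L \<mu> (\<lambda>x. f (euler_iter (t / real (Suc n)) (Suc n) x)) - integral\<^sup>L \<mu> f) < e" by blast
  qed
qed

text \<open>Along the integral curves that start in \<open>N\<close>, the polygons converge to \<open>\<phi> t\<close>; the two limits of the same
  integrals agree.\<close>

lemma flow_integral_invariant:
  fixes f :: "'a \<Rightarrow> real" and Df :: "'a \<Rightarrow> 'a \<Rightarrow>\<^sub>L real"
  assumes f: "\<And>x. (f has_derivative blinfun_apply (Df x)) (at x)" "\<And>x. \<bar>f x\<bar> \<le> F" "\<And>x. norm (Df x) \<le> L"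
    "uniformly_continuous_on UNIV Df"
    and \<mu>: "\<mu> \<in> prob_measures U"
    and inv: "\<And>(g :: 'a \<Rightarrow> real) Dg. (\<And>x. (g has_derivative blinfun_apply (Dg x)) (at x)) \<Longrightarrow> continuous_on UNIV Dg \<Longrightarrow>
       integral\<^sup>L \<mu> (\<lambda>x. blinfun_apply (Dg x) (V x)) = 0"
    and t: "0 \<le> t"
    and ae: "AE x in \<mu>. x \<in> N"
    and curves: "\<And>x s. x \<in> N \<Longrightarrow> s \<in> {0..t} \<Longrightarrow> ((\<lambda>s. \<phi> s x) has_vector_derivative V (\<phi> s x)) (at s within {0..t})"
      "\<And>x. x \<in> N \<Longrightarrow> \<phi> 0 x = x"
    and meas: "(\<lambda>x. f (\<phi> t x)) \<in> borel_measurable \<mu>"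
  shows "integral\<^sup>L \<mu> (\<lambda>x. f (\<phi> t x)) = integral\<^sup>L \<mu> f"
proof -
  interpret prob_space \<mu> using \<mu> by (simp add: prob_measures_def)
  have fc: "continuous_on A f" for A
    using f(1) by (intro continuous_at_imp_continuous_on) (auto intro: has_derivative_continuous)
  have Ec: "continuous_on A (euler_iter h k)" for A h k
    using euler_iter_deriv by (intro continuous_at_imp_continuous_on) (auto intro: has_derivative_continuous)
  have "(\<lambda>n. integral\<^sup>L \<mu> (\<lambda>x. f (euler_iter (t / real (Suc n)) (Suc n) x))) \<longlonglongrightarrow> integral\<^sup>L \<mu> (\<lambda>x. f (\<phi> t x))"
  proof (rule integral_dominated_convergence[where w="\<lambda>_. F"])
    show "(\<lambda>x. f (euler_iter (t / real (Suc n)) (Suc n) x)) \<in> borel_measurable \<mu>" for n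
      by (rule borel_measurable_integrable, rule bounded_cont_integrable[OF \<mu>], rule bounded_contI)
         (use f(2) in \<open>auto intro!: continuous_on_compose2[OF fc[of UNIV] Ec] simp del: euler_iter.simps\<close>)
    show "AE x in \<mu>. (\<lambda>n. f (euler_iter (t / real (Suc n)) (Suc n) x)) \<longlonglongrightarrow> f (\<phi> t x)"
      using ae
    proof eventually_elim
      case (elim x)
      have "(\<lambda>n. euler_iter (t / real (Suc n)) (Suc n) x) \<longlonglongrightarrow> \<phi> t x"
        using euler_converges[of t "\<lambda>s. \<phi> s x", OF curves(1)[OF elim] t] curves(2)[OF elim] by simp
      then show ?case
        by (rule isCont_tendsto_compose[rotated]) (use f(1) has_derivative_continuous in blast)
    qed
  qed (use meas f(2) in auto)
  then show ?thesis by (rule LIMSEQ_unique[OF _ euler_integral_converges[OF f \<mu> inv t]])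
qed

end

section \<open>Functions of a Lyapunov function\<close>

text \<open>The quotient of \<open>flat (s - a)\<close> by \<open>flat (s - a) + flat (b - s)\<close>.\<close>

lemma smooth_step:
  assumes "a < (b::real)"
  shows "\<exists>\<theta> \<theta>'. (\<forall>s. (\<theta> has_real_derivative \<theta>' s) (at s)) \<and> continuous_on UNIV \<theta>' \<and>
    (\<forall>s. 0 \<le> \<theta>' s) \<and> (\<forall>s. 0 \<le> \<theta> s \<and> \<theta> s \<le> 1) \<and> (\<forall>s\<le>a. \<theta> s = 0) \<and> (\<forall>s\<ge>b. \<theta> s = 1) \<and>
    (\<forall>s. s \<le> a \<or> b \<le> s \<longrightarrow> \<theta>' s = 0)"
proof -
  let ?f = "\<lambda>s. flat 0 (s - a)" and ?g = "\<lambda>s. flat 0 (b - s)"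
  let ?f' = "\<lambda>s. flat 2 (s - a)" and ?g' = "\<lambda>s. - flat 2 (b - s)"
  define \<theta> where "\<theta> s = ?f s / (?f s + ?g s)" for s
  define \<theta>' where "\<theta>' s = (?f' s * ?g s - ?f s * ?g' s) / ((?f s + ?g s) * (?f s + ?g s))" for s
  have pos: "0 < ?f s + ?g s" for s
  proof (cases "s > a")
    case True then show ?thesis using flat_pos_iff[of 0 "s - a"] flat_nonneg[of 0 "b - s"] by simp
  next
    case False then show ?thesis using flat_pos_iff[of 0 "b - s"] flat_nonneg[of 0 "s - a"] assms by simp
  qed
  have df: "(flat 0 has_real_derivative flat 2 s) (at s)" for s
    using flat_derivative[of 0 s] by (simp add: numeral_2_eq_2)
  have fd: "(?f has_real_derivative ?f' s) (at s)" for s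
  proof -
    have "((\<lambda>s. s - a) has_real_derivative 1) (at s)" by (auto intro!: derivative_eq_intros)
    from DERIV_chain2[OF df this] show ?thesis by simp
  qed
  have gd: "(?g has_real_derivative ?g' s) (at s)" for s
  proof -
    have "((\<lambda>s. b - s) has_real_derivative - 1) (at s)" by (auto intro!: derivative_eq_intros)
    from DERIV_chain2[OF df this] show ?thesis by simp
  qed
  have cf: "continuous_on UNIV (flat k)" for k
    using flat_derivative[of k] by (intro continuous_at_imp_continuous_on) (auto intro: DERIV_isCont)
  have "(\<theta> has_real_derivative \<theta>' s) (at s)" for s
  proof -
    have "(\<theta> has_real_derivative (?f' s * (?f s + ?g s) - ?f s * (?f' s + ?g' s)) / ((?f s + ?g s) * (?f s + ?g s))) (at s)"
      unfolding \<theta>_def[abs_def] by (rule DERIV_divide[OF fd DERIV_add[OF fd gd]]) (use pos[of s] in simp)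
    then show ?thesis by (simp add: \<theta>'_def algebra_simps)
  qed
  moreover have "continuous_on UNIV \<theta>'"
  proof -
    have "?f s + ?g s \<noteq> 0" for s using pos[of s] by simp
    then show ?thesis unfolding \<theta>'_def[abs_def]
      by (intro continuous_intros continuous_on_compose2[OF cf]) auto
  qed
  moreover have "0 \<le> \<theta>' s" for s
    unfolding \<theta>'_def using pos[of s] by (intro divide_nonneg_pos) (auto simp: flat_nonneg mult_nonneg_nonneg)
  moreover have "0 \<le> \<theta> s \<and> \<theta> s \<le> 1" for s
    unfolding \<theta>_def using pos[of s] by (simp add: flat_nonneg)
  moreover have "\<theta> s = 0" if "s \<le> a" for s using that by (simp add: \<theta>_def flat_def)
  moreover have "\<theta> s = 1" if "b \<le> s" for s using that pos[of s] by (simp add: \<theta>_def flat_def)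
  moreover have "\<theta>' s = 0" if "s \<le> a \<or> b \<le> s" for s using that by (auto simp: \<theta>'_def flat_def)
  ultimately show ?thesis by blast
qed

text \<open>The Lyapunov function is nonnegative, so antiderivatives on a half-line are enough.\<close>

lemma antiderivative_exists:
  assumes "continuous_on UNIV (f :: real \<Rightarrow> real)"
  shows "\<exists>F. \<forall>s>c. (F has_real_derivative f s) (at s)"
proof (intro exI allI impI)
  fix s assume s: "s > c"
  have "((\<lambda>x. integral {c..x} f) has_real_derivative f s) (at s within {c..s+1})"
    by (rule integral_has_real_derivative) (use s assms in \<open>auto intro: continuous_on_subset\<close>)
  then have "((\<lambda>x. integral {c..x} f) has_real_derivative f s) (at s within {c<..<s+1})"
    by (rule has_field_derivative_subset) auto
  then show "((\<lambda>x. integral {c..x} f) has_real_derivative f s) (at s)"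
    using s by (simp add: at_within_open[of s "{c<..<s+1}"])
qed

lemma C_k_on_Un:
  assumes "open S" "open T"
  shows "C_k_on k S f \<Longrightarrow> C_k_on k T f \<Longrightarrow> C_k_on k (S \<union> T) f"
proof (induction k arbitrary: f)
  case 0
  then show ?case using continuous_on_open_Un[OF assms] by simp
next
  case (Suc k)
  have "f differentiable_on (S \<union> T)"
    using Suc.prems assms
    by (auto simp: differentiable_on_def at_within_open[of _ "S"] at_within_open[of _ "T"]
        intro: differentiable_at_withinI)
  then show ?case using Suc by simp
qed

lemma C_k_on_zero: "C_k_on k S (\<lambda>x. 0)"
proof (induction k)
  case (Suc k)
  have "partial_deriv i (\<lambda>x. 0) = (\<lambda>x. 0)" for i :: 'a
    by (rule ext) (simp add: partial_deriv_eq[OF has_derivative_const])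
  then show ?case using Suc by simp
qed simp

lemma C_k_on_extend_zero:
  assumes "open U" "compact K" "K \<subseteq> U" "C_k_on k U f" "\<And>x. x \<notin> K \<Longrightarrow> f x = 0"
  shows "C_k_on k UNIV f"
proof -
  have o: "open (- K)" using assms(2) by (simp add: compact_imp_closed open_Compl)
  have "C_k_on k (- K) f"
    by (rule C_k_on_cong[OF o _ C_k_on_zero]) (use assms(5) in auto)
  from C_k_on_Un[OF assms(1) o assms(4) this] show ?thesis
    using assms(3) by (metis Compl_subset_Compl_iff Un_commute compl_le_swap2 compl_sup_top sup.absorb_iff2 sup_assoc)
qed

lemma C_k_on_2_D:
  assumes "open U" "C_k_on 2 U W"
  shows "x \<in> U \<Longrightarrow> W differentiable (at x)" "continuous_on U W"
    "x \<in> U \<Longrightarrow> partial_deriv i W differentiable (at x)" "continuous_on U (partial_deriv i W)"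
    "continuous_on U (partial_deriv i (partial_deriv j W))"
proof -
  have W: "W differentiable_on U" "partial_deriv i W differentiable_on U"
    "continuous_on U (partial_deriv i (partial_deriv j W))" for i j
    using assms(2) by (auto simp: numeral_2_eq_2)
  show "x \<in> U \<Longrightarrow> W differentiable (at x)" "x \<in> U \<Longrightarrow> partial_deriv i W differentiable (at x)"
    using W(1,2) assms(1) by (auto simp: differentiable_on_def at_within_open[of _ U])
  show "continuous_on U W" "continuous_on U (partial_deriv i W)"
    using W(1,2) differentiable_imp_continuous_on by blast+
  show "continuous_on U (partial_deriv i (partial_deriv j W))" by (rule W(3))
qed

lemma partial_deriv_compose_real:
  fixes W :: "real^'n::finite \<Rightarrow> real"
  assumes "W differentiable (at x)" "(F has_real_derivative D) (at (W x))"
  shows "((\<lambda>x. F (W x)) has_derivative (\<lambda>h. (D *\<^sub>R grad W x) \<bullet> h)) (at x)"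
    "partial_deriv i (\<lambda>x. F (W x)) x = D * partial_deriv i W x"
proof -
  show d: "((\<lambda>x. F (W x)) has_derivative (\<lambda>h. (D *\<^sub>R grad W x) \<bullet> h)) (at x)"
    using has_derivative_compose[OF has_derivative_grad[OF assms(1)] has_field_derivative_imp_has_derivative[OF assms(2)]]
    by simp
  show "partial_deriv i (\<lambda>x. F (W x)) x = D * partial_deriv i W x"
    by (simp add: partial_deriv_eq[OF d] inner_axis grad_def)
qed

lemma partial_deriv_mult:
  fixes f g :: "real^'n::finite \<Rightarrow> real"
  assumes "f differentiable (at x)" "g differentiable (at x)"
  shows "((\<lambda>x. f x * g x) has_derivative (\<lambda>h. (f x *\<^sub>R grad g x + g x *\<^sub>R grad f x) \<bullet> h)) (at x)"
    "partial_deriv i (\<lambda>x. f x * g x) x = f x * partial_deriv i g x + g x * partial_deriv i f x"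
proof -
  show d: "((\<lambda>x. f x * g x) has_derivative (\<lambda>h. (f x *\<^sub>R grad g x + g x *\<^sub>R grad f x) \<bullet> h)) (at x)"
    using has_derivative_mult[OF has_derivative_grad[OF assms(1)] has_derivative_grad[OF assms(2)]]
    by (simp add: inner_add_left algebra_simps)
  show "partial_deriv i (\<lambda>x. f x * g x) x = f x * partial_deriv i g x + g x * partial_deriv i f x"
    by (simp add: partial_deriv_eq[OF d] inner_axis grad_def)
qed

lemma C_k_on_1_iff:
  "open U \<Longrightarrow> C_k_on 1 U f \<longleftrightarrow> (\<forall>x\<in>U. f differentiable (at x)) \<and> (\<forall>i. continuous_on U (partial_deriv i f))"
  by (simp add: differentiable_on_def at_within_open[of _ U] cong: ball_cong)

lemma C_1_mult:
  fixes f g :: "real^'n::finite \<Rightarrow> real"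
  assumes U: "open U" and f: "C_k_on 1 U f" and g: "C_k_on 1 U g"
  shows "C_k_on 1 U (\<lambda>x. f x * g x)"
proof -
  note D = f[unfolded C_k_on_1_iff[OF U]] g[unfolded C_k_on_1_iff[OF U]]
  have c: "continuous_on U f" "continuous_on U g"
    using D by (auto intro!: continuous_at_imp_continuous_on differentiable_imp_continuous_within)
  show ?thesis
    unfolding C_k_on_1_iff[OF U]
  proof (intro conjI ballI allI)
    show "(\<lambda>x. f x * g x) differentiable (at x)" if "x \<in> U" for x
      using partial_deriv_mult(1)[of f x g] D that unfolding differentiable_def by blast
    fix i
    have "continuous_on U (\<lambda>x. f x * partial_deriv i g x + g x * partial_deriv i f x)"
      using D c by (auto intro!: continuous_intros)
    then show "continuous_on U (partial_deriv i (\<lambda>x. f x * g x))"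
      by (rule continuous_on_eq) (use D in \<open>simp add: partial_deriv_mult\<close>)
  qed
qed

lemma C_1_compose_real:
  fixes W :: "real^'n::finite \<Rightarrow> real"
  assumes U: "open U" and W: "C_k_on 1 U W"
    and F: "\<And>x. x \<in> U \<Longrightarrow> (F has_real_derivative F' (W x)) (at (W x))" "continuous_on (W ` U) F'"
  shows "C_k_on 1 U (\<lambda>x. F (W x))"
proof -
  note D = W[unfolded C_k_on_1_iff[OF U]]
  have c: "continuous_on U W"
    using D by (auto intro!: continuous_at_imp_continuous_on differentiable_imp_continuous_within)
  show ?thesis
    unfolding C_k_on_1_iff[OF U]
  proof (intro conjI ballI allI)
    show "(\<lambda>x. F (W x)) differentiable (at x)" if "x \<in> U" for x
      using partial_deriv_compose_real(1)[of W x F] D F(1) that unfolding differentiable_def by blast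
    fix i
    have "continuous_on U (\<lambda>x. F' (W x) * partial_deriv i W x)"
      using D c by (auto intro!: continuous_intros continuous_on_compose2[OF F(2)])
    then show "continuous_on U (partial_deriv i (\<lambda>x. F (W x)))"
      by (rule continuous_on_eq) (simp add: partial_deriv_compose_real(2)[OF bspec[OF conjunct1[OF D]] F(1)])
  qed
qed

lemma C_2_compose_real:
  fixes W :: "real^'n::finite \<Rightarrow> real"
  assumes U: "open U" and W: "C_k_on 2 U W"
    and F: "\<And>x. x \<in> U \<Longrightarrow> (F has_real_derivative F1 (W x)) (at (W x))"
       "\<And>s. (F1 has_real_derivative F2 s) (at s)" "continuous_on UNIV F2"
  shows "C_k_on 2 U (\<lambda>x. F (W x))"
    "x \<in> U \<Longrightarrow> partial_deriv i (\<lambda>x. F (W x)) x = F1 (W x) * partial_deriv i W x"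
    "x \<in> U \<Longrightarrow> partial_deriv i (partial_deriv j (\<lambda>x. F (W x))) x =
       F2 (W x) * partial_deriv i W x * partial_deriv j W x + F1 (W x) * partial_deriv i (partial_deriv j W) x"
proof -
  note D = C_k_on_2_D[OF U W]
  have W1: "C_k_on 1 U W" "C_k_on 1 U (partial_deriv j W)" for j
    using D by (auto simp: C_k_on_1_iff[OF U] simp del: C_k_on.simps One_nat_def)
  have F1W: "C_k_on 1 U (\<lambda>x. F1 (W x))"
    by (rule C_1_compose_real[OF U W1(1) F(2)]) (rule continuous_on_subset[OF F(3)], simp)
  show p: "partial_deriv i (\<lambda>x. F (W x)) x = F1 (W x) * partial_deriv i W x" if "x \<in> U" for x i
    by (rule partial_deriv_compose_real(2)[OF D(1)[OF that] F(1)[OF that]])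
  have C1: "C_k_on 1 U (partial_deriv j (\<lambda>x. F (W x)))" for j
    by (rule C_k_on_cong[OF U _ C_1_mult[OF U F1W W1(2)[of j]]]) (simp add: p)
  have "(\<lambda>x. F (W x)) differentiable (at x)" if "x \<in> U" for x
    using partial_deriv_compose_real(1)[OF D(1)[OF that] F(1)[OF that]] unfolding differentiable_def by blast
  then show "C_k_on 2 U (\<lambda>x. F (W x))"
    using C1 U by (auto simp: numeral_2_eq_2 differentiable_on_def at_within_open[of _ U])
  assume x: "x \<in> U"
  have "partial_deriv i (partial_deriv j (\<lambda>x. F (W x))) x = partial_deriv i (\<lambda>x. F1 (W x) * partial_deriv j W x) x"
    by (rule partial_deriv_cong[OF U x p])
  also have "\<dots> = F1 (W x) * partial_deriv i (partial_deriv j W) x + partial_deriv j W x * partial_deriv i (\<lambda>x. F1 (W x)) x"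
    by (rule partial_deriv_mult(2)) (use F1W D(3)[OF x] x in \<open>auto simp: C_k_on_1_iff[OF U] simp del: C_k_on.simps One_nat_def\<close>)
  also have "partial_deriv i (\<lambda>x. F1 (W x)) x = F2 (W x) * partial_deriv i W x"
    by (rule partial_deriv_compose_real(2)[OF D(1)[OF x] F(2)])
  finally show "partial_deriv i (partial_deriv j (\<lambda>x. F (W x))) x =
       F2 (W x) * partial_deriv i W x * partial_deriv j W x + F1 (W x) * partial_deriv i (partial_deriv j W) x"
    by (simp add: algebra_simps)
qed

text \<open>The identity \<open>\<L>\<^sub>A (F \<circ> W) = F'(W) \<L>\<^sub>A W + F''(W) \<langle>\<nabla>W, A \<nabla>W\<rangle>\<close>, with \<open>D1\<close> and \<open>D2\<close> for the values of
  \<open>F'\<close> and \<open>F''\<close> at \<open>W x\<close>.\<close>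

lemma generator_compose:
  fixes W :: "real^'n::finite \<Rightarrow> real"
  assumes "\<And>i. partial_deriv i f x = D1 * partial_deriv i W x"
    "\<And>i j. partial_deriv i (partial_deriv j f) x =
       D2 * partial_deriv i W x * partial_deriv j W x + D1 * partial_deriv i (partial_deriv j W) x"
  shows "generator V A f x = D1 * generator V A W x + D2 * (grad W x \<bullet> (A x *v grad W x))"
proof -
  have "grad W x \<bullet> (A x *v grad W x) = (\<Sum>i\<in>UNIV. \<Sum>j\<in>UNIV. A x $ i $ j * (partial_deriv i W x * partial_deriv j W x))"
    by (simp add: inner_vec_def matrix_vector_mult_def grad_def sum_distrib_left mult_ac)
  then show ?thesis
    by (simp add: generator_def assms sum.distrib sum_distrib_left algebra_simps)
qed

lemma bounded_cont_compact_support: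
  assumes "continuous_on U h" "compact K" "K \<subseteq> U" "\<And>x. x \<in> U - K \<Longrightarrow> h x = 0"
  shows "h \<in> bounded_cont U"
proof -
  have "bounded (h ` K)"
    by (intro compact_imp_bounded compact_continuous_image continuous_on_subset[OF assms(1)] assms)
  then obtain b where b: "\<forall>y\<in>h ` K. \<bar>y\<bar> \<le> b" unfolding bounded_real by blast
  have "\<bar>h x\<bar> \<le> max b 0" if "x \<in> U" for x
    using b assms(4)[of x] that by (cases "x \<in> K") (auto simp: le_max_iff_disj)
  with assms(1) show ?thesis by (rule bounded_contI)
qed

lemma continuous_on_generator:
  assumes "continuous_on U A" "continuous_on U V" "C_k_on 2 U f"
  shows "continuous_on U (generator V A f)"
proof -
  have "continuous_on U (partial_deriv i f)" "continuous_on U (partial_deriv i (partial_deriv j f))" for i j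
    using assms(3) differentiable_imp_continuous_on by (auto simp: numeral_2_eq_2)
  then show ?thesis unfolding generator_def[abs_def]
    by (intro continuous_intros continuous_on_sum continuous_on_mult continuous_on_component assms)
qed

lemma generator_diff_bound:
  assumes "\<And>i. \<bar>partial_deriv i g x - partial_deriv i f x\<bar> \<le> e"
    "\<And>i j. \<bar>partial_deriv i (partial_deriv j g) x - partial_deriv i (partial_deriv j f) x\<bar> \<le> e"
  shows "\<bar>generator V A g x - generator V A f x\<bar> \<le>
    e * ((\<Sum>i\<in>UNIV. \<Sum>j\<in>UNIV. \<bar>A x $ i $ j\<bar>) + (\<Sum>i\<in>UNIV. \<bar>V x $ i\<bar>))"
proof -
  let ?a = "\<lambda>i j. A x $ i $ j * (partial_deriv i (partial_deriv j g) x - partial_deriv i (partial_deriv j f) x)"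
  let ?b = "\<lambda>i. V x $ i * (partial_deriv i g x - partial_deriv i f x)"
  have eq: "generator V A g x - generator V A f x = (\<Sum>i\<in>UNIV. \<Sum>j\<in>UNIV. ?a i j) + (\<Sum>i\<in>UNIV. ?b i)"
    unfolding generator_def right_diff_distrib sum_subtractf by (rule add_diff_add)
  have "\<bar>generator V A g x - generator V A f x\<bar> \<le> (\<Sum>i\<in>UNIV. \<Sum>j\<in>UNIV. \<bar>?a i j\<bar>) + (\<Sum>i\<in>UNIV. \<bar>?b i\<bar>)"
  proof -
    have "\<bar>\<Sum>i\<in>UNIV. \<Sum>j\<in>UNIV. ?a i j\<bar> \<le> (\<Sum>i\<in>UNIV. \<bar>\<Sum>j\<in>UNIV. ?a i j\<bar>)" by (rule sum_abs)
    also have "\<dots> \<le> (\<Sum>i\<in>UNIV. \<Sum>j\<in>UNIV. \<bar>?a i j\<bar>)" by (rule sum_mono) (rule sum_abs)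
    finally have "\<bar>\<Sum>i\<in>UNIV. \<Sum>j\<in>UNIV. ?a i j\<bar> \<le> (\<Sum>i\<in>UNIV. \<Sum>j\<in>UNIV. \<bar>?a i j\<bar>)" .
    from add_mono[OF this sum_abs[of ?b UNIV]] show ?thesis
      unfolding eq by (rule order_trans[OF abs_triangle_ineq])
  qed
  also have "\<dots> \<le> (\<Sum>i\<in>UNIV. \<Sum>j\<in>UNIV. \<bar>A x $ i $ j\<bar> * e) + (\<Sum>i\<in>UNIV. \<bar>V x $ i\<bar> * e)"
  proof -
    have "\<bar>?a i j\<bar> \<le> \<bar>A x $ i $ j\<bar> * e" for i j
      using mult_left_mono[OF assms(2)[of i j], of "\<bar>A x $ i $ j\<bar>"] by (simp only: abs_mult abs_ge_zero)
    moreover have "\<bar>?b i\<bar> \<le> \<bar>V x $ i\<bar> * e" for i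
      using mult_left_mono[OF assms(1)[of i], of "\<bar>V x $ i\<bar>"] by (simp only: abs_mult abs_ge_zero)
    ultimately show ?thesis by (intro add_mono sum_mono)
  qed
  also have "\<dots> = e * ((\<Sum>i\<in>UNIV. \<Sum>j\<in>UNIV. \<bar>A x $ i $ j\<bar>) + (\<Sum>i\<in>UNIV. \<bar>V x $ i\<bar>))"
  proof -
    have "(\<Sum>i\<in>UNIV. \<Sum>j\<in>UNIV. \<bar>A x $ i $ j\<bar> * e) = (\<Sum>i\<in>UNIV. \<Sum>j\<in>UNIV. \<bar>A x $ i $ j\<bar>) * e"
      unfolding sum_distrib_right ..
    moreover have "(\<Sum>i\<in>UNIV. \<bar>V x $ i\<bar> * e) = (\<Sum>i\<in>UNIV. \<bar>V x $ i\<bar>) * e"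
      unfolding sum_distrib_right ..
    moreover have "a * e + b * e = e * (a + b)" for a b :: real by (simp add: algebra_simps)
    ultimately show ?thesis by (simp only:)
  qed
  finally show ?thesis .
qed

text \<open>Functions of the Lyapunov function are only of class \<open>C\<^sup>2\<close>; mollification transfers the stationarity
  identity to them.\<close>

lemma stationary_measure_C2:
  fixes f :: "real^'n::finite \<Rightarrow> real"
  assumes U: "open U" and A: "continuous_on U A" and V: "continuous_on U V"
    and \<mu>: "stationary_measure U V A \<mu>"
    and K: "compact K" "K \<subseteq> U" and f: "\<And>x. x \<notin> K \<Longrightarrow> f x = 0" "C_k_on 2 UNIV f"
  shows "(LINT x|\<mu>. generator V A f x) = 0"
proof -
  have P: "\<mu> \<in> prob_measures U" using \<mu> by (simp add: stationary_measure_def)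
  interpret prob_space \<mu> using P by (simp add: prob_measures_def)
  have sp: "space \<mu> = U" by (rule prob_measures_space[OF P])
  obtain K' where K': "compact K'" "K' \<subseteq> U" "K \<subseteq> K'"
    "\<And>\<epsilon>. \<epsilon> > 0 \<Longrightarrow> \<exists>g. test_function U g \<and> (\<forall>x. x \<notin> K' \<longrightarrow> g x = 0) \<and>
       (\<forall>x i. \<bar>partial_deriv i g x - partial_deriv i f x\<bar> \<le> \<epsilon>) \<and>
       (\<forall>x i j. \<bar>partial_deriv i (partial_deriv j g) x - partial_deriv i (partial_deriv j f) x\<bar> \<le> \<epsilon>)"
    by (rule test_function_approx_C2[where f=f, OF U K f]) (assumption, rule that)
  let ?c = "\<lambda>x. (\<Sum>i\<in>UNIV. \<Sum>j\<in>UNIV. \<bar>A x $ i $ j\<bar>) + (\<Sum>i\<in>UNIV. \<bar>V x $ i\<bar>)"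
  have "continuous_on K' ?c"
    by (intro continuous_intros continuous_on_sum continuous_on_component continuous_on_subset[OF A K'(2)]
        continuous_on_subset[OF V K'(2)])
  then have "bounded (?c ` K')" by (intro compact_imp_bounded compact_continuous_image K')
  then obtain b where "\<forall>y\<in>?c ` K'. \<bar>y\<bar> \<le> b" unfolding bounded_real by blast
  then have b: "?c x \<le> max b 1" if "x \<in> K'" for x using that by force
  have gen0: "generator V A h x = 0" if "\<And>x. x \<notin> K' \<Longrightarrow> h x = 0" "x \<notin> K'" for h x
  proof -
    have "partial_deriv i h y = 0" if "y \<notin> K'" for i y
      by (rule partial_deriv_outside_support[OF K'(1) \<open>\<And>x. x \<notin> K' \<Longrightarrow> h x = 0\<close> that])
    moreover from partial_deriv_outside_support[OF K'(1) this \<open>x \<notin> K'\<close>]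
    have "partial_deriv i (partial_deriv j h) x = 0" for i j .
    ultimately show ?thesis using \<open>x \<notin> K'\<close> by (simp add: generator_def)
  qed
  have int: "integrable \<mu> (generator V A h)" if "\<And>x. x \<notin> K' \<Longrightarrow> h x = 0" "C_k_on 2 UNIV h" for h
  proof (rule bounded_cont_integrable[OF P], rule bounded_cont_compact_support[OF _ K'(1,2)])
    show "continuous_on U (generator V A h)"
      by (rule continuous_on_generator[OF A V C_k_on_subset[OF that(2)]]) simp
    show "generator V A h x = 0" if "x \<in> U - K'" for x using gen0[of h x] that \<open>\<And>x. x \<notin> K' \<Longrightarrow> h x = 0\<close> by blast
  qed
  have f0: "f x = 0" if "x \<notin> K'" for x using f(1) K'(3) that by blast
  have "\<bar>LINT x|\<mu>. generator V A f x\<bar> \<le> e" if e: "e > 0" for e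
  proof -
    obtain g where g: "test_function U g" "\<forall>x. x \<notin> K' \<longrightarrow> g x = 0"
      "\<forall>x i. \<bar>partial_deriv i g x - partial_deriv i f x\<bar> \<le> e / max b 1"
      "\<forall>x i j. \<bar>partial_deriv i (partial_deriv j g) x - partial_deriv i (partial_deriv j f) x\<bar> \<le> e / max b 1"
      using K'(4)[of "e / max b 1"] e by auto
    have g2: "C_k_on 2 UNIV g" using g(1) unfolding test_function_def by blast
    have pw: "\<bar>generator V A g x - generator V A f x\<bar> \<le> e" for x
    proof (cases "x \<in> K'")
      case True
      have "\<bar>generator V A g x - generator V A f x\<bar> \<le> (e / max b 1) * ?c x"
        by (rule generator_diff_bound) (use g in auto)
      also have "\<dots> \<le> (e / max b 1) * max b 1" using b[OF True] e by (intro mult_left_mono) auto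
      finally show ?thesis by simp
    next
      case False
      then show ?thesis using gen0[of g x] gen0[of f x] g(2) f0 e by simp
    qed
    have "(LINT x|\<mu>. generator V A g x) = 0" using \<mu> g(1) by (simp add: stationary_measure_def)
    then have "(LINT x|\<mu>. generator V A f x) = - (LINT x|\<mu>. generator V A g x - generator V A f x)"
      using int[of g] int[of f] g(2) g2 f(2) f0 by simp
    then have "\<bar>LINT x|\<mu>. generator V A f x\<bar> \<le> (LINT x|\<mu>. \<bar>generator V A g x - generator V A f x\<bar>)"
      by simp
    also have "\<dots> \<le> (LINT x|\<mu>. e)"
      by (rule integral_mono_AE) (use int[of g] int[of f] g(2) g2 f(2) f0 pw in auto)
    finally show ?thesis by (simp add: prob_space)
  qed
  from this have "\<bar>LINT x|\<mu>. generator V A f x\<bar> \<le> 0"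
    by (rule_tac field_le_epsilon) simp
  then show ?thesis by simp
qed

section \<open>Tail estimates for stationary measures\<close>

lemma prob_measures_measurable:
  assumes "\<mu> \<in> prob_measures U" "continuous_on U (f :: 'a::topological_space \<Rightarrow> 'b::topological_space)"
  shows "f \<in> borel_measurable \<mu>"
proof -
  have s: "sets \<mu> = sets (restrict_space borel U)" using assms by (simp add: prob_measures_def)
  have "f \<in> borel_measurable (restrict_space borel U)"
    by (rule borel_measurable_continuous_on_restrict[OF assms(2)])
  then show ?thesis using s by (simp cong: measurable_cong_sets)
qed

lemma quadratic_form_bound:
  fixes M :: "real^'n^'n::finite"
  assumes "\<And>i j. \<bar>M $ i $ j\<bar> \<le> e"
  shows "v \<bullet> (M *v v) \<le> e * (\<Sum>i\<in>UNIV. \<Sum>j\<in>UNIV. \<bar>v $ i\<bar> * \<bar>v $ j\<bar>)"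
proof -
  have "v \<bullet> (M *v v) = (\<Sum>i\<in>UNIV. \<Sum>j\<in>UNIV. v $ i * (M $ i $ j * v $ j))"
    by (simp add: inner_vec_def matrix_vector_mult_def sum_distrib_left)
  also have "\<dots> \<le> (\<Sum>i\<in>UNIV. \<Sum>j\<in>UNIV. e * (\<bar>v $ i\<bar> * \<bar>v $ j\<bar>))"
  proof (intro sum_mono)
    fix i j
    have "v $ i * (M $ i $ j * v $ j) \<le> \<bar>M $ i $ j\<bar> * (\<bar>v $ i\<bar> * \<bar>v $ j\<bar>)"
      using abs_ge_self[of "v $ i * (M $ i $ j * v $ j)"] by (simp add: abs_mult mult_ac)
    also have "\<dots> \<le> e * (\<bar>v $ i\<bar> * \<bar>v $ j\<bar>)"
      by (intro mult_right_mono assms) auto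
    finally show "v $ i * (M $ i $ j * v $ j) \<le> e * (\<bar>v $ i\<bar> * \<bar>v $ j\<bar>)" .
  qed
  also have "\<dots> = e * (\<Sum>i\<in>UNIV. \<Sum>j\<in>UNIV. \<bar>v $ i\<bar> * \<bar>v $ j\<bar>)"
    by (simp add: sum_distrib_left)
  finally show ?thesis .
qed

text \<open>The estimates use the diffusion matrices only through continuity and positive semidefiniteness, which replace
  the Sobolev regularity and the factorisation here.\<close>

locale lyapunov =
  fixes U :: "(real^'n::finite) set" and V :: "real^'n \<Rightarrow> real^'n"
    and \<A> :: "(real^'n \<Rightarrow> real^'n^'n) set" and W :: "real^'n \<Rightarrow> real" and \<rho> \<gamma> :: real
  assumes open_U: "open U" and V: "continuous_on U V"
    and \<A>_cont: "\<And>A. A \<in> \<A> \<Longrightarrow> continuous_on U A"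
    and \<A>_nonneg: "\<And>A x v. A \<in> \<A> \<Longrightarrow> x \<in> U \<Longrightarrow> 0 \<le> v \<bullet> (A x *v v)"
    and W_compact: "compact_function U W" and W_C2: "C_k_on 2 U W"
    and \<rho>: "0 < \<rho>" "ereal \<rho> < (SUP y\<in>U. ereal (W y))" and \<gamma>: "0 < \<gamma>"
    and drift: "\<And>A x. A \<in> \<A> \<Longrightarrow> x \<in> U \<Longrightarrow> \<rho> < W x \<Longrightarrow> generator V A W x \<le> - \<gamma>"
begin

abbreviation top :: ereal where "top \<equiv> (SUP y\<in>U. ereal (W y))"

abbreviation sublevel :: "real \<Rightarrow> (real^'n) set" where
  "sublevel c \<equiv> {x \<in> U. W x \<le> c}"

lemma W_cont: "continuous_on U W" and W_nonneg: "x \<in> U \<Longrightarrow> 0 \<le> W x"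
  and W_less_top: "x \<in> U \<Longrightarrow> ereal (W x) < top"
  using W_compact by (auto simp: compact_function_def)

lemma compact_sublevel:
  assumes "ereal c < top" shows "compact (sublevel c)"
proof -
  have "((\<lambda>x. ereal (W x)) \<longlongrightarrow> top) (to_boundary U)" using W_compact by (simp add: compact_function_def)
  then have "\<forall>\<^sub>F x in to_boundary U. ereal c < ereal (W x)" using assms by (rule order_tendstoD(1))
  moreover have "eventually P (to_boundary U) \<longleftrightarrow> (\<exists>K\<in>{K. compact K \<and> K \<subseteq> U}. eventually P (principal (U - K)))" for P
    unfolding to_boundary_def
  proof (rule eventually_INF_base)
    show "{K. compact K \<and> K \<subseteq> U} \<noteq> {}" using compact_empty by blast
    fix K L assume "K \<in> {K. compact K \<and> K \<subseteq> U}" "L \<in> {K. compact K \<and> K \<subseteq> U}"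
    then show "\<exists>x\<in>{K. compact K \<and> K \<subseteq> U}. principal (U - x) \<le> inf (principal (U - K)) (principal (U - L))"
      by (intro bexI[of _ "K \<union> L"]) (auto intro: compact_Un)
  qed
  ultimately obtain K where K: "compact K" "K \<subseteq> U" "\<And>x. x \<in> U - K \<Longrightarrow> c < W x"
    by (auto simp: eventually_principal)
  have "closed (K \<inter> W -` {..c})"
    by (rule continuous_closed_preimage) (use K W_cont continuous_on_subset compact_imp_closed in auto)
  then have "compact (K \<inter> (K \<inter> W -` {..c}))" by (rule compact_Int_closed[OF K(1)])
  moreover have "K \<inter> (K \<inter> W -` {..c}) = sublevel c" using K(2,3) by (force simp: not_less[symmetric])
  ultimately show ?thesis by simp
qed

lemma between: "ereal c < top \<Longrightarrow> \<exists>c'>c. ereal c' < top"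
  using ereal_dense2[of "ereal c" top] by auto

text \<open>The supremum of \<open>W\<close> may be infinite and is not attained; finite levels approach it.\<close>

lemma exhaustion:
  assumes "ereal r < top"
  shows "\<exists>c. \<forall>n::nat. r \<le> c n \<and> ereal (c n) < top \<and> (\<forall>x\<in>U. \<forall>\<^sub>F n in sequentially. W x < c n)"
proof -
  obtain u :: "nat \<Rightarrow> ereal" where u: "\<And>n. u n < top" "u \<longlonglongrightarrow> top"
    using approx_from_below_dense_linorder[OF assms] by blast
  define c where "c n = max r (real_of_ereal (max (u n) (ereal r)))" for n
  have fin: "max (u n) (ereal r) = ereal (real_of_ereal (max (u n) (ereal r)))" for n
    using u(1)[of n] assms by (cases "u n") (auto simp: max_def)
  have c: "ereal (c n) = max (u n) (ereal r)" for n
    unfolding c_def by (subst (2) fin) (metis fin ereal_max max.cobounded2 max.absorb2)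
  have "r \<le> c n \<and> ereal (c n) < top \<and> (\<forall>x\<in>U. \<forall>\<^sub>F n in sequentially. W x < c n)" for n
  proof (intro conjI ballI)
    show "r \<le> c n" by (simp add: c_def)
    show "ereal (c n) < top" unfolding c using u(1) assms by simp
    fix x assume "x \<in> U"
    have "\<forall>\<^sub>F n in sequentially. ereal (W x) < u n"
      by (rule order_tendstoD(1)[OF u(2) W_less_top[OF \<open>x \<in> U\<close>]])
    then show "\<forall>\<^sub>F n in sequentially. W x < c n"
    proof eventually_elim
      case (elim n)
      then have "ereal (W x) < ereal (c n)" unfolding c by (simp add: less_max_iff_disj)
      then show ?case by simp
    qed
  qed
  then show ?thesis by blast
qed

lemma level_sets:
  assumes "\<mu> \<in> prob_measures U"
  shows "{x \<in> U. W x \<le> c} \<in> sets \<mu>" "{x \<in> U. c \<le> W x} \<in> sets \<mu>" "{x \<in> U. c \<le> W x \<and> W x \<le> d} \<in> sets \<mu>"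
proof -
  have m[measurable]: "W \<in> borel_measurable \<mu>" by (rule prob_measures_measurable[OF assms W_cont])
  have "{x \<in> space \<mu>. W x \<le> c} \<in> sets \<mu>" "{x \<in> space \<mu>. c \<le> W x} \<in> sets \<mu>"
    "{x \<in> space \<mu>. c \<le> W x \<and> W x \<le> d} \<in> sets \<mu>" by measurable
  then show "{x \<in> U. W x \<le> c} \<in> sets \<mu>" "{x \<in> U. c \<le> W x} \<in> sets \<mu>" "{x \<in> U. c \<le> W x \<and> W x \<le> d} \<in> sets \<mu>"
    by (simp_all add: prob_measures_space[OF assms])
qed

lemma superlevel_limit:
  assumes \<mu>: "\<mu> \<in> prob_measures U" and c: "\<And>x. x \<in> U \<Longrightarrow> \<forall>\<^sub>F n in sequentially. W x < c n"
  shows "(\<lambda>n. measure \<mu> {x \<in> U. r \<le> W x \<and> W x \<le> c n}) \<longlonglongrightarrow> measure \<mu> {x \<in> U. r \<le> W x}"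
    "(\<lambda>n. measure \<mu> {x \<in> U. c n \<le> W x}) \<longlonglongrightarrow> 0"
proof -
  interpret prob_space \<mu> using \<mu> by (simp add: prob_measures_def)
  note ls = level_sets[OF \<mu>]
  have "(\<lambda>n. integral\<^sup>L \<mu> (indicat_real {x \<in> U. r \<le> W x \<and> W x \<le> c n})) \<longlonglongrightarrow> integral\<^sup>L \<mu> (indicator {x \<in> U. r \<le> W x})"
  proof (rule integral_dominated_convergence[where w="\<lambda>_. 1"])
    show "AE x in \<mu>. (\<lambda>n. indicat_real {x \<in> U. r \<le> W x \<and> W x \<le> c n} x) \<longlonglongrightarrow> indicator {x \<in> U. r \<le> W x} x"
    proof (rule AE_I2, rule tendsto_eventually)
      fix x assume "x \<in> space \<mu>"
      then have x: "x \<in> U" by (simp add: prob_measures_space[OF \<mu>])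
      show "\<forall>\<^sub>F n in sequentially. indicat_real {x \<in> U. r \<le> W x \<and> W x \<le> c n} x = indicator {x \<in> U. r \<le> W x} x"
        using c[OF x] by eventually_elim (auto simp: indicator_def)
    qed
  qed (use ls in \<open>auto simp: indicator_def\<close>)
  then show "(\<lambda>n. measure \<mu> {x \<in> U. r \<le> W x \<and> W x \<le> c n}) \<longlonglongrightarrow> measure \<mu> {x \<in> U. r \<le> W x}"
    using ls by simp
  have "(\<lambda>n. integral\<^sup>L \<mu> (indicat_real {x \<in> U. c n \<le> W x})) \<longlonglongrightarrow> integral\<^sup>L \<mu> (\<lambda>x. 0)"
  proof (rule integral_dominated_convergence[where w="\<lambda>_. 1"])
    show "AE x in \<mu>. (\<lambda>n. indicat_real {x \<in> U. c n \<le> W x} x) \<longlonglongrightarrow> 0"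
    proof (rule AE_I2, rule tendsto_eventually)
      fix x assume "x \<in> space \<mu>"
      then have x: "x \<in> U" by (simp add: prob_measures_space[OF \<mu>])
      show "\<forall>\<^sub>F n in sequentially. indicat_real {x \<in> U. c n \<le> W x} x = 0"
        using c[OF x] by eventually_elim (auto simp: indicator_def)
    qed
  qed (use ls in \<open>auto simp: indicator_def\<close>)
  then show "(\<lambda>n. measure \<mu> {x \<in> U. c n \<le> W x}) \<longlonglongrightarrow> 0"
    using ls by simp
qed

text \<open>Integrate the generator applied to \<open>F \<circ> W\<close>, where \<open>F'\<close> rises on \<open>[\<rho>, r]\<close>, equals \<open>1\<close> on \<open>[r, c]\<close> and
  falls afterwards.  The gain is \<open>\<gamma>\<close> times the mass of the slab; the loss is confined to
  \<open>\<rho> < W < r\<close>, since where \<open>F'\<close> falls the second-order term has the good sign.  Hence the constant depends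
  on \<open>r\<close> but not on \<open>c\<close>.\<close>

lemma slab_estimate:
  assumes r: "\<rho> < r" "ereal r < top"
  shows "\<exists>C\<ge>0. \<forall>A\<in>\<A>. \<forall>\<mu> e c. stationary_measure U V A \<mu> \<longrightarrow> 0 \<le> e \<longrightarrow>
      (\<forall>x\<in>sublevel r. \<forall>i j. \<bar>A x $ i $ j\<bar> \<le> e) \<longrightarrow> r \<le> c \<longrightarrow> ereal c < top \<longrightarrow>
      measure \<mu> {x \<in> U. r \<le> W x \<and> W x \<le> c} \<le> C * e"
proof -
  from smooth_step[OF r(1)] obtain \<theta> \<theta>' where \<theta>: "\<And>s. (\<theta> has_real_derivative \<theta>' s) (at s)"
    "continuous_on UNIV \<theta>'" "\<And>s. 0 \<le> \<theta>' s" "\<And>s. 0 \<le> \<theta> s \<and> \<theta> s \<le> 1" "\<And>s. s \<le> \<rho> \<Longrightarrow> \<theta> s = 0"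
    "\<And>s. r \<le> s \<Longrightarrow> \<theta> s = 1" "\<And>s. s \<le> \<rho> \<or> r \<le> s \<Longrightarrow> \<theta>' s = 0" by blast
  obtain M where M: "M \<ge> 0" "\<And>s. \<theta>' s \<le> M"
  proof -
    have "bounded (\<theta>' ` {\<rho>..r})"
      by (intro compact_imp_bounded compact_continuous_image continuous_on_subset[OF \<theta>(2)]) auto
    then obtain m where m: "\<forall>y\<in>\<theta>' ` {\<rho>..r}. \<bar>y\<bar> \<le> m" unfolding bounded_real by blast
    have "\<theta>' s \<le> max m 0" for s
    proof (cases "s \<in> {\<rho>..r}")
      case True
      then have "\<bar>\<theta>' s\<bar> \<le> m" using m by blast
      then show ?thesis by (simp add: le_max_iff_disj)
    qed (use \<theta>(7)[of s] in auto)
    then show ?thesis by (rule that[of "max m 0", rotated]) simp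
  qed
  let ?q = "\<lambda>x. \<Sum>i\<in>UNIV. \<Sum>j\<in>UNIV. \<bar>grad W x $ i\<bar> * \<bar>grad W x $ j\<bar>"
  note WD = C_k_on_2_D[OF open_U W_C2]
  obtain B where B: "B \<ge> 0" "\<And>x. x \<in> sublevel r \<Longrightarrow> ?q x \<le> B"
  proof -
    have "continuous_on U ?q"
      using WD(4) unfolding grad_def by (intro continuous_intros continuous_on_sum) auto
    then have "bounded (?q ` sublevel r)"
      by (intro compact_imp_bounded compact_continuous_image compact_sublevel r(2)) (rule continuous_on_subset, auto)
    then obtain m where m: "\<forall>y\<in>?q ` sublevel r. \<bar>y\<bar> \<le> m" unfolding bounded_real by blast
    have "?q x \<le> max m 0" if "x \<in> sublevel r" for x
    proof -
      have "\<bar>?q x\<bar> \<le> m" using m that by blast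
      then show ?thesis by (simp add: le_max_iff_disj)
    qed
    then show ?thesis by (intro that[of "max m 0"] max.cobounded2)
  qed
  show ?thesis
  proof (intro exI[of _ "M * B / \<gamma>"] conjI ballI allI impI)
    show "0 \<le> M * B / \<gamma>" using M B \<gamma> by simp
    fix A \<mu> e c
    assume A: "A \<in> \<A>" and \<mu>: "stationary_measure U V A \<mu>" and e: "0 \<le> e"
      and small: "\<forall>x\<in>sublevel r. \<forall>i j. \<bar>A x $ i $ j\<bar> \<le> e" and c: "r \<le> c" "ereal c < top"
    have P: "\<mu> \<in> prob_measures U" using \<mu> by (simp add: stationary_measure_def)
    interpret prob_space \<mu> using P by (simp add: prob_measures_def)
    obtain d where d: "c < d" "ereal d < top" using between[OF c(2)] by blast
    from smooth_step[OF d(1)] obtain \<eta> \<eta>' where \<eta>: "\<And>s. (\<eta> has_real_derivative \<eta>' s) (at s)"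
      "continuous_on UNIV \<eta>'" "\<And>s. 0 \<le> \<eta>' s" "\<And>s. 0 \<le> \<eta> s \<and> \<eta> s \<le> 1" "\<And>s. s \<le> c \<Longrightarrow> \<eta> s = 0"
      "\<And>s. d \<le> s \<Longrightarrow> \<eta> s = 1" "\<And>s. s \<le> c \<or> d \<le> s \<Longrightarrow> \<eta>' s = 0" by blast
    \<comment> \<open>the first and second derivative of \<open>F\<close>\<close>
    define F1 where "F1 s = \<theta> s * (1 - \<eta> s)" for s
    define F2 where "F2 s = \<theta>' s * (1 - \<eta> s) - \<theta> s * \<eta>' s" for s
    have cont: "continuous_on UNIV \<theta>" "continuous_on UNIV \<eta>"
      using \<theta>(1) \<eta>(1) by (auto intro!: continuous_at_imp_continuous_on DERIV_isCont)
    have F12: "(F1 has_real_derivative F2 s) (at s)" for s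
      unfolding F1_def[abs_def] F2_def by (auto intro!: derivative_eq_intros \<theta>(1) \<eta>(1))
    have F2c: "continuous_on UNIV F2"
      unfolding F2_def[abs_def] by (intro continuous_intros cont \<theta> \<eta>)
    have F1c: "continuous_on UNIV F1"
      unfolding F1_def[abs_def] by (intro continuous_intros cont)
    obtain F where F: "\<And>s. s > -1 \<Longrightarrow> (F has_real_derivative F1 s) (at s)"
      using antiderivative_exists[OF F1c] by blast
    have Fconst: "F s = F d" if "d \<le> s" for s
    proof -
      have "\<exists>k. \<forall>x\<in>{d..}. F x = k"
      proof (rule has_field_derivative_zero_constant)
        fix x assume x: "x \<in> {d..}"
        have "F1 x = 0" using \<eta>(6) x by (simp add: F1_def)
        moreover have "x > -1" using x d c r \<rho> by simp
        ultimately show "(F has_field_derivative 0) (at x within {d..})"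
          using F[of x] by (simp add: has_field_derivative_at_within)
      qed simp
      then show ?thesis using that by force
    qed
    let ?G = "\<lambda>s. F s - F d"
    have G: "(?G has_real_derivative F1 (W x)) (at (W x))" if "x \<in> U" for x
      using F[of "W x"] W_nonneg[OF that] by (auto intro!: derivative_eq_intros)
    have comp1: "C_k_on 2 U (\<lambda>x. ?G (W x))"
      by (rule C_2_compose_real(1)[OF open_U W_C2 G F12 F2c])
    have comp2: "partial_deriv i (\<lambda>x. ?G (W x)) x = F1 (W x) * partial_deriv i W x" if "x \<in> U" for x i
      by (rule C_2_compose_real(2)[OF open_U W_C2 G F12 F2c that])
    have comp3: "partial_deriv i (partial_deriv j (\<lambda>x. ?G (W x))) x =
       F2 (W x) * partial_deriv i W x * partial_deriv j W x + F1 (W x) * partial_deriv i (partial_deriv j W) x"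
      if "x \<in> U" for x i j
      by (rule C_2_compose_real(3)[OF open_U W_C2 G F12 F2c that])
    \<comment> \<open>normalised to vanish above level \<open>d\<close>, and therefore compactly supported\<close>
    define f where "f x = (if x \<in> U then ?G (W x) else 0)" for x
    have fU: "f x = ?G (W x)" if "x \<in> U" for x using that by (simp add: f_def)
    have f0: "f x = 0" if "x \<notin> sublevel d" for x
      using that Fconst[of "W x"] by (auto simp: f_def)
    have fC: "C_k_on 2 U f" by (rule C_k_on_cong[OF open_U _ comp1]) (simp add: f_def)
    have fC': "C_k_on 2 UNIV f"
      by (rule C_k_on_extend_zero[OF open_U compact_sublevel[OF d(2)] _ fC f0]) auto
    have p1: "partial_deriv i f x = F1 (W x) * partial_deriv i W x" if "x \<in> U" for x i
      using partial_deriv_cong[OF open_U that fU] comp2[OF that] by simp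
    have p2: "partial_deriv i (partial_deriv j f) x =
       F2 (W x) * partial_deriv i W x * partial_deriv j W x + F1 (W x) * partial_deriv i (partial_deriv j W) x" if "x \<in> U" for x i j
    proof -
      have "partial_deriv i (partial_deriv j f) x = partial_deriv i (partial_deriv j (\<lambda>x. ?G (W x))) x"
        by (rule partial_deriv_cong[OF open_U that], rule partial_deriv_cong[OF open_U _ fU])
      then show ?thesis using comp3[OF that] by simp
    qed
    have gen: "generator V A f x = F1 (W x) * generator V A W x + F2 (W x) * (grad W x \<bullet> (A x *v grad W x))"
      if "x \<in> U" for x
      by (rule generator_compose) (rule p1[OF that], rule p2[OF that])
    have zero: "(LINT x|\<mu>. generator V A f x) = 0"
      by (rule stationary_measure_C2[OF open_U \<A>_cont[OF A] V \<mu> compact_sublevel[OF d(2)] _ f0 fC']) auto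
    have int: "integrable \<mu> (generator V A f)"
    proof (rule bounded_cont_integrable[OF P], rule bounded_cont_compact_support[OF _ compact_sublevel[OF d(2)]])
      show "continuous_on U (generator V A f)" by (rule continuous_on_generator[OF \<A>_cont[OF A] V fC])
      show "generator V A f x = 0" if "x \<in> U - sublevel d" for x
      proof -
        have "x \<in> U" "d \<le> W x" using that by auto
        then have "F1 (W x) = 0" "F2 (W x) = 0"
          using \<eta>(6,7)[of "W x"] by (auto simp: F1_def F2_def)
        then show ?thesis using gen[OF \<open>x \<in> U\<close>] by simp
      qed
    qed auto
    let ?E = "{x \<in> U. r \<le> W x \<and> W x \<le> c}"
    have pw: "generator V A f x \<le> M * B * e - \<gamma> * indicator ?E x" if x: "x \<in> U" for x
    proof (cases "W x \<le> \<rho>")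
      case True
      then have "F1 (W x) = 0" "F2 (W x) = 0" "x \<notin> ?E"
        using \<theta>(5,7)[of "W x"] r by (auto simp: F1_def F2_def)
      then show ?thesis using gen[OF x] M B e by simp
    next
      case False
      let ?Q = "grad W x \<bullet> (A x *v grad W x)"
      have Q0: "0 \<le> ?Q" by (rule \<A>_nonneg[OF A x])
      have F10: "0 \<le> F1 (W x)" using \<theta>(4)[of "W x"] \<eta>(4)[of "W x"] by (simp add: F1_def)
      have "F1 (W x) * generator V A W x \<le> F1 (W x) * (- \<gamma>)"
        using drift[OF A x] False F10 by (intro mult_left_mono) auto
      also have "\<dots> \<le> - \<gamma> * indicator ?E x"
        using F10 \<gamma> \<theta>(6)[of "W x"] \<eta>(5)[of "W x"] by (auto simp: indicator_def F1_def)
      finally have 1: "F1 (W x) * generator V A W x \<le> - \<gamma> * indicator ?E x" .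
      \<comment> \<open>the falling part of \<open>F'\<close> only decreases the second-order term\<close>
      have "F2 (W x) \<le> \<theta>' (W x)"
      proof -
        have "\<theta>' (W x) * (1 - \<eta> (W x)) \<le> \<theta>' (W x) * 1"
          using \<theta>(3) \<eta>(4)[of "W x"] by (intro mult_left_mono) auto
        moreover have "0 \<le> \<theta> (W x) * \<eta>' (W x)" using \<theta>(4) \<eta>(3) by simp
        ultimately show ?thesis by (simp add: F2_def)
      qed
      then have "F2 (W x) * ?Q \<le> \<theta>' (W x) * ?Q" using Q0 by (rule mult_right_mono)
      also have "\<dots> \<le> M * (B * e)"
      proof (cases "W x \<le> r")
        case True
        then have xr: "x \<in> sublevel r" using x by simp
        have "?Q \<le> e * ?q x" by (rule quadratic_form_bound) (use small xr in blast)
        also have "\<dots> \<le> e * B" using B(2)[OF xr] e by (rule mult_left_mono)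
        finally have "?Q \<le> B * e" by (simp add: mult.commute)
        then show ?thesis using M \<theta>(3) Q0 by (intro mult_mono) auto
      next
        case False
        then show ?thesis using \<theta>(7)[of "W x"] M B e by simp
      qed
      finally show ?thesis using 1 gen[OF x] by (simp add: mult.assoc)
    qed
    have Es: "?E \<in> sets \<mu>" by (rule level_sets(3)[OF P])
    have "0 \<le> (LINT x|\<mu>. M * B * e - \<gamma> * indicator ?E x)"
      unfolding zero[symmetric]
    proof (rule integral_mono_AE)
      show "integrable \<mu> (\<lambda>x. M * B * e - \<gamma> * indicator ?E x)"
        using Es by (intro Bochner_Integration.integrable_diff integrable_const integrable_mult_right
          integrable_real_indicator) (auto simp: emeasure_eq_measure)
      show "AE x in \<mu>. generator V A f x \<le> M * B * e - \<gamma> * indicator ?E x"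
        using pw by (intro AE_I2) (simp add: prob_measures_space[OF P])
    qed (rule int)
    also have "\<dots> = M * B * e - \<gamma> * measure \<mu> ?E"
      using Es by (subst Bochner_Integration.integral_diff)
        (auto simp: prob_space emeasure_eq_measure Int_absorb2[OF sets.sets_into_space])
    finally show "measure \<mu> ?E \<le> M * B / \<gamma> * e" using \<gamma> by (simp add: field_simps)
  qed
qed

text \<open>As the bound on the slabs does not depend on the upper level, it passes to the whole superlevel set.\<close>

lemma tail_estimate:
  assumes r: "\<rho> < r" "ereal r < top"
  shows "\<exists>C\<ge>0. \<forall>A\<in>\<A>. \<forall>\<mu> e. stationary_measure U V A \<mu> \<longrightarrow> 0 \<le> e \<longrightarrow>
      (\<forall>x\<in>sublevel r. \<forall>i j. \<bar>A x $ i $ j\<bar> \<le> e) \<longrightarrow> measure \<mu> {x \<in> U. r \<le> W x} \<le> C * e"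
proof -
  obtain C where C: "C \<ge> 0" "\<And>A \<mu> e c. A \<in> \<A> \<Longrightarrow> stationary_measure U V A \<mu> \<Longrightarrow> 0 \<le> e \<Longrightarrow>
      \<forall>x\<in>sublevel r. \<forall>i j. \<bar>A x $ i $ j\<bar> \<le> e \<Longrightarrow> r \<le> c \<Longrightarrow> ereal c < top \<Longrightarrow>
      measure \<mu> {x \<in> U. r \<le> W x \<and> W x \<le> c} \<le> C * e" using slab_estimate[OF r] by blast
  obtain c where c: "\<And>n::nat. r \<le> c n" "\<And>n. ereal (c n) < top" "\<And>x. x \<in> U \<Longrightarrow> \<forall>\<^sub>F n in sequentially. W x < c n"
    using exhaustion[OF r(2)] by blast
  show ?thesis
  proof (intro exI[of _ C] conjI C(1) ballI allI impI)
    fix A \<mu> e assume *: "A \<in> \<A>" "stationary_measure U V A \<mu>" "0 \<le> e" "\<forall>x\<in>sublevel r. \<forall>i j. \<bar>A x $ i $ j\<bar> \<le> e"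
    have P: "\<mu> \<in> prob_measures U" using *(2) by (simp add: stationary_measure_def)
    show "measure \<mu> {x \<in> U. r \<le> W x} \<le> C * e"
    proof (rule LIMSEQ_le_const2[OF superlevel_limit(1)[OF P c(3)]])
      show "\<exists>N. \<forall>n\<ge>N. measure \<mu> {x \<in> U. r \<le> W x \<and> W x \<le> c n} \<le> C * e"
        using C(2)[OF * c(1) c(2)] by (intro exI allI impI)
    qed
  qed
qed

lemma cutoff:
  assumes "a < b" "ereal b < top"
  shows "\<exists>\<zeta>. C_k_on 1 UNIV \<zeta> \<and> (\<forall>x. x \<notin> sublevel b \<longrightarrow> \<zeta> x = 0) \<and> (\<forall>x\<in>U. W x \<le> a \<longrightarrow> \<zeta> x = 1) \<and>
     (\<forall>x. 0 \<le> \<zeta> x \<and> \<zeta> x \<le> 1)"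
proof -
  from smooth_step[OF assms(1)] obtain \<theta> \<theta>' where \<theta>: "\<And>s. (\<theta> has_real_derivative \<theta>' s) (at s)"
    "continuous_on UNIV \<theta>'" "\<And>s. 0 \<le> \<theta> s \<and> \<theta> s \<le> 1" "\<And>s. s \<le> a \<Longrightarrow> \<theta> s = 0"
    "\<And>s. b \<le> s \<Longrightarrow> \<theta> s = 1" by blast
  define \<zeta> where "\<zeta> x = (if x \<in> U then 1 - \<theta> (W x) else 0)" for x
  have W1: "C_k_on 1 U W"
    using C_k_on_2_D[OF open_U W_C2] by (auto simp: C_k_on_1_iff[OF open_U] simp del: C_k_on.simps One_nat_def)
  have "C_k_on 1 U (\<lambda>x. (\<lambda>s. 1 - \<theta> s) (W x))"
  proof (rule C_1_compose_real[OF open_U W1])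
    show "((\<lambda>s. 1 - \<theta> s) has_real_derivative (\<lambda>s. - \<theta>' s) (W x)) (at (W x))" for x
      by (auto intro!: derivative_eq_intros \<theta>(1))
    show "continuous_on (W ` U) (\<lambda>s. - \<theta>' s)"
      by (intro continuous_intros continuous_on_subset[OF \<theta>(2)]) simp
  qed
  then have \<zeta>U: "C_k_on 1 U \<zeta>" by (rule C_k_on_cong[OF open_U, rotated]) (simp add: \<zeta>_def)
  have \<zeta>0: "\<zeta> x = 0" if "x \<notin> sublevel b" for x using that \<theta>(5)[of "W x"] by (auto simp: \<zeta>_def)
  have "C_k_on 1 UNIV \<zeta>"
    by (rule C_k_on_extend_zero[OF open_U compact_sublevel[OF assms(2)] _ \<zeta>U \<zeta>0]) auto
  then show ?thesis
    using \<zeta>0 \<theta>(3,4) by (intro exI[of _ \<zeta>]) (auto simp: \<zeta>_def)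
qed

end

section \<open>Null sequences and their limit measures\<close>

lemma C_k_on_continuous: "C_k_on 1 UNIV \<zeta> \<Longrightarrow> continuous_on S \<zeta>"
  by (auto intro: continuous_on_subset differentiable_imp_continuous_on)

locale stationary_sequence = lyapunov U V \<A> W \<rho> \<gamma>
  for U :: "(real^'n::finite) set" and V \<A> W \<rho> \<gamma> +
  fixes B :: "nat \<Rightarrow> real^'n \<Rightarrow> real^'n^'n" and \<nu> :: "nat \<Rightarrow> (real^'n) measure"
  assumes B_in: "\<And>l. B l \<in> \<A>" and stationary: "\<And>l. stationary_measure U V (B l) (\<nu> l)"
    and B_null: "\<And>K e. compact K \<Longrightarrow> K \<subseteq> U \<Longrightarrow> e > 0 \<Longrightarrow> \<forall>\<^sub>F l in sequentially. \<forall>x\<in>K. \<forall>i j. \<bar>B l x $ i $ j\<bar> \<le> e"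
begin

lemma \<nu>_prob: "\<nu> l \<in> prob_measures U"
  using stationary by (simp add: stationary_measure_def)

lemma superlevel_null:
  assumes r: "\<rho> < r" "ereal r < top"
  shows "(\<lambda>l. measure (\<nu> l) {x \<in> U. r \<le> W x}) \<longlonglongrightarrow> 0"
proof -
  obtain C where C: "C \<ge> 0" "\<And>A \<mu> e. A \<in> \<A> \<Longrightarrow> stationary_measure U V A \<mu> \<Longrightarrow> 0 \<le> e \<Longrightarrow>
      \<forall>x\<in>sublevel r. \<forall>i j. \<bar>A x $ i $ j\<bar> \<le> e \<Longrightarrow> measure \<mu> {x \<in> U. r \<le> W x} \<le> C * e"
    using tail_estimate[OF r] by blast
  show ?thesis
  proof (rule tendstoI)
    fix e :: real assume e: "e > 0"
    define e' where "e' = e / (C + 1) / 2"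
    have e': "e' > 0" using e C(1) by (simp add: e'_def)
    have "C * e' \<le> (C + 1) * e'" using e' by simp
    also have "\<dots> = e / 2"
    proof -
      have "q * (e / q / 2) = e / 2" if "q > 0" for q :: real using that by simp
      from this[of "C + 1"] show ?thesis unfolding e'_def using C(1) by simp
    qed
    finally have Ce: "C * e' < e" using e by simp
    have "sublevel r \<subseteq> U" by auto
    from B_null[OF compact_sublevel[OF r(2)] this e']
    show "\<forall>\<^sub>F l in sequentially. dist (measure (\<nu> l) {x \<in> U. r \<le> W x}) 0 < e"
    proof eventually_elim
      case (elim l)
      from C(2)[OF B_in stationary less_imp_le[OF e'] elim] Ce
      show ?case by simp
    qed
  qed
qed

text \<open>All but finitely many members of the sequence have small mass above one level \<open>r > \<rho>\<close>; each
  of the remaining ones has small mass above some level of its own.  One minus a cutoff function expresses this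
  smallness by a continuous function.\<close>

lemma tight:
  assumes \<epsilon>: "\<epsilon> > 0"
  shows "\<exists>K f. compact K \<and> K \<subseteq> U \<and> f \<in> bounded_cont U \<and> (\<forall>x\<in>U. 0 \<le> f x) \<and> (\<forall>x\<in>U - K. 1 \<le> f x) \<and>
    (\<forall>\<mu>\<in>range \<nu>. integral\<^sup>L \<mu> f \<le> \<epsilon>)"
proof -
  obtain r where r: "\<rho> < r" "ereal r < top" using between[OF \<rho>(2)] by blast
  obtain cs where cs: "\<And>n::nat. r \<le> cs n" "\<And>n. ereal (cs n) < top" "\<And>x. x \<in> U \<Longrightarrow> \<forall>\<^sub>F n in sequentially. W x < cs n"
    using exhaustion[OF r(2)] by blast
  have "\<forall>l. \<exists>c. ereal c < top \<and> measure (\<nu> l) {x \<in> U. c \<le> W x} \<le> \<epsilon>"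
  proof
    fix l
    have "\<forall>\<^sub>F n in sequentially. measure (\<nu> l) {x \<in> U. cs n \<le> W x} < \<epsilon>"
      by (rule order_tendstoD(2)[OF superlevel_limit(2)[OF \<nu>_prob cs(3)] \<epsilon>])
    then obtain n where "measure (\<nu> l) {x \<in> U. cs n \<le> W x} < \<epsilon>" unfolding eventually_sequentially by blast
    then show "\<exists>c. ereal c < top \<and> measure (\<nu> l) {x \<in> U. c \<le> W x} \<le> \<epsilon>" using cs(2) by (intro exI[of _ "cs n"]) simp
  qed
  from choice[OF this] obtain cl where cl: "\<And>l. ereal (cl l) < top" "\<And>l. measure (\<nu> l) {x \<in> U. cl l \<le> W x} \<le> \<epsilon>" by blast
  have "\<forall>\<^sub>F l in sequentially. measure (\<nu> l) {x \<in> U. r \<le> W x} < \<epsilon>"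
    by (rule order_tendstoD(2)[OF superlevel_null[OF r] \<epsilon>])
  then obtain l0 where l0: "\<And>l. l \<ge> l0 \<Longrightarrow> measure (\<nu> l) {x \<in> U. r \<le> W x} < \<epsilon>" unfolding eventually_sequentially by blast
  define c where "c = Max (insert r (cl ` {..<l0}))"
  have fin: "finite (insert r (cl ` {..<l0}))" by simp
  have "c \<in> insert r (cl ` {..<l0})" unfolding c_def by (rule Max_in[OF fin]) simp
  then have ct: "ereal c < top" using r(2) cl(1) by auto
  have cr: "r \<le> c" "l < l0 \<Longrightarrow> cl l \<le> c" for l unfolding c_def by (auto intro: Max_ge[OF fin])
  have mc: "measure (\<nu> l) {x \<in> U. c \<le> W x} \<le> \<epsilon>" for l
  proof -
    interpret prob_space "\<nu> l" using \<nu>_prob by (simp add: prob_measures_def)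
    show ?thesis
    proof (cases "l < l0")
      case True
      have "measure (\<nu> l) {x \<in> U. c \<le> W x} \<le> measure (\<nu> l) {x \<in> U. cl l \<le> W x}"
        by (rule finite_measure_mono[OF _ level_sets(2)[OF \<nu>_prob]]) (use cr(2)[OF True] in auto)
      then show ?thesis using cl(2)[of l] by simp
    next
      case False
      have "measure (\<nu> l) {x \<in> U. c \<le> W x} \<le> measure (\<nu> l) {x \<in> U. r \<le> W x}"
        by (rule finite_measure_mono[OF _ level_sets(2)[OF \<nu>_prob]]) (use cr(1) in auto)
      then show ?thesis using l0[of l] False by simp
    qed
  qed
  obtain b where b: "c < b" "ereal b < top" using between[OF ct] by blast
  from cutoff[OF b] obtain \<zeta> where \<zeta>: "C_k_on 1 UNIV \<zeta>" "\<forall>x. x \<notin> sublevel b \<longrightarrow> \<zeta> x = 0"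
    "\<forall>x\<in>U. W x \<le> c \<longrightarrow> \<zeta> x = 1" "\<forall>x. 0 \<le> \<zeta> x \<and> \<zeta> x \<le> 1" by blast
  have fb: "(\<lambda>x. 1 - \<zeta> x) \<in> bounded_cont U"
    by (rule bounded_contI[of _ _ 1]) (use \<zeta>(4) in \<open>auto intro!: continuous_intros C_k_on_continuous[OF \<zeta>(1)]\<close>)
  show ?thesis
  proof (intro exI[of _ "sublevel b"] exI[of _ "\<lambda>x. 1 - \<zeta> x"] conjI ballI fb compact_sublevel b)
    fix \<mu> assume "\<mu> \<in> range \<nu>"
    then obtain l where l: "\<mu> = \<nu> l" by blast
    interpret prob_space "\<nu> l" using \<nu>_prob by (simp add: prob_measures_def)
    have "integral\<^sup>L (\<nu> l) (\<lambda>x. 1 - \<zeta> x) \<le> integral\<^sup>L (\<nu> l) (indicator {x \<in> U. c \<le> W x})"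
    proof (rule integral_mono_AE)
      show "AE x in \<nu> l. 1 - \<zeta> x \<le> indicator {x \<in> U. c \<le> W x} x"
        using \<zeta>(3,4) by (intro AE_I2) (auto simp: prob_measures_space[OF \<nu>_prob] indicator_def)
    qed (use bounded_cont_integrable[OF \<nu>_prob fb] level_sets(2)[OF \<nu>_prob] in
        \<open>auto simp: emeasure_eq_measure intro!: integrable_real_indicator\<close>)
    also have "\<dots> = measure (\<nu> l) {x \<in> U. c \<le> W x}" using level_sets(2)[OF \<nu>_prob] by simp
    finally show "integral\<^sup>L \<mu> (\<lambda>x. 1 - \<zeta> x) \<le> \<epsilon>" using mc[of l] l by simp
  qed (use \<zeta> in auto)
qed

theorem relatively_compact: "compactin (weak_topology U) (weak_topology U closure_of range \<nu>)"
  by (rule prokhorov[OF open_U _ tight]) (auto simp: \<nu>_prob)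

end

lemma limitin_weak_topology_D:
  assumes "limitin (weak_topology U) \<nu> \<mu> F"
  shows "\<mu> \<in> prob_measures U" "f \<in> bounded_cont U \<Longrightarrow> ((\<lambda>l. integral\<^sup>L (\<nu> l) f) \<longlongrightarrow> integral\<^sup>L \<mu> f) F"
proof -
  show \<mu>: "\<mu> \<in> prob_measures U" using limitin_topspace[OF assms] by (simp add: topspace_weak_topology)
  assume f: "f \<in> bounded_cont U"
  show "((\<lambda>l. integral\<^sup>L (\<nu> l) f) \<longlongrightarrow> integral\<^sup>L \<mu> f) F"
  proof (rule topological_tendstoI)
    fix S :: "real set" assume S: "open S" "integral\<^sup>L \<mu> f \<in> S"
    have "openin (weak_topology U) {\<kappa> \<in> topspace (weak_topology U). integral\<^sup>L \<kappa> f \<in> S}"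
      by (rule openin_continuous_map_preimage[OF continuous_map_integral[OF f]]) (use S in simp)
    moreover have "\<mu> \<in> {\<kappa> \<in> topspace (weak_topology U). integral\<^sup>L \<kappa> f \<in> S}"
      using \<mu> S by (simp add: topspace_weak_topology)
    ultimately have "\<forall>\<^sub>F l in F. \<nu> l \<in> {\<kappa> \<in> topspace (weak_topology U). integral\<^sup>L \<kappa> f \<in> S}"
      using assms unfolding limitin_def by blast
    then show "\<forall>\<^sub>F l in F. integral\<^sup>L (\<nu> l) f \<in> S" by eventually_elim simp
  qed
qed

locale limit_of_stationary = stationary_sequence U V \<A> W \<rho> \<gamma> B \<nu>
  for U :: "(real^'n::finite) set" and V \<A> W \<rho> \<gamma> B \<nu> +
  fixes \<mu> :: "(real^'n) measure"
  assumes limit: "limitin (weak_topology U) \<nu> \<mu> sequentially"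
begin

lemma \<mu>_prob: "\<mu> \<in> prob_measures U"
  by (rule limitin_weak_topology_D(1)[OF limit])

text \<open>A continuous function that vanishes on \<open>{W \<le> r}\<close> and equals \<open>1\<close> outside \<open>{W \<le> b}\<close> has integrals tending to zero.
  Levels \<open>b\<close> decreasing to \<open>\<rho>\<close> give the claim.\<close>

lemma AE_sublevel: "AE x in \<mu>. W x \<le> \<rho>"
proof -
  have AEb: "AE x in \<mu>. W x \<le> b" if b: "\<rho> < b" "ereal b < top" for b
  proof -
    define r where "r = (\<rho> + b) / 2"
    have r: "\<rho> < r" "r < b" using b by (auto simp: r_def)
    then have rt: "ereal r < top" using b(2) by (meson ereal_less(2) less_ereal.simps(1) less_trans)
    from cutoff[OF r(2) b(2)] obtain \<zeta> where \<zeta>: "C_k_on 1 UNIV \<zeta>" "\<forall>x. x \<notin> sublevel b \<longrightarrow> \<zeta> x = 0"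
      "\<forall>x\<in>U. W x \<le> r \<longrightarrow> \<zeta> x = 1" "\<forall>x. 0 \<le> \<zeta> x \<and> \<zeta> x \<le> 1" by blast
    have fb: "(\<lambda>x. 1 - \<zeta> x) \<in> bounded_cont U"
      by (rule bounded_contI[of _ _ 1]) (use \<zeta>(4) in \<open>auto intro!: continuous_intros C_k_on_continuous[OF \<zeta>(1)]\<close>)
    have le: "integral\<^sup>L (\<nu> l) (\<lambda>x. 1 - \<zeta> x) \<le> measure (\<nu> l) {x \<in> U. r \<le> W x}" for l
    proof -
      interpret prob_space "\<nu> l" using \<nu>_prob by (simp add: prob_measures_def)
      have "integral\<^sup>L (\<nu> l) (\<lambda>x. 1 - \<zeta> x) \<le> integral\<^sup>L (\<nu> l) (indicator {x \<in> U. r \<le> W x})"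
      proof (rule integral_mono_AE)
        show "AE x in \<nu> l. 1 - \<zeta> x \<le> indicator {x \<in> U. r \<le> W x} x"
          using \<zeta>(3,4) by (intro AE_I2) (auto simp: prob_measures_space[OF \<nu>_prob] indicator_def)
      qed (use bounded_cont_integrable[OF \<nu>_prob fb] level_sets(2)[OF \<nu>_prob] in
        \<open>auto simp: emeasure_eq_measure intro!: integrable_real_indicator\<close>)
      also have "\<dots> = measure (\<nu> l) {x \<in> U. r \<le> W x}" using level_sets(2)[OF \<nu>_prob] by simp
      finally show ?thesis .
    qed
    have "integral\<^sup>L \<mu> (\<lambda>x. 1 - \<zeta> x) \<le> 0"
      by (rule LIMSEQ_le[OF limitin_weak_topology_D(2)[OF limit fb] superlevel_null[OF r(1) rt]]) (use le in blast)
    moreover have "0 \<le> integral\<^sup>L \<mu> (\<lambda>x. 1 - \<zeta> x)" using \<zeta>(4) by (intro integral_nonneg_AE AE_I2) auto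
    ultimately have "integral\<^sup>L \<mu> (\<lambda>x. 1 - \<zeta> x) = 0" by simp
    then have "AE x in \<mu>. 1 - \<zeta> x = 0"
      using integral_nonneg_eq_0_iff_AE[OF bounded_cont_integrable[OF \<mu>_prob fb]] \<zeta>(4) by simp
    then show ?thesis using AE_space
    proof eventually_elim
      case (elim x)
      then have "\<zeta> x \<noteq> 0" "x \<in> U" by (auto simp: prob_measures_space[OF \<mu>_prob])
      then show ?case using \<zeta>(2) by blast
    qed
  qed
  obtain b where b: "\<rho> < b" "ereal b < top" using between[OF \<rho>(2)] by blast
  let ?b = "\<lambda>n. \<rho> + (b - \<rho>) * inverse (real (Suc n))"
  have bn: "\<rho> < ?b n" "?b n \<le> b" for n
  proof -
    show "\<rho> < ?b n" using b(1) by simp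
    have "(b - \<rho>) * inverse (real (Suc n)) \<le> (b - \<rho>) * 1" using b(1) by (intro mult_left_mono) (auto simp: field_simps)
    then show "?b n \<le> b" by simp
  qed
  have "AE x in \<mu>. W x \<le> ?b n" for n
    by (rule AEb[OF bn(1)]) (use bn(2)[of n] b(2) in \<open>meson ereal_less_eq(3) le_less_trans\<close>)
  then have "AE x in \<mu>. \<forall>n. W x \<le> ?b n" unfolding AE_all_countable by blast
  then show ?thesis
  proof eventually_elim
    case (elim x)
    have "?b \<longlonglongrightarrow> \<rho> + (b - \<rho>) * 0"
      by (intro tendsto_intros LIMSEQ_inverse_real_of_nat)
    then show ?case using elim by (intro LIMSEQ_le_const[of ?b]) auto
  qed
qed

text \<open>The second-order part of the generator is bounded by the size of the diffusion matrices on the support of \<open>g\<close>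
  and disappears in the limit; the first-order part is a fixed continuous function with compact support.\<close>

lemma drift_integral_test_function:
  assumes g: "test_function U g"
  shows "integral\<^sup>L \<mu> (\<lambda>x. V x \<bullet> grad g x) = 0"
proof -
  let ?K = "closure {x. g x \<noteq> 0}"
  have K: "compact ?K" "?K \<subseteq> U" using g by (auto simp: test_function_def)
  have g2: "C_k_on 2 UNIV g" using g unfolding test_function_def by blast
  have g0: "g x = 0" if "x \<notin> ?K" for x using that closure_subset[of "{x. g x \<noteq> 0}"] by blast
  have p0: "partial_deriv i g x = 0" if "x \<notin> ?K" for x i
    by (rule partial_deriv_outside_support[OF K(1) g0 that])
  have pp0: "partial_deriv i (partial_deriv j g) x = 0" if "x \<notin> ?K" for x i j
    by (rule partial_deriv_outside_support[OF K(1) p0 that])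
  note gD = C_k_on_2_D[OF open_UNIV g2]
  let ?h = "\<lambda>x. V x \<bullet> grad g x"
  have gc: "continuous_on S (grad g)" for S
    unfolding continuous_on_grad_iff using gD(4) continuous_on_subset by blast
  have hb: "?h \<in> bounded_cont U"
    by (rule bounded_cont_compact_support[OF _ K])
       (intro continuous_intros V gc, simp add: inner_vec_def grad_def p0)
  let ?s = "\<lambda>x. \<Sum>i\<in>UNIV. \<Sum>j\<in>UNIV. \<bar>partial_deriv i (partial_deriv j g) x\<bar>"
  have "continuous_on ?K ?s"
    by (intro continuous_intros continuous_on_sum continuous_on_subset[OF gD(5)]) auto
  then have "bounded (?s ` ?K)" by (intro compact_imp_bounded compact_continuous_image K)
  then obtain m where m: "\<forall>y\<in>?s ` ?K. \<bar>y\<bar> \<le> m" unfolding bounded_real by blast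
  define D where "D = max m 0 + 1"
  have D: "D > 0" "?s x \<le> D" for x
  proof -
    show "D > 0" by (simp add: D_def)
    show "?s x \<le> D"
    proof (cases "x \<in> ?K")
      case True
      then have "\<bar>?s x\<bar> \<le> m" using m by blast
      then show ?thesis by (simp add: D_def)
    next
      case False
      then show ?thesis by (simp add: pp0 D_def)
    qed
  qed
  have "(\<lambda>l. integral\<^sup>L (\<nu> l) ?h) \<longlonglongrightarrow> 0"
  proof (rule tendstoI)
    fix e :: real assume e: "e > 0"
    define e' where "e' = e / D / 2"
    have e': "e' > 0" "e' * D < e" using e D(1) by (auto simp: e'_def)
    from B_null[OF K e'(1)]
    show "\<forall>\<^sub>F l in sequentially. dist (integral\<^sup>L (\<nu> l) ?h) 0 < e"
    proof eventually_elim
      case (elim l)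
      interpret prob_space "\<nu> l" using \<nu>_prob by (simp add: prob_measures_def)
      let ?g = "generator V (B l) g"
      have gi: "integrable (\<nu> l) ?g"
        by (rule bounded_cont_integrable[OF \<nu>_prob], rule bounded_cont_compact_support[OF _ K])
           (rule continuous_on_generator[OF \<A>_cont[OF B_in] V C_k_on_subset[OF g2]], simp, simp add: generator_def p0 pp0)
      have hi: "integrable (\<nu> l) ?h" by (rule bounded_cont_integrable[OF \<nu>_prob hb])
      have pw: "\<bar>?h x - ?g x\<bar> \<le> e' * D" for x
      proof (cases "x \<in> ?K")
        case True
        have "\<bar>?h x - ?g x\<bar> = \<bar>\<Sum>i\<in>UNIV. \<Sum>j\<in>UNIV. B l x $ i $ j * partial_deriv i (partial_deriv j g) x\<bar>"
          by (simp add: generator_def inner_vec_def grad_def)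
        also have "\<dots> \<le> (\<Sum>i\<in>UNIV. \<bar>\<Sum>j\<in>UNIV. B l x $ i $ j * partial_deriv i (partial_deriv j g) x\<bar>)"
          by (rule sum_abs)
        also have "\<dots> \<le> (\<Sum>i\<in>UNIV. \<Sum>j\<in>UNIV. e' * \<bar>partial_deriv i (partial_deriv j g) x\<bar>)"
        proof (rule sum_mono)
          fix i
          have "\<bar>\<Sum>j\<in>UNIV. B l x $ i $ j * partial_deriv i (partial_deriv j g) x\<bar> \<le>
              (\<Sum>j\<in>UNIV. \<bar>B l x $ i $ j * partial_deriv i (partial_deriv j g) x\<bar>)" by (rule sum_abs)
          also have "\<dots> \<le> (\<Sum>j\<in>UNIV. e' * \<bar>partial_deriv i (partial_deriv j g) x\<bar>)"
          proof (rule sum_mono)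
            fix j
            show "\<bar>B l x $ i $ j * partial_deriv i (partial_deriv j g) x\<bar> \<le> e' * \<bar>partial_deriv i (partial_deriv j g) x\<bar>"
              unfolding abs_mult using elim True by (intro mult_right_mono) auto
          qed
          finally show "\<bar>\<Sum>j\<in>UNIV. B l x $ i $ j * partial_deriv i (partial_deriv j g) x\<bar> \<le>
            (\<Sum>j\<in>UNIV. e' * \<bar>partial_deriv i (partial_deriv j g) x\<bar>)" .
        qed
        also have "\<dots> = e' * ?s x" by (simp add: sum_distrib_left)
        also have "\<dots> \<le> e' * D" using e'(1) D(2) by (intro mult_left_mono) auto
        finally show ?thesis .
      next
        case False
        then show ?thesis using e' D(1) by (simp add: generator_def inner_vec_def grad_def p0 pp0)
      qed
      have "integral\<^sup>L (\<nu> l) ?g = 0" using stationary g by (simp add: stationary_measure_def)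
      then have "integral\<^sup>L (\<nu> l) ?h = integral\<^sup>L (\<nu> l) (\<lambda>x. ?h x - ?g x)" using gi hi by simp
      also have "\<bar>\<dots>\<bar> \<le> integral\<^sup>L (\<nu> l) (\<lambda>x. \<bar>?h x - ?g x\<bar>)" by (rule integral_abs_bound)
      also have "\<dots> \<le> integral\<^sup>L (\<nu> l) (\<lambda>x. e' * D)" by (rule integral_mono_AE) (use gi hi pw in auto)
      finally show ?case using e'(2) by (simp add: prob_space)
    qed
  qed
  with limitin_weak_topology_D(2)[OF limit hb] show ?thesis by (rule LIMSEQ_unique)
qed

lemma drift_integral_C1:
  assumes K: "compact K" "K \<subseteq> U" and f: "\<And>x. x \<notin> K \<Longrightarrow> f x = 0" "C_k_on 1 UNIV f"
  shows "integral\<^sup>L \<mu> (\<lambda>x. V x \<bullet> grad f x) = 0"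
proof -
  interpret prob_space \<mu> using \<mu>_prob by (simp add: prob_measures_def)
  obtain K' where K': "compact K'" "K' \<subseteq> U" "K \<subseteq> K'"
    "\<And>\<epsilon>. \<epsilon> > 0 \<Longrightarrow> \<exists>g. test_function U g \<and> (\<forall>x. x \<notin> K' \<longrightarrow> g x = 0) \<and>
       (\<forall>x i. \<bar>partial_deriv i g x - partial_deriv i f x\<bar> \<le> \<epsilon>)"
    by (rule test_function_approx_C1[where f=f, OF open_U K f]) (assumption, rule that)
  let ?c = "\<lambda>x. \<Sum>i\<in>UNIV. \<bar>V x $ i\<bar>"
  have "continuous_on K' ?c"
    by (intro continuous_intros continuous_on_sum continuous_on_component continuous_on_subset[OF V K'(2)])
  then have "bounded (?c ` K')" by (intro compact_imp_bounded compact_continuous_image K')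
  then obtain m where m: "\<forall>y\<in>?c ` K'. \<bar>y\<bar> \<le> m" unfolding bounded_real by blast
  define D where "D = max m 0 + 1"
  have D: "D > 0" "x \<in> K' \<Longrightarrow> ?c x \<le> D" for x
  proof -
    show "D > 0" by (simp add: D_def)
    assume "x \<in> K'"
    then have "\<bar>?c x\<bar> \<le> m" using m by blast
    then show "?c x \<le> D" by (simp add: D_def)
  qed
  have int: "integrable \<mu> (\<lambda>x. V x \<bullet> grad h x)" if h: "\<And>x. x \<notin> K' \<Longrightarrow> h x = 0" "C_k_on 1 UNIV h" for h
  proof (rule bounded_cont_integrable[OF \<mu>_prob], rule bounded_cont_compact_support[OF _ K'(1,2)])
    have "continuous_on U (grad h)"
      unfolding continuous_on_grad_iff using h(2) by (auto intro: continuous_on_subset)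
    then show "continuous_on U (\<lambda>x. V x \<bullet> grad h x)" by (intro continuous_intros V)
    show "V x \<bullet> grad h x = 0" if "x \<in> U - K'" for x
      using partial_deriv_outside_support[where f=h, OF K'(1) h(1)] that by (simp add: inner_vec_def grad_def)
  qed
  have f0: "f x = 0" if "x \<notin> K'" for x using f(1) K'(3) that by blast
  have "\<bar>integral\<^sup>L \<mu> (\<lambda>x. V x \<bullet> grad f x)\<bar> \<le> e" if e: "e > 0" for e
  proof -
    obtain g where g: "test_function U g" "\<forall>x. x \<notin> K' \<longrightarrow> g x = 0"
      "\<forall>x i. \<bar>partial_deriv i g x - partial_deriv i f x\<bar> \<le> e / D"
      using K'(4)[of "e / D"] e D(1) by auto
    have g1: "C_k_on 1 UNIV g" using g(1) unfolding test_function_def by blast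
    have pw: "\<bar>V x \<bullet> grad f x - V x \<bullet> grad g x\<bar> \<le> e" for x
    proof (cases "x \<in> K'")
      case True
      have "V x \<bullet> grad f x - V x \<bullet> grad g x = (\<Sum>i\<in>UNIV. V x $ i * (partial_deriv i f x - partial_deriv i g x))"
        by (simp add: inner_vec_def grad_def right_diff_distrib sum_subtractf)
      then have "\<bar>V x \<bullet> grad f x - V x \<bullet> grad g x\<bar> \<le> (\<Sum>i\<in>UNIV. \<bar>V x $ i * (partial_deriv i f x - partial_deriv i g x)\<bar>)"
        by (simp add: sum_abs)
      also have "\<dots> \<le> (\<Sum>i\<in>UNIV. \<bar>V x $ i\<bar> * (e / D))"
      proof (rule sum_mono)
        fix i
        show "\<bar>V x $ i * (partial_deriv i f x - partial_deriv i g x)\<bar> \<le> \<bar>V x $ i\<bar> * (e / D)"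
          unfolding abs_mult using g(3) by (intro mult_left_mono) (auto simp: abs_minus_commute)
      qed
      also have "\<dots> = ?c x * (e / D)" by (simp only: sum_distrib_right)
      also have "\<dots> \<le> D * (e / D)" using D(1) D(2)[OF True] e by (intro mult_right_mono) auto
      finally show ?thesis using D(1) by simp
    next
      case False
      have "partial_deriv i f x = 0" "partial_deriv i g x = 0" for i
        using partial_deriv_outside_support[where f=f, OF K'(1) f0 False]
          partial_deriv_outside_support[where f=g, OF K'(1) _ False] g(2) by auto
      then show ?thesis using e by (simp add: inner_vec_def grad_def)
    qed
    have fi: "integrable \<mu> (\<lambda>x. V x \<bullet> grad f x)" by (rule int[OF f0 f(2)])
    have gi: "integrable \<mu> (\<lambda>x. V x \<bullet> grad g x)" by (rule int[OF _ g1]) (use g(2) in blast)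
    have "integral\<^sup>L \<mu> (\<lambda>x. V x \<bullet> grad f x) = integral\<^sup>L \<mu> (\<lambda>x. V x \<bullet> grad f x - V x \<bullet> grad g x)"
      using fi gi drift_integral_test_function[OF g(1)] by simp
    also have "\<bar>\<dots>\<bar> \<le> integral\<^sup>L \<mu> (\<lambda>x. \<bar>V x \<bullet> grad f x - V x \<bullet> grad g x\<bar>)" by (rule integral_abs_bound)
    also have "\<dots> \<le> integral\<^sup>L \<mu> (\<lambda>x. e)" by (rule integral_mono_AE) (use fi gi pw in auto)
    finally show ?thesis by (simp add: prob_space)
  qed
  then have "\<bar>integral\<^sup>L \<mu> (\<lambda>x. V x \<bullet> grad f x)\<bar> \<le> 0" by (rule_tac field_le_epsilon) simp
  then show ?thesis by simp
qed

end

section \<open>Compactly supported functions and fields of class \<open>C\<^sup>1\<close>\<close>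

lemma has_derivative_vec_lambda:
  fixes f :: "real^'n::finite \<Rightarrow> real^'m::finite"
  assumes "\<And>i. ((\<lambda>x. f x $ i) has_derivative (\<lambda>h. g i \<bullet> h)) (at x)"
  shows "(f has_derivative (\<lambda>h. \<chi> i. g i \<bullet> h)) (at x)"
proof (subst has_derivative_componentwise_within, intro ballI)
  fix b :: "real^'m" assume "b \<in> Basis"
  then obtain i where b: "b = axis i 1" by (auto simp: Basis_vec_def)
  show "((\<lambda>x. f x \<bullet> b) has_derivative (\<lambda>h. (\<chi> i. g i \<bullet> h) \<bullet> b)) (at x)"
    using assms[of i] by (simp add: b inner_axis)
qed

lemma finite_measure_eq_boxes:
  fixes M N :: "'a::euclidean_space measure"
  assumes "finite_measure M" "sets M = sets borel" "sets N = sets borel"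
    "\<And>a b. emeasure M (box a b) = emeasure N (box a b)"
  shows "M = N"
proof (rule measure_eqI_generator_eq)
  interpret finite_measure M by fact
  let ?E = "range (\<lambda>(a, b). box a b::'a set)"
  show "Int_stable ?E" by (auto simp: Int_stable_def box_Int_box)
  show "?E \<subseteq> Pow UNIV" by simp
  have "sets (borel :: 'a measure) = sigma_sets UNIV ?E" by (subst borel_eq_box) simp
  then show "sets M = sigma_sets UNIV ?E" "sets N = sigma_sets UNIV ?E" using assms by auto
  let ?A = "\<lambda>n::nat. box (- (real n *\<^sub>R One)) (real n *\<^sub>R One) :: 'a set"
  show "range ?A \<subseteq> ?E" "(\<Union>i. ?A i) = UNIV" unfolding UN_box_eq_UNIV by auto
  show "emeasure M (?A i) \<noteq> \<infinity>" for i by simp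
  show "emeasure M X = emeasure N X" if "X \<in> ?E" for X using that assms(4) by auto
qed

lemma continuous_compact_support_bounded:
  fixes f :: "'a::topological_space \<Rightarrow> 'b::real_normed_vector"
  assumes "continuous_on UNIV f" "compact K" "\<And>x. x \<notin> K \<Longrightarrow> f x = 0"
  shows "\<exists>b. \<forall>x. norm (f x) \<le> b"
proof -
  have "bounded (f ` K)"
    by (intro compact_imp_bounded compact_continuous_image continuous_on_subset[OF assms(1)] assms) simp
  then obtain b where b: "\<And>x. x \<in> K \<Longrightarrow> norm (f x) \<le> b" unfolding bounded_iff by blast
  have "norm (f x) \<le> max b 0" for x
    using b[of x] assms(3)[of x] by (cases "x \<in> K") (auto simp: le_max_iff_disj)
  then show ?thesis by blast
qed

lemma C1_compact_support_real:
  fixes f :: "real^'n::finite \<Rightarrow> real"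
  assumes f: "C_k_on 1 UNIV f" and K: "compact K" "\<And>x. x \<notin> K \<Longrightarrow> f x = 0"
  defines "Df \<equiv> \<lambda>x. blinfun_inner_right (grad f x)"
  shows "(f has_derivative blinfun_apply (Df x)) (at x)" "\<exists>b. \<forall>x. \<bar>f x\<bar> \<le> b" "\<exists>b. \<forall>x. norm (Df x) \<le> b"
    "uniformly_continuous_on UNIV Df"
proof -
  note D = f[unfolded C_k_on_1_iff[OF open_UNIV]]
  show "(f has_derivative blinfun_apply (Df x)) (at x)"
    using has_derivative_grad[of f x] D by (simp add: Df_def)
  show "\<exists>b. \<forall>x. \<bar>f x\<bar> \<le> b"
    using continuous_compact_support_bounded[where f=f, OF C_k_on_continuous[OF f] K] by simp
  have c: "continuous_on UNIV Df"
    unfolding Df_def using D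
    by (intro bounded_linear.continuous_on[OF bounded_linear_blinfun_inner_right]) (simp add: continuous_on_grad_iff)
  have z: "Df x = 0" if "x \<notin> K" for x
  proof -
    have "grad f x = 0" using partial_deriv_outside_support[where f=f, OF K that] by (simp add: grad_def vec_eq_iff)
    then show ?thesis by (simp add: Df_def blinfun_eqI)
  qed
  show "\<exists>b. \<forall>x. norm (Df x) \<le> b" by (rule continuous_compact_support_bounded[OF c K(1) z])
  show "uniformly_continuous_on UNIV Df" by (rule uniformly_continuous_on_compact_support[OF c K(1) z])
qed

lemma C1_compact_support_field:
  fixes G :: "real^'n::finite \<Rightarrow> real^'n"
  assumes G: "\<And>i. C_k_on 1 UNIV (\<lambda>x. G x $ i)" and K: "compact K" "\<And>x. x \<notin> K \<Longrightarrow> G x = 0"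
  shows "\<exists>DG S C. bounded_field G DG S C"
proof -
  define DG where "DG x = Blinfun (\<lambda>h. \<chi> i. grad (\<lambda>x. G x $ i) x \<bullet> h)" for x
  note D = G[unfolded C_k_on_1_iff[OF open_UNIV]]
  have d: "(G has_derivative (\<lambda>h. \<chi> i. grad (\<lambda>x. G x $ i) x \<bullet> h)) (at x)" for x
    by (rule has_derivative_vec_lambda, rule has_derivative_grad) (use D in blast)
  have ap: "blinfun_apply (DG x) = (\<lambda>h. \<chi> i. grad (\<lambda>x. G x $ i) x \<bullet> h)" for x
    unfolding DG_def by (rule bounded_linear_Blinfun_apply[OF has_derivative_bounded_linear[OF d]])
  have dG: "(G has_derivative blinfun_apply (DG x)) (at x)" for x using d by (simp add: ap)
  have Gc: "continuous_on UNIV G"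
    using dG by (auto intro!: continuous_at_imp_continuous_on has_derivative_continuous)
  have c: "continuous_on UNIV DG"
  proof (rule continuous_on_blinfun_componentwise)
    fix b :: "real^'n"
    have "continuous_on UNIV (grad (\<lambda>x. G x $ i))" for i
      using D by (simp add: continuous_on_grad_iff)
    then show "continuous_on UNIV (\<lambda>x. blinfun_apply (DG x) b)"
      unfolding ap by (intro continuous_on_vec_lambda continuous_intros)
  qed
  have z: "DG x = 0" if "x \<notin> K" for x
  proof -
    have g0: "grad (\<lambda>x. G x $ i) x = 0" for i
      using partial_deriv_outside_support[where f="\<lambda>x. G x $ i", OF K(1) _ that] K(2) by (simp add: grad_def vec_eq_iff)
    show ?thesis by (rule blinfun_eqI) (simp add: ap g0 vec_eq_iff)
  qed
  obtain S C where "\<forall>x. norm (G x) \<le> S" "\<forall>x. norm (DG x) \<le> C"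
    using continuous_compact_support_bounded[OF Gc K] continuous_compact_support_bounded[OF c K(1) z] by blast
  then have "bounded_field G DG S C"
    using dG uniformly_continuous_on_compact_support[OF c K(1) z] by unfold_locales auto
  then show ?thesis by blast
qed

section \<open>The Lyapunov function along the flow\<close>

text \<open>The last assumption is the pointwise trace of a null family: it lets the diffusion vanish
  in the drift condition.\<close>

locale lyapunov_flow = lyapunov U V \<A> W \<rho> \<gamma> + local_flow U V I \<phi>
  for U :: "(real^'n::finite) set" and V \<A> W \<rho> \<gamma> I \<phi> +
  assumes arbitrarily_small: "\<And>x e. x \<in> U \<Longrightarrow> e > 0 \<Longrightarrow> \<exists>A\<in>\<A>. \<forall>i j. \<bar>A x $ i $ j\<bar> \<le> e"
begin

lemma deterministic_drift:
  assumes x: "x \<in> U" and Wx: "\<rho> < W x" shows "grad W x \<bullet> V x \<le> - \<gamma>"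
proof (rule field_le_epsilon)
  fix e :: real assume e: "e > 0"
  let ?s = "\<Sum>i\<in>UNIV. \<Sum>j\<in>UNIV. \<bar>partial_deriv i (partial_deriv j W) x\<bar>"
  have s: "?s \<ge> 0" by (intro sum_nonneg) auto
  define e' where "e' = e / (?s + 1)"
  have e': "e' > 0" using e s by (simp add: e'_def)
  obtain A where A: "A \<in> \<A>" "\<forall>i j. \<bar>A x $ i $ j\<bar> \<le> e'" using arbitrarily_small[OF x e'] by blast
  have "- (\<Sum>i\<in>UNIV. \<Sum>j\<in>UNIV. A x $ i $ j * partial_deriv i (partial_deriv j W) x) \<le> e' * ?s"
    unfolding sum_negf[symmetric] sum_distrib_left
  proof (intro sum_mono)
    fix i j
    have "- (A x $ i $ j * partial_deriv i (partial_deriv j W) x) \<le> \<bar>A x $ i $ j\<bar> * \<bar>partial_deriv i (partial_deriv j W) x\<bar>"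
      using abs_ge_minus_self[of "A x $ i $ j * partial_deriv i (partial_deriv j W) x"] by (simp add: abs_mult)
    also have "\<dots> \<le> e' * \<bar>partial_deriv i (partial_deriv j W) x\<bar>" using A(2) by (intro mult_right_mono) auto
    finally show "- (A x $ i $ j * partial_deriv i (partial_deriv j W) x) \<le> e' * \<bar>partial_deriv i (partial_deriv j W) x\<bar>" .
  qed
  also have "e' * ?s \<le> e"
  proof -
    have "e' * ?s \<le> e' * (?s + 1)" using e' by (intro mult_left_mono) auto
    also have "\<dots> = e" using s by (simp add: e'_def)
    finally show ?thesis .
  qed
  finally have "- (\<Sum>i\<in>UNIV. \<Sum>j\<in>UNIV. A x $ i $ j * partial_deriv i (partial_deriv j W) x) \<le> e" .
  moreover have "generator V A W x = (\<Sum>i\<in>UNIV. \<Sum>j\<in>UNIV. A x $ i $ j * partial_deriv i (partial_deriv j W) x) + grad W x \<bullet> V x"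
    by (simp add: generator_def inner_vec_def grad_def mult.commute)
  ultimately show "grad W x \<bullet> V x \<le> - \<gamma> + e" using drift[OF A(1) x Wx] by simp
qed

lemma decay:
  assumes x: "x \<in> U" and t: "t \<in> I x" "0 \<le> t"
  shows "W (\<phi> t x) \<le> max \<rho> (W x - \<gamma> * t)"
proof (rule lyapunov_decay[OF _ _ _ x t])
  show "(W has_derivative (\<lambda>h. grad W y \<bullet> h)) (at y)" if "y \<in> U" for y
    by (rule has_derivative_grad[OF C_k_on_2_D(1)[OF open_U W_C2 that]])
  show "grad W y \<bullet> V y \<le> - \<gamma>" if "y \<in> U" "\<rho> < W y" for y by (rule deterministic_drift[OF that])
qed (use \<gamma> in simp)

text \<open>The decay keeps a trajectory inside the compact sublevel set of its initial value, or of \<open>\<rho>\<close>.\<close>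

lemma complete_flow: assumes x: "x \<in> U" shows "{0..} \<subseteq> I x"
proof (rule forward_complete[OF x])
  let ?m = "max \<rho> (W x)"
  show "compact (sublevel ?m)"
    by (rule compact_sublevel) (use \<rho>(2) W_less_top[OF x] in \<open>simp add: max_def\<close>)
  show "\<phi> t x \<in> sublevel ?m" if t: "t \<in> I x" "0 \<le> t" for t
  proof -
    have "0 \<le> \<gamma> * t" using t \<gamma> by simp
    then show ?thesis using decay[OF x t] flow_in[OF x t(1)] by auto
  qed
qed auto

lemma entry_time:
  assumes x: "x \<in> U" and t: "0 \<le> t" "W x - \<rho> \<le> \<gamma> * t" shows "\<phi> t x \<in> sublevel \<rho>"
proof -
  have "t \<in> I x" using complete_flow[OF x] t by auto
  from decay[OF x this t(1)] flow_in[OF x this] t(2) show ?thesis by auto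
qed

lemma U_nonempty: "U \<noteq> {}"
  using \<rho>(2) by (auto simp: bot_ereal_def)

sublocale dissipative_flow U V I \<phi> "sublevel \<rho>"
proof
  show "x \<in> U \<Longrightarrow> {0..} \<subseteq> I x" for x by (rule complete_flow)
  show "compact (sublevel \<rho>)" by (rule compact_sublevel[OF \<rho>(2)])
  show "sublevel \<rho> \<subseteq> U" by auto
  show "sublevel \<rho> \<noteq> {}"
  proof -
    obtain x where x: "x \<in> U" using U_nonempty by blast
    have "\<phi> (max 0 ((W x - \<rho>) / \<gamma>)) x \<in> sublevel \<rho>"
      by (rule entry_time[OF x]) (use \<gamma> in \<open>auto simp: field_simps max_def\<close>)
    then show ?thesis by blast
  qed
  show "\<phi> t x \<in> sublevel \<rho>" if "0 \<le> t" "x \<in> sublevel \<rho>" for t x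
  proof (rule entry_time)
    have "0 \<le> \<gamma> * t" using that \<gamma> by simp
    then show "W x - \<rho> \<le> \<gamma> * t" using that by simp
  qed (use that in auto)
  show "\<exists>T\<ge>0. \<forall>t\<ge>T. \<phi> t ` K \<subseteq> sublevel \<rho>" if K: "compact K" "K \<subseteq> U" for K
  proof -
    have "bounded (W ` K)"
      by (intro compact_imp_bounded compact_continuous_image continuous_on_subset[OF W_cont] K)
    then obtain m where m: "\<forall>y\<in>W ` K. \<bar>y\<bar> \<le> m" unfolding bounded_real by blast
    show ?thesis
    proof (intro exI[of _ "max 0 ((m - \<rho>) / \<gamma>)"] conjI allI impI subsetI)
      fix t y assume t: "max 0 ((m - \<rho>) / \<gamma>) \<le> t" and "y \<in> \<phi> t ` K"
      then obtain x where x: "x \<in> K" "y = \<phi> t x" by blast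
      have "W x \<le> m" using m x(1) by (auto simp: abs_le_iff)
      moreover have "m - \<rho> \<le> \<gamma> * t" using t \<gamma> by (simp add: field_simps)
      ultimately show "y \<in> sublevel \<rho>" unfolding x(2)
        using x(1) K(2) t by (intro entry_time) auto
    qed simp
  qed
qed

end

section \<open>Invariance and support of limit measures\<close>

locale lyapunov_flow_limit = lyapunov_flow U V \<A> W \<rho> \<gamma> I \<phi> + limit_of_stationary U V \<A> W \<rho> \<gamma> B \<nu> \<mu>
  for U :: "(real^'n::finite) set" and V \<A> W \<rho> \<gamma> I \<phi> B \<nu> \<mu> +
  assumes V_C1: "\<And>i. C_k_on 1 U (\<lambda>x. V x $ i)"
begin

sublocale \<mu>: prob_space \<mu>
  using \<mu>_prob by (simp add: prob_measures_def)

lemma sets_\<mu>: "sets \<mu> = sets (restrict_space borel U)"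
  using \<mu>_prob by (simp add: prob_measures_def)

lemma space_\<mu>: "space \<mu> = U"
  by (rule prob_measures_space[OF \<mu>_prob])

lemma AE_in_N: "AE x in \<mu>. x \<in> sublevel \<rho>"
  using AE_sublevel AE_space by eventually_elim (simp add: space_\<mu>)

lemma flow_cont: "0 \<le> t \<Longrightarrow> continuous_on U (\<phi> t)"
  by (rule continuous_on_flow) (use time_in in auto)

text \<open>The field is cut off above level \<open>a > \<rho>\<close>.  Trajectories in \<open>{W \<le> \<rho>}\<close> see the original field, and so does
  the measure, which is concentrated there; multiplying \<open>g\<close> by the cutoff function gives it compact support without changing
  its gradient on that set.\<close>

lemma flow_invariant_integral:
  assumes t: "0 \<le> t" and f: "C_k_on 1 UNIV f" and K: "compact K" "\<And>x. x \<notin> K \<Longrightarrow> f x = (0::real)"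
  shows "integral\<^sup>L \<mu> (\<lambda>x. f (\<phi> t x)) = integral\<^sup>L \<mu> f"
proof -
  obtain a where a: "\<rho> < a" "ereal a < top" using between[OF \<rho>(2)] by blast
  obtain b where b: "a < b" "ereal b < top" using between[OF a(2)] by blast
  from cutoff[OF b] obtain \<zeta> where \<zeta>: "C_k_on 1 UNIV \<zeta>" "\<And>x. x \<notin> sublevel b \<Longrightarrow> \<zeta> x = 0"
    "\<And>x. x \<in> U \<Longrightarrow> W x \<le> a \<Longrightarrow> \<zeta> x = 1" by blast
  have Kb: "compact (sublevel b)" by (rule compact_sublevel[OF b(2)])
  \<comment> \<open>outside \<open>U\<close> the field is arbitrary; \<open>0\<close> makes the extension continuously differentiable\<close>
  define G where "G x = (if x \<in> U then \<zeta> x *\<^sub>R V x else 0)" for x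
  have G0: "G x = 0" if "x \<notin> sublevel b" for x using \<zeta>(2)[OF that] by (simp add: G_def)
  have GC: "C_k_on 1 UNIV (\<lambda>x. G x $ i)" for i
  proof (rule C_k_on_extend_zero[OF open_U Kb])
    have "C_k_on 1 U (\<lambda>x. \<zeta> x * V x $ i)"
      by (rule C_1_mult[OF open_U C_k_on_subset[OF \<zeta>(1)] V_C1]) simp
    then show "C_k_on 1 U (\<lambda>x. G x $ i)" by (rule C_k_on_cong[OF open_U, rotated]) (simp add: G_def)
    show "G x $ i = 0" if "x \<notin> sublevel b" for x using G0[OF that] by simp
  qed auto
  have GV: "G x = V x" if "x \<in> sublevel \<rho>" for x using that \<zeta>(3)[of x] a by (simp add: G_def)
  obtain DG S C where "bounded_field G DG S C" using C1_compact_support_field[OF GC Kb G0] by blast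
  then interpret G: bounded_field G DG S C .
  note Df = C1_compact_support_real[OF f K]
  obtain F L where FL: "\<forall>x. \<bar>f x\<bar> \<le> F" "\<forall>x. norm (blinfun_inner_right (grad f x)) \<le> L" using Df(2,3) by blast
  show ?thesis
  proof (rule G.flow_integral_invariant[OF Df(1) _ _ Df(4) \<mu>_prob _ t AE_in_N])
    show "\<bar>f x\<bar> \<le> F" "norm (blinfun_inner_right (grad f x)) \<le> L" for x using FL by auto
    show "integral\<^sup>L \<mu> (\<lambda>x. blinfun_apply (Dg x) (G x)) = 0"
      if g: "\<And>x. (g has_derivative blinfun_apply (Dg x)) (at x)" "continuous_on UNIV Dg" for g :: "real^'n \<Rightarrow> real" and Dg
    proof -
      have pg: "partial_deriv i g x = blinfun_apply (Dg x) (axis i 1)" for i x by (rule partial_deriv_eq[OF g(1)])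
      have gC: "C_k_on 1 UNIV g"
        unfolding C_k_on_1_iff[OF open_UNIV] pg[abs_def]
        using g by (auto simp: differentiable_def intro!: continuous_intros)
      let ?h = "\<lambda>x. \<zeta> x * g x"
      have hC: "C_k_on 1 UNIV ?h" by (rule C_1_mult[OF open_UNIV \<zeta>(1) gC])
      have "integral\<^sup>L \<mu> (\<lambda>x. V x \<bullet> grad ?h x) = 0"
        by (rule drift_integral_C1[OF Kb _ _ hC]) (use \<zeta>(2) in auto)
      moreover have "integral\<^sup>L \<mu> (\<lambda>x. blinfun_apply (Dg x) (G x)) = integral\<^sup>L \<mu> (\<lambda>x. V x \<bullet> grad ?h x)"
      proof (rule integral_cong_AE)
        have "continuous_on U (\<lambda>x. \<zeta> x *\<^sub>R V x)"
          by (intro continuous_intros V C_k_on_continuous[OF \<zeta>(1)])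
        then have Gc: "continuous_on U G" by (rule continuous_on_eq) (simp add: G_def)
        show "(\<lambda>x. blinfun_apply (Dg x) (G x)) \<in> borel_measurable \<mu>"
          by (intro prob_measures_measurable[OF \<mu>_prob] blinfun.continuous_on Gc continuous_on_subset[OF g(2)]) simp
        have "continuous_on UNIV (grad ?h)"
          unfolding continuous_on_grad_iff using hC[unfolded C_k_on_1_iff[OF open_UNIV]] by blast
        then show "(\<lambda>x. V x \<bullet> grad ?h x) \<in> borel_measurable \<mu>"
          by (intro prob_measures_measurable[OF \<mu>_prob] continuous_on_inner V) (rule continuous_on_subset, auto)
        show "AE x in \<mu>. blinfun_apply (Dg x) (G x) = V x \<bullet> grad ?h x"
          using AE_in_N
        proof eventually_elim
          fix x assume xN: "x \<in> sublevel \<rho>"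
          have x: "x \<in> U" "W x < a" using xN a by auto
          \<comment> \<open>the cutoff function equals \<open>1\<close> on a whole neighbourhood of \<open>x\<close>, hence the room between \<open>\<rho>\<close> and \<open>a\<close>\<close>
          have o: "open (U \<inter> W -` {..<a})" by (rule continuous_open_preimage[OF W_cont open_U]) simp
          have "partial_deriv i ?h x = partial_deriv i g x" for i
            by (rule partial_deriv_cong[OF o]) (use x \<zeta>(3) in auto)
          then have gr: "grad ?h x = grad g x" by (simp add: grad_def)
          have "g differentiable (at x)" using g(1)[of x] by (auto simp: differentiable_def)
          from has_derivative_unique[OF g(1) has_derivative_grad[OF this]]
          have "blinfun_apply (Dg x) (G x) = grad g x \<bullet> G x" by metis
          then show "blinfun_apply (Dg x) (G x) = V x \<bullet> grad ?h x"
            by (simp add: gr GV[OF xN] inner_commute)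
        qed
      qed
      ultimately show ?thesis by simp
    qed
    show "((\<lambda>s. \<phi> s x) has_vector_derivative G (\<phi> s x)) (at s within {0..t})"
      if x: "x \<in> sublevel \<rho>" and s: "s \<in> {0..t}" for x s
    proof -
      have "\<phi> s x \<in> sublevel \<rho>" using trapped[of s x] x s by auto
      moreover have "((\<lambda>s. \<phi> s x) has_vector_derivative V (\<phi> s x)) (at s)"
        by (rule flow_derivative) (use x s time_in in auto)
      ultimately show ?thesis using GV by (simp add: has_vector_derivative_at_within)
    qed
    show "\<phi> 0 x = x" if "x \<in> sublevel \<rho>" for x using flow_0[of x] that by simp
    show "(\<lambda>x. f (\<phi> t x)) \<in> borel_measurable \<mu>"
      by (intro prob_measures_measurable[OF \<mu>_prob]
        continuous_on_compose2[OF C_k_on_continuous[OF f, of UNIV] flow_cont[OF t]]) simp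
  qed
qed

lemma in_sets: "X \<in> sets borel \<Longrightarrow> X \<subseteq> U \<Longrightarrow> X \<in> sets \<mu>"
  by (auto simp: sets_\<mu> sets_restrict_space intro!: image_eqI[of _ _ X])

lemma sets_borel: "X \<in> sets \<mu> \<Longrightarrow> X \<in> sets borel \<and> X \<subseteq> U"
  using open_U by (auto simp: sets_\<mu> sets_restrict_space)

lemma flow_measurable: "0 \<le> t \<Longrightarrow> \<phi> t \<in> borel_measurable \<mu>"
  by (rule prob_measures_measurable[OF \<mu>_prob flow_cont])

lemma forward_preimage_sets:
  assumes "0 \<le> t" "X \<in> sets \<mu>" shows "{x \<in> U. \<phi> t x \<in> X} \<in> sets \<mu>"
proof -
  have "\<phi> t -` X \<inter> space \<mu> \<in> sets \<mu>"
    using sets_borel[OF assms(2)] by (intro measurable_sets[OF flow_measurable[OF assms(1)]]) simp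
  moreover have "\<phi> t -` X \<inter> space \<mu> = {x \<in> U. \<phi> t x \<in> X}" by (auto simp: space_\<mu>)
  ultimately show ?thesis by simp
qed

text \<open>Invariance of integrals of smooth bumps passes to boxes, and boxes determine finite Borel measures.\<close>

lemma forward_invariant:
  assumes t: "0 \<le> t" and X: "X \<in> sets \<mu>"
  shows "emeasure \<mu> {x \<in> U. \<phi> t x \<in> X} = emeasure \<mu> X"
proof -
  have m: "\<phi> t \<in> borel_measurable \<mu>" "(\<lambda>x. x) \<in> borel_measurable \<mu>"
    by (rule flow_measurable[OF t], rule prob_measures_measurable[OF \<mu>_prob continuous_on_id])
  let ?M = "distr \<mu> borel (\<phi> t)" and ?N = "distr \<mu> borel (\<lambda>x. x)"
  interpret M: prob_space ?M by (rule \<mu>.prob_space_distr[OF m(1)])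
  interpret N: prob_space ?N by (rule \<mu>.prob_space_distr[OF m(2)])
  have lim: "(\<lambda>k. integral\<^sup>L \<mu> (\<lambda>x. box_bump (real (Suc k)) a b (h x))) \<longlonglongrightarrow> measure (distr \<mu> borel h) (box a b)"
    if h: "h \<in> borel_measurable \<mu>" for h a b
  proof -
    have bm: "box_bump k a b \<in> borel_measurable borel" for k
      by (intro borel_measurable_continuous_onI smooth_expr_continuous_on smooth_expr_box_bump)
    have "(\<lambda>k. integral\<^sup>L \<mu> (\<lambda>x. box_bump (real (Suc k)) a b (h x))) \<longlonglongrightarrow> integral\<^sup>L \<mu> (\<lambda>x. indicator (box a b) (h x))"
    proof (rule integral_dominated_convergence[where w="\<lambda>_. 1"])
      show "(\<lambda>x. box_bump (real (Suc k)) a b (h x)) \<in> borel_measurable \<mu>" for k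
        by (rule measurable_compose[OF h bm])
      show "AE x in \<mu>. (\<lambda>k. box_bump (real (Suc k)) a b (h x)) \<longlonglongrightarrow> indicator (box a b) (h x)"
        by (intro AE_I2 box_bump_tendsto)
      show "AE x in \<mu>. norm (box_bump (real (Suc k)) a b (h x)) \<le> 1" for k
        by (intro AE_I2) (simp add: box_bump_nonneg box_bump_le_1)
    qed (use h in simp_all)
    also have "integral\<^sup>L \<mu> (\<lambda>x. indicator (box a b) (h x)) = integral\<^sup>L (distr \<mu> borel h) (indicator (box a b) :: _ \<Rightarrow> real)"
      by (rule integral_distr[symmetric, OF h]) simp
    also have "\<dots> = measure (distr \<mu> borel h) (box a b)" by simp
    finally show ?thesis .
  qed
  have "?M = ?N"
  proof (rule finite_measure_eq_boxes)
    fix a b :: "real^'n"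
    have "integral\<^sup>L \<mu> (\<lambda>x. box_bump (real (Suc k)) a b (\<phi> t x)) = integral\<^sup>L \<mu> (box_bump (real (Suc k)) a b)" for k
    proof (rule flow_invariant_integral[OF t, where K="cbox a b"])
      show "C_k_on 1 UNIV (box_bump (real (Suc k)) a b)" by (intro smooth_expr_C_k smooth_expr_box_bump)
      show "box_bump (real (Suc k)) a b x = 0" if "x \<notin> cbox a b" for x
        using that box_subset_cbox[of a b] box_bump_eq_0_iff[of "real (Suc k)" a b x] by auto
    qed simp
    then have "measure ?M (box a b) = measure ?N (box a b)"
      using LIMSEQ_unique[OF lim[OF m(1)] , of a b] lim[OF m(2), of a b] by simp
    then show "emeasure ?M (box a b) = emeasure ?N (box a b)"
      by (simp add: M.emeasure_eq_measure N.emeasure_eq_measure)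
  qed (simp_all add: M.finite_measure_axioms)
  moreover have XB: "X \<in> sets borel" "X \<subseteq> U" using sets_borel[OF X] by auto
  moreover have "emeasure ?M X = emeasure \<mu> {x \<in> U. \<phi> t x \<in> X}"
    using XB by (subst emeasure_distr[OF m(1)]) (auto simp: space_\<mu> intro!: arg_cong[of _ _ "emeasure \<mu>"])
  moreover have "emeasure ?N X = emeasure \<mu> X"
    using XB by (subst emeasure_distr[OF m(2)]) (auto simp: space_\<mu> intro!: arg_cong[of _ _ "emeasure \<mu>"])
  ultimately show ?thesis by simp
qed

text \<open>The image \<open>\<phi> n ` N\<close> has full measure, because its preimage contains \<open>N\<close>.\<close>

lemma AE_core: "AE x in \<mu>. x \<in> core"
proof -
  have "AE x in \<mu>. x \<in> \<phi> (real n) ` sublevel \<rho>" for n :: nat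
  proof -
    let ?X = "\<phi> (real n) ` sublevel \<rho>"
    have "?X \<subseteq> sublevel \<rho>" using trapped by auto
    then have X: "?X \<in> sets \<mu>"
      by (intro in_sets borel_closed compact_imp_closed compact_image) auto
    have Y: "{x \<in> U. \<phi> (real n) x \<in> ?X} \<in> sets \<mu>"
      by (rule forward_preimage_sets[OF _ X]) simp
    have "AE x in \<mu>. x \<in> {x \<in> U. \<phi> (real n) x \<in> ?X}"
      using AE_in_N by eventually_elim auto
    then have "measure \<mu> {x \<in> U. \<phi> (real n) x \<in> ?X} = 1" using \<mu>.AE_in_set_eq_1[OF Y] by blast
    then have "measure \<mu> ?X = 1" using forward_invariant[OF _ X, of "real n"] by (simp add: measure_def)
    then show ?thesis using \<mu>.AE_in_set_eq_1[OF X] by blast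
  qed
  then have "AE x in \<mu>. \<forall>n::nat. x \<in> \<phi> (real n) ` sublevel \<rho>" by (simp add: AE_all_countable)
  then show ?thesis by (simp add: core_eq_nat)
qed

lemma support_subset_core: "measure_support \<mu> \<subseteq> core"
proof
  fix x assume x: "x \<in> measure_support \<mu>"
  show "x \<in> core"
  proof (rule ccontr)
    assume "x \<notin> core"
    then have "0 < emeasure \<mu> (- core \<inter> space \<mu>)"
      using x compact_core by (auto simp: measure_support_def open_Compl compact_imp_closed)
    moreover have "emeasure \<mu> {x \<in> space \<mu>. x \<notin> core} = 0"
      using AE_core by (intro emeasure_eq_0_AE) simp
    moreover have "- core \<inter> space \<mu> = {x \<in> space \<mu>. x \<notin> core}" by auto
    ultimately show False by simp
  qed
qed

text \<open>For negative times the map is defined only on an open subset of \<open>U\<close>.\<close>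

lemma preimage_measurable:
  assumes X: "X \<in> sets \<mu>" shows "{x \<in> U. t \<in> I x \<and> \<phi> t x \<in> X} \<in> sets \<mu>"
proof -
  let ?S = "{x \<in> U. t \<in> I x}"
  have "open ((\<lambda>x. (t, x)) -` domain)"
    by (intro open_vimage open_domain continuous_intros)
  moreover have "(\<lambda>x. (t, x)) -` domain = ?S" by (auto simp: domain_def)
  ultimately have S: "?S \<in> sets borel" by simp
  have "\<phi> t \<in> borel_measurable (restrict_space borel ?S)"
    by (intro borel_measurable_continuous_on_restrict continuous_on_flow) auto
  from measurable_sets[OF this] sets_borel[OF X]
  have "\<phi> t -` X \<inter> ?S \<in> sets (restrict_space borel ?S)" by (simp add: space_restrict_space)
  then have "\<phi> t -` X \<inter> ?S \<in> sets borel" using S by (subst (asm) sets_restrict_space_iff) auto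
  moreover have "\<phi> t -` X \<inter> ?S = {x \<in> U. t \<in> I x \<and> \<phi> t x \<in> X}" by auto
  ultimately show ?thesis by (intro in_sets) auto
qed

text \<open>Negative times reduce to positive ones: almost every point lies in the core, where \<open>\<phi> t\<close> and \<open>\<phi> (- t)\<close>
  are inverse to each other.\<close>

lemma invariant: "invariant_measure I \<phi> \<mu>"
  unfolding invariant_measure_def space_\<mu>
proof (intro allI ballI)
  fix t :: real and X assume X: "X \<in> sets \<mu>"
  show "emeasure \<mu> {x \<in> U. t \<in> I x \<and> \<phi> t x \<in> X} = emeasure \<mu> X"
  proof (cases "0 \<le> t")
    case True
    then have "{x \<in> U. t \<in> I x \<and> \<phi> t x \<in> X} = {x \<in> U. \<phi> t x \<in> X}" using time_in by auto
    then show ?thesis using forward_invariant[OF True X] by simp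
  next
    case False
    then have t: "0 \<le> - t" by simp
    let ?Y = "{x \<in> U. t \<in> I x \<and> \<phi> t x \<in> X}"
    note Y = preimage_measurable[OF X, of t]
    have "{x \<in> U. \<phi> (- t) x \<in> ?Y} \<in> sets \<mu>"
      by (rule forward_preimage_sets[OF t Y])
    moreover have "AE x in \<mu>. x \<in> {x \<in> U. \<phi> (- t) x \<in> ?Y} \<longleftrightarrow> x \<in> X"
      using AE_core
    proof eventually_elim
      fix x assume x: "x \<in> core"
      have xU: "x \<in> U" using x core_subset by auto
      have "\<phi> t (\<phi> (- t) x) = x"
        using flow_add[OF xU, of "- t" t] core_full_orbits[OF x] flow_0[OF xU] by simp
      moreover have "\<phi> (- t) x \<in> U" "t \<in> I (\<phi> (- t) x)"
        using core_forward[OF t x] core_subset core_full_orbits by auto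
      ultimately show "x \<in> {x \<in> U. \<phi> (- t) x \<in> ?Y} \<longleftrightarrow> x \<in> X" using xU by simp
    qed
    ultimately have "emeasure \<mu> {x \<in> U. \<phi> (- t) x \<in> ?Y} = emeasure \<mu> X"
      using X by (intro emeasure_eq_AE) auto
    then show ?thesis using forward_invariant[OF t Y] by simp
  qed
qed

end

section \<open>Null families\<close>

lemma eventually_net_filter:
  assumes "directed_set D le"
  shows "eventually P (net_filter D le) \<longleftrightarrow> (\<exists>a\<in>D. \<forall>b\<in>D. le a b \<longrightarrow> P b)"
proof -
  have "eventually P (net_filter D le) \<longleftrightarrow> (\<exists>a\<in>D. eventually P (principal {b \<in> D. le a b}))"
    unfolding net_filter_def
  proof (rule eventually_INF_base)
    show "D \<noteq> {}" using assms by (simp add: directed_set_def)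
    fix a b assume ab: "a \<in> D" "b \<in> D"
    then obtain c where c: "c \<in> D" "le a c" "le b c" using assms unfolding directed_set_def by blast
    have tr: "le x z" if "x \<in> D" "y \<in> D" "z \<in> D" "le x y" "le y z" for x y z
      using assms that unfolding directed_set_def transp_on_def by blast
    have "{z \<in> D. le c z} \<subseteq> {z \<in> D. le a z} \<inter> {z \<in> D. le b z}" using tr ab c by blast
    then show "\<exists>x\<in>D. principal {z \<in> D. le x z} \<le> inf (principal {z \<in> D. le a z}) (principal {z \<in> D. le b z})"
      using c(1) by auto
  qed
  then show ?thesis by (auto simp: eventually_principal)
qed

text \<open>The quadratic form of \<open>A = G G\<^sup>T / 2\<close> is half the squared norm of \<open>G\<^sup>T v\<close>.\<close>

lemma diffusion_matrices_nonneg: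
  fixes A :: "real^'n::finite \<Rightarrow> real^'n^'n"
  assumes "A \<in> diffusion_matrices TYPE('m::finite) U p" "x \<in> U"
  shows "0 \<le> v \<bullet> (A x *v v)"
proof -
  from assms obtain G :: "real^'n \<Rightarrow> real^'m^'n" where "A x = (1/2) *\<^sub>R (G x ** transpose (G x))"
    unfolding diffusion_matrices_def by blast
  then have "v \<bullet> (A x *v v) = (1/2) * (v \<bullet> (G x *v (transpose (G x) *v v)))"
    by (simp add: scaleR_matrix_vector_assoc[symmetric] matrix_vector_mul_assoc[symmetric])
  also have "\<dots> = (1/2) * ((transpose (G x) *v v) \<bullet> (transpose (G x) *v v))"
    by (simp add: dot_lmul_matrix[symmetric])
  finally show ?thesis using inner_ge_zero[of "transpose (G x) *v v"] by linarith
qed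

theorem theoremB:
  fixes \<U> :: "(real^'n::finite) set"
    and V :: "real^'n \<Rightarrow> real^'n"
    and \<I> :: "real^'n \<Rightarrow> real set"
    and \<phi> :: "real \<Rightarrow> real^'n \<Rightarrow> real^'n"
    and p :: real
    and D :: "'k set"
    and le :: "'k \<Rightarrow> 'k \<Rightarrow> bool"
    and A :: "'k \<Rightarrow> real^'n \<Rightarrow> real^'n^'n"
  assumes "open \<U>" and "connected \<U>"
    and "continuous_on \<U> V"
    and "generates_local_flow \<U> V \<I> \<phi>"
    and "CARD('n) \<le> CARD('m::finite)"
    and "real CARD('n) < p"
    and "null_family TYPE('m) \<U> p D le A"
    and "\<exists>U. uniform_lyapunov_function \<U> V (A ` D) U"
  shows "sequentially_null_compact \<U> V p (A ` D) \<and>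
    ((\<forall>i. C_k_on 1 \<U> (\<lambda>x. V x $ i)) \<longrightarrow>
       (\<exists>!J. is_global_attractor \<U> \<I> \<phi> J) \<and>
       (\<forall>\<mu>. limit_measure \<U> V p (A ` D) \<mu> \<longrightarrow>
          invariant_measure \<I> \<phi> \<mu> \<and> measure_support \<mu> \<subseteq> global_attractor \<U> \<I> \<phi>))"
proof -
  have D: "directed_set D le" "\<And>\<alpha>. \<alpha> \<in> D \<Longrightarrow> A \<alpha> \<in> diffusion_matrices TYPE('m) \<U> p"
    "W1p_loc_tendsto \<U> p A (\<lambda>x. 0) (net_filter D le)"
    using \<open>null_family _ _ _ _ _ _\<close> by (auto simp: null_family_def)
  obtain W \<rho> \<gamma> where W: "compact_function \<U> W" "C_k_on 2 \<U> W"
    and \<rho>: "0 < \<rho>" "ereal \<rho> < (SUP y\<in>\<U>. ereal (W y))" and \<gamma>: "0 < \<gamma>"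
    and drift: "\<And>B x. B \<in> A ` D \<Longrightarrow> x \<in> \<U> - closure {y\<in>\<U>. W y < \<rho>} \<Longrightarrow> generator V B W x \<le> - \<gamma>"
    using \<open>\<exists>U. uniform_lyapunov_function _ _ _ U\<close> unfolding uniform_lyapunov_function_def by blast
  have Wc: "continuous_on \<U> W" using W(1) by (simp add: compact_function_def)
  \<comment> \<open>the drift condition is given off the closure of the open sublevel set, which contains no point with \<open>W > \<rho>\<close>\<close>
  have out: "x \<notin> closure {y \<in> \<U>. W y < \<rho>}" if "x \<in> \<U>" "\<rho> < W x" for x
  proof -
    have o: "open (\<U> \<inter> W -` {\<rho><..})" by (rule continuous_open_preimage[OF Wc \<open>open \<U>\<close>]) simp
    have "\<U> \<inter> W -` {\<rho><..} \<inter> {y \<in> \<U>. W y < \<rho>} = {}" by auto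
    then have "\<U> \<inter> W -` {\<rho><..} \<inter> closure {y \<in> \<U>. W y < \<rho>} = {}"
      using open_Int_closure_eq_empty[OF o] by blast
    then show ?thesis using that by auto
  qed
  interpret L: lyapunov \<U> V "A ` D" W \<rho> \<gamma>
  proof
    show "continuous_on \<U> B" if "B \<in> A ` D" for B
      using that D(2) by (auto simp: diffusion_matrices_def)
    show "0 \<le> v \<bullet> (B x *v v)" if "B \<in> A ` D" "x \<in> \<U>" for B x v
      using that D(2) diffusion_matrices_nonneg by blast
    show "generator V B W x \<le> - \<gamma>" if "B \<in> A ` D" "x \<in> \<U>" "\<rho> < W x" for B x
      using drift[OF that(1)] out[OF that(2,3)] that(2) by blast
    show "compact_function \<U> W" "C_k_on 2 \<U> W" by (fact W)+
    show "0 < \<rho>" "ereal \<rho> < (SUP y\<in>\<U>. ereal (W y))" by (fact \<rho>)+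
    show "0 < \<gamma>" by (fact \<gamma>)
    show "open \<U>" "continuous_on \<U> V" by fact+
  qed
  \<comment> \<open>a tail of the net has small entries at \<open>x\<close>, and tails are nonempty because the index set is directed\<close>
  have small: "\<exists>B\<in>A ` D. \<forall>i j. \<bar>B x $ i $ j\<bar> \<le> e" if x: "x \<in> \<U>" and e: "e > 0" for x e
  proof -
    have "\<forall>\<^sub>F \<alpha> in net_filter D le. A \<alpha> \<in> diffusion_matrices TYPE('m) \<U> p"
      using D(1,2) by (auto simp: eventually_net_filter directed_set_def)
    then have "\<forall>\<^sub>F \<alpha> in net_filter D le. \<forall>y\<in>{x}. \<forall>i j. \<bar>A \<alpha> y $ i $ j\<bar> \<le> e"
      by (intro W1p_null_imp_uniformly_null[OF \<open>open \<U>\<close> \<open>real CARD('n) < p\<close> _ _ e _ D(3)]) (use x in auto)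
    then obtain a where a: "a \<in> D" "\<And>b. b \<in> D \<Longrightarrow> le a b \<Longrightarrow> \<forall>i j. \<bar>A b x $ i $ j\<bar> \<le> e"
      unfolding eventually_net_filter[OF D(1)] by blast
    moreover have "le a a" using D(1) a(1) by (auto simp: directed_set_def reflp_on_def)
    ultimately show ?thesis by blast
  qed
  have seq: "stationary_sequence \<U> V (A ` D) W \<rho> \<gamma> B \<nu>"
    if B: "null_sequence \<U> p (A ` D) B" and \<nu>: "\<And>l. stationary_measure \<U> V (B l) (\<nu> l)" for B \<nu>
  proof (intro stationary_sequence.intro stationary_sequence_axioms.intro)
    show "lyapunov \<U> V (A ` D) W \<rho> \<gamma>" by (rule L.lyapunov_axioms)
    show Bin: "B l \<in> A ` D" for l using B by (simp add: null_sequence_def)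
    show "stationary_measure \<U> V (B l) (\<nu> l)" for l by (rule \<nu>)
    fix K :: "(real^'n) set" and e :: real assume K: "compact K" "K \<subseteq> \<U>" "e > 0"
    have ev: "\<forall>\<^sub>F l in sequentially. B l \<in> diffusion_matrices TYPE('m) \<U> p"
    proof (intro always_eventually allI)
      fix l show "B l \<in> diffusion_matrices TYPE('m) \<U> p" using Bin[of l] D(2) by auto
    qed
    have "W1p_loc_tendsto \<U> p B (\<lambda>x. 0) sequentially" using B by (simp add: null_sequence_def)
    from W1p_null_imp_uniformly_null[OF \<open>open \<U>\<close> \<open>real CARD('n) < p\<close> K ev this]
    show "\<forall>\<^sub>F l in sequentially. \<forall>x\<in>K. \<forall>i j. \<bar>B l x $ i $ j\<bar> \<le> e" .
  qed
  show ?thesis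
  proof (intro conjI impI allI)
    show "sequentially_null_compact \<U> V p (A ` D)"
      unfolding sequentially_null_compact_def
    proof (intro allI impI)
      fix B \<nu>
      assume "null_sequence \<U> p (A ` D) B \<and> (\<forall>l. stationary_measure \<U> V (B l) (\<nu> l))"
      then interpret S: stationary_sequence \<U> V "A ` D" W \<rho> \<gamma> B \<nu> by (intro seq) auto
      show "compactin (weak_topology \<U>) (weak_topology \<U> closure_of range \<nu>)"
        by (rule S.relatively_compact)
    qed
    assume V1: "\<forall>i. C_k_on 1 \<U> (\<lambda>x. V x $ i)"
    interpret F: lyapunov_flow \<U> V "A ` D" W \<rho> \<gamma> \<I> \<phi>
    proof unfold_locales
      show "generates_local_flow \<U> V \<I> \<phi>" by fact
    qed (fact \<open>open \<U>\<close>, rule small)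
    note attractor = global_attractor_eq[OF F.core_is_global_attractor]
    show "\<exists>!J. is_global_attractor \<U> \<I> \<phi> J" by (rule attractor)
    fix \<mu> assume "limit_measure \<U> V p (A ` D) \<mu>"
    then obtain B \<nu> where B: "null_sequence \<U> p (A ` D) B" and \<nu>: "\<And>l. stationary_measure \<U> V (B l) (\<nu> l)"
      and lim: "limitin (weak_topology \<U>) \<nu> \<mu> sequentially"
      unfolding limit_measure_def by blast
    interpret S: stationary_sequence \<U> V "A ` D" W \<rho> \<gamma> B \<nu> by (rule seq[OF B \<nu>])
    interpret T: lyapunov_flow_limit \<U> V "A ` D" W \<rho> \<gamma> \<I> \<phi> B \<nu> \<mu>
    proof unfold_locales
      show "limitin (weak_topology \<U>) \<nu> \<mu> sequentially" by (rule lim)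
      show "C_k_on 1 \<U> (\<lambda>x. V x $ i)" for i using V1 by blast
    qed
    show "invariant_measure \<I> \<phi> \<mu>" by (rule T.invariant)
    show "measure_support \<mu> \<subseteq> global_attractor \<U> \<I> \<phi>"
      unfolding attractor(2) by (rule T.support_subset_core)
  qed
qed

end
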